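(* Let $\tau$ be a partition of $n$, and let $c<0$ be a real number not of the form $r/m$ with $r,m$ coprime integers and $2\le m\le n$. Then the signature character of the module $M_c(\tau)$ over the rational Cherednik algebra $\mathbb{H}_c$ of type $A$ is $$ch_s(M_c(\tau))=\sum_{v\in\mathcal{B}(M_c(\tau))} t^{wt(v)}(-1)^{f(v)},$$ where the index set $\mathcal{B}(M_c(\tau))$ and the functions $wt$ and $f$ are those defined in the context.
   Context: $\mathbb{H}_c$ ($n\ge2$) is the rational Cherednik algebra for $W=S_n$, $\mathfrak h=\mathbb{C}^n$: it is generated by $\mathbb{C}S_n$ and $x_1,\dots,x_n,y_1,\dots,y_n$, where the $x_i$ commute, the $y_i$ commute, $wx_iw^{-1}=x_{w(i)}$, $wy_iw^{-1}=y_{w(i)}$, $y_ix_j-x_jy_i=c\,s_{ij}$ for $i\ne j$, and $y_ix_i-x_iy_i=1-c\sum_{j\neq i}s_{ij}$ ($s_{ij}$ the transposition). For a partition $\tau$ of $n$, viewed as an irreducible representation of $S_n$ ($(n)$ trivial, $(1^n)$ sign), $M_c(\tau)$ is the module induced from $\tau$ on which all $y_i$ act by $0$; as a vector space it is $\mathbb{C}[x_1,\dots,x_n]\otimes\tau$, graded by polynomial degree. It has a nondegenerate contravariant Hermitian form $\langle\cdot,\cdot\rangle$ ($S_n$-invariant, with $\langle x_iu,v\rangle=\langle u,y_iv\rangle$), unique up to scaling, normalized to be positive definite on $\tau$ in degree $0$. The signature character is $ch_s(M_c(\tau))=\sum_{m\ge0}t^m s_m$, where $s_m$ is the number of positive minus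 the number of negative eigenvalues of the form on the degree $m$ part. The content vector of a standard Young tableau $T$ of shape $\tau$ is $(d_1,\dots,d_n)$, where $d_k=(\text{column})-(\text{row})$ of the box containing $k$. $\mathcal{B}(M_c(\tau))$ is the set of triples $v=(\mu,\sigma,T)$ where $\mu=(g_1\le g_2\le\dots\le g_n)$ with $g_i\in\mathbb{Z}_{\ge0}$; $\sigma\in S_n$ is such that $i<j$ and $g_i=g_j$ imply $\sigma(i)<\sigma(j)$; and $T$ is a standard Young tableau of shape $\tau$. Put $wt(v)=|\mu|=g_1+\dots+g_n$ and, with $(d_1,\dots,d_n)$ the content vector of $T$, $$\begin{aligned} f(v)=&\sum_{i=1}^n\min\{g_i,\lfloor cd_i\rfloor\}\\&+\sum_{\substack{1\le s<t\le n\\ \sigma(s)>\sigma(t)}}\Big(\min\{g_t-g_s-1,\lfloor c(d_t-d_s-1)\rfloor\}+\min\{g_t-g_s-1,\lfloor c(d_t-d_s+1)\rfloor\}\Big)\\&+\sum_{\substack{1\le s<t\le n\\ \sigma(s)<\sigma(t)}}\Big(\min\{g_t-g_s,\lfloor c(d_t-d_s-1)\rfloor\}+\min\{g_t-g_s,\lfloor c(d_t-d_s+1)\rfloor\}\Big),\end{aligned}$$ with the convention that any $\min$ having a negative argument is replaced by $0$ (so that the corresponding power of $-1$ is $1$). *)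

theory Defs
  imports
    "HOL-Algebra.QuotRing"
    "HOL-Combinatorics.Permutations"
    "HOL-Computational_Algebra.Formal_Power_Series"
    "HOL-Library.Poly_Mapping"
    "Jordan_Normal_Form.Char_Poly"
    "Jordan_Normal_Form.VS_Connect"
begin

section \<open>Formal linear combinations and quotient modules\<close>

text \<open>The complex vector space with basis S, realised as finitely supported functions. The
  multiplicative fields of a module record play no role, as in the vector modules of
  Jordan_Normal_Form.\<close>

definition formal_space :: "'a set \<Rightarrow> (complex, 'a \<Rightarrow>\<^sub>0 complex) module" where
  "formal_space S =
     \<lparr>carrier = {u. Poly_Mapping.keys u \<subseteq> S}, monoid.mult = undefined, one = undefined,
      zero = 0, add = (+), smult = (\<lambda>a. Poly_Mapping.map ((*) a))\<rparr>"

definition linear_ext :: "('a \<Rightarrow> 'b) \<Rightarrow> ('a \<Rightarrow>\<^sub>0 complex) \<Rightarrow> ('b \<Rightarrow>\<^sub>0 complex)" where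
  "linear_ext f u =
     (\<Sum>k\<in>Poly_Mapping.keys u. Poly_Mapping.single (f k) (Poly_Mapping.lookup u k))"

definition quot_module :: "('a, 'b) module \<Rightarrow> 'b set \<Rightarrow> ('a, 'b set) module" where
  "quot_module V W =
     \<lparr>carrier = a_rcosets\<^bsub>V\<^esub> W, monoid.mult = undefined, one = undefined,
      zero = W, add = set_add V, smult = (\<lambda>a U. \<Union>u\<in>U. W +>\<^bsub>V\<^esub> (a \<odot>\<^bsub>V\<^esub> u))\<rparr>"

section \<open>The rational Cherednik algebra\<close>

datatype 'g free_monoid = Word (letters: "'g list")

instantiation free_monoid :: (type) monoid_add
begin

definition "0 = Word []"

definition "u + v = Word (letters u @ letters v)"

instance
  by standard (simp_all add: zero_free_monoid_def plus_free_monoid_def)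

end

text \<open>Indices run over 1..n and S_n consists of the permutations of 1..n; the parameter n restricts
  the generators. By the convolution product on finitely supported functions, the functions
  supported on words in the generators form the free algebra.\<close>

datatype generator = X nat | Y nat | Perm "nat \<Rightarrow> nat"

definition generators :: "nat \<Rightarrow> generator set" where
  "generators n = X ` {1..n} \<union> Y ` {1..n} \<union> Perm ` {w. w permutes {1..n}}"

type_synonym falg = "generator free_monoid \<Rightarrow>\<^sub>0 complex"

definition free_algebra :: "nat \<Rightarrow> falg ring" where
  "free_algebra n =
     \<lparr>carrier = {p. \<forall>w\<in>Poly_Mapping.keys p. set (letters w) \<subseteq> generators n},
      monoid.mult = (*), one = 1, zero = 0, add = (+)\<rparr>"

abbreviation monom_of :: "generator list \<Rightarrow> falg" where
  "monom_of gs \<equiv> Poly_Mapping.single (Word gs) 1"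

abbreviation scalar :: "complex \<Rightarrow> falg" where
  "scalar z \<equiv> Poly_Mapping.single 0 z"

definition cherednik_relators :: "nat \<Rightarrow> real \<Rightarrow> falg set" where
  "cherednik_relators n c =
     {monom_of [Perm id] - 1}
   \<union> {monom_of [Perm v, Perm w] - monom_of [Perm (v \<circ> w)] | v w.
        v permutes {1..n} \<and> w permutes {1..n}}
   \<union> {monom_of [X i, X j] - monom_of [X j, X i] | i j. i \<in> {1..n} \<and> j \<in> {1..n}}
   \<union> {monom_of [Y i, Y j] - monom_of [Y j, Y i] | i j. i \<in> {1..n} \<and> j \<in> {1..n}}
   \<union> {monom_of [Perm w, X i, Perm (inv_into UNIV w)] - monom_of [X (w i)] | w i.
        w permutes {1..n} \<and> i \<in> {1..n}}
   \<union> {monom_of [Perm w, Y i, Perm (inv_into UNIV w)] - monom_of [Y (w i)] | w i.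
        w permutes {1..n} \<and> i \<in> {1..n}}
   \<union> {monom_of [Y i, X j] - monom_of [X j, Y i]
        - scalar (complex_of_real c) * monom_of [Perm (transpose i j)] | i j.
        i \<in> {1..n} \<and> j \<in> {1..n} \<and> i \<noteq> j}
   \<union> {monom_of [Y i, X i] - monom_of [X i, Y i]
        - (1 - scalar (complex_of_real c) * (\<Sum>j\<in>{1..n} - {i}. monom_of [Perm (transpose i j)])) | i.
        i \<in> {1..n}}"

definition cherednik_ideal :: "nat \<Rightarrow> real \<Rightarrow> falg set" where
  "cherednik_ideal n c = Idl\<^bsub>free_algebra n\<^esub> (cherednik_relators n c)"

definition cherednik_algebra :: "nat \<Rightarrow> real \<Rightarrow> falg set ring" where
  "cherednik_algebra n c = free_algebra n Quot cherednik_ideal n c"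

definition cls :: "nat \<Rightarrow> real \<Rightarrow> falg \<Rightarrow> falg set" where
  "cls n c p = cherednik_ideal n c +>\<^bsub>free_algebra n\<^esub> p"

section \<open>Partitions, tableaux and Specht modules\<close>

definition partition_of :: "nat \<Rightarrow> nat list \<Rightarrow> bool" where
  "partition_of n \<tau> \<longleftrightarrow> sorted_wrt (\<ge>) \<tau> \<and> 0 \<notin> set \<tau> \<and> sum_list \<tau> = n"

text \<open>Boxes are pairs (row, column), counted from 0.\<close>

definition boxes :: "nat list \<Rightarrow> (nat \<times> nat) set" where
  "boxes \<tau> = {(r, q). r < length \<tau> \<and> q < \<tau> ! r}"

text \<open>Extensionality makes a tableau depend only on its entries inside the shape.\<close>

definition standard_tableaux :: "nat list \<Rightarrow> (nat \<times> nat \<Rightarrow> nat) set" where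
  "standard_tableaux \<tau> =
     {T \<in> extensional (boxes \<tau>). bij_betw T (boxes \<tau>) {1..sum_list \<tau>} \<and>
        (\<forall>r q q'. (r, q) \<in> boxes \<tau> \<and> (r, q') \<in> boxes \<tau> \<and> q < q' \<longrightarrow> T (r, q) < T (r, q')) \<and>
        (\<forall>r r' q. (r, q) \<in> boxes \<tau> \<and> (r', q) \<in> boxes \<tau> \<and> r < r' \<longrightarrow> T (r, q) < T (r', q))}"

definition box_of :: "nat list \<Rightarrow> (nat \<times> nat \<Rightarrow> nat) \<Rightarrow> nat \<Rightarrow> nat \<times> nat" where
  "box_of \<tau> T k = (THE b. b \<in> boxes \<tau> \<and> T b = k)"

definition box_content :: "nat list \<Rightarrow> (nat \<times> nat \<Rightarrow> nat) \<Rightarrow> nat \<Rightarrow> int" where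
  "box_content \<tau> T k = int (snd (box_of \<tau> T k)) - int (fst (box_of \<tau> T k))"

text \<open>The irreducible representation attached to a partition is the left ideal of the group algebra
  generated by the Young symmetrizer (row symmetrizer times signed column sum) of the tableau filled
  row by row. With this convention (n) gives the trivial and (1,...,1) the sign representation.\<close>

definition row_tableau :: "nat list \<Rightarrow> nat \<times> nat \<Rightarrow> nat" where
  "row_tableau \<tau> = (\<lambda>(r, q). sum_list (take r \<tau>) + q + 1)"

definition row_group :: "nat list \<Rightarrow> (nat \<Rightarrow> nat) set" where
  "row_group \<tau> = {p. p permutes {1..sum_list \<tau>} \<and>
     (\<forall>k\<in>{1..sum_list \<tau>}.
        fst (box_of \<tau> (row_tableau \<tau>) (p k)) = fst (box_of \<tau> (row_tableau \<tau>) k))}"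

definition column_group :: "nat list \<Rightarrow> (nat \<Rightarrow> nat) set" where
  "column_group \<tau> = {p. p permutes {1..sum_list \<tau>} \<and>
     (\<forall>k\<in>{1..sum_list \<tau>}.
        snd (box_of \<tau> (row_tableau \<tau>) (p k)) = snd (box_of \<tau> (row_tableau \<tau>) k))}"

definition young_symmetrizer :: "nat list \<Rightarrow> (nat \<Rightarrow> nat) \<Rightarrow>\<^sub>0 complex" where
  "young_symmetrizer \<tau> =
     (\<Sum>a\<in>row_group \<tau>. \<Sum>b\<in>column_group \<tau>. Poly_Mapping.single (a \<circ> b) (of_int (sign b)))"

definition perm_act :: "(nat \<Rightarrow> nat) \<Rightarrow> ((nat \<Rightarrow> nat) \<Rightarrow>\<^sub>0 complex) \<Rightarrow> ((nat \<Rightarrow> nat) \<Rightarrow>\<^sub>0 complex)" where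
  "perm_act w = linear_ext (\<lambda>p. w \<circ> p)"

definition specht :: "nat list \<Rightarrow> ((nat \<Rightarrow> nat) \<Rightarrow>\<^sub>0 complex) set" where
  "specht \<tau> =
     LinearCombinations.module.span class_ring (formal_space {p. p permutes {1..sum_list \<tau>}})
       {perm_act w (young_symmetrizer \<tau>) | w. w permutes {1..sum_list \<tau>}}"

section \<open>The induced modules\<close>

text \<open>The induced module is the tensor product of the Cherednik algebra H with the representation
  over the subalgebra generated by S_n and the Y i, where the Y i act on the representation by 0. It
  is the quotient of the space of formal combinations of pairs (h, v), standing for elementary
  tensors, by the bilinearity relations and by (h w, v) = (h, w v) and (h y_i, v) = 0; these last
  relations for algebra generators imply those for the whole subalgebra.\<close>

type_synonym pre_tensor = "(falg set \<times> ((nat \<Rightarrow> nat) \<Rightarrow>\<^sub>0 complex)) \<Rightarrow>\<^sub>0 complex"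

abbreviation pure :: "falg set \<Rightarrow> ((nat \<Rightarrow> nat) \<Rightarrow>\<^sub>0 complex) \<Rightarrow> pre_tensor" where
  "pure h v \<equiv> Poly_Mapping.single (h, v) 1"

definition pre_tensor_space :: "nat \<Rightarrow> real \<Rightarrow> nat list \<Rightarrow> (complex, pre_tensor) module" where
  "pre_tensor_space n c \<tau> = formal_space (carrier (cherednik_algebra n c) \<times> specht \<tau>)"

definition tensor_relators :: "nat \<Rightarrow> real \<Rightarrow> nat list \<Rightarrow> pre_tensor set" where
  "tensor_relators n c \<tau> =
    (let H = cherednik_algebra n c in
     {pure (h \<oplus>\<^bsub>H\<^esub> h') v - pure h v - pure h' v | h h' v.
        h \<in> carrier H \<and> h' \<in> carrier H \<and> v \<in> specht \<tau>}
   \<union> {pure h (v + v') - pure h v - pure h v' | h v v'.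
        h \<in> carrier H \<and> v \<in> specht \<tau> \<and> v' \<in> specht \<tau>}
   \<union> {pure (cls n c (scalar z) \<otimes>\<^bsub>H\<^esub> h) v - Poly_Mapping.single (h, v) z | z h v.
        h \<in> carrier H \<and> v \<in> specht \<tau>}
   \<union> {pure h (Poly_Mapping.map ((*) z) v) - Poly_Mapping.single (h, v) z | z h v.
        h \<in> carrier H \<and> v \<in> specht \<tau>}
   \<union> {pure (h \<otimes>\<^bsub>H\<^esub> cls n c (monom_of [Perm w])) v - pure h (perm_act w v) | h w v.
        h \<in> carrier H \<and> w permutes {1..n} \<and> v \<in> specht \<tau>}
   \<union> {pure (h \<otimes>\<^bsub>H\<^esub> cls n c (monom_of [Y i])) v | h i v.
        h \<in> carrier H \<and> i \<in> {1..n} \<and> v \<in> specht \<tau>})"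

definition tensor_null :: "nat \<Rightarrow> real \<Rightarrow> nat list \<Rightarrow> pre_tensor set" where
  "tensor_null n c \<tau> =
     LinearCombinations.module.span class_ring (pre_tensor_space n c \<tau>) (tensor_relators n c \<tau>)"

definition standard_module :: "nat \<Rightarrow> real \<Rightarrow> nat list \<Rightarrow> (complex, pre_tensor set) module" where
  "standard_module n c \<tau> = quot_module (pre_tensor_space n c \<tau>) (tensor_null n c \<tau>)"

text \<open>The action of the algebra, given on elementary tensors by left multiplication.\<close>

definition cherednik_act ::
    "nat \<Rightarrow> real \<Rightarrow> nat list \<Rightarrow> falg set \<Rightarrow> pre_tensor set \<Rightarrow> pre_tensor set" where
  "cherednik_act n c \<tau> h U =
     (\<Union>u\<in>U. tensor_null n c \<tau> +>\<^bsub>pre_tensor_space n c \<tau>\<^esub>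
        linear_ext (\<lambda>(h', v). (h \<otimes>\<^bsub>cherednik_algebra n c\<^esub> h', v)) u)"

abbreviation gen_act ::
    "nat \<Rightarrow> real \<Rightarrow> nat list \<Rightarrow> generator \<Rightarrow> pre_tensor set \<Rightarrow> pre_tensor set" where
  "gen_act n c \<tau> g \<equiv> cherednik_act n c \<tau> (cls n c (monom_of [g]))"

text \<open>Degree m is spanned by the tensors of monomials of degree m in the X i with vectors of the
  representation.\<close>

definition degree_part :: "nat \<Rightarrow> real \<Rightarrow> nat list \<Rightarrow> nat \<Rightarrow> pre_tensor set set" where
  "degree_part n c \<tau> m =
     {tensor_null n c \<tau> +>\<^bsub>pre_tensor_space n c \<tau>\<^esub> u | u.
        Poly_Mapping.keys u \<subseteq>
          {(cls n c (monom_of (map X is)), v) | is v.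
             set is \<subseteq> {1..n} \<and> length is = m \<and> v \<in> specht \<tau>}}"

section \<open>The contravariant form and the signature character\<close>

text \<open>Hermitian forms are linear in the first argument.\<close>

definition contravariant_form ::
    "nat \<Rightarrow> real \<Rightarrow> nat list \<Rightarrow> (pre_tensor set \<Rightarrow> pre_tensor set \<Rightarrow> complex) \<Rightarrow> bool" where
  "contravariant_form n c \<tau> F \<longleftrightarrow>
    (let M = standard_module n c \<tau> in
     (\<forall>u\<in>carrier M. \<forall>u'\<in>carrier M. \<forall>v\<in>carrier M. F (u \<oplus>\<^bsub>M\<^esub> u') v = F u v + F u' v) \<and>
     (\<forall>z. \<forall>u\<in>carrier M. \<forall>v\<in>carrier M. F (z \<odot>\<^bsub>M\<^esub> u) v = z * F u v) \<and>
     (\<forall>u\<in>carrier M. \<forall>v\<in>carrier M. F v u = cnj (F u v)) \<and>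
     (\<forall>w. w permutes {1..n} \<longrightarrow> (\<forall>u\<in>carrier M. \<forall>v\<in>carrier M.
        F (gen_act n c \<tau> (Perm w) u) (gen_act n c \<tau> (Perm w) v) = F u v)) \<and>
     (\<forall>i\<in>{1..n}. \<forall>u\<in>carrier M. \<forall>v\<in>carrier M.
        F (gen_act n c \<tau> (X i) u) v = F u (gen_act n c \<tau> (Y i) v)) \<and>
     (\<forall>u\<in>carrier M. (\<forall>v\<in>carrier M. F u v = 0) \<longrightarrow> u = \<zero>\<^bsub>M\<^esub>) \<and>
     (\<forall>u\<in>degree_part n c \<tau> 0. u \<noteq> \<zero>\<^bsub>M\<^esub> \<longrightarrow> Re (F u u) > 0))"

text \<open>The eigenvalues, counted with multiplicity, are those of the Gram matrix with respect to a
  basis. The Gram matrix is Hermitian, so its eigenvalues are real; by the law of inertia the numbers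
  of positive and of negative ones do not depend on the basis.\<close>

definition degree_signature ::
    "nat \<Rightarrow> real \<Rightarrow> nat list \<Rightarrow> (pre_tensor set \<Rightarrow> pre_tensor set \<Rightarrow> complex) \<Rightarrow> nat \<Rightarrow> int" where
  "degree_signature n c \<tau> F m =
    (let M\<^sub>m = (standard_module n c \<tau>)\<lparr>carrier := degree_part n c \<tau> m\<rparr>;
         bs = (SOME bs. distinct bs \<and> vectorspace.basis class_ring M\<^sub>m (set bs));
         G = mat (length bs) (length bs) (\<lambda>(i, j). F (bs ! i) (bs ! j));
         ev = proots (char_poly G)
     in int (size {#z \<in># ev. Re z > 0#}) - int (size {#z \<in># ev. Re z < 0#}))"

text \<open>The contravariant form is unique up to a positive real factor, which does not affect
  signatures.\<close>

definition signature_character :: "nat \<Rightarrow> real \<Rightarrow> nat list \<Rightarrow> int fps" where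
  "signature_character n c \<tau> =
     Abs_fps (degree_signature n c \<tau> (SOME F. contravariant_form n c \<tau> F))"

section \<open>The combinatorial side\<close>

type_synonym triple = "(nat \<Rightarrow> nat) \<times> (nat \<Rightarrow> nat) \<times> (nat \<times> nat \<Rightarrow> nat)"

definition index_triples :: "nat \<Rightarrow> nat list \<Rightarrow> triple set" where
  "index_triples n \<tau> =
     {(g, \<sigma>, T). g \<in> extensional {1..n} \<and> mono_on {1..n} g \<and>
        \<sigma> permutes {1..n} \<and>
        (\<forall>i\<in>{1..n}. \<forall>j\<in>{1..n}. i < j \<and> g i = g j \<longrightarrow> \<sigma> i < \<sigma> j) \<and>
        T \<in> standard_tableaux \<tau>}"

definition wt :: "nat \<Rightarrow> triple \<Rightarrow> nat" where
  "wt n = (\<lambda>(g, \<sigma>, T). \<Sum>i=1..n. g i)"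

text \<open>A minimum with a negative argument is replaced by 0, so all terms are natural numbers.\<close>

definition cut_min :: "int \<Rightarrow> int \<Rightarrow> nat" where
  "cut_min a b = (if a < 0 \<or> b < 0 then 0 else nat (min a b))"

definition sign_exponent :: "nat \<Rightarrow> real \<Rightarrow> nat list \<Rightarrow> triple \<Rightarrow> nat" where
  "sign_exponent n c \<tau> = (\<lambda>(g, \<sigma>, T).
     let d = box_content \<tau> T;
         gap = (\<lambda>s t. int (g t) - int (g s));
         lo = (\<lambda>s t. \<lfloor>c * real_of_int (d t - d s - 1)\<rfloor>);
         hi = (\<lambda>s t. \<lfloor>c * real_of_int (d t - d s + 1)\<rfloor>)
     in (\<Sum>i=1..n. cut_min (int (g i)) \<lfloor>c * real_of_int (d i)\<rfloor>)
      + (\<Sum>(s, t)\<in>{(s, t). 1 \<le> s \<and> s < t \<and> t \<le> n \<and> \<sigma> s > \<sigma> t}.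
           cut_min (gap s t - 1) (lo s t) + cut_min (gap s t - 1) (hi s t))
      + (\<Sum>(s, t)\<in>{(s, t). 1 \<le> s \<and> s < t \<and> t \<le> n \<and> \<sigma> s < \<sigma> t}.
           cut_min (gap s t) (lo s t) + cut_min (gap s t) (hi s t)))"

end

theory Submission
 imports Defs "Jordan_Normal_Form.Schur_Decomposition"
begin

text \<open>The standard module is a space of polynomials with coefficients in the Specht module VV. By the normal form
 (T_normal, Psi_kernel) it is N = C[x] \<otimes> VV, with the y_i acting as Dunkl operators. A contravariant form
 is determined by its restriction to degree 0, and there by invariance up to a positive factor (form_unique);
 hence it is a multiple of the explicit form BB, which pairs x^\<alpha> v with g as the inner product of v with
 the degree 0 part of y^\<alpha> g. The signature in degree m is the signature of a Gram matrix of BB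
 (degree_signature_GM).

 To diagonalise BB, take the operators ZZ_i = y_i x_i + c (sum of s_ij over j > i), which are self-adjoint
 for BB. In a suitable order of the monomials they are triangular, and the diagonal part is the
 Jucys-Murphy action on VV (sl_ZZ_xv, dg_so). So the joint eigenvalues are indexed by pairs of an exponent
 \<alpha> and a standard tableau T, which correspond to the triples of the theorem: \<sigma> sorts \<alpha>
 (index_sum). The eigenvalues involve c only through c times an integer of size below n. When c k is
 no integer for 0 < |k| \<le> n they separate the pairs (zr_inj), so eigenvectors for different pairs are
 orthogonal. An eigenvector for each pair is obtained from the constants by two intertwiners, the adjacent
 one and x_1 (1 2 ... n), and each step multiplies the norm by an explicit real number (good_sh, good_sw).
 The resulting norm is a product of factors l - c e and of squares (NN). The product of l - c e for l = 1, ..., g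
 has as many negative factors as min {g, floor (c e)} counts, so the sign of the norm is (-1)^f (sgn_NN),
 and the law of inertia gives the formula for such c.

 The only other values of c < 0 satisfying the hypothesis are the negative integers (generic_or_integer).
 There eigenvalues collide, but the form is still nondegenerate (nondeg_int), so the signature
 at c = -k equals the signature at a generic parameter slightly to the left of -k
 (signature_locally_constant); and f is the same at both, because the floor of c e is constant there
 when c e \<ge> 0 and negative otherwise (SE_left_of_int). For nondegeneracy, suppose that the radical is nonzero.
 It is stable under the x_i, so it contains a vector all of whose exponents have entries far apart and far from 0.
 For such exponents the norm NN(c) has a finite nonzero limit at -k: the number of zeros minus the number of
 poles of its factors is a signed count of boxes on neighbouring diagonals of T, which is 0
 (theta_identity, NN_tz). After projecting to the weights that collide at -k, the Gram determinant
 is a product of these norms up to nonvanishing factors, hence nonzero at -k, whereas the radical vector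
 contributes a zero row.\<close>

section \<open>Linear algebra on finitely supported functions\<close>

abbreviation lk :: "('a \<Rightarrow>\<^sub>0 complex) => 'a => complex" where "lk \<equiv> Poly_Mapping.lookup"
abbreviation ks :: "('a \<Rightarrow>\<^sub>0 complex) => 'a set" where "ks \<equiv> Poly_Mapping.keys"
abbreviation ba :: "'a => ('a \<Rightarrow>\<^sub>0 complex)" where "ba k \<equiv> Poly_Mapping.single k 1"

definition sc :: "complex => ('a \<Rightarrow>\<^sub>0 complex) => ('a \<Rightarrow>\<^sub>0 complex)" where
 "sc a u = Poly_Mapping.map ((*) a) u"

lemma lk_sc [simp]: "lk (sc a u) k = a * lk u k"
 unfolding sc_def by transfer (simp add: when_def)

global_interpretation fv: vector_space sc
 by unfold_locales (auto intro!: poly_mapping_eqI simp: lookup_add algebra_simps)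

lemma sc_simps [simp]: "sc a (sc b u) = sc (a * b) u" "sc 1 u = u" "sc 0 u = 0" "sc a 0 = 0"
 by (auto intro: poly_mapping_eqI)

lemma sc_single [simp]: "sc a (Poly_Mapping.single k b) = Poly_Mapping.single k (a * b)"
 by (auto intro!: poly_mapping_eqI simp: lookup_single when_def)

lemma sc_minus1: "sc (-1) u = - u" by (auto intro: poly_mapping_eqI)

lemma single_sc: "Poly_Mapping.single k a = sc a (ba k)" by simp

lemmas sc_distribs = fv.scale_right_distrib fv.scale_left_distrib fv.scale_right_diff_distrib
 fv.scale_left_diff_distrib

definition lin :: "('a => ('b \<Rightarrow>\<^sub>0 complex)) => ('a \<Rightarrow>\<^sub>0 complex) => ('b \<Rightarrow>\<^sub>0 complex)" where
 "lin g u = (\<Sum>k\<in>ks u. sc (lk u k) (g k))"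

lemma lin_superset: "finite S ==> ks u \<subseteq> S ==> lin g u = (\<Sum>k\<in>S. sc (lk u k) (g k))"
 unfolding lin_def by (rule sum.mono_neutral_left) (auto simp: in_keys_iff)

definition linear_op :: "(('a \<Rightarrow>\<^sub>0 complex) => ('b \<Rightarrow>\<^sub>0 complex)) => bool" where
 "linear_op f \<longleftrightarrow> (\<forall>u v. f (u + v) = f u + f v) & (\<forall>a u. f (sc a u) = sc a (f u))"

lemma linear_opI: "(\<And>u v. f (u + v) = f u + f v) ==> (\<And>a u. f (sc a u) = sc a (f u)) ==> linear_op f"
 by (simp add: linear_op_def)

lemma lop_add: "linear_op f ==> f (u + v) = f u + f v" by (simp add: linear_op_def)
lemma lop_sc: "linear_op f ==> f (sc a u) = sc a (f u)" by (simp add: linear_op_def)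
lemma lop_zero: "linear_op f ==> f 0 = 0" using lop_sc[of f 0 0] by simp
lemma lop_minus: "linear_op f ==> f (- u) = - f u" using lop_sc[of f "-1" u] by (simp add: sc_minus1)
lemma lop_diff: "linear_op f ==> f (u - v) = f u - f v"
 using lop_add[of f u "- v"] by (simp add: lop_minus)
lemma lop_sum: "linear_op f ==> f (\<Sum>i\<in>A. g i) = (\<Sum>i\<in>A. f (g i))"
 by (induction A rule: infinite_finite_induct) (auto simp: lop_zero lop_add)

lemmas lops = lop_add lop_sc lop_zero lop_minus lop_diff lop_sum

lemma linear_lin [simp]: "linear_op (lin g)"
proof (rule linear_opI)
 fix u v :: "'a \<Rightarrow>\<^sub>0 complex"
 have "lin g (u + v) = (\<Sum>k\<in>ks u \<union> ks v. sc (lk (u + v) k) (g k))"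
  by (rule lin_superset) (use keys_add[of u v] in auto)
 also have "... = (\<Sum>k\<in>ks u \<union> ks v. sc (lk u k) (g k)) + (\<Sum>k\<in>ks u \<union> ks v. sc (lk v k) (g k))"
  by (simp add: lookup_add sc_distribs sum.distrib)
 finally show "lin g (u + v) = lin g u + lin g v"
  by (simp add: lin_superset[of "ks u \<union> ks v"])
next
 fix a and u :: "'a \<Rightarrow>\<^sub>0 complex"
 have "lin g (sc a u) = (\<Sum>k\<in>ks u. sc (lk (sc a u) k) (g k))"
  by (rule lin_superset) (auto simp: in_keys_iff)
 thus "lin g (sc a u) = sc a (lin g u)"
  by (simp add: lin_def fv.scale_sum_right)
qed

lemma lin_ba [simp]: "lin g (ba k) = g k" by (simp add: lin_def)
lemma lin_single: "lin g (Poly_Mapping.single k a) = sc a (g k)"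
 using lop_sc[of "lin g" a "ba k"] by simp

lemma expand: "u = (\<Sum>k\<in>ks u. sc (lk u k) (ba k))"
 by (rule poly_mapping_eqI) (auto simp: lookup_sum lookup_single when_def in_keys_iff)

lemma linear_ext_eq_lin: "linear_ext f = lin (%k. ba (f k))"
 by (rule ext) (simp add: linear_ext_def lin_def)

lemma linear_linear_ext [simp]: "linear_op (linear_ext f)" by (simp add: linear_ext_eq_lin)
lemma linear_ext_ba [simp]: "linear_ext f (ba k) = ba (f k)" by (simp add: linear_ext_eq_lin)
lemma linear_ext_single: "linear_ext f (Poly_Mapping.single k a) = Poly_Mapping.single (f k) a"
 by (simp add: linear_ext_eq_lin lin_single)

lemma lin_compI: "linear_op f ==> linear_op g ==> linear_op (%u. f (g u))"
 by (simp add: linear_op_def)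
lemma lin_idI: "linear_op (%u. u)" by (simp add: linear_op_def)
lemma linear_id' [simp]: "linear_op id" by (simp add: linear_op_def)
lemma lin_plusI: "linear_op f ==> linear_op g ==> linear_op (%u. f u + g u)"
 by (simp add: linear_op_def sc_distribs algebra_simps)
lemma lin_minusI: "linear_op f ==> linear_op g ==> linear_op (%u. f u - g u)"
 by (simp add: linear_op_def sc_distribs algebra_simps)
lemma lin_scaledI: "linear_op f ==> linear_op (%u. sc a (f u))"
 by (simp add: linear_op_def sc_distribs mult.commute)
lemma lin_zeroI: "linear_op (%u. 0)" by (simp add: linear_op_def)
lemma lin_sumI: "(\<And>i. i \<in> A ==> linear_op (f i)) ==> linear_op (%u. \<Sum>i\<in>A. f i u)"
 by (induction A rule: infinite_finite_induct) (simp_all add: lin_zeroI lin_plusI)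

lemmas linear_intros = lin_idI lin_plusI lin_minusI lin_scaledI lin_sumI lin_zeroI

lemma linear_eqI:
 assumes "linear_op f" "linear_op g" "\<And>k. k \<in> ks u ==> f (ba k) = g (ba k)"
 shows "f u = g u"
 by (subst (1 2) expand[of u]) (simp only: lops[OF assms(1)] lops[OF assms(2)], auto intro!: sum.cong simp: assms simp del: sc_single)

lemma linear_span_image:
 assumes "linear_op f" "\<And>x. x \<in> S ==> f x \<in> fv.span T" "u \<in> fv.span S"
 shows "f u \<in> fv.span T"
 using assms(3) by (induction rule: fv.span_induct_alt)
  (auto simp: lops[OF assms(1)] intro: fv.span_add fv.span_scale assms(2) fv.span_zero)

lemma linear_span_eq:
 assumes "linear_op f" "linear_op g" "\<And>x. x \<in> S ==> f x = g x" "u \<in> fv.span S"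
 shows "f u = g u"
 using assms(4) by (induction rule: fv.span_induct_alt) (auto simp: lops[OF assms(1)] lops[OF assms(2)] assms(3))

subsection \<open>Spans and cosets in modules of functions\<close>

lemma carrier_formal: "carrier (formal_space S) = {u. ks u \<subseteq> S}" by (simp add: formal_space_def)
lemma formal_ops [simp]: "add (formal_space S) = (+)" "\<zero>\<^bsub>formal_space S\<^esub> = 0"
 "module.smult (formal_space S) = sc"
 by (auto simp: formal_space_def sc_def fun_eq_iff)

lemma ks_add_sub: "ks u \<subseteq> S ==> ks v \<subseteq> S ==> ks (u + v) \<subseteq> S" using keys_add by fastforce
lemma ks_sc_sub: "ks u \<subseteq> S ==> ks (sc a u) \<subseteq> S" by (auto simp: in_keys_iff)
lemma ks_uminus: "ks (- u) = ks (u :: 'a \<Rightarrow>\<^sub>0 complex)" by (auto simp: in_keys_iff)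

lemma abelian_group_formal: "abelian_group (formal_space S)"
proof (rule abelian_groupI)
 fix x assume "x \<in> carrier (formal_space S)"
 thus "\<exists>y\<in>carrier (formal_space S). y \<oplus>\<^bsub>formal_space S\<^esub> x = \<zero>\<^bsub>formal_space S\<^esub>"
  by (intro bexI[of _ "- x"]) (auto simp: carrier_formal ks_uminus)
qed (auto simp: carrier_formal ks_add_sub add_ac)

lemma module_formal: "Module.module class_ring (formal_space S)"
proof (rule module.intro)
 show "cring (class_ring :: complex ring)" by (rule class_cring.is_cring)
 show "abelian_group (formal_space S)" by (rule abelian_group_formal)
 show "module_axioms class_ring (formal_space S)"
  by unfold_locales (auto simp: carrier_formal ks_sc_sub sc_distribs)
qed

lemma finsum_formal:
 assumes "f \<in> A \<rightarrow> carrier (formal_space S)"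
 shows "finsum (formal_space S) f A = (\<Sum>x\<in>A. f x)"
proof -
 interpret abelian_group "formal_space S" by (rule abelian_group_formal)
 show ?thesis using assms
 proof (induction A rule: infinite_finite_induct)
  case (insert x F)
  thus ?case by (subst finsum_insert) auto
 qed (auto simp: finsum_infinite)
qed

lemma span_formal:
 assumes "R \<subseteq> carrier (formal_space S)"
 shows "LinearCombinations.module.span class_ring (formal_space S) R = fv.span R"
proof -
 interpret m: Module.module class_ring "formal_space S" by (rule module_formal)
 have lc: "m.lincomb a A = (\<Sum>x\<in>A. sc (a x) x)" if "A \<subseteq> R" for a A
  unfolding m.lincomb_def using that assms
  by (subst finsum_formal) (auto simp: carrier_formal in_keys_iff subset_iff)
 show ?thesis unfolding m.span_def fv.span_explicit
 proof (intro equalityI subsetI)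
  fix x assume "x \<in> {m.lincomb a A |a A. finite A & A \<subseteq> R & a \<in> A \<rightarrow> carrier class_ring}"
  then obtain a A where "x = m.lincomb a A" "finite A" "A \<subseteq> R" by blast
  thus "x \<in> {\<Sum>a\<in>t. sc (r a) a |t r. finite t & t \<subseteq> R}" using lc by blast
 next
  fix x assume "x \<in> {\<Sum>a\<in>t. sc (r a) a |t r. finite t & t \<subseteq> R}"
  then obtain t r where "x = (\<Sum>a\<in>t. sc (r a) a)" "finite t" "t \<subseteq> R" by blast
  thus "x \<in> {m.lincomb a A |a A. finite A & A \<subseteq> R & a \<in> A \<rightarrow> carrier class_ring}"
   using lc[of t r] by (auto intro!: exI[of _ r] exI[of _ t])
 qed
qed

lemma coset_formal:
 "W +>\<^bsub>formal_space S\<^esub> u = {w + u | w. w \<in> W}"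
 by (auto simp: a_r_coset_def' formal_space_def)

subsection \<open>The standard Hermitian inner product\<close>

definition ip :: "('a \<Rightarrow>\<^sub>0 complex) => ('a \<Rightarrow>\<^sub>0 complex) => complex" where
 "ip u v = (\<Sum>k\<in>ks u. lk u k * cnj (lk v k))"

lemma ip_superset: "finite S ==> ks u \<subseteq> S ==> ip u v = (\<Sum>k\<in>S. lk u k * cnj (lk v k))"
 unfolding ip_def by (rule sum.mono_neutral_left) (auto simp: in_keys_iff)

lemma ip_superset2: "finite S ==> ks v \<subseteq> S ==> ip u v = (\<Sum>k\<in>S. lk u k * cnj (lk v k))"
proof -
 assume a: "finite S" "ks v \<subseteq> S"
 have "ip u v = (\<Sum>k\<in>ks u \<union> S. lk u k * cnj (lk v k))" using a by (intro ip_superset) auto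
 also have "... = (\<Sum>k\<in>S. lk u k * cnj (lk v k))"
  using a by (intro sum.mono_neutral_right) (auto simp: in_keys_iff subset_iff)
 finally show ?thesis .
qed

lemma ip_add_left: "ip (u + v) w = ip u w + ip v w"
 by (subst (1 2 3) ip_superset[of "ks u \<union> ks v"])
  (use keys_add[of u v] in \<open>auto simp: lookup_add algebra_simps sum.distrib\<close>)
lemma ip_sc_left: "ip (sc a u) w = a * ip u w"
 by (subst (1 2) ip_superset[of "ks u"]) (auto simp: in_keys_iff sum_distrib_left mult_ac)
lemma ip_cnj: "ip v u = cnj (ip u v)"
 by (subst ip_superset2[of "ks u"]) (auto simp: ip_def mult_ac)
lemma ip_add_right: "ip w (u + v) = ip w u + ip w v"
 by (metis ip_add_left ip_cnj complex_cnj_add)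
lemma ip_sc_right: "ip w (sc a u) = cnj a * ip w u"
 by (metis ip_sc_left ip_cnj complex_cnj_mult)
lemma ip_zero [simp]: "ip 0 w = 0" "ip w 0 = 0" by (auto simp: ip_def)
lemma ip_minus_left: "ip (- u) w = - ip u w" using ip_sc_left[of "-1" u w] by (simp add: sc_minus1)
lemma ip_diff_left: "ip (u - v) w = ip u w - ip v w"
 using ip_add_left[of u "- v" w] by (simp add: ip_minus_left)
lemma ip_diff_right: "ip w (u - v) = ip w u - ip w v"
 by (metis ip_diff_left ip_cnj complex_cnj_diff)
lemma ip_sum_left: "ip (\<Sum>i\<in>A. f i) w = (\<Sum>i\<in>A. ip (f i) w)"
 by (induction A rule: infinite_finite_induct) (auto simp: ip_add_left)
lemma ip_sum_right: "ip w (\<Sum>i\<in>A. f i) = (\<Sum>i\<in>A. ip w (f i))"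
 by (induction A rule: infinite_finite_induct) (auto simp: ip_add_right)

lemmas ip_simps = ip_add_left ip_add_right ip_sc_left ip_sc_right ip_diff_left ip_diff_right

lemma ip_self: "ip u u = of_real (\<Sum>k\<in>ks u. (cmod (lk u k))\<^sup>2)"
 by (simp add: ip_def complex_norm_square del: of_real_power)
lemma ip_pos: "u ~= 0 ==> 0 < Re (ip u u)"
proof -
 assume "u ~= 0"
 then obtain k where k: "k \<in> ks u" by (metis all_not_in_conv keys_eq_empty)
 have "0 < (\<Sum>k\<in>ks u. (cmod (lk u k))\<^sup>2)"
  by (rule sum_pos2[OF _ k]) (use k in \<open>auto simp: in_keys_iff\<close>)
 thus ?thesis by (simp add: ip_self)
qed
lemma ip_self_real: "ip u u = of_real (Re (ip u u))" by (simp add: ip_self)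
lemma ip_self_zero: "ip u u = 0 \<longleftrightarrow> u = 0" using ip_pos[of u] by (cases "u = 0") auto

lemma ip_linear_ext:
 assumes "inj f" shows "ip (linear_ext f u) (linear_ext f v) = ip u v"
proof -
 have l: "lk (linear_ext f w) (f k) = lk w k" for w k
  by (subst linear_ext_def) (auto simp: lookup_sum lookup_single when_def inj_eq[OF assms] in_keys_iff)
 have sub: "ks (linear_ext f w) \<subseteq> f ` ks w" for w
  unfolding linear_ext_def by (rule order.trans[OF keys_sum]) auto
 have "ip (linear_ext f u) (linear_ext f v) = (\<Sum>k\<in>f ` ks u. lk (linear_ext f u) k * cnj (lk (linear_ext f v) k))"
  by (rule ip_superset) (auto intro: sub[THEN subsetD])
 also have "... = ip u v"
  by (subst sum.reindex[OF inj_on_subset[OF assms subset_UNIV]]) (simp add: l ip_def)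
 finally show ?thesis .
qed

section \<open>The Young symmetrizer as a Jucys-Murphy eigenvector\<close>

abbreviation pinv :: "('a => 'b) => 'b => 'a" where "pinv f \<equiv> inv_into UNIV f"

lemma perm_act_single: "perm_act w (Poly_Mapping.single p z) = Poly_Mapping.single (w o p) z"
 by (simp add: perm_act_def linear_ext_single)

lemma perm_act_comp: "perm_act w (perm_act v u) = perm_act (w o v) u"
 unfolding perm_act_def
 by (rule linear_eqI[OF lin_compI[OF linear_linear_ext linear_linear_ext]]) (auto simp: comp_assoc)

lemma perm_act_id [simp]: "perm_act id u = u" "perm_act (%x. x) u = u"
 unfolding perm_act_def by (rule linear_eqI[where g = "%u. u"]; auto intro: linear_intros simp: comp_def)+

lemma linear_perm_act [simp]: "linear_op (perm_act w)" by (simp add: perm_act_def)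

lemma perm_act_ba [simp]: "perm_act w (ba p) = ba (w o p)" by (simp add: perm_act_def)

lemmas perm_act_lops = lops[OF linear_perm_act]

lemma ip_perm_act: "inj w ==> ip (perm_act w u) (perm_act w v) = ip u v"
 unfolding perm_act_def by (rule ip_linear_ext) (auto simp: inj_def fun_eq_iff)

type_synonym gv = "(nat => nat) \<Rightarrow>\<^sub>0 complex"
type_synonym tableau = "nat \<times> nat => nat"

text \<open>The Jucys-Murphy element (1 k) + (2 k) + ... + (k-1 k) acting from the left.\<close>

definition jm :: "nat => gv => gv" where
 "jm k v = (\<Sum>j\<in>{1..<k}. perm_act (transpose j k) v)"

lemma linear_jm [simp]: "linear_op (jm k)" unfolding jm_def by (intro linear_intros) simp

lemma comp_transpose: "inj a ==> a o transpose i j = transpose (a i) (a j) o a"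
 by (auto simp: fun_eq_iff transpose_def inj_eq)

lemma transpose_braid:
 "j ~= k ==> j ~= i ==> i ~= k ==> transpose j k o transpose i k = transpose i k o transpose j i"
 by (auto simp: fun_eq_iff transpose_def)

locale young =
 fixes n :: nat and \<tau> :: "nat list"
 assumes part: "partition_of n \<tau>"
begin

lemma sum_tau: "sum_list \<tau> = n" using part by (simp add: partition_of_def)

abbreviation "Ix \<equiv> {1..n}"
abbreviation "Bx \<equiv> boxes \<tau>"
abbreviation "rt \<equiv> row_tableau \<tau>"

lemma tau_anti: "r \<le> r' ==> r' < length \<tau> ==> \<tau> ! r' \<le> \<tau> ! r"
 using part by (cases "r = r'") (auto simp: partition_of_def sorted_wrt_iff_nth_less)

lemma boxes_down: "(r, q) \<in> Bx ==> r' \<le> r ==> q' \<le> q ==> (r', q') \<in> Bx"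
 using tau_anti[of r' r] by (auto simp: boxes_def)

lemma boxes_Sigma: "Bx = Sigma {..<length \<tau>} (%r. {..<\<tau> ! r})" by (auto simp: boxes_def)

lemma finite_boxes [simp]: "finite Bx" by (simp add: boxes_Sigma)

lemma card_boxes: "card Bx = n"
 by (simp add: boxes_Sigma sum_tau[symmetric] sum_list_sum_nth atLeast0LessThan)

lemma take_mono: "r < r' ==> r < length \<tau> ==> sum_list (take r \<tau>) + \<tau> ! r \<le> sum_list (take r' \<tau>)"
proof (induction r' rule: nat_induct)
 case (Suc r')
 show ?case
 proof (cases "r = r'")
  case True thus ?thesis using Suc by (simp add: take_Suc_conv_app_nth)
 next
  case False
  hence "sum_list (take r \<tau>) + \<tau> ! r \<le> sum_list (take r' \<tau>)" using Suc by auto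
  also have "... \<le> sum_list (take (Suc r') \<tau>)"
   by (cases "r' < length \<tau>") (auto simp: take_Suc_conv_app_nth)
  finally show ?thesis .
 qed
qed auto

lemma rt_row_less: "(r, q) \<in> Bx ==> r < r' ==> rt (r, q) < rt (r', q')"
 using take_mono[of r r'] by (auto simp: boxes_def row_tableau_def)

lemma rt_col_less: "q < q' ==> rt (r, q) < rt (r, q')" by (simp add: row_tableau_def)

lemma rt_le: "(r, q) \<in> Bx ==> rt (r, q) \<in> Ix"
 using take_mono[of r "length \<tau>"] by (auto simp: boxes_def row_tableau_def sum_tau)

lemma rt_inj: "inj_on rt Bx"
proof (rule inj_onI)
 fix b b' assume b: "b \<in> Bx" "b' \<in> Bx" "rt b = rt b'"
 obtain r q r' q' where e: "b = (r, q)" "b' = (r', q')" by (cases b, cases b')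
 have "r = r'" using rt_row_less[of r q r' q'] rt_row_less[of r' q' r q] b e by (metis less_irrefl linorder_neqE_nat)
 thus "b = b'" using b e rt_col_less[of q q' r] rt_col_less[of q' q r] by (metis less_irrefl linorder_neqE_nat)
qed

lemma rt_bij: "bij_betw rt Bx Ix"
proof -
 have "rt ` Bx \<subseteq> Ix" using rt_le by auto
 moreover have "card (rt ` Bx) = n" using card_image[OF rt_inj] card_boxes by simp
 ultimately have "rt ` Bx = Ix" by (intro card_subset_eq) auto
 thus ?thesis using rt_inj by (simp add: bij_betw_def)
qed

lemma box_of_in:
 assumes "bij_betw T Bx Ix" "k \<in> Ix"
 shows "box_of \<tau> T k \<in> Bx & T (box_of \<tau> T k) = k"
proof -
 obtain b where b: "b \<in> Bx" "T b = k" using assms by (metis bij_betw_def imageE)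
 have "box_of \<tau> T k = b" unfolding box_of_def
  by (rule the_equality) (use b assms(1) in \<open>auto simp: bij_betw_def inj_on_def\<close>)
 thus ?thesis using b by simp
qed

lemma box_of_eq:
 assumes "bij_betw T Bx Ix" "b \<in> Bx"
 shows "box_of \<tau> T (T b) = b"
 unfolding box_of_def by (rule the_equality) (use assms in \<open>auto simp: bij_betw_def inj_on_def\<close>)

abbreviation "rw k \<equiv> fst (box_of \<tau> rt k)"
abbreviation "cl k \<equiv> snd (box_of \<tau> rt k)"

lemma rwcl: "k \<in> Ix ==> (rw k, cl k) \<in> Bx & rt (rw k, cl k) = k"
 using box_of_in[OF rt_bij] by simp
lemma rwcl_rt: "b \<in> Bx ==> box_of \<tau> rt (rt b) = b" using box_of_eq[OF rt_bij] by simp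

lemma rwcl_eqI: "j \<in> Ix ==> k \<in> Ix ==> rw j = rw k ==> cl j = cl k ==> j = k"
 using rwcl by metis

abbreviation "RG \<equiv> row_group \<tau>"
abbreviation "CG \<equiv> column_group \<tau>"
abbreviation "yu \<equiv> young_symmetrizer \<tau>"

lemma RG_iff: "a \<in> RG \<longleftrightarrow> a permutes Ix & (\<forall>k\<in>Ix. rw (a k) = rw k)"
 by (simp add: row_group_def sum_tau)
lemma CG_iff: "a \<in> CG \<longleftrightarrow> a permutes Ix & (\<forall>k\<in>Ix. cl (a k) = cl k)"
 by (simp add: column_group_def sum_tau)

lemma finite_RG [simp]: "finite RG"
 by (rule finite_subset[OF _ finite_permutations[of "Ix"]]) (auto simp: RG_iff)
lemma finite_CG [simp]: "finite CG"
 by (rule finite_subset[OF _ finite_permutations[of "Ix"]]) (auto simp: CG_iff)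

lemma comp_stabilizes:
 assumes a: "a permutes Ix" "\<forall>k\<in>Ix. f (a k) = f k" and b: "b permutes Ix" "\<forall>k\<in>Ix. f (b k) = f k"
 shows "(a o b) permutes Ix & (\<forall>k\<in>Ix. f ((a o b) k) = f k)"
 using permutes_compose[OF b(1) a(1)] a(2) b(2) permutes_in_image[OF b(1)] unfolding comp_apply by metis
lemma inv_stabilizes:
 assumes a: "a permutes Ix" "\<forall>k\<in>Ix. f (a k) = f k"
 shows "pinv a permutes Ix & (\<forall>k\<in>Ix. f (pinv a k) = f k)"
 using permutes_inv[OF a(1)] a(2) permutes_in_image[OF permutes_inv[OF a(1)]] permutes_inverses(1)[OF a(1)] by metis
lemma RG_comp: "a \<in> RG ==> b \<in> RG ==> a o b \<in> RG" unfolding RG_iff by (intro comp_stabilizes) auto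
lemma RG_inv: "a \<in> RG ==> pinv a \<in> RG" unfolding RG_iff by (intro inv_stabilizes) auto
lemma CG_comp: "a \<in> CG ==> b \<in> CG ==> a o b \<in> CG" unfolding CG_iff by (intro comp_stabilizes) auto
lemma CG_inv: "a \<in> CG ==> pinv a \<in> CG" unfolding CG_iff by (intro inv_stabilizes) auto
lemma RG_transpose: "i \<in> Ix ==> j \<in> Ix ==> rw i = rw j ==> transpose i j \<in> RG"
 by (auto simp: RG_iff permutes_swap_id transpose_def)
lemma CG_transpose: "i \<in> Ix ==> j \<in> Ix ==> cl i = cl j ==> transpose i j \<in> CG"
 by (auto simp: CG_iff permutes_swap_id transpose_def)
lemma id_RG: "id \<in> RG" by (auto simp: RG_iff permutes_id)
lemma id_CG: "id \<in> CG" by (auto simp: CG_iff permutes_id)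

definition "casym = (\<Sum>b\<in>CG. Poly_Mapping.single b (of_int (sign b) :: complex))"

lemma yu_eq: "yu = (\<Sum>a\<in>RG. perm_act a casym)"
 by (simp add: young_symmetrizer_def casym_def perm_act_lops perm_act_single)

lemma RG_perm: "a \<in> RG ==> a permutes Ix" by (simp add: RG_iff)
lemma CG_perm: "a \<in> CG ==> a permutes Ix" by (simp add: CG_iff)
lemma RG_inv_o: "a \<in> RG ==> a o pinv a = id" "a \<in> RG ==> pinv a o a = id"
 using permutes_inv_o[OF RG_perm] by blast+
lemma CG_inv_o: "a \<in> CG ==> a o pinv a = id" "a \<in> CG ==> pinv a o a = id"
 using permutes_inv_o[OF CG_perm] by blast+

lemma perm_act_casym: "t \<in> CG ==> perm_act t casym = sc (of_int (sign t)) casym"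
proof -
 assume t: "t \<in> CG"
 have perm: "permutation b" if "b \<in> CG" for b
  using CG_perm[OF that] permutation_permutes by blast
 have *: "sign t * sign (t o b) = sign b" if "b \<in> CG" for b
  using sign_compose[OF perm[OF t] perm[OF that]] by (simp add: sign_def)
 have "perm_act t casym = (\<Sum>b\<in>CG. Poly_Mapping.single (t o b) (of_int (sign b)))"
  by (simp add: casym_def perm_act_lops perm_act_single)
 also have "... = (\<Sum>b\<in>CG. Poly_Mapping.single b (of_int (sign t * sign b)))"
 proof (rule sum.reindex_bij_witness[of _ "%b. pinv t o b" "%b. t o b"])
  fix b assume b: "b \<in> CG"
  show "pinv t o (t o b) = b" "t o (pinv t o b) = b" by (simp_all add: o_assoc CG_inv_o[OF t])
  show "t o b \<in> CG" "pinv t o b \<in> CG" using t b by (auto intro: CG_comp CG_inv)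
  show "Poly_Mapping.single (t o b) (complex_of_int (sign t * sign (t o b))) =
   Poly_Mapping.single (t o b) (complex_of_int (sign b))" by (simp only: *[OF b])
 qed
 also have "... = sc (of_int (sign t)) casym"
  by (simp add: casym_def fv.scale_sum_right)
 finally show ?thesis .
qed

lemma sum_RG_shift: "r \<in> RG ==> (\<Sum>a\<in>RG. f (r o a)) = (\<Sum>a\<in>RG. f a)"
 by (rule sum.reindex_bij_witness[of _ "%b. pinv r o b" "%b. r o b"])
  (simp_all add: RG_comp RG_inv o_assoc RG_inv_o)

lemma perm_act_yu: "r \<in> RG ==> perm_act r yu = yu"
 using sum_RG_shift[of r "%a. perm_act a casym"] by (simp add: yu_eq perm_act_lops perm_act_comp)

definition "rowset r = {j \<in> Ix. rw j = r}"

text \<open>A sign-reversing involution. Including the term j = k, the sum runs over pairs (j, a) with a in the row group. Row r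
 has an entry in the column of a^-1 k; composing with the transposition of these two entries, a column permutation,
 changes the sign of the signed column sum, and the resulting product comes from another pair. So the sum with the
 term j = k vanishes.\<close>

lemma garnir:
 assumes k: "k \<in> Ix" and r: "r < rw k"
 shows "(\<Sum>j\<in>rowset r. perm_act (transpose j k) yu) = - yu"
proof -
 define P where "P = insert k (rowset r) \<times> RG"
 define f where "f = (%(j, a). perm_act (transpose j k o a) casym)"
 \<comment> \<open>the entry of row r in the column of the entry a^-1 k\<close>
 define i where "i = (%a. rt (r, cl (pinv a k)))"
 define \<phi> where "\<phi> = (%(j, a). if j = k then (a (i a), a) else if j = a (i a) then (k, a)
  else (a (i a), transpose j (a (i a)) o a))"
 have kX: "k \<notin> rowset r" using r by (auto simp: rowset_def)
 have finX: "finite (rowset r)" by (simp add: rowset_def)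
 have i: "i a \<in> Ix" "rw (i a) = r" "cl (i a) = cl (pinv a k)" "pinv a k \<in> Ix" "rw (pinv a k) = rw k"
  "a (pinv a k) = k" if "a \<in> RG" for a
 proof -
  have p: "pinv a permutes Ix" using that by (auto simp: RG_iff permutes_inv)
  show j: "pinv a k \<in> Ix" using k p by (simp only: permutes_in_image)
  show rj: "rw (pinv a k) = rw k" using RG_inv[OF that] k by (simp add: RG_iff)
  show "a (pinv a k) = k" using that by (auto simp: RG_iff permutes_inverses)
  have "(r, cl (pinv a k)) \<in> Bx" using rwcl[OF j] rj r boxes_down by fastforce
  thus "i a \<in> Ix" "rw (i a) = r" "cl (i a) = cl (pinv a k)"
   unfolding i_def using rt_le rwcl_rt by auto
 qed
 have ai: "a (i a) \<in> rowset r" if "a \<in> RG" for a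
  using i[OF that] that permutes_in_image[of a "Ix" "i a"] by (auto simp: rowset_def RG_iff)
 have inv_a: "pinv (transpose j (a (i a)) o a) k = pinv a k" if "a \<in> RG" "j \<in> rowset r" for a j
 proof -
  have a: "a permutes Ix" using that by (simp add: RG_iff)
  have "(transpose j (a (i a)) o a) (pinv a k) = k"
   using i[OF that(1)] ai[OF that(1)] that(2) kX by (auto simp: transpose_def)
  moreover have "bij (transpose j (a (i a)) o a)" using a by (simp add: bij_comp permutes_bij)
  ultimately show ?thesis by (metis bij_inv_eq_iff)
 qed
 have tr: "transpose j (a (i a)) o a \<in> RG" if "a \<in> RG" "j \<in> rowset r" for a j
  using that ai[OF that(1)] by (intro RG_comp RG_transpose) (auto simp: rowset_def)
 have \<phi>P: "\<phi> x \<in> P" if "x \<in> P" for x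
  using that ai tr by (auto simp: \<phi>_def P_def)
 have ieq: "i (transpose j (a (i a)) o a) = i a" if "a \<in> RG" "j \<in> rowset r" for a j
  by (simp add: i_def inv_a[OF that, unfolded i_def])
 have \<phi>\<phi>: "\<phi> (\<phi> x) = x" if xP: "x \<in> P" for x
 proof -
  obtain j a where x: "x = (j, a)" by (cases x)
  have a: "a \<in> RG" and j: "j = k \<or> j \<in> rowset r" using xP x by (auto simp: P_def)
  show ?thesis
  proof (cases "j = k \<or> j = a (i a)")
   case True
   thus ?thesis using ai[OF a] kX by (auto simp: \<phi>_def x)
  next
   case False
   hence jX: "j \<in> rowset r" using j by auto
   let ?t = "transpose j (a (i a))"
   have "\<phi> x = (a (i a), ?t o a)" using False by (simp add: \<phi>_def x)
   moreover have "(?t o a) (i (?t o a)) = j" unfolding ieq[OF a jX] by simp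
   ultimately show ?thesis
    using False ai[OF a] kX
    by (auto simp: \<phi>_def x transpose_commute o_assoc)
  qed
 qed
 have neg: "f (\<phi> x) = - f x" if xP: "x \<in> P" for x
 proof -
  obtain j a where x: "x = (j, a)" by (cases x)
  have a: "a \<in> RG" and j: "j = k \<or> j \<in> rowset r" using xP x by (auto simp: P_def)
  obtain j2 a2 where x2: "\<phi> x = (j2, a2)" by (cases "\<phi> x")
  let ?t = "transpose (i a) (pinv a k)"
  have inj: "inj a" using permutes_inj[OF RG_perm[OF a]] .
  have t: "?t \<in> CG" using i[OF a] by (intro CG_transpose) auto
  have ne: "i a ~= pinv a k" using i[OF a] r by auto
  have "transpose j2 k o a2 = transpose j k o (transpose (a (i a)) k o a)"
  proof -
   have nk: "a (i a) ~= k" using ai[OF a] kX by auto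
   consider "j = k" | "j = a (i a)" "j ~= k" | "j ~= k" "j ~= a (i a)" by blast
   thus ?thesis
   proof cases
    case 3
    thus ?thesis using x2 x transpose_braid[OF 3 nk] by (auto simp: \<phi>_def o_assoc)
   qed (use x2 x nk in \<open>auto simp: \<phi>_def o_assoc\<close>)
  qed
  also have "... = (transpose j k o a) o ?t"
   using comp_transpose[OF inj, of "i a" "pinv a k"] i(6)[OF a] by (simp only: comp_assoc)
  finally have "f (\<phi> x) = perm_act (transpose j k o a) (perm_act ?t casym)"
   by (simp add: x2 f_def perm_act_comp)
  also have "... = - f x"
   using ne by (simp add: perm_act_casym[OF t] sign_swap_id perm_act_lops x f_def sc_minus1)
  finally show ?thesis .
 qed
 have "sum f P = (\<Sum>x\<in>P. - f x)"
  by (rule sum.reindex_bij_witness[of P \<phi> \<phi>]) (use \<phi>P \<phi>\<phi> neg in auto)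
 hence "sum f P = - sum f P" by (simp add: sum_negf)
 hence "sum f P + sum f P = 0" by (simp only: eq_neg_iff_add_eq_0)
 hence "sc 2 (sum f P) = 0" using fv.scale_left_distrib[of 1 1 "sum f P"] by simp
 hence "sum f P = 0" by (metis fv.scale_eq_0_iff zero_neq_numeral)
 moreover have "sum f P = (\<Sum>j\<in>insert k (rowset r). perm_act (transpose j k) yu)"
  by (simp add: P_def sum.cartesian_product[symmetric] f_def yu_eq perm_act_lops perm_act_comp)
 ultimately have "perm_act (transpose k k) yu + (\<Sum>j\<in>rowset r. perm_act (transpose j k) yu) = 0"
  using kX finX by simp
 thus ?thesis by (simp add: eq_neg_iff_add_eq_0 add.commute)
qed

lemma less_iff_box:
 assumes j: "j \<in> Ix" and k: "k \<in> Ix"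
 shows "j < k \<longleftrightarrow> rw j < rw k \<or> (rw j = rw k & cl j < cl k)"
proof -
 have lt: "a < b" if "a \<in> Ix" "b \<in> Ix" "rw a < rw b \<or> (rw a = rw b & cl a < cl b)" for a b
  using that rt_row_less[of "rw a" "cl a" "rw b" "cl b"] rt_col_less[of "cl a" "cl b" "rw a"] rwcl[of a] rwcl[of b]
  by auto
 consider "rw j < rw k \<or> (rw j = rw k & cl j < cl k)" | "rw k < rw j \<or> (rw k = rw j & cl k < cl j)"
  | "rw j = rw k & cl j = cl k"
  using linorder_less_linear[of "rw j" "rw k"] linorder_less_linear[of "cl j" "cl k"] by fastforce
 thus ?thesis using lt[OF j k] lt[OF k j] rwcl_eqI[OF j k] by cases auto
qed

text \<open>The indices j < k are those in higher rows, each of which contributes -1 by the Garnir relation, and those to the left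
 of k in its own row, each of which fixes yu.\<close>

lemma jm_yu:
 assumes k: "k \<in> Ix"
 shows "jm k yu = sc (of_int (int (cl k) - int (rw k))) yu"
proof -
 let ?f = "%j. perm_act (transpose j k) yu"
 let ?S = "{j \<in> Ix. rw j = rw k & cl j < cl k}"
 have split: "{1..<k} = (\<Union>r<rw k. rowset r) \<union> ?S"
 proof (rule Set.set_eqI)
  fix x show "x \<in> {1..<k} \<longleftrightarrow> x \<in> (\<Union>r<rw k. rowset r) \<union> ?S"
   using k less_iff_box[of x k] by (cases "x \<in> Ix") (auto simp: rowset_def)
 qed
 have "jm k yu = sum ?f (\<Union>r<rw k. rowset r) + sum ?f ?S"
  unfolding jm_def split by (rule sum.union_disjoint) (auto simp: rowset_def)
 also have "sum ?f (\<Union>r<rw k. rowset r) = (\<Sum>r<rw k. sum ?f (rowset r))"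
  by (rule sum.UNION_disjoint) (auto simp: rowset_def)
 also have "... = (\<Sum>r<rw k. - yu)" by (rule sum.cong) (auto simp: garnir[OF k])
 also have "... = sc (- of_nat (rw k)) yu" by (simp add: sum_negf fv.sum_constant_scale)
 also have "sum ?f ?S = (\<Sum>j\<in>?S. yu)"
  by (rule sum.cong) (use k in \<open>auto intro!: perm_act_yu RG_transpose\<close>)
 also have "... = sc (of_nat (card ?S)) yu" by (simp add: fv.sum_constant_scale)
 also have "card ?S = cl k"
 proof -
  have "bij_betw (%q. rt (rw k, q)) {..<cl k} ?S"
   unfolding bij_betw_def
  proof (intro conjI inj_onI equalityI subsetI)
   fix q q' assume "q \<in> {..<cl k}" "q' \<in> {..<cl k}" "rt (rw k, q) = rt (rw k, q')"
   thus "q = q'" using rt_col_less by (metis less_irrefl linorder_neqE_nat)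
  next
   fix j assume "j \<in> (%q. rt (rw k, q)) ` {..<cl k}"
   then obtain q where q: "q < cl k" "j = rt (rw k, q)" by auto
   hence "(rw k, q) \<in> Bx" using rwcl[OF k] boxes_down by (meson less_imp_le order_refl)
   thus "j \<in> ?S" using q rt_le rwcl_rt by auto
  next
   fix j assume "j \<in> ?S"
   thus "j \<in> (%q. rt (rw k, q)) ` {..<cl k}" using rwcl[of j] by (auto intro!: image_eqI[of _ _ "cl j"])
  qed
  thus ?thesis by (simp add: bij_betw_same_card[symmetric])
 qed
 finally show ?thesis by (simp add: fv.scale_left_diff_distrib)
qed

section \<open>Row symmetrisation\<close>

lemma card_rwcl: "card {k \<in> Ix. P (rw k) (cl k)} = card {b \<in> Bx. P (fst b) (snd b)}"
proof -
 have "bij_betw rt {b \<in> Bx. P (fst b) (snd b)} {k \<in> Ix. P (rw k) (cl k)}"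
  unfolding bij_betw_def
 proof (intro conjI equalityI subsetI)
  show "inj_on rt {b \<in> Bx. P (fst b) (snd b)}" by (rule inj_on_subset[OF rt_inj]) auto
 next
  fix k assume "k \<in> rt ` {b \<in> Bx. P (fst b) (snd b)}"
  then obtain b where b: "b \<in> Bx" "P (fst b) (snd b)" "k = rt b" by blast
  thus "k \<in> {k \<in> Ix. P (rw k) (cl k)}" using rt_le[of "fst b" "snd b"] rwcl_rt[OF b(1)] by simp
 next
  fix k assume k: "k \<in> {k \<in> Ix. P (rw k) (cl k)}"
  thus "k \<in> rt ` {b \<in> Bx. P (fst b) (snd b)}" using rwcl[of k] by (intro image_eqI[of _ _ "(rw k, cl k)"]) auto
 qed
 thus ?thesis by (simp add: bij_betw_same_card)
qed

lemma card_row_part: "r < length \<tau> ==> card {k \<in> Ix. rw k = r & cl k < m} = min (\<tau> ! r) m"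
proof -
 assume r: "r < length \<tau>"
 have "{b \<in> Bx. fst b = r & snd b < m} = {r} \<times> {..<min (\<tau> ! r) m}" using r by (auto simp: boxes_def)
 thus ?thesis using card_rwcl[of "%x y. x = r & y < m"] by (simp add: card_cartesian_product)
qed

lemma rw_less_length: "k \<in> Ix ==> rw k < length \<tau> & cl k < \<tau> ! rw k"
 using rwcl[of k] unfolding boxes_def by (cases "box_of \<tau> rt k") auto

text \<open>Counting. For every m, as many entries k have column of g^-1 k below m as have column below m; in each row the former
 are at most as many as the latter, since the row has distinct columns. Hence there is equality in every row, and
 moving each k inside its row to the column of g^-1 k is a row permutation that turns g into a column permutation.\<close>

lemma RC_dichotomy:
 assumes g: "g permutes Ix"
  and no: "\<And>i j. i \<in> Ix ==> j \<in> Ix ==> rw i = rw j ==> cl (pinv g i) = cl (pinv g j) ==> i = j"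
 shows "\<exists>p\<in>RG. \<exists>q\<in>CG. g = p o q"
proof -
 let ?c = "%k. cl (pinv g k)"
 have gi: "pinv g permutes Ix" by (rule permutes_inv[OF g])
 have count: "card {k \<in> Ix. ?c k < m} = card {k \<in> Ix. cl k < m}" for m
 proof (rule bij_betw_same_card[of "pinv g"], rule bij_betw_byWitness[where f' = g])
  show "\<forall>x\<in>{k \<in> Ix. ?c k < m}. g (pinv g x) = x" "\<forall>x\<in>{k \<in> Ix. cl k < m}. pinv g (g x) = x"
   by (simp_all add: permutes_inverses[OF g])
 qed (use permutes_in_image[OF gi] permutes_in_image[OF g] permutes_inverses[OF g] in auto)
 have rows: "card {k \<in> Ix. P k} = (\<Sum>r<length \<tau>. card {k \<in> Ix. rw k = r & P k})" for P
 proof -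
  have "{k \<in> Ix. P k} = (\<Union>r<length \<tau>. {k \<in> Ix. rw k = r & P k})"
   using rw_less_length by blast
  hence "card {k \<in> Ix. P k} = card (\<Union>r<length \<tau>. {k \<in> Ix. rw k = r & P k})" by (rule arg_cong)
  also have "... = (\<Sum>r<length \<tau>. card {k \<in> Ix. rw k = r & P k})"
   by (rule card_UN_disjoint) auto
  finally show ?thesis .
 qed
 have le: "card {k \<in> Ix. rw k = r & ?c k < m} \<le> card {k \<in> Ix. rw k = r & cl k < m}"
  if r: "r < length \<tau>" for r m
 proof -
  have "card {k \<in> Ix. rw k = r & ?c k < m} = card (?c ` {k \<in> Ix. rw k = r & ?c k < m})"
  proof (rule card_image[symmetric], rule inj_onI)
   fix x y assume "x \<in> {k \<in> Ix. rw k = r & ?c k < m}" "y \<in> {k \<in> Ix. rw k = r & ?c k < m}" "?c x = ?c y"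
   hence "x \<in> Ix" "y \<in> Ix" "rw x = rw y" "?c x = ?c y" by simp_all
   thus "x = y" by (rule no)
  qed
  also have "... \<le> card {..<m}" by (rule card_mono) auto
  finally have 1: "card {k \<in> Ix. rw k = r & ?c k < m} \<le> m" by simp
  have "card {k \<in> Ix. rw k = r & ?c k < m} \<le> card {k \<in> Ix. rw k = r & cl k < \<tau> ! r}"
   using rw_less_length by (intro card_mono) auto
  thus ?thesis using 1 card_row_part[OF r] by simp
 qed
 have eq: "card {k \<in> Ix. rw k = r & ?c k < m} = card {k \<in> Ix. rw k = r & cl k < m}"
  if r: "r < length \<tau>" for r m
  by (rule sum_mono_inv[of "%r. card {k \<in> Ix. rw k = r & ?c k < m}" "{..<length \<tau>}"
     "%r. card {k \<in> Ix. rw k = r & cl k < m}" r])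
   (use rows[of "%k. ?c k < m"] rows[of "%k. cl k < m"] count le r in auto)
 have inB: "(rw k, ?c k) \<in> Bx" if k: "k \<in> Ix" for k
 proof -
  let ?r = "rw k"
  have r: "?r < length \<tau>" using rw_less_length[OF k] by simp
  have "{j \<in> Ix. rw j = ?r & ?c j < \<tau> ! ?r} = {j \<in> Ix. rw j = ?r}"
  proof (rule card_subset_eq)
   have "{j \<in> Ix. rw j = ?r} = {j \<in> Ix. rw j = ?r & cl j < \<tau> ! ?r}"
    using rw_less_length by (intro Collect_cong) metis
   thus "card {j \<in> Ix. rw j = ?r & ?c j < \<tau> ! ?r} = card {j \<in> Ix. rw j = ?r}"
    using eq[OF r] by simp
  qed auto
  hence "?c k < \<tau> ! ?r" using k by blast
  thus ?thesis using r by (simp add: boxes_def)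
 qed
 \<comment> \<open>moves k inside its row to the column of g^-1 k\<close>
 define h where "h = (%k. if k \<in> Ix then rt (rw k, ?c k) else k)"
 have h: "h k \<in> Ix & rw (h k) = rw k & cl (h k) = ?c k" if "k \<in> Ix" for k
  using inB[OF that] rt_le rwcl_rt that by (auto simp: h_def)
 have inj: "inj_on h Ix"
 proof (rule inj_onI)
  fix x y assume "x \<in> Ix" "y \<in> Ix" "h x = h y"
  thus "x = y" using h[of x] h[of y] no[of x y] by simp
 qed
 have hp: "h permutes Ix"
 proof (rule bij_imp_permutes)
  have "h ` Ix \<subseteq> Ix" using h by blast
  hence "h ` Ix = Ix" using inj by (simp add: endo_inj_surj)
  thus "bij_betw h Ix Ix" using inj by (simp add: bij_betw_def)
 qed (auto simp: h_def)
 have hR: "h \<in> RG" using hp h by (simp add: RG_iff)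
 have q: "h o g \<in> CG" unfolding CG_iff
 proof (intro conjI ballI)
  show "h o g permutes Ix" by (rule permutes_compose[OF g hp])
  fix k assume k: "k \<in> Ix"
  have "g k \<in> Ix" using k by (simp only: permutes_in_image[OF g])
  thus "cl ((h o g) k) = cl k" using h[of "g k"] permutes_inverses(2)[OF g, of k] by simp
 qed
 have "g = pinv h o (h o g)" using permutes_inv_o(2)[OF hp] by (simp add: o_assoc)
 thus ?thesis using RG_inv[OF hR] q by blast
qed

text \<open>If g = p q with p a row and q a column permutation, p is absorbed by the sum and q gives a sign. Otherwise some row
 transposition is conjugate by g to a column transposition, and the sum equals its own negative.\<close>

lemma row_absorb:
 assumes g: "g permutes Ix"
 shows "\<exists>z. (\<Sum>a\<in>RG. perm_act (a o g) casym) = sc z yu"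
proof (cases "\<exists>p\<in>RG. \<exists>q\<in>CG. g = p o q")
 case True
 then obtain p q where pq: "p \<in> RG" "q \<in> CG" "g = p o q" by blast
 have "(\<Sum>a\<in>RG. perm_act (a o g) casym) = (\<Sum>a\<in>RG. perm_act (a o p) (perm_act q casym))"
  by (simp add: pq perm_act_comp o_assoc)
 also have "... = sc (of_int (sign q)) (\<Sum>a\<in>RG. perm_act (a o p) casym)"
  by (simp add: perm_act_casym[OF pq(2)] perm_act_lops fv.scale_sum_right)
 also have "(\<Sum>a\<in>RG. perm_act (a o p) casym) = (\<Sum>a\<in>RG. perm_act a casym)"
  by (rule sum.reindex_bij_witness[of _ "%b. b o pinv p" "%b. b o p"])
   (use pq in \<open>simp_all add: RG_comp RG_inv comp_assoc RG_inv_o\<close>)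
 finally show ?thesis unfolding yu_eq by blast
next
 case False
 then obtain i j where ij: "i \<in> Ix" "j \<in> Ix" "rw i = rw j" "cl (pinv g i) = cl (pinv g j)" "i ~= j"
  using RC_dichotomy[OF g] by blast
 let ?t = "transpose i j" and ?t' = "transpose (pinv g i) (pinv g j)"
 have gi: "pinv g permutes Ix" by (rule permutes_inv[OF g])
 have t: "?t \<in> RG" using ij by (intro RG_transpose)
 have "pinv g i \<in> Ix" "pinv g j \<in> Ix" using ij by (simp_all only: permutes_in_image[OF gi])
 hence t': "?t' \<in> CG" using ij by (intro CG_transpose)
 have ne: "pinv g i ~= pinv g j" using ij(5) permutes_inj[OF gi] by (auto dest: injD)
 have "?t o g = g o ?t'"
  using comp_transpose[OF permutes_inj[OF g], of "pinv g i" "pinv g j"] permutes_inverses(1)[OF g] by simp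
 hence eq: "a o ?t o g = a o g o ?t'" for a by (metis comp_assoc)
 let ?S = "\<Sum>a\<in>RG. perm_act (a o g) casym"
 have "?S = (\<Sum>a\<in>RG. perm_act (a o ?t o g) casym)"
  by (rule sum.reindex_bij_witness[of _ "%b. b o ?t" "%b. b o ?t"])
   (use t in \<open>simp_all add: RG_comp comp_assoc\<close>)
 also have "... = (\<Sum>a\<in>RG. perm_act (a o g) (perm_act ?t' casym))" by (simp add: eq perm_act_comp)
 also have "... = - ?S" using ne
  by (simp add: perm_act_casym[OF t'] sign_swap_id perm_act_lops sum_negf sc_minus1)
 finally have "?S + ?S = 0" by (simp only: eq_neg_iff_add_eq_0)
 hence "sc 2 ?S = 0" using fv.scale_left_distrib[of 1 1 ?S] by simp
 hence "?S = 0" by (metis fv.scale_eq_0_iff zero_neq_numeral)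
 thus ?thesis by (intro exI[of _ 0]) simp
qed

definition "VV = fv.span {perm_act w yu | w. w permutes Ix}"

lemma ks_yu: "ks yu \<subseteq> {p. p permutes Ix}"
proof -
 have "ks (Poly_Mapping.single (a o b) (of_int (sign b) :: complex)) \<subseteq> {p. p permutes Ix}"
  if "a \<in> RG" "b \<in> CG" for a b
  using permutes_compose[OF CG_perm[OF that(2)] RG_perm[OF that(1)]] by auto
 thus ?thesis unfolding young_symmetrizer_def
  by (intro order.trans[OF keys_sum] UN_least)
qed

lemma ks_perm_act: "ks (perm_act w u) \<subseteq> (%p. w o p) ` ks u"
 unfolding perm_act_def linear_ext_def by (intro order.trans[OF keys_sum] UN_least) auto

lemma specht_eq: "specht \<tau> = VV"
 unfolding specht_def VV_def sum_tau
proof (rule span_formal)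
 show "{perm_act w yu |w. w permutes Ix} \<subseteq> carrier (formal_space {p. p permutes Ix})"
 proof (clarsimp simp only: carrier_formal mem_Collect_eq)
  fix w x assume w: "w permutes Ix" and x: "x \<in> ks (perm_act w yu)"
  then obtain p where "p \<in> ks yu" "x = w o p" using ks_perm_act[of w yu] by blast
  thus "x permutes Ix" using ks_yu permutes_compose[OF _ w] by blast
 qed
qed

lemma VV_perm_act: "v \<in> VV ==> w permutes Ix ==> perm_act w v \<in> VV"
 unfolding VV_def
 by (rule linear_span_image[OF linear_perm_act]) (auto simp: perm_act_comp intro!: fv.span_base permutes_compose)

lemma VV_subspace: "fv.subspace VV" unfolding VV_def by (rule fv.subspace_span)
lemmas VV_closed = VV_subspace[THEN fv.subspace_add] VV_subspace[THEN fv.subspace_scale]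
 VV_subspace[THEN fv.subspace_diff] VV_subspace[THEN fv.subspace_sum] VV_subspace[THEN fv.subspace_0]

lemma yu_VV: "yu \<in> VV" unfolding VV_def
 by (rule fv.span_base) (auto intro!: exI[of _ id] permutes_id)

text \<open>So the invariants of the row group in VV are one-dimensional. This makes the weight space of the row tableau a line
 (ewt_T0) and the invariant form on VV unique (form_unique).\<close>

lemma row_sym_VV:
 assumes "v \<in> VV" shows "\<exists>z. (\<Sum>a\<in>RG. perm_act a v) = sc z yu"
 using assms unfolding VV_def
proof (induction rule: fv.span_induct_alt)
 case base
 show ?case by (intro exI[of _ 0]) (simp add: perm_act_lops)
next
 case (step c x y)
 then obtain w z where w: "w permutes Ix" "x = perm_act w yu" and z: "(\<Sum>a\<in>RG. perm_act a y) = sc z yu" by blast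
 have "\<exists>z. \<forall>b\<in>RG. (\<Sum>a\<in>RG. perm_act (a o (w o b)) casym) = sc (z b) yu"
  by (intro bchoice ballI row_absorb permutes_compose[OF RG_perm w(1)])
 then obtain zz where zz: "\<And>b. b \<in> RG ==> (\<Sum>a\<in>RG. perm_act (a o (w o b)) casym) = sc (zz b) yu" by blast
 have "(\<Sum>a\<in>RG. perm_act a x) = (\<Sum>a\<in>RG. \<Sum>b\<in>RG. perm_act (a o (w o b)) casym)"
  by (simp add: w yu_eq perm_act_lops perm_act_comp comp_assoc)
 also have "... = (\<Sum>b\<in>RG. sc (zz b) yu)" by (subst sum.swap) (simp add: zz)
 also have "... = sc (sum zz RG) yu" by (simp add: fv.scale_sum_left)
 finally show ?case using z
  by (intro exI[of _ "c * sum zz RG + z"]) (simp add: perm_act_lops sum.distrib fv.scale_sum_right[symmetric] sc_distribs)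
qed

section \<open>Joint eigenspaces of the Jucys-Murphy elements\<close>

abbreviation (input) "sw i \<equiv> transpose i (Suc i)"

lemma perm_act_sw2 [simp]: "perm_act (transpose i j) (perm_act (transpose i j) v) = v"
 by (simp add: perm_act_comp)

lemma sw_jm: "1 \<le> i ==> jm (Suc i) (perm_act (sw i) v) = perm_act (sw i) (jm i v) + v"
proof -
 assume i: "1 \<le> i"
 have e: "transpose j (Suc i) o sw i = sw i o transpose j i" if "j \<in> {1..<i}" for j
  using that by (auto simp: fun_eq_iff transpose_def)
 have "{1..<Suc i} = insert i {1..<i}" using i by auto
 hence "jm (Suc i) (perm_act (sw i) v) = perm_act (sw i) (perm_act (sw i) v) + (\<Sum>j\<in>{1..<i}. perm_act (transpose j (Suc i)) (perm_act (sw i) v))"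
  unfolding jm_def by simp
 also have "(\<Sum>j\<in>{1..<i}. perm_act (transpose j (Suc i)) (perm_act (sw i) v)) = perm_act (sw i) (jm i v)"
  unfolding jm_def perm_act_lops perm_act_comp by (rule sum.cong) (simp_all only: e)
 also have "perm_act (sw i) (perm_act (sw i) v) = v" by simp
 finally show ?thesis by (simp add: add.commute)
qed

lemma sw_jm': "1 \<le> i ==> jm i (perm_act (sw i) v) = perm_act (sw i) (jm (Suc i) v) - v"
 using sw_jm[of i "perm_act (sw i) v"]
 by (metis (no_types, lifting) add_diff_cancel_right' lop_add linear_perm_act perm_act_sw2)

lemma sw_jm_other:
 assumes "1 \<le> i" "k ~= i" "k ~= Suc i"
 shows "jm k (perm_act (sw i) v) = perm_act (sw i) (jm k v)"
proof (cases "k < i")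
 case True
 have e: "transpose j k o sw i = sw i o transpose j k" if "j \<in> {1..<k}" for j
  using that True by (auto simp: fun_eq_iff transpose_def)
 show ?thesis unfolding jm_def perm_act_lops perm_act_comp
  by (rule sum.cong) (simp_all only: e)
next
 case False
 hence k: "Suc i < k" using assms by auto
 have e: "transpose (sw i j) k o sw i = sw i o transpose j k" if "j \<in> {1..<k}" for j
  using that k by (auto simp: fun_eq_iff transpose_def)
 have "jm k (perm_act (sw i) v) = (\<Sum>j\<in>{1..<k}. perm_act (transpose (sw i j) k o sw i) v)"
  unfolding jm_def perm_act_comp
  by (rule sum.reindex_bij_witness[of _ "sw i" "sw i"]) (use k assms in \<open>auto simp: transpose_def\<close>)
 also have "... = perm_act (sw i) (jm k v)"
  unfolding jm_def perm_act_lops perm_act_comp by (rule sum.cong) (simp_all only: e)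
 finally show ?thesis .
qed

definition "ewt d = {v \<in> VV. \<forall>k\<in>Ix. jm k v = sc (of_int (d k)) v}"

lemma ewt_cong: "(\<And>k. k \<in> Ix ==> d k = d' k) ==> ewt d = ewt d'" by (simp add: ewt_def)

lemma ip_transpose: "ip (perm_act (transpose i j) u) v = ip u (perm_act (transpose i j) v)"
 using ip_perm_act[of "transpose i j" u "perm_act (transpose i j) v"] by simp

lemma ip_jm: "ip (jm k u) v = ip u (jm k v)"
 by (simp add: jm_def ip_sum_left ip_sum_right ip_transpose)

lemma ewt_orth:
 assumes "v \<in> ewt d" "w \<in> ewt d'" "k \<in> Ix" "d k ~= d' k"
 shows "ip v w = 0"
proof -
 have "ip (jm k v) w = ip v (jm k w)" by (rule ip_jm)
 hence "of_int (d k) * ip v w = of_int (d' k) * ip v w"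
  using assms by (simp add: ewt_def ip_sc_left ip_sc_right)
 thus ?thesis using assms(4) by auto
qed

text \<open>The intertwiner between the weight spaces for d and for d with the entries i, i+1 exchanged, where D is the difference
 d (i+1) - d i.\<close>

definition swv :: "nat => int => gv => gv" where
 "swv i D v = perm_act (sw i) v - sc (1 / of_int D) v"

lemma swv_ewt:
 assumes v: "v \<in> ewt d" and i: "1 \<le> i" "Suc i \<le> n" and D: "D = d (Suc i) - d i" "D ~= 0"
 shows "swv i D v \<in> ewt (d o sw i)" unfolding ewt_def
proof (intro CollectI conjI ballI)
 have swp: "sw i permutes Ix" using i by (intro permutes_swap_id) auto
 have vV: "v \<in> VV" and e: "\<And>k. k \<in> Ix ==> jm k v = sc (of_int (d k)) v" using v by (auto simp: ewt_def)
 show "swv i D v \<in> VV" unfolding swv_def by (intro VV_closed VV_perm_act vV swp)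
 have ei: "jm i v = sc (of_int (d i)) v" "jm (Suc i) v = sc (of_int (d (Suc i))) v" using e i by auto
 have dd: "(of_int (d (Suc i)) :: complex) = of_int D + of_int (d i)" using D by simp
 have D0: "(of_int D :: complex) ~= 0" using D by simp
 fix k assume k: "k \<in> Ix"
 consider "k = i" | "k = Suc i" | "k ~= i" "k ~= Suc i" by blast
 thus "jm k (swv i D v) = sc (of_int ((d o sw i) k)) (swv i D v)"
 proof cases
  case 1
  have "jm k (swv i D v) = sc (of_int (d (Suc i))) (perm_act (sw i) v) - v - sc (of_int (d i) / of_int D) v"
   using 1 i by (simp add: swv_def lops[OF linear_jm] sw_jm' ei perm_act_lops)
  also have "... = sc (of_int (d (Suc i))) (perm_act (sw i) v) - sc (1 + of_int (d i) / of_int D) v"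
   by (simp add: sc_distribs)
  also have "1 + of_int (d i) / of_int D = (of_int (d (Suc i)) / of_int D :: complex)"
   using D0 by (simp add: dd field_simps)
  finally show ?thesis using 1 by (simp add: swv_def sc_distribs)
 next
  case 2
  have "jm k (swv i D v) = sc (of_int (d i)) (perm_act (sw i) v) + v - sc (of_int (d (Suc i)) / of_int D) v"
   using 2 i by (simp add: swv_def lops[OF linear_jm] sw_jm ei perm_act_lops)
  also have "... = sc (of_int (d i)) (perm_act (sw i) v) - sc (of_int (d (Suc i)) / of_int D - 1) v"
   by (simp add: sc_distribs)
  also have "of_int (d (Suc i)) / of_int D - 1 = (of_int (d i) / of_int D :: complex)"
   using D0 by (simp add: dd field_simps)
  finally show ?thesis using 2 by (simp add: swv_def sc_distribs)
 next
  case 3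
  thus ?thesis using i e[OF k]
   by (simp add: swv_def lops[OF linear_jm] sw_jm_other perm_act_lops sc_distribs mult.commute)
 qed
qed

lemma swv_norm:
 assumes v: "v \<in> ewt d" and i: "1 \<le> i" "Suc i \<le> n" and D: "D = d (Suc i) - d i" "D ~= 0"
 shows "ip (swv i D v) (swv i D v) = (1 - 1 / (of_int D)\<^sup>2) * ip v v"
proof -
 have "ip (swv i D v) v = 0"
  by (rule ewt_orth[OF swv_ewt[OF assms] v, of i]) (use D i in auto)
 hence o1: "ip (perm_act (sw i) v) v = (1 / of_int D) * ip v v"
  by (simp add: swv_def ip_simps)
 hence o2: "ip v (perm_act (sw i) v) = (1 / of_int D) * ip v v"
  by (metis ip_transpose)
 have o3: "ip (perm_act (sw i) v) (perm_act (sw i) v) = ip v v"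
  by (rule ip_perm_act) simp
 show ?thesis unfolding swv_def
  by (simp add: ip_simps o1 o2 o3 power2_eq_square algebra_simps)
qed

lemma swv_swv:
 assumes "v \<in> VV" "D ~= 0"
 shows "swv i (- D) (swv i D v) = sc (1 - 1 / (of_int D)\<^sup>2) v"
 unfolding swv_def by (simp add: perm_act_lops sc_distribs power2_eq_square algebra_simps)

text \<open>The intertwined vector has norm (1 - 1/e^2) times that of v, which is 0.\<close>

lemma ewt_adjacent:
 assumes v: "v \<in> ewt d" and i: "1 \<le> i" "Suc i \<le> n" and D: "d (Suc i) - d i = e" "e = 1 \<or> e = -1"
 shows "perm_act (sw i) v = sc (of_int e) v"
proof -
 have "ip (swv i e v) (swv i e v) = 0" using swv_norm[OF v i, of e] D by auto
 hence "swv i e v = 0" by (simp add: ip_self_zero)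
 thus ?thesis using D(2) by (auto simp: swv_def)
qed

section \<open>Standard tableaux\<close>

abbreviation "SYT \<equiv> standard_tableaux \<tau>"
abbreviation "ct T k \<equiv> box_content \<tau> T k"
abbreviation "bo T k \<equiv> box_of \<tau> T k"

lemma SYT_D:
 assumes "T \<in> SYT"
 shows "T \<in> extensional Bx" "bij_betw T Bx Ix"
  "\<And>r q q'. (r, q) \<in> Bx ==> (r, q') \<in> Bx ==> q < q' ==> T (r, q) < T (r, q')"
  "\<And>r r' q. (r, q) \<in> Bx ==> (r', q) \<in> Bx ==> r < r' ==> T (r, q) < T (r', q)"
 using assms unfolding standard_tableaux_def sum_tau by blast+

lemma SYT_I:
 assumes "T \<in> extensional Bx" "bij_betw T Bx Ix"
  "\<And>r q q'. (r, q) \<in> Bx ==> (r, q') \<in> Bx ==> q < q' ==> T (r, q) < T (r, q')"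
  "\<And>r r' q. (r, q) \<in> Bx ==> (r', q) \<in> Bx ==> r < r' ==> T (r, q) < T (r', q)"
 shows "T \<in> SYT"
 using assms unfolding standard_tableaux_def sum_tau by blast

lemma finite_SYT [simp]: "finite SYT"
proof (rule finite_subset)
 show "SYT \<subseteq> Bx \<rightarrow>\<^sub>E Ix"
  using bij_betwE[OF SYT_D(2)] SYT_D(1) by (auto simp only: PiE_def Pi_iff)
qed (rule finite_PiE, auto)

lemma bo: "T \<in> SYT ==> k \<in> Ix ==> bo T k \<in> Bx & T (bo T k) = k"
 using box_of_in SYT_D(2) by blast
lemma bo_T: "T \<in> SYT ==> b \<in> Bx ==> bo T (T b) = b"
 using box_of_eq SYT_D(2) by blast
lemma T_in: "T \<in> SYT ==> b \<in> Bx ==> T b \<in> Ix"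
 using bij_betwE[OF SYT_D(2)] by blast

lemma T_mono:
 assumes T: "T \<in> SYT" and b: "(r, q) \<in> Bx" "(r', q') \<in> Bx" "r \<le> r'" "q \<le> q'" "(r, q) ~= (r', q')"
 shows "T (r, q) < T (r', q')"
proof -
 have m: "(r, q') \<in> Bx" using boxes_down[OF b(2) b(3) order_refl] .
 have 1: "T (r, q) \<le> T (r, q')" using SYT_D(3)[OF T b(1) m] b(4) by (cases "q = q'") auto
 have 2: "T (r, q') \<le> T (r', q')" using SYT_D(4)[OF T m b(2)] b(3) by (cases "r = r'") auto
 show ?thesis
 proof (cases "q = q'")
  case True thus ?thesis using SYT_D(4)[OF T m b(2)] b by auto
 next
  case False thus ?thesis using SYT_D(3)[OF T b(1) m] b 2 by auto
 qed
qed

lemma row_lt_col_gt: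
 assumes T: "T \<in> SYT" and "k \<in> Ix" "l \<in> Ix" "k < l" "fst (bo T l) < fst (bo T k)"
 shows "snd (bo T k) < snd (bo T l)"
proof (rule ccontr)
 assume "\<not> ?thesis"
 hence "T (fst (bo T l), snd (bo T l)) < T (fst (bo T k), snd (bo T k))"
  using assms bo[OF T] by (intro T_mono) auto
 thus False using assms bo[OF T] by auto
qed

text \<open>Two boxes on the same diagonal have a box of the shape properly between them, whose entry would lie strictly between i
 and i+1.\<close>

lemma ct_Suc_ne:
 assumes T: "T \<in> SYT" and i: "1 \<le> i" "Suc i \<le> n"
 shows "ct T (Suc i) ~= ct T i"
proof
 assume e: "ct T (Suc i) = ct T i"
 obtain r q where b: "bo T i = (r, q)" by (cases "bo T i")
 obtain r' q' where b': "bo T (Suc i) = (r', q')" by (cases "bo T (Suc i)")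
 have B: "(r, q) \<in> Bx" "T (r, q) = i" "(r', q') \<in> Bx" "T (r', q') = Suc i"
  using bo[OF T, of i] bo[OF T, of "Suc i"] i b b' by auto
 have d: "int q' - int r' = int q - int r" using e b b' by (simp add: box_content_def)
 consider "r = r'" | "r' < r" | "r < r'" by linarith
 thus False
 proof cases
  case 1 thus False using d B by auto
 next
  case 2 hence "T (r', q') < T (r, q)" using d B by (intro T_mono[OF T]) auto
  thus False using B by simp
 next
  case 3
  hence q: "q < q'" using d by simp
  have m: "(r, q') \<in> Bx" using boxes_down[OF B(3), of r q'] 3 by simp
  have "T (r, q) < T (r, q')" by (rule SYT_D(3)[OF T B(1) m q])
  moreover have "T (r, q') < T (r', q')" by (rule SYT_D(4)[OF T m B(3) 3])
  ultimately show False using B by simp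
 qed
qed

definition swT :: "nat => tableau => tableau" where
 "swT i T = (\<lambda>b\<in>Bx. transpose i (Suc i) (T b))"

lemma transpose_less: "a < b ==> \<not> (a = i & b = Suc i) ==> sw i a < sw i b"
 by (auto simp: transpose_def)

lemma swT_SYT:
 assumes T: "T \<in> SYT" and i: "1 \<le> i" "Suc i \<le> n"
  and ne: "ct T (Suc i) - ct T i ~= 1" "ct T (Suc i) - ct T i ~= -1"
 shows "swT i T \<in> SYT"
proof (rule SYT_I)
 show "swT i T \<in> extensional Bx" by (simp add: swT_def)
 have "sw i permutes Ix" using i by (intro permutes_swap_id) auto
 hence "bij_betw (sw i o T) Bx Ix"
  using bij_betw_trans[OF SYT_D(2)[OF T] permutes_imp_bij] by blast
 thus "bij_betw (swT i T) Bx Ix"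
  by (rule bij_betw_cong[THEN iffD1, rotated]) (simp add: swT_def)
 have btw: False if "(r, q) \<in> Bx" "(r', q') \<in> Bx" "T (r, q) = i" "T (r', q') = Suc i"
  "r = r' & q < q' \<or> q = q' & r < r'" for r q r' q'
 proof -
  have "bo T i = (r, q)" "bo T (Suc i) = (r', q')" using bo_T[OF T that(1)] bo_T[OF T that(2)] that by auto
  hence c: "ct T i = int q - int r" "ct T (Suc i) = int q' - int r'" by (simp_all add: box_content_def)
  from that(5) show False
  proof
   assume a: "r = r' & q < q'"
   hence lt: "Suc q < q'" using ne c by (cases "Suc q = q'") auto
   have m: "(r, Suc q) \<in> Bx" using boxes_down[OF that(2), of r "Suc q"] a lt by simp
   have "T (r, q) < T (r, Suc q)" by (rule SYT_D(3)[OF T that(1) m]) simp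
   moreover have "T (r, Suc q) < T (r, q')" by (rule SYT_D(3)[OF T m _ lt]) (use that(2) a in simp)
   ultimately show False using that a by simp
  next
   assume a: "q = q' & r < r'"
   hence lt: "Suc r < r'" using ne c by (cases "Suc r = r'") auto
   have m: "(Suc r, q) \<in> Bx" using boxes_down[OF that(2), of "Suc r" q] a lt by simp
   have "T (r, q) < T (Suc r, q)" by (rule SYT_D(4)[OF T that(1) m]) simp
   moreover have "T (Suc r, q) < T (r', q)" by (rule SYT_D(4)[OF T m _ lt]) (use that(2) a in simp)
   ultimately show False using that a by simp
  qed
 qed
 show "swT i T (r, q) < swT i T (r, q')" if "(r, q) \<in> Bx" "(r, q') \<in> Bx" "q < q'" for r q q'
  using that btw[OF that(1,2)] SYT_D(3)[OF T that] by (auto simp: swT_def intro!: transpose_less)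
 show "swT i T (r, q) < swT i T (r', q)" if "(r, q) \<in> Bx" "(r', q) \<in> Bx" "r < r'" for r r' q
  using that btw[OF that(1,2)] SYT_D(4)[OF T that] by (auto simp: swT_def intro!: transpose_less)
qed

lemma bo_swT:
 assumes T: "T \<in> SYT" and i: "1 \<le> i" "Suc i \<le> n" and S: "swT i T \<in> SYT" and k: "k \<in> Ix"
 shows "bo (swT i T) k = bo T (sw i k)"
proof -
 have "sw i permutes Ix" using i by (intro permutes_swap_id) auto
 hence k': "sw i k \<in> Ix" using k by (simp only: permutes_in_image)
 have "swT i T (bo T (sw i k)) = k" using bo[OF T k'] by (simp add: swT_def)
 thus ?thesis using bo_T[OF S, of "bo T (sw i k)"] bo[OF T k'] by simp
qed

lemma ct_swT:
 "T \<in> SYT ==> 1 \<le> i ==> Suc i \<le> n ==> swT i T \<in> SYT ==> k \<in> Ix ==> ct (swT i T) k = ct T (sw i k)"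
 by (simp add: box_content_def bo_swT)

definition "T0 = restrict rt Bx"

lemma T0_SYT: "T0 \<in> SYT"
proof (rule SYT_I)
 show "bij_betw T0 Bx Ix" using rt_bij by (rule bij_betw_cong[THEN iffD1, rotated]) (simp add: T0_def)
qed (auto simp: T0_def rt_row_less rt_col_less)

lemma bo_T0: "bo T0 k = bo rt k"
 unfolding box_of_def T0_def by (rule arg_cong[of _ _ The]) (auto simp: fun_eq_iff)

lemma label_card:
 assumes bij: "bij_betw f B {1..m}" and b: "b \<in> B"
 shows "f b = card {b' \<in> B. f b' \<le> f b}"
proof -
 have fb: "f b \<in> {1..m}" using assms by (auto simp: bij_betw_def)
 have "bij_betw f {b' \<in> B. f b' \<le> f b} {1..f b}"
  unfolding bij_betw_def
 proof (intro conjI equalityI subsetI)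
  show "inj_on f {b' \<in> B. f b' \<le> f b}" using bij by (auto simp: bij_betw_def intro: inj_on_subset)
 next
  fix x assume "x \<in> f ` {b' \<in> B. f b' \<le> f b}"
  thus "x \<in> {1..f b}" using bij by (auto simp: bij_betw_def)
 next
  fix x assume x: "x \<in> {1..f b}"
  hence "x \<in> f ` B" using bij fb by (auto simp: bij_betw_def)
  thus "x \<in> f ` {b' \<in> B. f b' \<le> f b}" using x by auto
 qed
 thus ?thesis by (simp add: bij_betw_same_card)
qed

lemma exists_descent:
 assumes T: "T \<in> SYT" "T ~= T0"
 shows "\<exists>i. 1 \<le> i & Suc i \<le> n & fst (bo T (Suc i)) < fst (bo T i)"
proof (rule ccontr)
 assume no: "\<not> ?thesis"
 have mono: "fst (bo T k) \<le> fst (bo T l)" if "1 \<le> k" "k \<le> l" "l \<le> n" for k l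
  using that(2,3)
 proof (induction l rule: dec_induct)
  case (step l)
  hence "fst (bo T l) \<le> fst (bo T (Suc l))" using no that by (meson not_le_imp_less le_trans less_imp_le_nat)
  thus ?case using step by simp
 qed simp
 have le_iff: "T b \<le> T b' \<longleftrightarrow> rt b \<le> rt b'" if b: "b \<in> Bx" "b' \<in> Bx" for b b'
 proof -
  have lt: "T x < T y" if "x \<in> Bx" "y \<in> Bx" "rt x < rt y" for x y
  proof -
   obtain r q r' q' where e: "x = (r, q)" "y = (r', q')" by (cases x, cases y)
   have "r \<le> r'" using rt_row_less[of r' q' r q] that e by fastforce
   show ?thesis
   proof (cases "r = r'")
    case True
    hence "q < q'" using rt_col_less[of q' q r] that e by (cases q q' rule: linorder_cases) auto
    thus ?thesis using SYT_D(3)[OF T(1)] that e True by auto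
   next
    case False
    hence "r < r'" using \<open>r \<le> r'\<close> by simp
    thus ?thesis using mono[of "T y" "T x"] T_in[OF T(1) that(1)] T_in[OF T(1) that(2)]
     bo_T[OF T(1) that(1)] bo_T[OF T(1) that(2)] e by (cases "T x < T y") auto
   qed
  qed
  show ?thesis
  proof (cases "b = b'")
   case False
   hence "rt b ~= rt b'" using rt_inj b by (auto dest: inj_onD)
   thus ?thesis using lt[OF b] lt[OF b(2,1)] by (cases "rt b" "rt b'" rule: linorder_cases) auto
  qed simp
 qed
 have "T = T0"
 proof (rule extensionalityI[of _ Bx])
  fix b assume b: "b \<in> Bx"
  have "{b' \<in> Bx. T b' \<le> T b} = {b' \<in> Bx. rt b' \<le> rt b}" using le_iff[OF _ b] by blast
  thus "T b = T0 b" using label_card[OF SYT_D(2)[OF T(1)] b] label_card[OF rt_bij b] b by (simp add: T0_def)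
 qed (use SYT_D(1)[OF T(1)] in \<open>auto simp: T0_def\<close>)
 thus False using T by simp
qed

definition "height T = (\<Sum>k\<in>Ix. k * fst (bo T k))"

lemma SYT_induct [consumes 1, case_names base step]:
 assumes T: "T \<in> SYT" and base: "P T0"
  and step: "\<And>T i. T \<in> SYT ==> 1 \<le> i ==> Suc i \<le> n ==> swT i T \<in> SYT ==>
   \<bar>ct T (Suc i) - ct T i\<bar> \<ge> 2 ==> P (swT i T) ==> P T"
 shows "P T"
 using T
proof (induction "n * (n * length \<tau>) - height T" arbitrary: T rule: less_induct)
 case less
 show ?case
 proof (cases "T = T0")
  case True thus ?thesis using base by simp
 next
  case False
  then obtain i where i: "1 \<le> i" "Suc i \<le> n" "fst (bo T (Suc i)) < fst (bo T i)"
   using exists_descent[OF less.prems] by blast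
  have "snd (bo T i) < snd (bo T (Suc i))" using row_lt_col_gt[OF less.prems, of i "Suc i"] i by simp
  hence D: "ct T (Suc i) - ct T i \<ge> 2" using i(3) by (simp add: box_content_def)
  hence S: "swT i T \<in> SYT" using swT_SYT[OF less.prems i(1,2)] by simp
  let ?f = "%k. fst (bo T k)" and ?g = "%k. fst (bo (swT i T) k)"
  have bound: "height T' \<le> n * (n * length \<tau>)" if "T' \<in> SYT" for T'
  proof -
   have "height T' \<le> (\<Sum>k\<in>Ix. n * length \<tau>)" unfolding height_def
   proof (rule sum_mono)
    fix k assume k: "k \<in> Ix"
    hence "fst (bo T' k) < length \<tau>" using bo[OF that k] unfolding boxes_def by (cases "bo T' k") auto
    thus "k * fst (bo T' k) \<le> n * length \<tau>" using k by (intro mult_mono) auto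
   qed
   thus ?thesis by simp
  qed
  have split: "(\<Sum>k\<in>Ix. k * h k) = i * h i + Suc i * h (Suc i) + (\<Sum>k\<in>Ix - {i, Suc i}. k * h k)" for h
  proof -
   have "(\<Sum>k\<in>Ix. k * h k) = (\<Sum>k\<in>{i, Suc i}. k * h k) + (\<Sum>k\<in>Ix - {i, Suc i}. k * h k)"
    using i by (subst sum.subset_diff[of "{i, Suc i}"]) auto
   thus ?thesis by simp
  qed
  have g: "?g i = ?f (Suc i)" "?g (Suc i) = ?f i" "\<And>k. k \<in> Ix - {i, Suc i} ==> ?g k = ?f k"
   using bo_swT[OF less.prems i(1,2) S] i by (auto simp: transpose_def)
  have "(\<Sum>k\<in>Ix - {i, Suc i}. k * ?g k) = (\<Sum>k\<in>Ix - {i, Suc i}. k * ?f k)"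
   by (rule sum.cong) (simp_all only: g)
  hence "height T < height (swT i T)" unfolding height_def split g using i(3) by (simp add: algebra_simps)
  hence "n * (n * length \<tau>) - height (swT i T) < n * (n * length \<tau>) - height T"
   using bound[OF S] by linarith
  hence "P (swT i T)" using less.hyps S by blast
  thus ?thesis using step[OF less.prems i(1,2) S] D by simp
 qed
qed

text \<open>By standardness, the boxes on the diagonal of (r, q) or on the next one above it that carry an entry smaller than k
 are exactly those weakly north-west of (r, q), without (r, q) itself.\<close>

lemma diag_count:
 assumes T: "T \<in> SYT" and k: "k \<in> Ix" and b: "bo T k = (r, q)"
 shows "card {j \<in> {1..<k}. ct T j = ct T k} = min r q"
  and "card {j \<in> {1..<k}. ct T j = ct T k + 1} = min r (Suc q)"
proof -
 have kb: "(r, q) \<in> Bx" "T (r, q) = k" using bo[OF T k] b by auto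
 have ck: "ct T k = int q - int r" using b by (simp add: box_content_def)
 have gen: "card {j \<in> {1..<k}. ct T j = int (q + e) - int r} = min r (q + e)" if e: "e \<le> 1" for e
 proof -
  let ?f = "%l. T (r - l, q + e - l)"
  have in1: "(r - l, q + e - l) \<in> Bx" "?f l < k" if l: "l \<in> {1..min r (q + e)}" for l
  proof -
   show m: "(r - l, q + e - l) \<in> Bx" using boxes_down[OF kb(1), of "r - l" "q + e - l"] l e by auto
   have "?f l < T (r, q)" using T_mono[OF T m kb(1)] l e by auto
   thus "?f l < k" using kb by simp
  qed
  have "bij_betw ?f {1..min r (q + e)} {j \<in> {1..<k}. ct T j = int (q + e) - int r}"
   unfolding bij_betw_def
  proof (intro conjI equalityI subsetI inj_onI)
   fix x y assume xy: "x \<in> {1..min r (q + e)}" "y \<in> {1..min r (q + e)}" "?f x = ?f y"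
   hence "(r - x, q + e - x) = (r - y, q + e - y)"
    using bo_T[OF T in1(1)[of x]] bo_T[OF T in1(1)[of y]] by metis
   thus "x = y" using xy by auto
  next
   fix j assume "j \<in> ?f ` {1..min r (q + e)}"
   then obtain l where l: "l \<in> {1..min r (q + e)}" "j = ?f l" by blast
   have "ct T j = int (q + e - l) - int (r - l)" using bo_T[OF T in1(1)[OF l(1)]] l by (simp add: box_content_def)
   also have "... = int (q + e) - int r" using l by auto
   finally show "j \<in> {j \<in> {1..<k}. ct T j = int (q + e) - int r}"
    using in1[OF l(1)] T_in[OF T in1(1)[OF l(1)]] l by auto
  next
   fix j assume j: "j \<in> {j \<in> {1..<k}. ct T j = int (q + e) - int r}"
   obtain r' q' where b': "bo T j = (r', q')" by (cases "bo T j")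
   have jb: "(r', q') \<in> Bx" "T (r', q') = j" using bo[OF T, of j] b' j k by auto
   have d: "int q' - int r' = int (q + e) - int r" using j b' by (simp add: box_content_def)
   have "r' < r"
   proof (rule ccontr)
    assume n: "\<not> r' < r"
    have "T (r, q) \<le> T (r', q')"
    proof (cases "(r, q) = (r', q')")
     case False
     thus ?thesis using T_mono[OF T kb(1) jb(1)] n d by auto
    qed simp
    thus False using j jb kb by simp
   qed
   hence "r - (r - r') = r'" "q + e - (r - r') = q'" "r - r' \<in> {1..min r (q + e)}" using d by auto
   hence "r - r' \<in> {1..min r (q + e)}" "j = ?f (r - r')" using jb by simp_all
   thus "j \<in> ?f ` {1..min r (q + e)}" by blast
  qed
  from bij_betw_same_card[OF this] show ?thesis by simp
 qed
 show "card {j \<in> {1..<k}. ct T j = ct T k} = min r q" using gen[of 0] ck by simp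
 show "card {j \<in> {1..<k}. ct T j = ct T k + 1} = min r (Suc q)"
 proof -
  have e: "ct T k + 1 = int (q + 1) - int r" using ck by simp
  show ?thesis unfolding e using gen[of 1] by simp
 qed
qed

text \<open>Cancels zeros against poles in the norm at negative integers. For k in the box (r, q) the two counts are min r q and
 min r (q+1), which differ exactly when q < r, that is when the content is negative.\<close>

lemma theta_identity:
 assumes T: "T \<in> SYT" and k: "k \<in> Ix"
 shows "(if ct T k < 0 then 1 else 0) + int (card {j \<in> {1..<k}. ct T j = ct T k})
  - int (card {j \<in> {1..<k}. ct T j = ct T k + 1}) = 0"
proof -
 obtain r q where b: "bo T k = (r, q)" by (cases "bo T k")
 hence "ct T k = int q - int r" by (simp add: box_content_def)
 thus ?thesis using diag_count[OF T k b] by (auto simp: min_def)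
qed

text \<open>The diagonal of k and the number of smaller entries on it determine the box of k.\<close>

lemma ct_inj:
 assumes T: "T \<in> SYT" "T' \<in> SYT" and e: "\<And>k. k \<in> Ix ==> ct T k = ct T' k"
 shows "T = T'"
proof -
 have "bo T k = bo T' k" if k: "k \<in> Ix" for k
 proof -
  obtain r q r' q' where b: "bo T k = (r, q)" "bo T' k = (r', q')" by (cases "bo T k", cases "bo T' k")
  have "{j \<in> {1..<k}. ct T j = ct T k} = {j \<in> {1..<k}. ct T' j = ct T' k}" using e k by auto
  hence "min r q = min r' q'" using diag_count(1)[OF T(1) k b(1)] diag_count(1)[OF T(2) k b(2)] by simp
  moreover have "int q - int r = int q' - int r'" using e[OF k] b by (simp add: box_content_def)
  ultimately show ?thesis using b by (auto simp: min_def split: if_splits)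
 qed
 hence "T b = T' b" if "b \<in> Bx" for b using bo_T[OF T(1) that] bo[OF T(2) T_in[OF T(1) that]] T_in[OF T(1) that] by simp
 thus ?thesis using SYT_D(1)[OF T(1)] SYT_D(1)[OF T(2)] by (intro extensionalityI[of _ Bx]) auto
qed

lemma ct_bound:
 assumes T: "T \<in> SYT" and k: "k \<in> Ix" and l: "l \<in> Ix"
 shows "\<bar>ct T k - ct T l\<bar> < int n" and "\<bar>ct T k\<bar> < int n"
proof -
 have rq: "r' + q < n" if "(r, q) \<in> Bx" "(r', q') \<in> Bx" for r q r' q'
 proof -
  have "(%x. (0::nat, x)) ` {..q} \<union> (%x. (x, 0)) ` {..r'} \<subseteq> Bx"
   using boxes_down[OF that(1)] boxes_down[OF that(2)] by auto
  hence "card ((%x. (0::nat, x)) ` {..q} \<union> (%x. (Suc x, 0)) ` {..<r'}) \<le> card Bx"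
   by (intro card_mono) auto
  also have "card ((%x. (0::nat, x)) ` {..q} \<union> (%x. (Suc x, 0)) ` {..<r'}) = Suc q + r'"
   by (subst card_Un_disjoint) (auto simp: card_image inj_on_def)
  finally show ?thesis by (simp add: card_boxes)
 qed
 obtain r q r' q' where b: "bo T k = (r, q)" "bo T l = (r', q')" by (cases "bo T k", cases "bo T l")
 hence B: "(r, q) \<in> Bx" "(r', q') \<in> Bx" using bo[OF T k] bo[OF T l] by auto
 show "\<bar>ct T k - ct T l\<bar> < int n" "\<bar>ct T k\<bar> < int n"
  using b rq[OF B] rq[OF B(2,1)] rq[OF B(1,1)] by (auto simp: box_content_def)
qed

section \<open>The Young basis\<close>

lemma yu_ewt: "yu \<in> ewt (ct T0)"
 using jm_yu yu_VV by (simp add: ewt_def box_content_def bo_T0)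

lemma yu_nz: "yu ~= 0"
proof -
 have "lk yu id = (\<Sum>a\<in>RG. \<Sum>b\<in>CG. if a = id & b = id then 1 else 0)"
  unfolding young_symmetrizer_def lookup_sum lookup_single when_def
 proof (intro sum.cong refl)
  fix a b assume ab: "a \<in> RG" "b \<in> CG"
  have "a = id & b = id" if e: "a o b = id"
  proof -
   have bp: "b permutes Ix" using ab by (simp add: CG_iff)
   have "b k = k" if k: "k \<in> Ix" for k
   proof -
    have bk: "b k \<in> Ix" using k by (simp only: permutes_in_image[OF bp])
    have "a (b k) = k" using e by (metis comp_apply id_apply)
    hence "rw k = rw (b k)" using ab(1) bk unfolding RG_iff by metis
    moreover have "cl (b k) = cl k" using ab(2) k unfolding CG_iff by blast
    ultimately show ?thesis using rwcl_eqI[OF bk k] by simp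
   qed
   hence "b = id" using bp by (auto simp: fun_eq_iff permutes_def)
   thus ?thesis using e by simp
  qed
  thus "(if a o b = id then complex_of_int (sign b) else 0) = (if a = id & b = id then 1 else 0)"
   by (auto simp: sign_id)
 qed
 also have "... = 1"
 proof -
  have "(\<Sum>b\<in>CG. if a = id & b = id then 1 else 0 :: complex) = (if a = id then 1 else 0)" for a :: "nat => nat"
   using id_CG by (cases "a = id") simp_all
  thus ?thesis using id_RG by simp
 qed
 finally show ?thesis by auto
qed

lemma tr_step: "j ~= k ==> j \<le> k ==>
 perm_act (transpose j (Suc k)) v = perm_act (sw k) (perm_act (transpose j k) (perm_act (sw k) v))"
proof -
 assume "j ~= k" "j \<le> k"
 hence "transpose j (Suc k) = sw k o (transpose j k o sw k)" by (auto simp: fun_eq_iff transpose_def)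
 thus ?thesis by (simp only: perm_act_comp)
qed

text \<open>Entries i, i+1 in a row of the row tableau have contents differing by 1, so their transposition fixes v; these
 transpositions generate the row group.\<close>

lemma RG_fix:
 assumes v: "v \<in> ewt (ct T0)" and a: "a \<in> RG"
 shows "perm_act a v = v"
proof -
 have adj: "perm_act (sw i) v = v" if "1 \<le> i" "Suc i \<le> n" "rw i = rw (Suc i)" for i
 proof -
  have i: "i \<in> Ix" "Suc i \<in> Ix" using that by auto
  have "rt (r, Suc q) = Suc (rt (r, q))" for r q by (simp add: row_tableau_def)
  hence "rt (rw i, Suc (cl i)) = Suc i" using rwcl[OF i(1)] by simp
  moreover have "rt (rw i, cl (Suc i)) = Suc i" using rwcl[OF i(2)] that by simp
  ultimately have "cl (Suc i) = Suc (cl i)"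
   using rt_col_less by (metis less_irrefl linorder_neqE_nat)
  hence "ct T0 (Suc i) - ct T0 i = 1" using that by (simp add: box_content_def bo_T0)
  thus ?thesis using ewt_adjacent[OF v that(1,2), of 1] by simp
 qed
 have tr: "perm_act (transpose j k) v = v" if "1 \<le> j" "j \<le> k" "k \<le> n" "rw j = rw k" for j k
  using that(2,3,4)
 proof (induction k rule: dec_induct)
  case base
  thus ?case by (simp add: transpose_same)
 next
  case (step k)
  have jk: "j \<in> Ix" "k \<in> Ix" "Suc k \<in> Ix" using step that by auto
  have "\<not> rw k < rw j" "\<not> rw (Suc k) < rw k"
   using less_iff_box[OF jk(1,2)] less_iff_box[OF jk(2,1)] less_iff_box[OF jk(3,2)] step.hyps by auto
  hence r: "rw j = rw k" "rw k = rw (Suc k)" using step.prems by auto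
  have a: "perm_act (sw k) v = v" using adj[of k] r jk step.prems by auto
  show ?case
  proof (cases "j = k")
   case False
   have "perm_act (transpose j k) v = v" using step.IH r step.prems by simp
   thus ?thesis using tr_step[OF False step.hyps(1)] a by simp
  qed (use a in simp)
 qed
 hence tr': "perm_act (transpose j k) v = v" if "j \<in> Ix" "k \<in> Ix" "rw j = rw k" for j k
 proof (cases "j \<le> k")
  case True
  thus ?thesis using that by (intro tr) auto
 next
  case False
  hence "perm_act (transpose k j) v = v" using that by (intro tr) auto
  thus ?thesis by (simp only: transpose_commute)
 qed
 show ?thesis using a
 proof (induction "card {k \<in> Ix. a k ~= k}" arbitrary: a rule: less_induct)
  case less
  have ap: "a permutes Ix" using less.prems by (simp add: RG_iff)
  show ?case
  proof (cases "\<exists>k\<in>Ix. a k ~= k")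
   case False
   hence "a = id" using ap by (auto simp: fun_eq_iff permutes_def)
   thus ?thesis by simp
  next
   case True
   then obtain k where k: "k \<in> Ix" "a k ~= k" by blast
   have ak: "a k \<in> Ix" using k by (simp only: permutes_in_image[OF ap])
   have rk: "rw (a k) = rw k" using less.prems k unfolding RG_iff by blast
   let ?t = "transpose k (a k)"
   have t: "?t \<in> RG" using k ak rk by (intro RG_transpose) auto
   have sub: "{j \<in> Ix. (?t o a) j ~= j} \<subseteq> {j \<in> Ix. a j ~= j} - {k}"
   proof
    fix j assume j: "j \<in> {j \<in> Ix. (?t o a) j ~= j}"
    have jk: "j ~= k" using j by auto
    have "a j ~= j"
    proof
     assume e: "a j = j"
     have "j ~= a k" using jk e injD[OF permutes_inj[OF ap], of j k] by auto
     thus False using j jk e by (simp add: transpose_def)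
    qed
    thus "j \<in> {j \<in> Ix. a j ~= j} - {k}" using j jk by blast
   qed
   have "card {j \<in> Ix. (?t o a) j ~= j} < card {j \<in> Ix. a j ~= j}"
   proof (rule psubset_card_mono)
    show "{j \<in> Ix. (?t o a) j ~= j} \<subset> {j \<in> Ix. a j ~= j}"
     using sub k(1,2) by (intro psubsetI order.trans[OF sub]) blast+
   qed simp
   hence IH: "perm_act (?t o a) v = v" using less.hyps RG_comp[OF t less.prems] by blast
   have "a = ?t o (?t o a)" by (simp add: fun_eq_iff)
   hence "perm_act a v = perm_act ?t (perm_act (?t o a) v)" by (simp only: perm_act_comp)
   also have "... = v" unfolding IH by (rule tr'[OF k(1) ak]) (simp add: rk)
   finally show ?thesis .
  qed
 qed
qed

lemma ewt_T0: assumes "v \<in> ewt (ct T0)" shows "\<exists>z. v = sc z yu"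
proof -
 have "v \<in> VV" using assms by (simp add: ewt_def)
 then obtain z where z: "(\<Sum>a\<in>RG. perm_act a v) = sc z yu" using row_sym_VV by blast
 have "(\<Sum>a\<in>RG. perm_act a v) = sc (of_nat (card RG)) v"
  using RG_fix[OF assms] by (simp add: fv.sum_constant_scale)
 moreover have "card RG ~= 0" using id_RG by (auto simp: card_eq_0_iff)
 ultimately have "v = sc (z / of_nat (card RG)) yu"
  using z by (metis (no_types, lifting) fv.scale_left_imp_eq fv.scale_scale nonzero_mult_div_cancel_left of_nat_eq_0_iff times_divide_eq_right)
 thus ?thesis by blast
qed

text \<open>The weight space of the row tableau is the line of yu, and along an admissible exchange the intertwiners in both
 directions compose to the nonzero scalar 1 - 1/D^2.\<close>

lemma ewt_line: "T \<in> SYT ==> \<exists>v. v ~= 0 & v \<in> ewt (ct T) & (\<forall>w\<in>ewt (ct T). \<exists>z. w = sc z v)"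
proof (induction T rule: SYT_induct)
 case base
 thus ?case using yu_nz yu_ewt ewt_T0 by blast
next
 case (step T i)
 let ?S = "swT i T"
 define D where "D = ct T (Suc i) - ct T i"
 have D: "D ~= 0" "D\<^sup>2 ~= 1" using step(5) by (auto simp: D_def power2_eq_1_iff)
 have c0: "(1 - 1 / (of_int D)\<^sup>2 :: complex) ~= 0"
 proof -
  have "(of_int (D\<^sup>2) :: complex) ~= 1" using D by (simp add: of_int_eq_1_iff del: of_int_power)
  thus ?thesis by auto
 qed
 have swk: "sw i k \<in> Ix" if "k \<in> Ix" for k
  using that permutes_in_image[OF permutes_swap_id[of i "Ix" "Suc i"]] step(2,3) by simp
 have ctS: "ct ?S i = ct T (Suc i)" "ct ?S (Suc i) = ct T i"
  using ct_swT[OF step(1-4)] step(2,3) by auto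
 have eT: "ewt (ct ?S o sw i) = ewt (ct T)" and eS: "ewt (ct T o sw i) = ewt (ct ?S)"
  by (rule ewt_cong, simp only: comp_apply ct_swT[OF step(1-4)] swk transpose_involutory)+
 have d1: "- D = ct ?S (Suc i) - ct ?S i" "- D ~= 0" using ctS D by (simp_all add: D_def)
 obtain v where v: "v ~= 0" "v \<in> ewt (ct ?S)" "\<And>w. w \<in> ewt (ct ?S) ==> \<exists>z. w = sc z v"
  using step.IH by blast
 have v1: "swv i (- D) v \<in> ewt (ct T)"
  using swv_ewt[OF v(2) step(2,3) d1] by (simp only: eT)
 have n1: "ip (swv i (- D) v) (swv i (- D) v) = (1 - 1 / (of_int D)\<^sup>2) * ip v v"
  using swv_norm[OF v(2) step(2,3) d1] by simp
 have "swv i (- D) v ~= 0" using n1 c0 v(1) by (auto simp: ip_self_zero)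
 moreover have "\<exists>z. w = sc z (swv i (- D) v)" if w: "w \<in> ewt (ct T)" for w
 proof -
  have wV: "w \<in> VV" using w by (simp add: ewt_def)
  have "swv i D w \<in> ewt (ct ?S)" using swv_ewt[OF w step(2,3) D_def D(1)] by (simp only: eS)
  then obtain z where z: "swv i D w = sc z v" using v(3) by blast
  have "sc (1 - 1 / (of_int D)\<^sup>2) w = swv i (- D) (sc z v)" using swv_swv[OF wV D(1), of i] z by simp
  also have "... = sc z (swv i (- D) v)" by (simp add: swv_def perm_act_lops sc_distribs mult.commute)
  finally have "w = sc (z / (1 - 1 / (of_int D)\<^sup>2)) (swv i (- D) v)"
   using c0 by (metis fv.scale_left_imp_eq fv.scale_scale nonzero_mult_div_cancel_left times_divide_eq_right)
  thus ?thesis by blast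
 qed
 ultimately show ?case using v1 by blast
qed

definition "yv T = (SOME v. v ~= 0 & v \<in> ewt (ct T) & (\<forall>w\<in>ewt (ct T). \<exists>z. w = sc z v))"

lemma yv: "T \<in> SYT ==> yv T ~= 0 & yv T \<in> ewt (ct T) & (\<forall>w\<in>ewt (ct T). \<exists>z. w = sc z (yv T))"
 unfolding yv_def by (rule someI_ex, rule ewt_line)

lemma yv_orth: "T \<in> SYT ==> T' \<in> SYT ==> T ~= T' ==> ip (yv T) (yv T') = 0"
 using ct_inj[of T T'] ewt_orth yv by metis

lemma span_perm_closed:
 assumes sw: "\<And>i v. 1 \<le> i ==> Suc i \<le> n ==> v \<in> W ==> perm_act (sw i) v \<in> W"
  and w: "w permutes Ix" and v: "v \<in> W"
 shows "perm_act w v \<in> W"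
proof -
 have tr: "\<forall>v\<in>W. perm_act (transpose j k) v \<in> W" if "1 \<le> j" "j \<le> k" "k \<le> n" for j k
  using that(2,3)
 proof (induction k rule: dec_induct)
  case base
  thus ?case by (simp add: transpose_same)
 next
  case (step k)
  show ?case
  proof (cases "j = k")
   case True thus ?thesis using sw step that by auto
  next
   case False
   have "1 \<le> k" "Suc k \<le> n" "\<forall>v\<in>W. perm_act (transpose j k) v \<in> W" using step that by auto
   thus ?thesis using sw[of k] tr_step[OF False step.hyps(1)] by simp
  qed
 qed
 have "\<forall>v\<in>W. perm_act w v \<in> W"
  using w finite_atLeastAtMost[of 1 n]
 proof (induction rule: permutes_induct)
  case id thus ?case by simp
 next
  case (swap a b p)
  have "\<forall>v\<in>W. perm_act (transpose a b) v \<in> W"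
   using tr[of a b] tr[of b a] swap.hyps by (cases "a \<le> b") (simp_all add: transpose_commute)
  thus ?case using swap.IH by (simp only: perm_act_comp[symmetric] Ball_def) blast
 qed
 thus ?thesis using v by blast
qed

text \<open>The span of the weight vectors is stable under adjacent transpositions: such a transposition maps the vector of T to a
 multiple of itself when i and i+1 are adjacent in a row or column, and otherwise to a combination of the vectors of T
 and of the exchanged tableau. The span contains yu.\<close>

theorem VV_span: "VV = fv.span (yv ` SYT)"
proof
 show "fv.span (yv ` SYT) \<subseteq> VV" unfolding VV_def
  by (rule fv.span_minimal) (use yv in \<open>auto simp: ewt_def VV_def\<close>)
 have yuW: "yu \<in> fv.span (yv ` SYT)"
  using yv[OF T0_SYT] yu_ewt T0_SYT by (metis fv.span_base fv.span_scale imageI)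
 have sw: "perm_act (sw i) v \<in> fv.span (yv ` SYT)" if i: "1 \<le> i" "Suc i \<le> n" and v: "v \<in> fv.span (yv ` SYT)" for i v
 proof (rule linear_span_image[OF linear_perm_act _ v])
  fix x assume "x \<in> yv ` SYT"
  then obtain T where T: "T \<in> SYT" "x = yv T" by blast
  define D where "D = ct T (Suc i) - ct T i"
  have D0: "D ~= 0" using ct_Suc_ne[OF T(1) i] by (simp add: D_def)
  have xe: "x \<in> ewt (ct T)" using yv[OF T(1)] T(2) by simp
  have xs: "x \<in> fv.span (yv ` SYT)" using T by (auto intro: fv.span_base)
  show "perm_act (sw i) x \<in> fv.span (yv ` SYT)"
  proof (cases "D = 1 \<or> D = -1")
   case True
   hence "perm_act (sw i) x = sc (of_int D) x" using ewt_adjacent[OF xe i, of D] by (simp add: D_def)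
   thus ?thesis using xs fv.span_scale by metis
  next
   case False
   hence S: "swT i T \<in> SYT" using swT_SYT[OF T(1) i] by (simp add: D_def)
   have "ewt (ct T o sw i) = ewt (ct (swT i T))" using ct_swT[OF T(1) i S] by (intro ewt_cong) simp
   hence "swv i D x \<in> ewt (ct (swT i T))" using swv_ewt[OF xe i, of D] D0 by (simp add: D_def)
   then obtain z where "swv i D x = sc z (yv (swT i T))" using yv[OF S] by blast
   hence "perm_act (sw i) x = sc z (yv (swT i T)) + sc (1 / of_int D) x" by (simp add: swv_def diff_eq_eq)
   thus ?thesis using xs S by (auto intro!: fv.span_add fv.span_scale fv.span_base[of "yv (swT i T)"])
  qed
 qed
 show "VV \<subseteq> fv.span (yv ` SYT)" unfolding VV_def
 proof (rule fv.span_minimal[OF _ fv.subspace_span], rule subsetI)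
  fix x assume "x \<in> {perm_act w yu | w. w permutes Ix}"
  thus "x \<in> fv.span (yv ` SYT)" using span_perm_closed[of "fv.span (yv ` SYT)"] sw yuW by blast
 qed
qed

end

section \<open>The polynomial representation with coefficients in the group algebra\<close>

declare One_nat_def [simp del] sc_single [simp del] comp_def [simp del]

definition up :: "nat => (nat => nat) => (nat => nat)" where "up i \<alpha> = \<alpha>(i := Suc (\<alpha> i))"

lemma up_commute: "up i (up j \<alpha>) = up j (up i \<alpha>)" by (auto simp: up_def)

text \<open>The basis vector (\<alpha>, p) stands for x^\<alpha> \<otimes> p with p in the symmetric group. Restricting the
 coefficients to VV only later lets every operator be given on a basis.\<close>

type_synonym mv = "((nat => nat) \<times> (nat => nat)) \<Rightarrow>\<^sub>0 complex"

definition xv :: "(nat => nat) => gv => mv" where "xv \<alpha> v = linear_ext (%p. (\<alpha>, p)) v"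
definition XX :: "nat => mv => mv" where "XX i = linear_ext (%(\<alpha>, p). (up i \<alpha>, p))"
definition WW :: "(nat => nat) => mv => mv" where "WW w = linear_ext (%(\<alpha>, p). (\<alpha> o pinv w, w o p))"

text \<open>The sum over b \<le> q < a, with the sign convention of an oriented integral.\<close>

definition isum :: "(nat => 'a :: ab_group_add) => nat => nat => 'a" where
 "isum g b a = (\<Sum>q\<in>{b..<a}. g q) - (\<Sum>q\<in>{a..<b}. g q)"

text \<open>The exponents that occur in the divided difference: the entries at i and j are replaced by two numbers with sum
 \<alpha> i + \<alpha> j - 1, the one at j being q.\<close>

definition ex2 :: "nat => nat => (nat => nat) => nat => (nat => nat)" where
 "ex2 i j \<alpha> q = \<alpha>(i := \<alpha> i + \<alpha> j - 1 - q, j := q)"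

text \<open>The divided difference (x^\<alpha> - s x^\<alpha>) / (x_i - x_j), tensored with v, for the transposition s of i and j;
 the geometric sum makes it a polynomial.\<close>

definition DD :: "nat => nat => (nat => nat) => gv => mv" where
 "DD i j \<alpha> v = isum (%q. xv (ex2 i j \<alpha> q) v) (\<alpha> j) (\<alpha> i)"

lemma linear_xv [simp]: "linear_op (xv \<alpha>)" by (simp add: xv_def[abs_def])
lemma linear_XX [simp]: "linear_op (XX i)" by (simp add: XX_def)
lemma linear_WW [simp]: "linear_op (WW w)" by (simp add: WW_def)
lemmas xv_lops = lops[OF linear_xv] and XX_lops = lops[OF linear_XX] and WW_lops = lops[OF linear_WW]

lemma xv_ba [simp]: "xv \<alpha> (ba p) = ba (\<alpha>, p)" by (simp add: xv_def)
lemma XX_ba [simp]: "XX i (ba (\<alpha>, p)) = ba (up i \<alpha>, p)" by (simp add: XX_def)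
lemma WW_ba [simp]: "WW w (ba (\<alpha>, p)) = ba (\<alpha> o pinv w, w o p)" by (simp add: WW_def)

lemma XX_xv: "XX i (xv \<alpha> v) = xv (up i \<alpha>) v"
 by (rule linear_eqI[OF lin_compI[OF linear_XX linear_xv] linear_xv]) simp
lemma WW_xv: "WW w (xv \<alpha> v) = xv (\<alpha> o pinv w) (perm_act w v)"
 by (rule linear_eqI[OF lin_compI[OF linear_WW linear_xv] lin_compI[OF linear_xv linear_perm_act]]) simp

lemma mv_linear_eqI:
 assumes "linear_op f" "linear_op g" "\<And>\<alpha> p. f (ba (\<alpha>, p)) = g (ba (\<alpha>, p))"
 shows "f u = g u"
 by (rule linear_eqI[OF assms(1,2)]) (use assms(3) in auto)

lemma XX_commute: "XX i (XX j u) = XX j (XX i u)"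
 by (rule mv_linear_eqI[OF lin_compI[OF linear_XX linear_XX] lin_compI[OF linear_XX linear_XX]]) (simp add: up_commute)

lemma up_comp_inv: "bij w ==> up i \<alpha> o pinv w = up (w i) (\<alpha> o pinv w)"
 by (auto simp: up_def fun_eq_iff bij_inv_eq_iff bij_is_inj inv_f_f)

lemma WW_XX: "bij w ==> WW w (XX i u) = XX (w i) (WW w u)"
 by (rule mv_linear_eqI[OF lin_compI[OF linear_WW linear_XX] lin_compI[OF linear_XX linear_WW]]) (simp add: up_comp_inv)

lemma WW_WW: "bij w ==> bij v ==> WW w (WW v u) = WW (w o v) u"
 by (rule mv_linear_eqI[OF lin_compI[OF linear_WW linear_WW] linear_WW]) (simp add: o_inv_distrib comp_assoc)

lemma WW_id [simp]: "WW id u = u"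
 by (rule mv_linear_eqI[OF linear_WW lin_idI]) simp

lemma WW_tr2 [simp]: "WW (transpose i j) (WW (transpose i j) u) = u"
 by (subst WW_WW) simp_all

subsection \<open>Divided differences\<close>

lemma isum_Suc: "isum g b (Suc a) = isum g b a + g a"
proof (cases "b \<le> a")
 case False
 hence "{a..<b} = insert a {Suc a..<b}" by auto
 thus ?thesis using False by (simp add: isum_def)
qed (simp add: isum_def)

lemma isum_shift: "isum (%q. g (Suc q)) b a = isum g (Suc b) (Suc a)"
 unfolding isum_def by (simp only: sum.shift_bounds_Suc_ivl)

lemma isum_cong: "(\<And>q. min a b \<le> q ==> q < max a b ==> g q = h q) ==> isum g b a = isum h b a"
 unfolding isum_def by (intro arg_cong2[of _ _ _ _ "(-)"] sum.cong) auto

lemma lop_isum: "linear_op f ==> f (isum g b a) = isum (%q. f (g q)) b a"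
 by (simp add: isum_def lop_diff lop_sum)

lemma DD_up_other:
 assumes "i ~= j" "k ~= i" "k ~= j" shows "DD i j (up k \<alpha>) v = XX k (DD i j \<alpha> v)"
proof -
 have "ex2 i j (up k \<alpha>) q = up k (ex2 i j \<alpha> q)" for q using assms by (auto simp: ex2_def up_def fun_eq_iff)
 thus ?thesis using assms by (simp add: DD_def lop_isum XX_xv) (simp add: up_def)
qed

lemma comp_tr: "\<alpha> o transpose i j = \<alpha>(i := \<alpha> j, j := \<alpha> i)"
 by (auto simp: fun_eq_iff transpose_def)

lemma DD_up_j:
 assumes "i ~= j" shows "DD i j (up j \<alpha>) v = XX j (DD i j \<alpha> v) - xv (\<alpha> o transpose i j) v"
proof -
 have e: "up j (ex2 i j \<alpha> q) = ex2 i j (up j \<alpha>) (Suc q)" for q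
  using assms by (auto simp: ex2_def up_def fun_eq_iff)
 have "XX j (DD i j \<alpha> v) = isum (%q. xv (ex2 i j (up j \<alpha>) (Suc q)) v) (\<alpha> j) (\<alpha> i)"
  by (simp add: DD_def lop_isum XX_xv e)
 also have "... = isum (%q. xv (ex2 i j (up j \<alpha>) q) v) (Suc (\<alpha> j)) (Suc (\<alpha> i))" by (rule isum_shift)
 also have "... = DD i j (up j \<alpha>) v + xv (ex2 i j (up j \<alpha>) (\<alpha> i)) v"
  using assms by (simp add: isum_Suc DD_def up_def)
 also have "ex2 i j (up j \<alpha>) (\<alpha> i) = \<alpha> o transpose i j"
  using assms by (auto simp: ex2_def up_def comp_tr fun_eq_iff)
 finally show ?thesis by (simp only: add_diff_cancel_right')
qed

lemma DD_up_i:
 assumes "i ~= j" shows "DD i j (up i \<alpha>) v = XX i (DD i j \<alpha> v) + xv (\<alpha> o transpose i j) v"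
proof -
 have e: "up i (ex2 i j \<alpha> q) = ex2 i j (up i \<alpha>) q" if "q < max (\<alpha> i) (\<alpha> j)" for q
  using assms that by (auto simp: ex2_def up_def fun_eq_iff)
 have "XX i (DD i j \<alpha> v) = isum (%q. xv (up i (ex2 i j \<alpha> q)) v) (\<alpha> j) (\<alpha> i)"
  by (simp add: DD_def lop_isum XX_xv)
 also have "... = isum (%q. xv (ex2 i j (up i \<alpha>) q) v) (\<alpha> j) (\<alpha> i)"
  by (rule isum_cong) (simp add: e)
 finally have "XX i (DD i j \<alpha> v) + xv (ex2 i j (up i \<alpha>) (\<alpha> i)) v = DD i j (up i \<alpha>) v"
  using assms by (simp add: isum_Suc DD_def up_def)
 moreover have "ex2 i j (up i \<alpha>) (\<alpha> i) = \<alpha> o transpose i j"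
  using assms by (auto simp: ex2_def up_def comp_tr fun_eq_iff)
 ultimately show ?thesis by simp
qed

lemma DD_zero: "\<alpha> i = \<alpha> j ==> DD i j \<alpha> v = 0" by (simp add: DD_def isum_def)

lemma linear_DD [simp]: "linear_op (DD i j \<alpha>)"
 unfolding DD_def isum_def by (intro linear_intros) simp_all

context young
begin

section \<open>Dunkl operators\<close>

text \<open>Dunkl operators with coefficients in the group algebra: s_ij acts on the coefficient as well.\<close>

definition YY :: "complex => nat => mv => mv" where
 "YY c i = lin (%(\<alpha>, p). if i \<in> Ix then sc (of_nat (\<alpha> i)) (ba (\<alpha>(i := \<alpha> i - 1), p))
  - sc c (\<Sum>j\<in>Ix - {i}. DD i j \<alpha> (ba (transpose i j o p))) else 0)"

text \<open>The commutator of y_i and x_j prescribed by the defining relations.\<close>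

definition cc :: "complex => nat => nat => mv => mv" where
 "cc c i j u = (if i \<in> Ix & j \<in> Ix then
  if i = j then u - sc c (\<Sum>l\<in>Ix - {i}. WW (transpose i l) u) else sc c (WW (transpose i j) u) else 0)"

lemma linear_YY [simp]: "linear_op (YY c i)" by (simp add: YY_def)
lemma linear_cc [simp]: "linear_op (cc c i j)"
 unfolding cc_def[abs_def] by (cases "i \<in> Ix & j \<in> Ix"; cases "i = j")
  (simp_all only: if_True if_False simp_thms, (intro linear_intros linear_WW)+)

lemmas YY_lops = lops[OF linear_YY] and cc_lops = lops[OF linear_cc]

lemma YY_out: "i \<notin> Ix ==> YY c i u = 0"
 by (rule mv_linear_eqI[OF linear_YY lin_zeroI]) (simp only: YY_def lin_ba case_prod_conv if_False)

lemma YY_xv: "i \<in> Ix ==> YY c i (xv \<alpha> v) = sc (of_nat (\<alpha> i)) (xv (\<alpha>(i := \<alpha> i - 1)) v)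
  - sc c (\<Sum>j\<in>Ix - {i}. DD i j \<alpha> (perm_act (transpose i j) v))"
proof -
 assume i: "i \<in> Ix"
 have l: "linear_op (%v. sc (of_nat (\<alpha> i)) (xv (\<alpha>(i := \<alpha> i - 1)) v)
  - sc c (\<Sum>j\<in>Ix - {i}. DD i j \<alpha> (perm_act (transpose i j) v)))"
  by (intro lin_minusI lin_scaledI lin_sumI lin_compI[OF linear_DD linear_perm_act] linear_xv)
 show ?thesis
  by (rule linear_eqI[OF lin_compI[OF linear_YY linear_xv] l]) (simp only: xv_ba YY_def lin_ba i if_True case_prod_conv perm_act_ba)
qed

lemma YY_base: "(\<And>k. k \<in> Ix ==> \<alpha> k = 0) ==> YY c i (xv \<alpha> v) = 0"
proof (cases "i \<in> Ix")
 case True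
 assume a: "\<And>k. k \<in> Ix ==> \<alpha> k = 0"
 have "(\<Sum>j\<in>Ix - {i}. DD i j \<alpha> (perm_act (transpose i j) v)) = 0"
  by (rule sum.neutral) (use a True in \<open>auto intro: DD_zero\<close>)
 thus ?thesis using a True by (simp add: YY_xv)
qed (simp add: YY_out)

lemma YY_XX: "YY c i (XX k u) = XX k (YY c i u) + cc c i k u"
proof (cases "i \<in> Ix")
 case False
 hence "cc c i k u = 0" unfolding cc_def by (simp only: if_False simp_thms)
 thus ?thesis using YY_out[OF False] by (simp add: XX_lops)
next
 case i: True
 show ?thesis
 proof (rule mv_linear_eqI[OF lin_compI[OF linear_YY linear_XX] lin_plusI[OF lin_compI[OF linear_XX linear_YY] linear_cc]])
  fix \<alpha> p
  let ?v = "%j. perm_act (transpose i j) (ba p)"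
  have Y: "YY c i (ba (\<beta>, p)) = sc (of_nat (\<beta> i)) (xv (\<beta>(i := \<beta> i - 1)) (ba p))
   - sc c (\<Sum>j\<in>Ix - {i}. DD i j \<beta> (?v j))" for \<beta>
   using YY_xv[OF i, of c \<beta> "ba p"] by (simp only: xv_ba)
  have Wb: "WW (transpose i j) (ba (\<alpha>, p)) = xv (\<alpha> o transpose i j) (?v j)" for j by simp
  consider "k = i" | "k ~= i" "k \<in> Ix" | "k \<notin> Ix" by blast
  thus "YY c i (XX k (ba (\<alpha>, p))) = XX k (YY c i (ba (\<alpha>, p))) + cc c i k (ba (\<alpha>, p))"
  proof cases
   case 1
   have "(\<Sum>j\<in>Ix - {i}. DD i j (up i \<alpha>) (?v j)) =
     XX i (\<Sum>j\<in>Ix - {i}. DD i j \<alpha> (?v j)) + (\<Sum>j\<in>Ix - {i}. WW (transpose i j) (ba (\<alpha>, p)))"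
    unfolding XX_lops Wb sum.distrib[symmetric] by (rule sum.cong) (auto simp: DD_up_i)
   moreover have "sc (of_nat (up i \<alpha> i)) (xv ((up i \<alpha>)(i := up i \<alpha> i - 1)) (ba p)) =
     XX i (sc (of_nat (\<alpha> i)) (xv (\<alpha>(i := \<alpha> i - 1)) (ba p))) + ba (\<alpha>, p)"

   proof (cases "\<alpha> i")
    case 0
    hence "(up i \<alpha>)(i := up i \<alpha> i - 1) = \<alpha>" by (auto simp: up_def)
    thus ?thesis using 0 by (simp add: XX_lops up_def)
   next
    case (Suc m)
    hence "(up i \<alpha>)(i := up i \<alpha> i - 1) = \<alpha>" "up i (\<alpha>(i := \<alpha> i - 1)) = \<alpha>" by (auto simp: up_def)
    thus ?thesis by (simp add: XX_lops sc_distribs) (simp add: up_def sc_distribs)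
   qed
   ultimately show ?thesis using i
    unfolding 1 XX_ba Y cc_def XX_lops by (simp add: sc_distribs algebra_simps)
  next
   case 2
   let ?R = "Ix - {i} - {k}"
   have sp: "(\<Sum>j\<in>Ix - {i}. f j) = f k + (\<Sum>j\<in>?R. f j)" for f :: "nat => mv"
    using 2 by (intro sum.remove) auto
   have A: "(\<Sum>j\<in>?R. DD i j (up k \<alpha>) (?v j)) = XX k (\<Sum>j\<in>?R. DD i j \<alpha> (?v j))"
    unfolding XX_lops by (rule sum.cong) (use 2 in \<open>auto simp: DD_up_other\<close>)
   have B: "DD i k (up k \<alpha>) (?v k) = XX k (DD i k \<alpha> (?v k)) - WW (transpose i k) (ba (\<alpha>, p))"
    unfolding Wb using 2 by (intro DD_up_j) auto
   have C: "sc (of_nat (up k \<alpha> i)) (xv ((up k \<alpha>)(i := up k \<alpha> i - 1)) (ba p)) =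
     XX k (sc (of_nat (\<alpha> i)) (xv (\<alpha>(i := \<alpha> i - 1)) (ba p)))"
    using 2 by (simp add: XX_lops) (simp add: up_def fun_upd_twist)
   have D: "cc c i k (ba (\<alpha>, p)) = sc c (WW (transpose i k) (ba (\<alpha>, p)))"
    using i 2 unfolding cc_def by (simp only: if_True if_False simp_thms) auto
   show ?thesis unfolding XX_ba[of k \<alpha>] Y D sp A B C lop_diff[OF linear_XX] lop_sc[OF linear_XX] lop_add[OF linear_XX]
    by (simp only: sc_distribs) (simp only: algebra_simps)
  next
   case 3
   have A: "(\<Sum>j\<in>Ix - {i}. DD i j (up k \<alpha>) (?v j)) = XX k (\<Sum>j\<in>Ix - {i}. DD i j \<alpha> (?v j))"
    unfolding XX_lops by (rule sum.cong) (use 3 i in \<open>auto simp: DD_up_other\<close>)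
   have C: "sc (of_nat (up k \<alpha> i)) (xv ((up k \<alpha>)(i := up k \<alpha> i - 1)) (ba p)) =
     XX k (sc (of_nat (\<alpha> i)) (xv (\<alpha>(i := \<alpha> i - 1)) (ba p)))"
    using 3 i by (simp add: XX_lops) (auto simp: up_def fun_upd_twist)
   have D: "cc c i k (ba (\<alpha>, p)) = 0"
    using 3 unfolding cc_def by (simp only: if_False simp_thms)
   show ?thesis unfolding XX_ba[of k \<alpha>] Y D A C lop_diff[OF linear_XX] lop_sc[OF linear_XX] by simp
  qed
 qed
qed

subsection \<open>Relations\<close>

text \<open>An operator that commutes with multiplications up to a relabelling is determined by its values on constants. The
 relations between the y_i, and their equivariance, are obtained by applying this to the difference of the two sides,
 which commutes with the x_i by the relation YY_XX and vanishes on constants.\<close>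

lemma X_intertwiner_zero:
 assumes E: "linear_op E" and X: "\<And>k u. k \<in> Ix ==> E (XX k u) = XX (f k) (E u)"
  and base: "\<And>\<alpha> p. (\<And>k. k \<in> Ix ==> \<alpha> k = 0) ==> E (ba (\<alpha>, p)) = 0"
 shows "E u = 0"
proof (rule mv_linear_eqI[OF E lin_zeroI])
 fix \<alpha> p
 show "E (ba (\<alpha>, p)) = 0"
 proof (induction "\<Sum>k\<in>Ix. \<alpha> k" arbitrary: \<alpha> rule: less_induct)
  case less
  show ?case
  proof (cases "\<forall>k\<in>Ix. \<alpha> k = 0")
   case True thus ?thesis using base by blast
  next
   case False
   then obtain k where k: "k \<in> Ix" "0 < \<alpha> k" by blast
   define \<beta> where "\<beta> = \<alpha>(k := \<alpha> k - 1)"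
   have \<alpha>: "\<alpha> = up k \<beta>" using k by (auto simp: \<beta>_def up_def fun_eq_iff)
   have "(\<Sum>k\<in>Ix. \<beta> k) < (\<Sum>k\<in>Ix. \<alpha> k)"
    by (rule sum_strict_mono_ex1) (use k in \<open>auto simp: \<beta>_def\<close>)
   hence "E (ba (\<beta>, p)) = 0" using less by blast
   thus ?thesis unfolding \<alpha> XX_ba[symmetric] X[OF k(1)] by (simp add: XX_lops)
  qed
 qed
qed

lemma WW_cc:
 assumes w: "w permutes Ix" shows "WW w (cc c i j u) = cc c (w i) (w j) (WW w u)"
proof -
 have b: "bij w" by (rule permutes_bij[OF w])
 have tr: "WW w (WW (transpose i l) u) = WW (transpose (w i) (w l)) (WW w u)" for i l
  using comp_transpose[OF bij_is_inj[OF b], of i l] by (simp add: WW_WW b)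
 have range: "w i \<in> Ix \<longleftrightarrow> i \<in> Ix" for i by (rule permutes_in_image[OF w])
 have "WW w (\<Sum>l\<in>Ix - {i}. WW (transpose i l) u) = (\<Sum>l\<in>Ix - {w i}. WW (transpose (w i) l) (WW w u))"
  unfolding WW_lops
 proof (rule sum.reindex_bij_witness[of _ "pinv w" w])
  fix l assume l: "l \<in> Ix - {w i}"
  have "pinv w l \<in> Ix" using l permutes_in_image[OF permutes_inv[OF w]] by blast
  moreover have "w (pinv w l) = l" using permutes_inverses(1)[OF w] .
  ultimately show "pinv w l \<in> Ix - {i}" "w (pinv w l) = l" using l by auto
 next
  fix l assume l: "l \<in> Ix - {i}"
  thus "w l \<in> Ix - {w i}" using range[of l] bij_is_inj[OF b] by (auto simp: inj_eq simp del: atLeastAtMost_iff)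
  show "pinv w (w l) = l" using permutes_inverses(2)[OF w] .
  show "WW (transpose (w i) (w l)) (WW w u) = WW w (WW (transpose i l) u)" by (simp only: tr)
 qed
 note s = this
 have "w i = w j \<longleftrightarrow> i = j" using bij_is_inj[OF b] by (simp add: inj_eq)
 note r = this
 show ?thesis
 proof (cases "i \<in> Ix & j \<in> Ix")
  case False
  thus ?thesis unfolding cc_def range by (simp only: if_False lop_zero[OF linear_WW])
 next
  case T: True
  show ?thesis
  proof (cases "i = j")
   case True
   have i: "i \<in> Ix" using T by simp
   show ?thesis unfolding cc_def range True[symmetric]
    by (simp only: i if_True simp_thms lop_diff[OF linear_WW] lop_sc[OF linear_WW] s)
  next
   case False
   thus ?thesis using T r unfolding cc_def range
    by (simp only: if_True if_False simp_thms lop_sc[OF linear_WW] tr)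
  qed
 qed
qed

lemma WW_YY:
 assumes w: "w permutes Ix" shows "WW w (YY c i u) = YY c (w i) (WW w u)"
proof -
 have b: "bij w" by (rule permutes_bij[OF w])
 have "WW w (YY c i u) - YY c (w i) (WW w u) = 0"
 proof (rule X_intertwiner_zero[of "%u. WW w (YY c i u) - YY c (w i) (WW w u)" w])
  show "linear_op (%u. WW w (YY c i u) - YY c (w i) (WW w u))"
   by (intro lin_minusI lin_compI[OF linear_WW linear_YY] lin_compI[OF linear_YY linear_WW])
  fix k u
  show "WW w (YY c i (XX k u)) - YY c (w i) (WW w (XX k u)) = XX (w k) (WW w (YY c i u) - YY c (w i) (WW w u))"
   by (simp add: YY_XX WW_XX[OF b] WW_lops XX_lops WW_cc[OF w])
 next
  fix \<alpha> :: "nat => nat" and p assume a: "\<And>k. k \<in> Ix ==> \<alpha> k = 0"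
  have "(\<alpha> o pinv w) k = 0" if "k \<in> Ix" for k
   using a[of "pinv w k"] that permutes_in_image[OF permutes_inv[OF w], of k] by simp
  thus "WW w (YY c i (ba (\<alpha>, p))) - YY c (w i) (WW w (ba (\<alpha>, p))) = 0"
   using YY_base[of \<alpha> c i "ba p"] YY_base[of "\<alpha> o pinv w" c "w i" "ba (w o p)"] a by (simp add: WW_lops)
 qed
 thus ?thesis by simp
qed

lemma YY_tr: "a \<in> Ix ==> b \<in> Ix ==> YY c i (WW (transpose a b) u) = WW (transpose a b) (YY c (transpose a b i) u)"
 by (subst WW_YY) (simp_all add: permutes_swap_id)

text \<open>The Jacobi identity for y_i, y_j and x_k; it is exactly what the commutator of y_i and y_j needs to commute with x_k.\<close>

lemma YY_cc:
 assumes i: "i \<in> Ix" and j: "j \<in> Ix"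
 shows "YY c i (cc c j k u) - cc c j k (YY c i u) = YY c j (cc c i k u) - cc c i k (YY c j u)"
proof -
 have main: "YY c i (cc c j i u) - cc c j i (YY c i u) = YY c j (cc c i i u) - cc c i i (YY c j u)"
  if i: "i \<in> Ix" and j: "j \<in> Ix" and ne: "i ~= j" for i j
 proof -
  have sp: "(\<Sum>l\<in>Ix - {i}. f l) = f j + (\<Sum>l\<in>Ix - {i} - {j}. f l)" for f :: "nat => mv"
   using ne j by (intro sum.remove) auto
  have "(\<Sum>l\<in>Ix - {i} - {j}. YY c j (WW (transpose i l) u)) = (\<Sum>l\<in>Ix - {i} - {j}. WW (transpose i l) (YY c j u))"
  proof (rule sum.cong)
   fix l assume l: "l \<in> Ix - {i} - {j}"
   hence "transpose i l j = j" using ne by (auto simp: transpose_def)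
   thus "YY c j (WW (transpose i l) u) = WW (transpose i l) (YY c j u)" using YY_tr[of i l c j u] i l by simp
  qed simp
  thus ?thesis using i j ne
   by (simp add: cc_def YY_lops sp YY_tr sc_distribs transpose_commute[of j i] algebra_simps)
 qed
 consider "i = j" | "i ~= j" "k = i" | "i ~= j" "k = j" | "i ~= j" "k ~= i" "k ~= j" by blast
 thus ?thesis
 proof cases
  case 2 thus ?thesis using main[OF i j] by simp
 next
  case 3 thus ?thesis using main[OF j i] by simp
 next
  case 4
  have "transpose j k i = i" "transpose i k j = j" using 4 by (auto simp: transpose_def)
  thus ?thesis using YY_tr[of j k c i u] YY_tr[of i k c j u] i j 4 by (simp add: cc_def YY_lops)
 qed simp
qed

lemma YY_commute: "YY c i (YY c j u) = YY c j (YY c i u)"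
proof (cases "i \<in> Ix & j \<in> Ix")
 case False
 thus ?thesis using YY_out[of i c] YY_out[of j c] by (auto simp: YY_lops simp del: atLeastAtMost_iff)
next
 case ij: True
 have "YY c i (YY c j u) - YY c j (YY c i u) = 0"
 proof (rule X_intertwiner_zero[of "%u. YY c i (YY c j u) - YY c j (YY c i u)" "%k. k"])
  show "linear_op (%u. YY c i (YY c j u) - YY c j (YY c i u))"
   by (intro lin_minusI lin_compI[OF linear_YY linear_YY])
  fix k u
  show "YY c i (YY c j (XX k u)) - YY c j (YY c i (XX k u)) = XX k (YY c i (YY c j u) - YY c j (YY c i u))"
   using YY_cc[of i j c k u] ij by (simp add: YY_XX YY_lops XX_lops algebra_simps)
 next
  fix \<alpha> :: "nat => nat" and p assume a: "\<And>k. k \<in> Ix ==> \<alpha> k = 0"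
  show "YY c i (YY c j (ba (\<alpha>, p))) - YY c j (YY c i (ba (\<alpha>, p))) = 0"
   using YY_base[of \<alpha> c i "ba p", OF a] YY_base[of \<alpha> c j "ba p", OF a] by (simp add: YY_lops)
 qed
 thus ?thesis by simp
qed

end

abbreviation zf :: "nat => nat" where "zf \<equiv> (%_. 0)"

definition sl :: "(nat => nat) => mv => gv" where
 "sl \<alpha> = lin (%(\<beta>, p). if \<beta> = \<alpha> then ba p else 0)"

lemma linear_sl [simp]: "linear_op (sl \<alpha>)" by (simp add: sl_def)
lemmas sl_lops = lops[OF linear_sl]
lemma sl_xv: "sl \<alpha> (xv \<beta> v) = (if \<beta> = \<alpha> then v else 0)"
proof (cases "\<beta> = \<alpha>")
 case True
 have "sl \<alpha> (xv \<beta> v) = v"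
  by (rule linear_eqI[OF lin_compI[OF linear_sl linear_xv] lin_idI]) (simp add: sl_def True)
 thus ?thesis using True by simp
next
 case False
 have "sl \<alpha> (xv \<beta> v) = 0"
  by (rule linear_eqI[OF lin_compI[OF linear_sl linear_xv] lin_zeroI]) (simp add: sl_def False)
 thus ?thesis using False by simp
qed

lemma sl_ba: "sl \<gamma> (ba (\<alpha>, p)) = (if \<alpha> = \<gamma> then ba p else 0)" by (simp add: sl_def)

lemma lk_sl: "lk (sl \<alpha> f) p = lk f (\<alpha>, p)"
proof -
 have "lk (sl \<alpha> f) p = (\<Sum>k\<in>ks f. lk f k * lk (case k of (\<beta>, p) => if \<beta> = \<alpha> then ba p else 0) p)"
  by (simp add: sl_def lin_def lookup_sum)
 also have "... = (\<Sum>k\<in>ks f. if k = (\<alpha>, p) then lk f k else 0)"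
  by (rule sum.cong) (auto simp: lookup_single when_def split: if_splits)
 also have "... = lk f (\<alpha>, p)" by (simp add: in_keys_iff)
 finally show ?thesis .
qed

lemma mv_expand: "f = (\<Sum>\<alpha>\<in>fst ` ks f. xv \<alpha> (sl \<alpha> f))"
proof (rule poly_mapping_eqI)
 fix k :: "(nat => nat) \<times> (nat => nat)" obtain \<beta> p where k: "k = (\<beta>, p)" by (cases k)
 have l: "lk (xv \<alpha> v) (\<beta>, p) = (if \<beta> = \<alpha> then lk v p else 0)" for \<alpha> v
  using lk_sl[of \<beta> "xv \<alpha> v" p] by (auto simp: sl_xv)
 have "lk (\<Sum>\<alpha>\<in>fst ` ks f. xv \<alpha> (sl \<alpha> f)) k = (if \<beta> \<in> fst ` ks f then lk f (\<beta>, p) else 0)"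
  by (simp add: lookup_sum k l lk_sl)
 also have "... = lk f k"
 proof (cases "\<beta> \<in> fst ` ks f")
  case False
  hence "(\<beta>, p) \<notin> ks f" by force
  thus ?thesis using False by (simp add: k in_keys_iff)
 qed (simp add: k)
 finally show "lk f k = lk (\<Sum>\<alpha>\<in>fst ` ks f. xv \<alpha> (sl \<alpha> f)) k" by simp
qed

lemma mv_eq_iff_sl: "f = g \<longleftrightarrow> (\<forall>\<alpha>. sl \<alpha> f = sl \<alpha> g)"
 using lk_sl[of _ f] lk_sl[of _ g] by (metis poly_mapping_eqI surj_pair)

definition pr :: "('a => complex) => ('a \<Rightarrow>\<^sub>0 complex) => complex" where
 "pr F u = (\<Sum>k\<in>ks u. lk u k * F k)"

lemma pr_superset: "finite S ==> ks u \<subseteq> S ==> pr F u = (\<Sum>k\<in>S. lk u k * F k)"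
 unfolding pr_def by (rule sum.mono_neutral_left) (auto simp: in_keys_iff)
lemma pr_add: "pr F (u + v) = pr F u + pr F v"
 by (subst (1 2 3) pr_superset[of "ks u \<union> ks v"])
  (use keys_add[of u v] in \<open>auto simp: lookup_add algebra_simps sum.distrib\<close>)
lemma pr_sc: "pr F (sc a u) = a * pr F u"
 by (subst (1 2) pr_superset[of "ks u"]) (auto simp: in_keys_iff sum_distrib_left mult_ac)
lemma pr_ba: "pr F (ba k) = F k" by (simp add: pr_def)
lemma pr_zero [simp]: "pr F 0 = 0" by (simp add: pr_def)
lemma pr_sum: "pr F (\<Sum>i\<in>A. g i) = (\<Sum>i\<in>A. pr F (g i))"
 by (induction A rule: infinite_finite_induct) (auto simp: pr_add)
lemma pr_lin: "pr F (lin g u) = pr (%k. pr F (g k)) u"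
 by (simp add: lin_def pr_sum pr_sc) (simp add: pr_def)

context young
begin

section \<open>Graded pieces\<close>

text \<open>Exponents are functions on all of nat that vanish outside of 1..n; cm m are those of degree m. NM m is the degree m
 part of the standard module in coordinates, and NC is C[x] \<otimes> C[S_n] without restriction on the coefficients.\<close>

definition "comps = {\<alpha> :: nat => nat. \<forall>i. i \<notin> Ix --> \<alpha> i = 0}"
definition "cm m = {\<alpha> \<in> comps. (\<Sum>i\<in>Ix. \<alpha> i) = m}"
definition "NM m = fv.span {xv \<alpha> v | \<alpha> v. \<alpha> \<in> cm m & v \<in> VV}"
definition "NC = {f :: mv. fst ` ks f \<subseteq> comps}"

lemma comps_cm: "\<alpha> \<in> comps \<longleftrightarrow> (\<exists>m. \<alpha> \<in> cm m)" by (auto simp: cm_def)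
lemma cm_comps: "\<alpha> \<in> cm m ==> \<alpha> \<in> comps" by (auto simp: cm_def)

lemma finite_cm [simp]: "finite (cm m)"
proof (rule finite_subset)
 let ?r = "%\<alpha>. restrict \<alpha> Ix"
 show "cm m \<subseteq> (%f i. if i \<in> Ix then f i else 0) ` (Ix \<rightarrow>\<^sub>E {..m})"
 proof
  fix \<alpha> assume a: "\<alpha> \<in> cm m"
  have "\<alpha> i \<le> m" if "i \<in> Ix" for i
   using member_le_sum[OF that, of \<alpha>] a by (auto simp: cm_def)
  hence "?r \<alpha> \<in> Ix \<rightarrow>\<^sub>E {..m}" by auto
  moreover have "\<alpha> = (%i. if i \<in> Ix then ?r \<alpha> i else 0)"
   using a by (auto simp: cm_def comps_def fun_eq_iff)
  ultimately show "\<alpha> \<in> (%f i. if i \<in> Ix then f i else 0) ` (Ix \<rightarrow>\<^sub>E {..m})" by blast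
 qed
qed (intro finite_imageI finite_PiE, auto)

lemma zf_cm: "zf \<in> cm 0" by (simp add: cm_def comps_def)
lemma cm_0: "cm 0 = {zf}"
proof
 show "cm 0 \<subseteq> {zf}"
 proof
  fix \<alpha> assume a: "\<alpha> \<in> cm 0"
  hence "\<alpha> i = 0" for i by (cases "i \<in> Ix") (auto simp: cm_def comps_def)
  thus "\<alpha> \<in> {zf}" by auto
 qed
qed (simp add: zf_cm)

lemma up_cm: "i \<in> Ix ==> \<alpha> \<in> cm m ==> up i \<alpha> \<in> cm (Suc m)"
proof -
 assume i: "i \<in> Ix" and a: "\<alpha> \<in> cm m"
 have "(\<Sum>k\<in>Ix. up i \<alpha> k) = (\<Sum>k\<in>Ix. \<alpha> k + (if k = i then 1 else 0))"
  by (rule sum.cong) (auto simp: up_def)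
 also have "... = Suc m" using i a by (simp add: sum.distrib cm_def)
 finally show ?thesis using a i by (auto simp: cm_def comps_def up_def)
qed

lemma cm_Suc: "\<alpha> \<in> cm (Suc m) ==> \<exists>k\<in>Ix. \<exists>\<beta>\<in>cm m. \<alpha> = up k \<beta>"
proof -
 assume a: "\<alpha> \<in> cm (Suc m)"
 hence "\<exists>k\<in>Ix. \<alpha> k ~= 0" by (intro ccontr[of "\<exists>k\<in>Ix. \<alpha> k ~= 0"]) (auto simp: cm_def)
 then obtain k where k: "k \<in> Ix" "0 < \<alpha> k" by blast
 define \<beta> where "\<beta> = \<alpha>(k := \<alpha> k - 1)"
 have e: "\<alpha> = up k \<beta>" using k by (auto simp: \<beta>_def up_def fun_eq_iff)
 have bc: "\<beta> \<in> comps" using a k by (auto simp: cm_def comps_def \<beta>_def)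
 then obtain m' where m': "\<beta> \<in> cm m'" using comps_cm by blast
 hence "m' = m" using up_cm[OF k(1) m'] a e by (auto simp: cm_def)
 thus ?thesis using e k m' by blast
qed

lemma perm_cm: "w permutes Ix ==> \<alpha> \<in> cm m ==> \<alpha> o pinv w \<in> cm m"
proof -
 assume w: "w permutes Ix" and a: "\<alpha> \<in> cm m"
 have wi: "pinv w permutes Ix" by (rule permutes_inv[OF w])
 have "(\<Sum>i\<in>Ix. (\<alpha> o pinv w) i) = (\<Sum>i\<in>Ix. \<alpha> i)"
  using sum.permute[OF wi, of \<alpha>] by simp
 moreover have "(\<alpha> o pinv w) i = 0" if "i \<notin> Ix" for i
  using that a permutes_not_in[OF wi that] by (simp add: cm_def comps_def)
 ultimately show ?thesis using a by (simp add: cm_def comps_def)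
qed

lemma NM_xv: "\<alpha> \<in> cm m ==> v \<in> VV ==> xv \<alpha> v \<in> NM m"
 unfolding NM_def by (rule fv.span_base) blast

lemma NM_subspace: "fv.subspace (NM m)" unfolding NM_def by (rule fv.subspace_span)
lemmas NM_closed = NM_subspace[THEN fv.subspace_add] NM_subspace[THEN fv.subspace_scale]
 NM_subspace[THEN fv.subspace_diff] NM_subspace[THEN fv.subspace_sum] NM_subspace[THEN fv.subspace_0]

lemma NM_linear:
 assumes "linear_op f" "\<And>\<alpha> v. \<alpha> \<in> cm m ==> v \<in> VV ==> f (xv \<alpha> v) \<in> NM m'" "u \<in> NM m"
 shows "f u \<in> NM m'"
 using assms(3) unfolding NM_def[of m]
 by (induction rule: fv.span_induct_alt) (auto simp: lops[OF assms(1)] intro!: NM_closed assms(2))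

lemma NM_eqI:
 assumes "linear_op f" "linear_op g" "\<And>\<alpha> v. \<alpha> \<in> cm m ==> v \<in> VV ==> f (xv \<alpha> v) = g (xv \<alpha> v)" "u \<in> NM m"
 shows "f u = g u"
 using assms(4) unfolding NM_def
 by (induction rule: fv.span_induct_alt) (auto simp: lops[OF assms(1)] lops[OF assms(2)] assms(3))

lemma XX_NM: "i \<in> Ix ==> f \<in> NM m ==> XX i f \<in> NM (Suc m)"
 by (rule NM_linear[OF linear_XX]) (simp_all add: XX_xv NM_xv up_cm)

lemma WW_NM: "w permutes Ix ==> f \<in> NM m ==> WW w f \<in> NM m"
 by (rule NM_linear[OF linear_WW]) (simp_all add: WW_xv NM_xv perm_cm VV_perm_act)

lemma tr_perm: "i \<in> Ix ==> j \<in> Ix ==> transpose i j permutes Ix"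
 by (rule permutes_swap_id)

lemma cc_NM: "f \<in> NM m ==> cc c i k f \<in> NM m"
 unfolding cc_def by (auto intro!: NM_closed WW_NM tr_perm simp del: atLeastAtMost_iff)

lemma sl_NM: "f \<in> NM m ==> sl \<alpha> f \<in> VV & (\<alpha> \<notin> cm m --> sl \<alpha> f = 0)"
 unfolding NM_def by (induction rule: fv.span_induct_alt) (auto simp: sl_lops sl_xv intro!: VV_closed split: if_splits)

lemma NC_sl: "f \<in> NC \<longleftrightarrow> (\<forall>\<alpha>. \<alpha> \<notin> comps --> sl \<alpha> f = 0)"
proof
 assume "f \<in> NC"
 show "\<forall>\<alpha>. \<alpha> \<notin> comps --> sl \<alpha> f = 0"
 proof (intro allI impI poly_mapping_eqI)
  fix \<alpha> p assume "\<alpha> \<notin> comps"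
  hence "(\<alpha>, p) \<notin> ks f" using \<open>f \<in> NC\<close> unfolding NC_def by force
  thus "lk (sl \<alpha> f) p = lk 0 p" by (simp add: lk_sl in_keys_iff)
 qed
next
 assume a: "\<forall>\<alpha>. \<alpha> \<notin> comps --> sl \<alpha> f = 0"
 show "f \<in> NC" unfolding NC_def
 proof (intro CollectI image_subsetI)
  fix x assume "x \<in> ks f"
  hence "lk (sl (fst x) f) (snd x) ~= 0" by (simp add: lk_sl in_keys_iff)
  thus "fst x \<in> comps" using a by (metis lookup_zero)
 qed
qed

lemma NM_NC: "f \<in> NM m ==> f \<in> NC" using sl_NM cm_comps by (simp add: NC_sl) blast

lemma NC_closed: "f \<in> NC ==> g \<in> NC ==> f + g \<in> NC" "f \<in> NC ==> sc a f \<in> NC"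
 "f \<in> NC ==> g \<in> NC ==> f - g \<in> NC"
 by (simp_all add: NC_sl sl_lops)

lemma YY_xv_0: "YY c i (xv zf v) = 0" by (rule YY_base) simp

text \<open>By induction along multiplication by x_k: y_i x_k = x_k y_i + cc i k, and cc preserves the degree.\<close>

lemma YY_NM_xv: "\<alpha> \<in> cm m ==> v \<in> VV ==> (m = 0 --> YY c i (xv \<alpha> v) = 0) & (\<forall>m'. m = Suc m' --> YY c i (xv \<alpha> v) \<in> NM m')"
proof (induction m arbitrary: \<alpha>)
 case 0
 thus ?case by (simp add: cm_0 YY_xv_0)
next
 case (Suc m)
 obtain k \<beta> where k: "k \<in> Ix" "\<beta> \<in> cm m" "\<alpha> = up k \<beta>" using cm_Suc Suc.prems by blast
 have e: "YY c i (xv \<alpha> v) = XX k (YY c i (xv \<beta> v)) + cc c i k (xv \<beta> v)"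
  by (simp add: k(3) XX_xv[symmetric] YY_XX)
 have "XX k (YY c i (xv \<beta> v)) \<in> NM m"
  using Suc.IH[OF k(2) Suc.prems(2)] k(1) by (cases m) (auto intro!: XX_NM NM_closed simp: XX_lops simp del: atLeastAtMost_iff)
 thus ?case unfolding e using k Suc.prems by (auto intro!: NM_closed cc_NM NM_xv)
qed

lemma YY_NM: "f \<in> NM (Suc m) ==> YY c i f \<in> NM m"
 by (rule NM_linear[OF linear_YY]) (use YY_NM_xv in auto)
lemma YY_NM0: "f \<in> NM 0 ==> YY c i f = 0"
 by (rule NM_eqI[OF linear_YY lin_zeroI]) (use YY_NM_xv in auto)

lemma XX_NC: "k \<in> Ix ==> f \<in> NC ==> XX k f \<in> NC"
proof -
 assume k: "k \<in> Ix" and f: "f \<in> NC"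
 have u: "\<And>\<alpha>. \<alpha> \<in> comps ==> up k \<alpha> \<in> comps" using k by (auto simp: comps_def up_def)
 have "XX k (\<Sum>\<alpha>\<in>fst ` ks f. xv \<alpha> (sl \<alpha> f)) \<in> NC"
  unfolding XX_lops XX_xv NC_sl sl_lops
 proof (intro allI impI sum.neutral ballI)
  fix \<gamma> \<alpha> assume g: "\<gamma> \<notin> comps" "\<alpha> \<in> fst ` ks f"
  hence "up k \<alpha> ~= \<gamma>" using f u unfolding NC_def by blast
  thus "sl \<gamma> (xv (up k \<alpha>) (sl \<alpha> f)) = 0" by (simp add: sl_xv)
 qed
 thus ?thesis using mv_expand by metis
qed

lemma YY_NC: "f \<in> NC ==> YY c i f \<in> NC"
proof -
 have b: "YY c i (xv \<alpha> v) \<in> NC" if "\<alpha> \<in> cm m" for \<alpha> v m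
  using that
 proof (induction m arbitrary: \<alpha>)
  case 0
  thus ?case by (simp add: cm_0 YY_xv_0 NC_sl sl_lops)
 next
  case (Suc m)
  obtain k \<beta> where k: "k \<in> Ix" "\<beta> \<in> cm m" "\<alpha> = up k \<beta>" using cm_Suc Suc.prems by blast
  have W: "WW w (xv \<beta> v) \<in> NC" if "w permutes Ix" for w
   using perm_cm[OF that k(2)] by (auto simp: WW_xv NC_sl sl_xv cm_comps)
  have "NC_sum": "(\<Sum>i\<in>A. f i) \<in> NC" if "\<And>i. i \<in> A ==> f i \<in> NC" for A :: "nat set" and f
   using that by (simp add: NC_sl sl_lops sum.neutral)
  have bn: "xv \<beta> v \<in> NC" using k(2) by (auto simp: NC_sl sl_xv cm_comps)
  have z: "0 \<in> NC" by (simp add: NC_def)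
  have "cc c i k (xv \<beta> v) \<in> NC" unfolding cc_def
   by (auto intro!: NC_closed NC_sum W tr_perm bn z simp del: atLeastAtMost_iff)
  thus ?case using XX_NC[OF k(1) Suc.IH[OF k(2)]] by (simp add: k(3) XX_xv[symmetric] YY_XX NC_closed)
 qed
 assume f: "f \<in> NC"
 have "(\<Sum>\<alpha>\<in>fst ` ks f. YY c i (xv \<alpha> (sl \<alpha> f))) \<in> NC"
  unfolding NC_sl sl_lops
 proof (intro allI impI sum.neutral ballI)
  fix \<gamma> \<alpha> assume "\<gamma> \<notin> comps" "\<alpha> \<in> fst ` ks f"
  moreover have "\<alpha> \<in> comps" using f calculation unfolding NC_def by blast
  ultimately show "sl \<gamma> (YY c i (xv \<alpha> (sl \<alpha> f))) = 0" using b comps_cm NC_sl by blast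
 qed
 thus ?thesis by (subst mv_expand) (simp add: YY_lops)
qed

section \<open>The contravariant form\<close>

definition Ymon :: "complex => (nat => nat) => mv => mv" where
 "Ymon c \<alpha> g = fold (%i. YY c i ^^ \<alpha> i) [1..<Suc n] g"

lemma YY_pow_commute: "YY c i ((YY c j ^^ a) u) = (YY c j ^^ a) (YY c i u)"
 by (induction a) (simp_all add: YY_commute[of c i j])

lemma fold_up: "distinct is ==> i \<in> set is ==>
 fold (%j. YY c j ^^ up i \<alpha> j) is g = fold (%j. YY c j ^^ \<alpha> j) is (YY c i g)"
proof (induction "is" arbitrary: g)
 case (Cons j js)
 show ?case
 proof (cases "j = i")
  case True
  hence "i \<notin> set js" using Cons.prems by simp
  hence u: "\<And>x. x \<in> set js ==> up i \<alpha> x = \<alpha> x" by (auto simp: up_def)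
  have "fold (%j. YY c j ^^ up i \<alpha> j) js h = fold (%j. YY c j ^^ \<alpha> j) js h" for h
   by (rule List.fold_cong) (simp_all add: u)
  thus ?thesis using True by (simp add: up_def funpow_swap1)
 next
  case False
  thus ?thesis using Cons by (simp add: YY_pow_commute) (simp add: up_def)
 qed
qed simp

lemma Ymon_up: "i \<in> Ix ==> Ymon c (up i \<alpha>) g = Ymon c \<alpha> (YY c i g)"
 unfolding Ymon_def by (rule fold_up) auto

lemma Ymon_zero: "(\<And>k. k \<in> Ix ==> \<alpha> k = 0) ==> Ymon c \<alpha> g = g"
proof -
 assume a: "\<And>k. k \<in> Ix ==> \<alpha> k = 0"
 have "fold (%i. YY c i ^^ \<alpha> i) is g = g" if "set is \<subseteq> Ix" for "is"
  using that a by (induction "is" arbitrary: g) auto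
 note z = this
 show ?thesis unfolding Ymon_def by (rule z) auto
qed

lemma comps_cases: "\<alpha> \<in> comps ==> \<alpha> = zf \<or> (\<exists>k\<in>Ix. \<exists>\<beta>\<in>comps. \<alpha> = up k \<beta>)"
proof -
 assume "\<alpha> \<in> comps"
 then obtain m where m: "\<alpha> \<in> cm m" using comps_cm by blast
 show ?thesis
 proof (cases m)
  case 0 thus ?thesis using m by (simp add: cm_0)
 next
  case (Suc m') thus ?thesis using m cm_Suc[of \<alpha> m'] cm_comps by blast
 qed
qed

lemma comps_induct [consumes 1, case_names zero up]:
 assumes "\<alpha> \<in> comps" "P zf" "\<And>k \<beta>. k \<in> Ix ==> \<beta> \<in> comps ==> P \<beta> ==> P (up k \<beta>)"
 shows "P \<alpha>"
proof -
 obtain m where "\<alpha> \<in> cm m" using assms(1) comps_cm by blast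
 thus ?thesis
 proof (induction m arbitrary: \<alpha>)
  case 0 thus ?case using assms(2) by (simp add: cm_0)
 next
  case (Suc m) thus ?case using cm_Suc[of \<alpha> m] assms(3) cm_comps by metis
 qed
qed

lemma linear_Ymon [simp]: "linear_op (Ymon c \<alpha>)"
proof -
 have p: "linear_op (YY c i ^^ a)" for i a
 proof (induction a)
  case (Suc a) thus ?case using lin_compI[OF linear_YY Suc] by (simp add: comp_def)
 qed (simp add: linear_id'[unfolded id_def] id_def)
 have "linear_op (fold (%i. YY c i ^^ \<alpha> i) is)" for "is"
 proof (induction "is")
  case (Cons i "is") thus ?case using lin_compI[OF Cons p] by (simp add: comp_def)
 qed (simp add: lin_idI id_def)
 thus ?thesis by (simp add: Ymon_def[abs_def])
qed

text \<open>Conjugate linear in the second argument. On x^\<alpha> v it is the inner product of v with the constant term of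
 y^\<alpha> g (BB_xv).\<close>

definition BB :: "complex => mv => mv => complex" where
 "BB c f g = pr (%(\<alpha>, p). cnj (lk (Ymon c \<alpha> g) (zf, p))) f"

lemma BB_xv: "BB c (xv \<alpha> v) g = ip v (sl zf (Ymon c \<alpha> g))"
proof -
 have "BB c (xv \<alpha> v) g = pr (%p. cnj (lk (Ymon c \<alpha> g) (zf, p))) v"
  unfolding BB_def xv_def linear_ext_eq_lin pr_lin by (simp add: pr_ba)
 thus ?thesis by (simp add: pr_def ip_def lk_sl)
qed

lemma BB_add_left: "BB c (f + f') g = BB c f g + BB c f' g" by (simp add: BB_def pr_add)
lemma BB_sc_left: "BB c (sc a f) g = a * BB c f g" by (simp add: BB_def pr_sc)
lemma BB_zero_left [simp]: "BB c 0 g = 0" by (simp add: BB_def)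
lemma BB_sum_left: "BB c (\<Sum>i\<in>A. f i) g = (\<Sum>i\<in>A. BB c (f i) g)" by (simp add: BB_def pr_sum)
lemma BB_diff_left: "BB c (f - f') g = BB c f g - BB c f' g"
 using BB_add_left[of c "f - f'" f' g] by simp
lemma BB_expand: "BB c f g = (\<Sum>\<alpha>\<in>fst ` ks f. BB c (xv \<alpha> (sl \<alpha> f)) g)"
 by (subst mv_expand[of f]) (simp only: BB_sum_left)
lemma BB_add_right: "BB c f (g + g') = BB c f g + BB c f g'"
 by (subst (1 2 3) BB_expand) (simp add: BB_xv lop_add[OF linear_Ymon] sl_lops ip_add_right sum.distrib)
lemma BB_sc_right: "BB c f (sc a g) = cnj a * BB c f g"
 by (subst (1 2) BB_expand) (simp add: BB_xv lop_sc[OF linear_Ymon] sl_lops ip_sc_right sum_distrib_left)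
lemma BB_zero_right [simp]: "BB c f 0 = 0" using BB_sc_right[of c f 0 0] by simp
lemma BB_sum_right: "BB c f (\<Sum>i\<in>A. g i) = (\<Sum>i\<in>A. BB c f (g i))"
 by (induction A rule: infinite_finite_induct) (auto simp: BB_add_right)
lemma BB_diff_right: "BB c f (g - g') = BB c f g - BB c f g'"
 using BB_add_right[of c f "g - g'" g'] by simp
lemmas BB_simps = BB_add_left BB_add_right BB_sc_left BB_sc_right BB_diff_left BB_diff_right

lemma BB_XX: "i \<in> Ix ==> BB c (XX i f) g = BB c f (YY c i g)"
proof -
 assume i: "i \<in> Ix"
 have "BB c (XX i f) g = (\<Sum>\<alpha>\<in>fst ` ks f. BB c (xv (up i \<alpha>) (sl \<alpha> f)) g)"
  by (subst mv_expand[of f]) (simp only: XX_lops XX_xv BB_sum_left)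
 also have "... = BB c f (YY c i g)"
  by (subst BB_expand) (simp add: BB_xv Ymon_up[OF i])
 finally show ?thesis .
qed

lemma Ymon_WW:
 assumes w: "w permutes Ix" shows "Ymon c (\<alpha> o pinv w) (WW w g) = WW w (Ymon c \<alpha> g)"
proof (induction "\<Sum>k\<in>Ix. \<alpha> k" arbitrary: \<alpha> g rule: less_induct)
 case less
 show ?case
 proof (cases "\<forall>k\<in>Ix. \<alpha> k = 0")
  case True
  have "(\<alpha> o pinv w) k = 0" if k: "k \<in> Ix" for k
  proof -
   have "pinv w k \<in> Ix" using k by (simp only: permutes_in_image[OF permutes_inv[OF w]])
   thus ?thesis using True by simp
  qed
  thus ?thesis using True Ymon_zero[of \<alpha>] Ymon_zero[of "\<alpha> o pinv w"] by simp
 next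
  case False
  then obtain k where k: "k \<in> Ix" "0 < \<alpha> k" by blast
  define \<beta> where "\<beta> = \<alpha>(k := \<alpha> k - 1)"
  have \<alpha>: "\<alpha> = up k \<beta>" using k by (auto simp: \<beta>_def up_def fun_eq_iff)
  have lt: "(\<Sum>k\<in>Ix. \<beta> k) < (\<Sum>k\<in>Ix. \<alpha> k)"
   by (rule sum_strict_mono_ex1) (use k in \<open>auto simp: \<beta>_def\<close>)
  have wk: "w k \<in> Ix" using k(1) by (simp only: permutes_in_image[OF w])
  have "Ymon c (\<alpha> o pinv w) (WW w g) = Ymon c (\<beta> o pinv w) (YY c (w k) (WW w g))"
   unfolding \<alpha> up_comp_inv[OF permutes_bij[OF w]] by (rule Ymon_up[OF wk])
  also have "... = WW w (Ymon c \<beta> (YY c k g))"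
   unfolding WW_YY[OF w, symmetric] by (rule less[OF lt])
  also have "... = WW w (Ymon c \<alpha> g)" by (simp add: \<alpha> Ymon_up[OF k(1)])
  finally show ?thesis .
 qed
qed

lemma sl_zf_WW: "bij w ==> sl zf (WW w f) = perm_act w (sl zf f)"
proof -
 assume b: "bij w"
 have z: "\<alpha> o pinv w = zf \<longleftrightarrow> \<alpha> = zf" for \<alpha> :: "nat => nat"
 proof
  assume e: "\<alpha> o pinv w = zf"
  have "\<alpha> x = (\<alpha> o pinv w) (w x)" for x using b by (simp add: bij_is_inj inv_f_f)
  thus "\<alpha> = zf" unfolding e by auto
 qed auto
 show ?thesis
  by (rule mv_linear_eqI[OF lin_compI[OF linear_sl linear_WW] lin_compI[OF linear_perm_act linear_sl]])
   (simp add: sl_ba z perm_act_lops)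
qed

lemma BB_WW: "w permutes Ix ==> BB c (WW w f) (WW w g) = BB c f g"
proof -
 assume w: "w permutes Ix"
 have "BB c (WW w f) (WW w g) = (\<Sum>\<alpha>\<in>fst ` ks f. BB c (xv (\<alpha> o pinv w) (perm_act w (sl \<alpha> f))) (WW w g))"
  by (subst mv_expand[of f]) (simp only: WW_lops WW_xv BB_sum_left)
 also have "... = BB c f g"
  by (subst BB_expand)
   (simp add: BB_xv Ymon_WW[OF w] sl_zf_WW permutes_bij[OF w] ip_perm_act permutes_inj[OF w])
 finally show ?thesis .
qed

lemma BB_tr: "i \<in> Ix ==> j \<in> Ix ==> BB c (WW (transpose i j) f) g = BB c f (WW (transpose i j) g)"
 using BB_WW[OF tr_perm, of i j c f "WW (transpose i j) g"] by simp

lemma BB_cc: "cnj c = c ==> BB c (cc c i j f) g = BB c f (cc c i j g)"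
 unfolding cc_def by (auto simp: BB_simps BB_sum_left BB_sum_right BB_tr simp del: atLeastAtMost_iff intro!: sum.cong)

lemma cc_sym: "cc c i j f = cc c j i f"
 unfolding cc_def by (auto simp: transpose_commute[of i j])

lemma sl_zf_XX: "sl zf (XX i g) = 0"
proof (rule mv_linear_eqI[OF lin_compI[OF linear_sl linear_XX] lin_zeroI])
 fix \<alpha> p
 have "up i \<alpha> ~= zf" by (metis nat.distinct(1) up_def fun_upd_same)
 thus "sl zf (XX i (ba (\<alpha>, p))) = 0" by (simp add: sl_ba)
qed

text \<open>By induction on \<alpha> with y_i x_k = x_k y_i + cc i k; the term cc is self-adjoint for real c and symmetric in i
 and k.\<close>

lemma BB_YY_xv:
 assumes c: "cnj c = c" and i: "i \<in> Ix" and a: "\<alpha> \<in> comps"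
 shows "BB c (YY c i (xv \<alpha> v)) g = BB c (xv \<alpha> v) (XX i g)"
 using a
proof (induction \<alpha> arbitrary: g rule: comps_induct)
 case zero
 show ?case by (simp add: YY_xv_0 BB_xv Ymon_zero sl_zf_XX)
next
 case (up k \<beta>)
 have "BB c (YY c i (xv (up k \<beta>) v)) g = BB c (YY c i (xv \<beta> v)) (YY c k g) + BB c (cc c i k (xv \<beta> v)) g"
  by (simp add: XX_xv[symmetric] YY_XX BB_add_left BB_XX[OF up(1)])
 also have "... = BB c (xv \<beta> v) (XX i (YY c k g) + cc c k i g)"
  by (simp add: up.IH BB_cc[OF c] cc_sym[of c k i] BB_add_right)
 also have "... = BB c (xv (up k \<beta>) v) (XX i g)"
  by (simp add: XX_xv[symmetric] BB_XX[OF up(1)] YY_XX)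
 finally show ?case .
qed

lemma BB_YY:
 assumes c: "cnj c = c" and i: "i \<in> Ix" and f: "f \<in> NC"
 shows "BB c (YY c i f) g = BB c f (XX i g)"
proof -
 have "BB c (YY c i f) g = (\<Sum>\<alpha>\<in>fst ` ks f. BB c (YY c i (xv \<alpha> (sl \<alpha> f))) g)"
  by (subst mv_expand[of f]) (simp only: YY_lops BB_sum_left)
 also have "... = BB c f (XX i g)"
  by (subst BB_expand) (use f in \<open>auto intro!: sum.cong BB_YY_xv[OF c i] simp: NC_def\<close>)
 finally show ?thesis .
qed

text \<open>Move the factors of x^\<alpha> to the other side one by one; for the constant exponent only the constant term of g
 contributes, since every y_i kills constants.\<close>

lemma BB_herm_xv:
 assumes c: "cnj c = c" and a: "\<alpha> \<in> comps" and g: "g \<in> NC"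
 shows "BB c g (xv \<alpha> v) = cnj (BB c (xv \<alpha> v) g)"
 using a g
proof (induction \<alpha> arbitrary: g rule: comps_induct)
 case zero
 have t: "BB c (xv \<beta> (sl \<beta> g)) (xv zf v) = (if \<beta> = zf then ip (sl zf g) v else 0)" if "\<beta> \<in> fst ` ks g" for \<beta>
 proof -
  have "\<beta> \<in> comps" using that zero by (auto simp: NC_def)
  then consider "\<beta> = zf" | k \<gamma> where "k \<in> Ix" "\<beta> = up k \<gamma>" using comps_cases by blast
  thus ?thesis
  proof cases
   case 1 thus ?thesis by (simp add: BB_xv Ymon_zero sl_xv)
  next
   case (2 k \<gamma>)
   have "up k \<gamma> ~= zf" by (metis nat.distinct(1) up_def fun_upd_same)
   thus ?thesis by (simp add: 2(2) BB_xv Ymon_up[OF 2(1)] YY_xv_0 lop_zero[OF linear_Ymon] sl_lops)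
  qed
 qed
 have "BB c g (xv zf v) = (\<Sum>\<beta>\<in>fst ` ks g. if \<beta> = zf then ip (sl zf g) v else 0)"
  by (subst BB_expand) (rule sum.cong, simp_all add: t)
 also have "... = ip (sl zf g) v"
 proof (cases "zf \<in> fst ` ks g")
  case False
  hence "(zf, p) \<notin> ks g" for p by force
  hence "sl zf g = 0" by (intro poly_mapping_eqI) (simp add: lk_sl in_keys_iff)
  thus ?thesis using False by simp
 qed simp
 finally show ?case by (simp add: BB_xv Ymon_zero ip_cnj[of "sl zf g" v])
next
 case (up k \<beta>)
 have "BB c g (xv (up k \<beta>) v) = BB c (YY c k g) (xv \<beta> v)"
  by (simp add: XX_xv[symmetric] BB_YY[OF c up(1) up.prems])
 also have "... = cnj (BB c (xv \<beta> v) (YY c k g))" by (rule up.IH[OF YY_NC[OF up.prems]])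
 finally show ?case by (simp add: XX_xv[symmetric] BB_XX[OF up(1)])
qed

lemma BB_herm:
 assumes c: "cnj c = c" and f: "f \<in> NC" and g: "g \<in> NC"
 shows "BB c g f = cnj (BB c f g)"
proof -
 have "BB c g f = (\<Sum>\<alpha>\<in>fst ` ks f. BB c g (xv \<alpha> (sl \<alpha> f)))"
  by (subst mv_expand[of f]) (simp only: BB_sum_right)
 also have "... = (\<Sum>\<alpha>\<in>fst ` ks f. cnj (BB c (xv \<alpha> (sl \<alpha> f)) g))"
  by (rule sum.cong) (use f g in \<open>auto intro!: BB_herm_xv[OF c] simp: NC_def\<close>)
 also have "... = cnj (BB c f g)" by (subst (2) BB_expand) simp
 finally show ?thesis .
qed

lemma Ymon_NM: "\<alpha> \<in> cm m ==> g \<in> NM (m' + m) ==> Ymon c \<alpha> g \<in> NM m'"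
proof (induction m arbitrary: \<alpha> g)
 case 0 thus ?case by (simp add: cm_0 Ymon_zero)
next
 case (Suc m)
 obtain k \<beta> where k: "k \<in> Ix" "\<beta> \<in> cm m" "\<alpha> = up k \<beta>" using cm_Suc Suc.prems by blast
 thus ?case using Suc YY_NM by (simp add: Ymon_up)
qed

lemma Ymon_NM_zero: "\<alpha> \<in> cm m ==> g \<in> NM m' ==> m' < m ==> Ymon c \<alpha> g = 0"
proof (induction m arbitrary: \<alpha> g m')
 case (Suc m)
 obtain k \<beta> where k: "k \<in> Ix" "\<beta> \<in> cm m" "\<alpha> = up k \<beta>" using cm_Suc Suc.prems by blast
 show ?case
 proof (cases m')
  case 0
  thus ?thesis using k Suc.prems YY_NM0 by (simp add: Ymon_up lop_zero[OF linear_Ymon])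
 next
  case (Suc m'')
  thus ?thesis using k Suc.prems Suc.IH[OF k(2) YY_NM[of g m'']] by (simp add: Ymon_up)
 qed
qed simp

lemma BB_deg:
 assumes f: "f \<in> NM m" and g: "g \<in> NM m'" and ne: "m ~= m'"
 shows "BB c f g = 0"
 using f unfolding NM_def
proof (induction rule: fv.span_induct_alt)
 case (step a x y)
 then obtain \<alpha> v where x: "x = xv \<alpha> v" "\<alpha> \<in> cm m" by blast
 have "sl zf (Ymon c \<alpha> g) = 0"
 proof (cases "m' < m")
  case True thus ?thesis using Ymon_NM_zero[OF x(2) g] by (simp add: sl_lops)
 next
  case False
  hence "Ymon c \<alpha> g \<in> NM (m' - m)" using Ymon_NM[OF x(2), of g "m' - m"] g by simp
  moreover have "zf \<notin> cm (m' - m)" using False ne by (simp add: cm_def)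
  ultimately show ?thesis using sl_NM by blast
 qed
 thus ?case using step by (simp add: BB_simps x BB_xv)
qed simp

end

definition blw :: "(nat => nat) => nat => nat => bool" where
 "blw \<alpha> i j \<longleftrightarrow> \<alpha> i < \<alpha> j \<or> \<alpha> i = \<alpha> j & i < j"

context young
begin

section \<open>Operators of Jucys-Murphy-Cherednik type and their intertwiners\<close>

text \<open>The Cherednik operators of type A in the normalisation that is triangular for the order klt below; they satisfy the
 relations of the degenerate affine Hecke algebra with the adjacent transpositions.\<close>

definition ZZ :: "complex => nat => mv => mv" where
 "ZZ c i u = YY c i (XX i u) + sc c (\<Sum>j\<in>{i<..n}. WW (transpose i j) u)"

lemma linear_ZZ [simp]: "linear_op (ZZ c i)"
 unfolding ZZ_def[abs_def]
 by (rule lin_plusI[OF lin_compI[OF linear_YY linear_XX] lin_scaledI[OF lin_sumI[OF linear_WW]]])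
lemmas ZZ_lops = lops[OF linear_ZZ]

lemma WW_tr_conj: "bij w ==> WW w (WW (transpose i l) u) = WW (transpose (w i) (w l)) (WW w u)"
 using comp_transpose[OF bij_is_inj, of w i l] by (simp add: WW_WW)

lemma WW_YX: "w permutes Ix ==> WW w (YY c i (XX i u)) = YY c (w i) (XX (w i) (WW w u))"
 by (simp add: WW_YY WW_XX permutes_bij)

lemma ZZ_sw:
 assumes i: "1 \<le> i" "i < n"
 shows "ZZ c (Suc i) (WW (sw i) u) = WW (sw i) (ZZ c i u) - sc c u"
proof -
 have p: "sw i permutes Ix" using i by (intro tr_perm) auto
 have sp: "{i<..n} = insert (Suc i) {Suc i<..n}" using i by auto
 have e: "(\<Sum>j\<in>{Suc i<..n}. WW (transpose (Suc i) (sw i j)) (WW (sw i) u)) =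
  (\<Sum>j\<in>{Suc i<..n}. WW (transpose (Suc i) j) (WW (sw i) u))"
  by (rule sum.cong) (auto simp: transpose_def)
 have "WW (sw i) (ZZ c i u) = YY c (Suc i) (XX (Suc i) (WW (sw i) u)) +
   sc c (\<Sum>j\<in>{i<..n}. WW (transpose (Suc i) (sw i j)) (WW (sw i) u))"
  unfolding ZZ_def lop_add[OF linear_WW] lop_sc[OF linear_WW] lop_sum[OF linear_WW]
   WW_YX[OF p] WW_tr_conj[OF permutes_bij[OF p]] by (simp only: transpose_apply_first)
 also have "... = ZZ c (Suc i) (WW (sw i) u) + sc c u"
  by (simp add: ZZ_def sp e sc_distribs transpose_commute[of "Suc i" i])
 finally show ?thesis by simp
qed

lemma ZZ_sw':
 assumes i: "1 \<le> i" "i < n"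
 shows "ZZ c i (WW (sw i) u) = WW (sw i) (ZZ c (Suc i) u) + sc c u"
proof -
 have "ZZ c (Suc i) u = WW (sw i) (ZZ c i (WW (sw i) u)) - sc c (WW (sw i) u)"
  using ZZ_sw[OF i, of c "WW (sw i) u"] by simp
 hence "WW (sw i) (ZZ c (Suc i) u) = ZZ c i (WW (sw i) u) - sc c u" by (simp add: WW_lops)
 thus ?thesis by simp
qed

lemma ZZ_sw_other:
 assumes i: "1 \<le> i" "i < n" and k: "k ~= i" "k ~= Suc i"
 shows "ZZ c k (WW (sw i) u) = WW (sw i) (ZZ c k u)"
proof -
 have p: "sw i permutes Ix" using i by (intro tr_perm) auto
 have ki: "sw i k = k" using k by (simp add: transpose_def)
 have e: "(\<Sum>j\<in>{k<..n}. WW (transpose k (sw i j)) (WW (sw i) u)) =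
  (\<Sum>j\<in>{k<..n}. WW (transpose k j) (WW (sw i) u))"
  by (rule sum.reindex_bij_witness[of _ "sw i" "sw i"]) (use i k in \<open>auto simp: transpose_def\<close>)
 show ?thesis unfolding ZZ_def lop_add[OF linear_WW] lop_sc[OF linear_WW] lop_sum[OF linear_WW]
   WW_YX[OF p] WW_tr_conj[OF permutes_bij[OF p]] ki e ..
qed

text \<open>The cycle 1 -> 2 -> ... -> n -> 1.\<close>

definition om :: "nat => nat" where
 "om i = (if i \<in> {1..<n} then Suc i else if i = n & 1 \<le> n then 1 else i)"

lemma om_perm: "om permutes Ix"
proof (rule bij_imp_permutes)
 have "inj_on om Ix" by (auto simp: inj_on_def om_def split: if_splits)
 moreover have "om ` Ix \<subseteq> Ix" by (auto simp: om_def)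
 ultimately show "bij_betw om Ix Ix"
  by (simp add: bij_betw_def endo_inj_surj)
qed (auto simp: om_def)

lemma om_bij: "bij om" by (rule permutes_bij[OF om_perm])
lemma om_simps: "1 \<le> i ==> i < n ==> om i = Suc i" "1 \<le> n ==> om n = 1" by (auto simp: om_def)

text \<open>The affine intertwiner of Knop and Sahi. It shifts the weights cyclically and raises the last one by 1, so together
 with the adjacent intertwiners it reaches every exponent from 0.\<close>

definition Phi :: "mv => mv" where "Phi u = XX 1 (WW om u)"

lemma ZZ_Phi_Suc:
 assumes i: "1 \<le> i" "i < n" shows "ZZ c (Suc i) (Phi u) = Phi (ZZ c i u)"
proof -
 let ?u = "WW om u"
 have in': "Suc i \<in> Ix" "1 \<in> Ix" using i by auto
 have "(\<Sum>j\<in>{i<..n}. WW (transpose (Suc i) (om j)) ?u) = (\<Sum>j\<in>{i<..<n}. WW (transpose (Suc i) (Suc j)) ?u) + WW (transpose (Suc i) 1) ?u"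
 proof -
  have sp: "{i<..n} = insert n {i<..<n}" using i by auto
  have "(\<Sum>j\<in>{i<..<n}. WW (transpose (Suc i) (om j)) ?u) = (\<Sum>j\<in>{i<..<n}. WW (transpose (Suc i) (Suc j)) ?u)"
   by (rule sum.cong) (use i in \<open>auto simp: om_simps\<close>)
  thus ?thesis using i by (simp add: sp om_simps add.commute)
 qed
 also have "(\<Sum>j\<in>{i<..<n}. WW (transpose (Suc i) (Suc j)) ?u) = (\<Sum>j\<in>{Suc i<..n}. WW (transpose (Suc i) j) ?u)"
  by (rule sum.reindex_bij_witness[of _ "%j. j - 1" Suc]) auto
 finally have s: "(\<Sum>j\<in>{i<..n}. WW (transpose (Suc i) (om j)) ?u) =
  (\<Sum>j\<in>{Suc i<..n}. WW (transpose (Suc i) j) ?u) + WW (transpose (Suc i) 1) ?u" .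
 have R: "Phi (ZZ c i u) = XX 1 (YY c (Suc i) (XX (Suc i) ?u)) +
  sc c (XX 1 (\<Sum>j\<in>{Suc i<..n}. WW (transpose (Suc i) j) ?u)) + sc c (XX 1 (WW (transpose (Suc i) 1) ?u))"
  unfolding Phi_def ZZ_def lop_add[OF linear_WW] lop_sc[OF linear_WW] lop_sum[OF linear_WW]
   WW_YX[OF om_perm] WW_tr_conj[OF om_bij] om_simps(1)[OF i] s
  by (simp only: lop_add[OF linear_XX] lop_sc[OF linear_XX] sc_distribs add.assoc)
 have c1: "cc c (Suc i) 1 (XX (Suc i) ?u) = sc c (XX 1 (WW (transpose (Suc i) 1) ?u))"
  using in' i unfolding cc_def by (simp add: WW_XX)
 have c2: "(\<Sum>j\<in>{Suc i<..n}. WW (transpose (Suc i) j) (XX 1 ?u)) = XX 1 (\<Sum>j\<in>{Suc i<..n}. WW (transpose (Suc i) j) ?u)"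
  unfolding lop_sum[OF linear_XX] by (rule sum.cong) (use i in \<open>auto simp: WW_XX transpose_def\<close>)
 show ?thesis unfolding R unfolding Phi_def ZZ_def c2
  by (simp only: XX_commute[of "Suc i" 1] YY_XX c1 add.commute add.left_commute)
qed

lemma ZZ_Phi_1:
 assumes n: "1 \<le> n" shows "ZZ c 1 (Phi u) = Phi (ZZ c n u) + Phi u"
proof -
 let ?u = "WW om u"
 have sp: "Ix - {1} = {1<..n}" by auto
 have "cc c 1 1 (XX 1 ?u) = XX 1 ?u - sc c (\<Sum>l\<in>{1<..n}. WW (transpose 1 l) (XX 1 ?u))"
  unfolding cc_def sp using n by simp
 moreover have "Phi (ZZ c n u) = XX 1 (YY c 1 (XX 1 ?u))"
  unfolding Phi_def ZZ_def by (simp add: WW_lops WW_YX[OF om_perm] om_simps n)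
 ultimately show ?thesis unfolding Phi_def ZZ_def by (simp add: YY_XX)
qed

lemma BB_ZZ:
 assumes c: "cnj c = c" and i: "i \<in> Ix" and f: "f \<in> NC"
 shows "BB c (ZZ c i f) g = BB c f (ZZ c i g)"
proof -
 have "(\<Sum>j\<in>{i<..n}. BB c (WW (transpose i j) f) g) = (\<Sum>j\<in>{i<..n}. BB c f (WW (transpose i j) g))"
  by (rule sum.cong) (use i in \<open>auto intro!: BB_tr\<close>)
 thus ?thesis unfolding ZZ_def
  by (simp add: BB_simps BB_sum_left BB_sum_right BB_XX[OF i] BB_YY[OF c i XX_NC[OF i f]] c)
qed

text \<open>The adjoint of x_1 is y_1, and conjugating y_1 x_1 with the cycle gives y_n x_n, which is ZZ n since there are no j >
 n.\<close>

lemma BB_Phi: "1 \<le> n ==> BB c (Phi f) (Phi g) = BB c f (ZZ c n g)"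
proof -
 assume n: "1 \<le> n"
 have "BB c (Phi f) (Phi g) = BB c (WW om f) (WW om (YY c n (XX n g)))"
  unfolding Phi_def using n by (simp add: BB_XX WW_YX[OF om_perm] om_simps)
 thus ?thesis by (simp add: BB_WW[OF om_perm] ZZ_def)
qed

lemma Phi_NM: "1 \<le> n ==> f \<in> NM m ==> Phi f \<in> NM (Suc m)"
 unfolding Phi_def by (intro XX_NM WW_NM om_perm) auto

lemma ZZ_NM: "i \<in> Ix ==> f \<in> NM m ==> ZZ c i f \<in> NM m"
 unfolding ZZ_def by (intro NM_closed YY_NM XX_NM WW_NM tr_perm) auto

subsection \<open>The sorting permutation of an exponent\<close>

text \<open>The position of i after sorting; its inverse so is the permutation \<sigma> of the triples in the theorem.\<close>

definition rk :: "(nat => nat) => nat => nat" where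
 "rk \<alpha> i = (if i \<in> Ix then card {j \<in> Ix. \<alpha> j < \<alpha> i \<or> \<alpha> j = \<alpha> i & j \<le> i} else i)"
definition so :: "(nat => nat) => nat => nat" where "so \<alpha> = pinv (rk \<alpha>)"

lemma rk_less: "i \<in> Ix ==> j \<in> Ix ==> blw \<alpha> i j ==> rk \<alpha> i < rk \<alpha> j"
 unfolding rk_def
 by (simp, rule psubset_card_mono) (auto simp: blw_def)

lemma blw_total: "i ~= j ==> blw \<alpha> i j \<or> blw \<alpha> j i" by (auto simp: blw_def)

lemma rk_less_iff: "i \<in> Ix ==> j \<in> Ix ==> rk \<alpha> i < rk \<alpha> j \<longleftrightarrow> blw \<alpha> i j"
 using rk_less[of i j \<alpha>] rk_less[of j i \<alpha>] blw_total[of i j \<alpha>] by force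

lemma rk_perm: "rk \<alpha> permutes Ix"
proof (rule bij_imp_permutes)
 have "inj_on (rk \<alpha>) Ix"
 proof (rule inj_onI, rule ccontr)
  fix i j assume a: "i \<in> Ix" "j \<in> Ix" "rk \<alpha> i = rk \<alpha> j" "i ~= j"
  thus False using blw_total[of i j \<alpha>] rk_less[of i j \<alpha>] rk_less[of j i \<alpha>] by auto
 qed
 moreover have "rk \<alpha> ` Ix \<subseteq> Ix"
 proof (rule image_subsetI)
  fix i assume i: "i \<in> Ix"
  let ?S = "{j \<in> Ix. \<alpha> j < \<alpha> i \<or> \<alpha> j = \<alpha> i & j \<le> i}"
  have "card ?S \<le> card Ix" by (rule card_mono) auto
  moreover have "0 < card ?S" using i by (subst card_gt_0_iff) auto
  ultimately show "rk \<alpha> i \<in> Ix" using i by (simp add: rk_def)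
 qed
 ultimately show "bij_betw (rk \<alpha>) Ix Ix"
  by (simp add: bij_betw_def endo_inj_surj)
qed (simp only: rk_def if_False)

lemma so_perm: "so \<alpha> permutes Ix" unfolding so_def by (rule permutes_inv[OF rk_perm])
lemma rk_so [simp]: "rk \<alpha> (so \<alpha> s) = s" "so \<alpha> (rk \<alpha> s) = s"
 unfolding so_def using permutes_inverses[OF rk_perm] by auto
lemma so_in: "s \<in> Ix ==> so \<alpha> s \<in> Ix" by (simp only: permutes_in_image[OF so_perm])
lemma rk_in: "s \<in> Ix ==> rk \<alpha> s \<in> Ix" by (simp only: permutes_in_image[OF rk_perm])
lemma pinv_so: "pinv (so \<alpha>) = rk \<alpha>" unfolding so_def by (rule permutes_inv_inv[OF rk_perm])

lemma blw_so: "s \<in> Ix ==> t \<in> Ix ==> s < t ==> blw \<alpha> (so \<alpha> s) (so \<alpha> t)"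
 using rk_less_iff[OF so_in so_in, of s t \<alpha> \<alpha> \<alpha>] by simp

lemma so_unique:
 assumes p: "\<sigma> permutes Ix" and b: "\<And>s t. s \<in> Ix ==> t \<in> Ix ==> s < t ==> blw \<alpha> (\<sigma> s) (\<sigma> t)"
 shows "so \<alpha> = \<sigma>"
proof -
 have pin: "\<And>s. \<sigma> s \<in> Ix \<longleftrightarrow> s \<in> Ix" by (rule permutes_in_image[OF p])
 have r: "rk \<alpha> (\<sigma> t) = t" for t
 proof (cases "t \<in> Ix")
  case True
  have "{j \<in> Ix. \<alpha> j < \<alpha> (\<sigma> t) \<or> \<alpha> j = \<alpha> (\<sigma> t) & j \<le> \<sigma> t} = \<sigma> ` {1..t}"
  proof (intro equalityI subsetI)
   fix j assume j: "j \<in> {j \<in> Ix. \<alpha> j < \<alpha> (\<sigma> t) \<or> \<alpha> j = \<alpha> (\<sigma> t) & j \<le> \<sigma> t}"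
   then obtain s where s: "s \<in> Ix" "j = \<sigma> s" using permutes_image[OF p] by (metis (no_types, lifting) imageE mem_Collect_eq)
   have "\<not> t < s" using b[OF True s(1)] j s(2) by (auto simp: blw_def)
   thus "j \<in> \<sigma> ` {1..t}" using s by auto
  next
   fix j assume "j \<in> \<sigma> ` {1..t}"
   then obtain s where s: "s \<in> {1..t}" "j = \<sigma> s" by blast
   have sn: "s \<in> Ix" using s True by simp
   hence "j \<in> Ix" using pin s by simp
   moreover have "s = t \<or> blw \<alpha> (\<sigma> s) (\<sigma> t)" using b[OF sn True] s by fastforce
   ultimately show "j \<in> {j \<in> Ix. \<alpha> j < \<alpha> (\<sigma> t) \<or> \<alpha> j = \<alpha> (\<sigma> t) & j \<le> \<sigma> t}"
    using s by (auto simp: blw_def)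
  qed
  hence "rk \<alpha> (\<sigma> t) = card (\<sigma> ` {1..t})" using True pin[of t] unfolding rk_def by simp
  also have "... = t" by (subst card_image) (auto intro: inj_on_subset[OF permutes_inj[OF p]])
  finally show ?thesis .
 next
  case False
  thus ?thesis using permutes_not_in[OF p False] by (simp only: rk_def if_False)
 qed
 have "so \<alpha> t = \<sigma> t" for t using rk_so(2)[of \<alpha> "\<sigma> t"] r[of t] by simp
 thus ?thesis by auto
qed

lemma so_zf: "so zf = id"
 by (rule so_unique) (auto simp: blw_def permutes_id)

text \<open>The effect of Phi on exponents.\<close>

definition sh :: "(nat => nat) => (nat => nat)" where "sh \<alpha> = up 1 (\<alpha> o pinv om)"

lemma sh_om: "i \<in> Ix ==> sh \<alpha> (om i) = (if i = n then Suc (\<alpha> i) else \<alpha> i)"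
proof -
 assume i: "i \<in> Ix"
 have "om i = 1 \<longleftrightarrow> i = n" using i by (auto simp: om_def)
 thus ?thesis by (simp add: sh_def up_def permutes_inverses[OF om_perm])
   (metis permutes_inverses(2)[OF om_perm])
qed

lemma blw_sh: "i \<in> Ix ==> j \<in> Ix ==> blw \<alpha> i j ==> blw (sh \<alpha>) (om i) (om j)"
 unfolding blw_def by (simp only: sh_om) (auto simp: om_def split: if_splits)

lemma so_sh: "so (sh \<alpha>) = om o so \<alpha>"
 by (rule so_unique) (auto intro: permutes_compose[OF so_perm om_perm] simp only: o_apply blw_sh so_in blw_so)

lemma blw_sw: "\<alpha> i ~= \<alpha> (Suc i) ==> blw \<alpha> j k ==> blw (\<alpha> o sw i) (sw i j) (sw i k)"
 unfolding blw_def by (auto simp: transpose_def)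

lemma so_sw: "1 \<le> i ==> i < n ==> \<alpha> i ~= \<alpha> (Suc i) ==> so (\<alpha> o sw i) = sw i o so \<alpha>"
proof -
 assume i: "1 \<le> i" "i < n" and ne: "\<alpha> i ~= \<alpha> (Suc i)"
 have p: "sw i o so \<alpha> permutes Ix"
  by (rule permutes_compose[OF so_perm tr_perm]) (use i in auto)
 show ?thesis
  by (rule so_unique[OF p]) (simp only: o_apply[of "sw i" "so \<alpha>"] blw_sw[OF ne blw_so])
qed

lemma rk_sh: "rk (sh \<alpha>) (om i) = rk \<alpha> i"
 using rk_so(1)[of "sh \<alpha>" "rk \<alpha> i"] by (simp add: so_sh)
lemma rk_sw: "1 \<le> i ==> i < n ==> \<alpha> i ~= \<alpha> (Suc i) ==> rk (\<alpha> o sw i) (sw i j) = rk \<alpha> j"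
 using rk_so(1)[of "\<alpha> o sw i" "rk \<alpha> j"] by (simp add: so_sw)

end

lemma sum_upd2:
 fixes F :: "nat => nat => nat"
 assumes "finite S" "i \<in> S" "j \<in> S" "i ~= j"
 shows "(\<Sum>k\<in>S. F k ((\<gamma>(i := x, j := y)) k)) + (F i (\<gamma> i) + F j (\<gamma> j)) = (\<Sum>k\<in>S. F k (\<gamma> k)) + (F i x + F j y)"
proof -
 have sp: "(\<Sum>k\<in>S. g k) = g i + (g j + (\<Sum>k\<in>S - {i} - {j}. g k))" for g :: "nat => nat"
  using assms by (subst sum.remove[of S i], simp_all, subst sum.remove[of "S - {i}" j]) auto
 have "(\<Sum>k\<in>S - {i} - {j}. F k ((\<gamma>(i := x, j := y)) k)) = (\<Sum>k\<in>S - {i} - {j}. F k (\<gamma> k))"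
  by (rule sum.cong) auto
 thus ?thesis using assms(4) by (simp add: sp)
qed

context young
begin

subsection \<open>Triangularity\<close>

text \<open>A monomial other than x^\<gamma> that occurs in ZZ x^\<gamma> either has two entries moved closer together, which
 lowers the sum of squares, or two entries exchanged, which is measured by the second sum.\<close>

definition klt :: "(nat => nat) => (nat => nat) => bool" where
 "klt \<beta> \<gamma> \<longleftrightarrow> (\<Sum>k\<in>Ix. \<beta> k * \<beta> k) < (\<Sum>k\<in>Ix. \<gamma> k * \<gamma> k) \<or>
  (\<Sum>k\<in>Ix. \<beta> k * \<beta> k) = (\<Sum>k\<in>Ix. \<gamma> k * \<gamma> k) & (\<Sum>k\<in>Ix. k * \<beta> k) < (\<Sum>k\<in>Ix. k * \<gamma> k)"

lemma klt_irrefl: "\<not> klt \<beta> \<beta>" by (simp add: klt_def)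
lemma klt_trans: "klt \<alpha> \<beta> ==> klt \<beta> \<gamma> ==> klt \<alpha> \<gamma>" by (auto simp: klt_def)

lemma klt_swap:
 assumes "i \<in> Ix" "j \<in> Ix" "i < j" "\<gamma> i < \<gamma> j"
 shows "klt (\<gamma> o transpose i j) \<gamma>"
proof -
 have "(\<Sum>k\<in>Ix. (\<gamma> o transpose i j) k * (\<gamma> o transpose i j) k) = (\<Sum>k\<in>Ix. \<gamma> k * \<gamma> k)"
  using sum.permute[OF tr_perm[OF assms(1,2)], of "%k. \<gamma> k * \<gamma> k"] by (simp add: o_def)
 moreover have "(\<Sum>k\<in>Ix. k * (\<gamma> o transpose i j) k) + (i * \<gamma> i + j * \<gamma> j) = (\<Sum>k\<in>Ix. k * \<gamma> k) + (i * \<gamma> j + j * \<gamma> i)"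
  unfolding comp_tr using sum_upd2[of "Ix" i j "%k a. k * a" \<gamma> "\<gamma> j" "\<gamma> i"] assms by simp
 moreover have "i * \<gamma> j + j * \<gamma> i < i * \<gamma> i + j * \<gamma> j"
 proof -
  obtain d where d: "j = i + Suc d" using assms(3) less_iff_Suc_add[of i j] by auto
  obtain e where e: "\<gamma> j = \<gamma> i + Suc e" using assms(4) less_iff_Suc_add[of "\<gamma> i" "\<gamma> j"] by auto
  show ?thesis unfolding e unfolding d by (simp add: algebra_simps)
 qed
 ultimately show ?thesis unfolding klt_def by linarith
qed

lemma klt_interior:
 assumes "i \<in> Ix" "j \<in> Ix" "i ~= j" "min (\<gamma> i) (\<gamma> j) < q" "q < max (\<gamma> i) (\<gamma> j)"
 shows "klt (\<gamma>(i := \<gamma> i + \<gamma> j - q, j := q)) \<gamma>"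
proof -
 let ?x = "\<gamma> i + \<gamma> j - q"
 have "?x * ?x + q * q < \<gamma> i * \<gamma> i + \<gamma> j * \<gamma> j"
 proof -
  have m: "a + 0 < q ==> q < b ==> (a + b - q) * (a + b - q) + q * q < a * a + b * b" for a b :: nat
  proof -
   assume a: "a + 0 < q" "q < b"
   obtain d where d: "q = a + Suc d" using a less_imp_Suc_add by force
   obtain e where e: "b = q + Suc e" using a less_imp_Suc_add by force
   have x: "a + b - q = a + Suc e" using d e by simp
   show ?thesis unfolding x unfolding e d by (simp add: algebra_simps)
  qed
  show ?thesis
  proof (cases "\<gamma> i < \<gamma> j")
   case True thus ?thesis using m[of "\<gamma> i" "\<gamma> j"] assms by simp
  next
   case False thus ?thesis using m[of "\<gamma> j" "\<gamma> i"] assms by (simp add: add.commute)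
  qed
 qed
 thus ?thesis unfolding klt_def
  using sum_upd2[OF finite_atLeastAtMost assms(1-3), of "%k a. a * a" \<gamma> ?x q] by linarith
qed

lemma sl_isum: "sl \<beta> (isum g b a) = isum (%q. sl \<beta> (g q)) b a" by (rule lop_isum) simp

text \<open>Of the divided difference of x_i x^\<gamma> only the two extreme terms, x^\<gamma> and its image under s_ij, can fail
 to be lower than x^\<gamma>. The image is lower too unless it is cancelled by the transposition in ZZ, which is
 present for i < j.\<close>

lemma sl_DD:
 assumes ij: "i \<in> Ix" "j \<in> Ix" "i ~= j" and b: "\<not> klt \<beta> \<gamma>"
 shows "sl \<beta> (DD i j (up i \<gamma>) w) - (if i < j then sl \<beta> (xv (\<gamma> o transpose i j) w) else 0) =
  (if \<beta> = \<gamma> & blw \<gamma> j i then w else 0)"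
proof -
 define e where "e q = \<gamma>(i := \<gamma> i + \<gamma> j - q, j := q)" for q
 have E: "ex2 i j (up i \<gamma>) q = e q" for q using ij by (auto simp: ex2_def up_def e_def fun_eq_iff)
 have D: "sl \<beta> (DD i j (up i \<gamma>) w) = isum (%q. if e q = \<beta> then w else 0) (\<gamma> j) (Suc (\<gamma> i))"
  using ij unfolding DD_def sl_isum sl_xv E by (simp add: up_def)
 have int: "e q ~= \<beta>" if "min (\<gamma> i) (\<gamma> j) < q" "q < max (\<gamma> i) (\<gamma> j)" for q
  using klt_interior[OF ij that] b by (auto simp: e_def)
 have eb: "e (\<gamma> j) = \<gamma>" by (auto simp: e_def fun_eq_iff)
 have ea: "e (\<gamma> i) = \<gamma> o transpose i j" by (simp add: e_def comp_tr)
 consider "\<gamma> i = \<gamma> j" | "\<gamma> j < \<gamma> i" | "\<gamma> i < \<gamma> j" by linarith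
 thus ?thesis
 proof cases
  case 1
  have "\<gamma> o transpose i j = \<gamma>" using 1 by (auto simp: comp_tr fun_eq_iff)
  thus ?thesis using 1 ij eb unfolding D by (auto simp: isum_def sl_xv blw_def)
 next
  case 2
  have "(\<Sum>q\<in>{\<gamma> j..<Suc (\<gamma> i)}. if e q = \<beta> then w else 0) = (\<Sum>q\<in>{\<gamma> j, \<gamma> i}. if e q = \<beta> then w else 0)"
  proof (rule sum.mono_neutral_right)
   show "\<forall>q\<in>{\<gamma> j..<Suc (\<gamma> i)} - {\<gamma> j, \<gamma> i}. (if e q = \<beta> then w else 0) = 0"
   proof
    fix q assume "q \<in> {\<gamma> j..<Suc (\<gamma> i)} - {\<gamma> j, \<gamma> i}"
    thus "(if e q = \<beta> then w else 0) = 0" using int[of q] 2 by auto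
   qed
  qed (use 2 in auto)
  hence D2: "sl \<beta> (DD i j (up i \<gamma>) w) = (if \<gamma> = \<beta> then w else 0) + (if \<gamma> o transpose i j = \<beta> then w else 0)"
   using 2 unfolding D by (simp add: isum_def eb ea)
  show ?thesis
  proof (cases "i < j")
   case True thus ?thesis unfolding D2 using 2 by (auto simp: sl_xv blw_def)
  next
   case False
   hence "klt (\<gamma> o transpose i j) \<gamma>"
    using klt_swap[of j i \<gamma>] ij 2 by (simp add: transpose_commute[of j i])
   hence "\<gamma> o transpose i j ~= \<beta>" using b by auto
   thus ?thesis unfolding D2 using 2 False by (auto simp: blw_def)
  qed
 next
  case 3
  have z: "(\<Sum>q\<in>{Suc (\<gamma> i)..<\<gamma> j}. if e q = \<beta> then w else 0) = 0"
  proof (rule sum.neutral, rule ballI)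
   fix q assume "q \<in> {Suc (\<gamma> i)..<\<gamma> j}"
   thus "(if e q = \<beta> then w else 0) = 0" using int[of q] 3 by auto
  qed
  have D3: "sl \<beta> (DD i j (up i \<gamma>) w) = 0" using 3 unfolding D by (simp add: isum_def z)
  show ?thesis
  proof (cases "i < j")
   case True
   hence "klt (\<gamma> o transpose i j) \<gamma>" using klt_swap[OF ij(1,2) _ 3] by simp
   hence "\<gamma> o transpose i j ~= \<beta>" using b by auto
   thus ?thesis unfolding D3 using 3 by (auto simp: sl_xv blw_def)
  next
   case False thus ?thesis unfolding D3 using 3 by (auto simp: blw_def)
  qed
 qed
qed

text \<open>The diagonal part of ZZ. Conjugated with the sorting permutation, the transpositions with the indices below i become a
 Jucys-Murphy element (dg_so).\<close>

definition dg :: "complex => (nat => nat) => nat => gv => gv" where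
 "dg c \<beta> i v = sc (of_nat (\<beta> i) + 1) v - sc c (\<Sum>j\<in>{j\<in>Ix. blw \<beta> j i}. perm_act (transpose i j) v)"

lemma sl_ZZ_xv:
 assumes i: "i \<in> Ix" and b: "\<not> klt \<beta> \<gamma>"
 shows "sl \<beta> (ZZ c i (xv \<gamma> v)) = (if \<beta> = \<gamma> then dg c \<gamma> i v else 0)"
proof -
 let ?p = "%j. perm_act (transpose i j) v"
 have sp: "(\<Sum>j\<in>{i<..n}. sl \<beta> (WW (transpose i j) (xv \<gamma> v))) =
  (\<Sum>j\<in>Ix - {i}. if i < j then sl \<beta> (xv (\<gamma> o transpose i j) (?p j)) else 0)"
  by (rule sum.mono_neutral_cong_left) (use i in \<open>auto simp: WW_xv\<close>)
 have "sl \<beta> (ZZ c i (xv \<gamma> v)) = (if \<gamma> = \<beta> then sc (of_nat (\<gamma> i) + 1) v else 0)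
  - sc c (\<Sum>j\<in>Ix - {i}. sl \<beta> (DD i j (up i \<gamma>) (?p j)) - (if i < j then sl \<beta> (xv (\<gamma> o transpose i j) (?p j)) else 0))"
 proof -
  have u1: "(up i \<gamma>)(i := Suc (\<gamma> i) - 1) = \<gamma>" by (auto simp: up_def)
  have u2: "up i \<gamma> i = Suc (\<gamma> i)" by (simp add: up_def)
  show ?thesis unfolding ZZ_def XX_xv YY_xv[OF i] lops[OF linear_sl] sp sum_subtractf fv.scale_right_diff_distrib u2 u1
   by (simp add: sl_xv add.commute)
 qed
 also have "(\<Sum>j\<in>Ix - {i}. sl \<beta> (DD i j (up i \<gamma>) (?p j)) - (if i < j then sl \<beta> (xv (\<gamma> o transpose i j) (?p j)) else 0)) =
   (\<Sum>j\<in>Ix - {i}. if \<beta> = \<gamma> & blw \<gamma> j i then ?p j else 0)"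
  by (rule sum.cong[OF refl], rule sl_DD) (use i b in auto)
 also have "... = (if \<beta> = \<gamma> then \<Sum>j\<in>{j\<in>Ix. blw \<gamma> j i}. ?p j else 0)"
 proof (cases "\<beta> = \<gamma>")
  case True
  thus ?thesis by simp (rule sum.mono_neutral_cong_right, auto simp: blw_def)
 qed simp
 finally show ?thesis by (auto simp: dg_def)
qed

text \<open>The eigenvalue of ZZ i on the weight vector indexed by \<alpha> and T.\<close>

definition zr :: "real => (nat => nat) => tableau => nat => real" where
 "zr c \<alpha> T i = real (\<alpha> i) + 1 - c * of_int (ct T (rk \<alpha> i))"

lemma dg_so: "i \<in> Ix ==> dg c \<beta> i (perm_act (so \<beta>) v) =
 perm_act (so \<beta>) (sc (of_nat (\<beta> i) + 1) v - sc c (jm (rk \<beta> i) v))"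
proof -
 assume i: "i \<in> Ix"
 have b: "bij (so \<beta>)" by (rule permutes_bij[OF so_perm])
 have t: "perm_act (so \<beta>) (perm_act (transpose s t) v) = perm_act (transpose (so \<beta> s) (so \<beta> t)) (perm_act (so \<beta>) v)" for s t
  by (simp only: perm_act_comp comp_transpose[OF bij_is_inj[OF b]])
 have "perm_act (so \<beta>) (jm (rk \<beta> i) v) = (\<Sum>s\<in>{1..<rk \<beta> i}. perm_act (transpose (so \<beta> s) i) (perm_act (so \<beta>) v))"
  by (simp add: jm_def perm_act_lops t)
 also have "... = (\<Sum>j\<in>{j\<in>Ix. blw \<beta> j i}. perm_act (transpose i j) (perm_act (so \<beta>) v))"
 proof (rule sum.reindex_bij_witness[of _ "rk \<beta>" "so \<beta>"])
  fix s assume s: "s \<in> {1..<rk \<beta> i}"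
  hence "s \<in> Ix" using rk_in[OF i, of \<beta>] by auto
  thus "so \<beta> s \<in> {j \<in> Ix. blw \<beta> j i}"
   using so_in[of s \<beta>] rk_less_iff[OF so_in i, of s \<beta> \<beta>] s by auto
 next
  fix j assume "j \<in> {j \<in> Ix. blw \<beta> j i}"
  thus "rk \<beta> j \<in> {1..<rk \<beta> i}" using rk_in[of j \<beta>] rk_less_iff[OF _ i, of j \<beta>] by auto
 qed (simp_all add: transpose_commute[of i])
 finally show ?thesis by (simp add: dg_def perm_act_lops)
qed

lemma dg_yv:
 assumes T: "T \<in> SYT" and i: "i \<in> Ix"
 shows "dg (of_real c) \<beta> i (perm_act (so \<beta>) (yv T)) = sc (of_real (zr c \<beta> T i)) (perm_act (so \<beta>) (yv T))"
proof -
 have "jm (rk \<beta> i) (yv T) = sc (of_int (ct T (rk \<beta> i))) (yv T)"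
  using yv[OF T] rk_in[OF i, of \<beta>] by (simp add: ewt_def)
 thus ?thesis by (simp add: dg_so[OF i] perm_act_lops zr_def sc_distribs)
qed

lemma dg_ip: "i \<in> Ix ==> ip (dg (of_real c) \<beta> i u) v = ip u (dg (of_real c) \<beta> i v)"
 by (simp add: dg_def ip_simps ip_sum_left ip_sum_right ip_transpose)

definition pv :: "(nat => nat) => tableau => gv" where "pv \<beta> T = perm_act (so \<beta>) (yv T)"
text \<open>Up to the norm of yv T, the coefficient of x^\<beta> pv \<beta> T in f; the vectors pv \<beta> T form an orthogonal
 basis of VV.\<close>

definition coef :: "(nat => nat) => tableau => mv => complex" where
 "coef \<beta> T f = ip (sl \<beta> f) (pv \<beta> T)"

lemma coef_simps: "coef \<beta> T (f + g) = coef \<beta> T f + coef \<beta> T g" "coef \<beta> T (f - g) = coef \<beta> T f - coef \<beta> T g"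
 "coef \<beta> T (sc a f) = a * coef \<beta> T f" "coef \<beta> T 0 = 0"
 "coef \<beta> T (\<Sum>i\<in>A. F i) = (\<Sum>i\<in>A. coef \<beta> T (F i))"
 by (simp_all add: coef_def sl_lops ip_simps ip_sum_left)

text \<open>On the exponents that are maximal in f only the diagonal part of ZZ contributes.\<close>

lemma coef_ZZ:
 assumes i: "i \<in> Ix" and T: "T \<in> SYT" and b: "\<And>\<gamma>. klt \<beta> \<gamma> ==> sl \<gamma> f = 0"
 shows "coef \<beta> T (ZZ (of_real c) i f) = of_real (zr c \<beta> T i) * coef \<beta> T f"
proof -
 have "sl \<beta> (ZZ (of_real c) i f) = (\<Sum>\<gamma>\<in>fst ` ks f. sl \<beta> (ZZ (of_real c) i (xv \<gamma> (sl \<gamma> f))))"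
  by (subst mv_expand[of f]) (simp only: ZZ_lops sl_lops)
 also have "... = (\<Sum>\<gamma>\<in>fst ` ks f. if \<beta> = \<gamma> then dg (of_real c) \<beta> i (sl \<beta> f) else 0)"
 proof (rule sum.cong[OF refl])
  fix \<gamma>
  show "sl \<beta> (ZZ (of_real c) i (xv \<gamma> (sl \<gamma> f))) = (if \<beta> = \<gamma> then dg (of_real c) \<beta> i (sl \<beta> f) else 0)"
  proof (cases "klt \<beta> \<gamma>")
   case True
   hence "sl \<gamma> f = 0" "\<beta> ~= \<gamma>" using b klt_irrefl by auto
   thus ?thesis by (simp add: xv_lops ZZ_lops sl_lops)
  next
   case False thus ?thesis using sl_ZZ_xv[OF i False] by simp
  qed
 qed
 also have "... = dg (of_real c) \<beta> i (sl \<beta> f)"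
 proof (cases "\<beta> \<in> fst ` ks f")
  case False
  hence "(\<beta>, p) \<notin> ks f" for p by force
  hence "sl \<beta> f = 0" by (intro poly_mapping_eqI) (simp add: lk_sl in_keys_iff)
  thus ?thesis using False by (simp add: dg_def perm_act_lops)
 qed simp
 finally show ?thesis
  by (simp only: coef_def dg_ip[OF i] pv_def dg_yv[OF T i] ip_sc_right complex_cnj_complex_of_real)
qed

lemma VV_coef_zero:
 assumes "v \<in> VV" "\<And>T. T \<in> SYT ==> ip v (pv \<beta> T) = 0" shows "v = 0"
proof -
 let ?w = "perm_act (rk \<beta>) v"
 have "ip (perm_act (so \<beta>) ?w) (perm_act (so \<beta>) (yv T)) = ip ?w (yv T)" for T
  by (rule ip_perm_act[OF permutes_inj[OF so_perm]])
 moreover have so_rk: "so \<beta> o rk \<beta> = id" by (auto simp: fun_eq_iff)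
 moreover have "perm_act (so \<beta>) ?w = v" by (simp add: perm_act_comp so_rk)
 ultimately have "ip ?w (yv T) = 0" if "T \<in> SYT" for T using assms(2)[OF that] by (simp add: pv_def)
 hence o: "ip ?w y = 0" if "y \<in> yv ` SYT" for y using that by auto
 have "ip ?w x = 0" if "x \<in> fv.span (yv ` SYT)" for x
  using that by (induction rule: fv.span_induct_alt) (auto simp: ip_simps o)
 moreover have "?w \<in> VV" by (rule VV_perm_act[OF assms(1) rk_perm])
 ultimately have "?w = 0" using VV_span ip_self_zero by metis
 thus ?thesis using \<open>perm_act (so \<beta>) ?w = v\<close> by (simp add: perm_act_lops)
qed

end

lemma prod_one_factor:
 assumes "finite A" "a \<in> A" "f a = g a * k" "\<And>x. x \<in> A ==> x ~= a ==> f x = g x"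
 shows "(\<Prod>x\<in>A. f x) = (\<Prod>x\<in>A. g x) * (k :: real)"
proof -
 have "(\<Prod>x\<in>A - {a}. f x) = (\<Prod>x\<in>A - {a}. g x)" by (rule prod.cong) (use assms in auto)
 thus ?thesis using assms(3) by (simp add: prod.remove[OF assms(1,2)])
qed

context young
begin

section \<open>Weight vectors at generic parameters\<close>

text \<open>The parameters with c k not an integer for 0 < |k| \<le> n. Contents have absolute value below n, so all differences
 of contents, and these shifted by 1, are covered.\<close>

definition gen :: "real => bool" where "gen c \<longleftrightarrow> (\<forall>k::int. k ~= 0 & \<bar>k\<bar> \<le> int n --> c * of_int k \<notin> \<int>)"

lemma gen_nonzero: "gen c ==> \<bar>k\<bar> \<le> int n ==> l ~= 0 ==> of_int l - c * of_int k ~= 0"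
 unfolding gen_def by (cases "k = 0") (auto, metis Ints_of_int)

lemma ct_le: "T \<in> SYT ==> k \<in> Ix ==> \<bar>ct T k\<bar> \<le> int n" using ct_bound(2)[of T k k] by auto
lemma ct_diff_le: "T \<in> SYT ==> k \<in> Ix ==> l \<in> Ix ==> \<bar>ct T k - ct T l\<bar> + 1 \<le> int n"
 using ct_bound(1)[of T k l] by auto

lemma bo_content_bound:
 assumes "T \<in> SYT" "T' \<in> SYT" "k \<in> Ix" "l \<in> Ix"
 shows "\<bar>ct T k - ct T' l\<bar> + 1 \<le> int n"
proof -
 have "bo T k \<in> Bx" using bo[OF assms(1,3)] by blast
 hence m: "T' (bo T k) \<in> Ix" "bo T' (T' (bo T k)) = bo T k" using T_in[OF assms(2)] bo_T[OF assms(2)] by auto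
 hence "ct T' (T' (bo T k)) = ct T k" by (simp add: box_content_def)
 thus ?thesis using ct_diff_le[OF assms(2) m(1) assms(4)] by simp
qed

text \<open>Equal eigenvalues at i differ by an integer and by c times a difference of contents of absolute value below n; for
 such c the contents, and then the exponents, agree. The contents determine T.\<close>

lemma zr_inj:
 assumes g: "gen c" and a: "\<alpha> \<in> comps" "\<beta> \<in> comps" and T: "T \<in> SYT" "T' \<in> SYT"
  and e: "\<And>i. i \<in> Ix ==> zr c \<alpha> T i = zr c \<beta> T' i"
 shows "\<alpha> = \<beta> & T = T'"
proof -
 have main: "\<alpha> i = \<beta> i & ct T (rk \<alpha> i) = ct T' (rk \<beta> i)" if i: "i \<in> Ix" for i
 proof -
  let ?d = "ct T (rk \<alpha> i) - ct T' (rk \<beta> i)"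
  have eq: "c * of_int ?d = of_int (int (\<alpha> i) - int (\<beta> i))"
   using e[OF i] by (simp add: zr_def algebra_simps)
  have "\<bar>?d\<bar> \<le> int n" using bo_content_bound[OF T rk_in[OF i] rk_in[OF i], of \<alpha> \<beta>] by simp
  moreover have "c * of_int ?d \<in> \<int>" unfolding eq by (rule Ints_of_int)
  ultimately have "?d = 0" using g unfolding gen_def by blast
  thus ?thesis using eq by simp
 qed
 have ab: "\<alpha> = \<beta>"
 proof
  fix i show "\<alpha> i = \<beta> i" using main[of i] a by (cases "i \<in> Ix") (auto simp: comps_def)
 qed
 have "ct T s = ct T' s" if s: "s \<in> Ix" for s
  using main[OF so_in[OF s, of \<alpha>]] ab by simp
 thus ?thesis using ab ct_inj[OF T] by blast
qed

definition isw :: "real => (nat => nat) => tableau => mv => bool" where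
 "isw c \<alpha> T f \<longleftrightarrow> (\<exists>m. \<alpha> \<in> cm m & f \<in> NM m) &
  (\<forall>i\<in>Ix. ZZ (of_real c) i f = sc (of_real (zr c \<alpha> T i)) f)"

lemma isw_NC: "isw c \<alpha> T f ==> f \<in> NC" using NM_NC by (auto simp: isw_def)
lemma isw_comps: "isw c \<alpha> T f ==> \<alpha> \<in> comps" using cm_comps by (auto simp: isw_def)

lemma isw_orth:
 assumes g: "gen c" and T: "T \<in> SYT" "T' \<in> SYT" and f: "isw c \<alpha> T f" and h: "isw c \<beta> T' h"
  and ne: "(\<alpha>, T) ~= (\<beta>, T')"
 shows "BB (of_real c) f h = 0"
proof -
 obtain i where i: "i \<in> Ix" "zr c \<alpha> T i ~= zr c \<beta> T' i"
  using zr_inj[OF g isw_comps[OF f] isw_comps[OF h] T] ne by blast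
 have "BB (of_real c) (ZZ (of_real c) i f) h = BB (of_real c) f (ZZ (of_real c) i h)"
  by (rule BB_ZZ[OF _ i(1) isw_NC[OF f]]) simp
 hence "of_real (zr c \<alpha> T i) * BB (of_real c) f h = of_real (zr c \<beta> T' i) * BB (of_real c) f h"
  using f h i(1) by (simp add: isw_def BB_simps)
 thus ?thesis using i(2) by simp
qed

text \<open>A maximal exponent of a weight vector carries the eigenvalue of the diagonal part, so it has to be the index of the
 vector. This bounds the support of weight vectors (isw_support).\<close>

lemma top_coef:
 assumes g: "gen c" and T: "T \<in> SYT" "T' \<in> SYT" and f: "isw c \<alpha> T f" and b: "\<beta> \<in> comps"
  and top: "\<And>\<gamma>. klt \<beta> \<gamma> ==> sl \<gamma> f = 0" and nz: "coef \<beta> T' f ~= 0"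
 shows "\<beta> = \<alpha> & T' = T"
proof (rule zr_inj[OF g b isw_comps[OF f] T(2,1)])
 fix i assume i: "i \<in> Ix"
 have "coef \<beta> T' (ZZ (of_real c) i f) = of_real (zr c \<beta> T' i) * coef \<beta> T' f"
  by (rule coef_ZZ[OF i T(2) top])
 moreover have "ZZ (of_real c) i f = sc (of_real (zr c \<alpha> T i)) f" using f i by (simp add: isw_def)
 ultimately show "zr c \<beta> T' i = zr c \<alpha> T i" using nz by (simp add: coef_simps)
qed

lemma sl_ks: "sl \<beta> f ~= 0 ==> \<beta> \<in> fst ` ks f"
proof (rule ccontr)
 assume a: "sl \<beta> f ~= 0" "\<beta> \<notin> fst ` ks f"
 hence "(\<beta>, p) \<notin> ks f" for p by force
 hence "sl \<beta> f = 0" by (intro poly_mapping_eqI) (simp add: lk_sl in_keys_iff)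
 thus False using a by simp
qed

lemma exists_top:
 assumes "sl \<beta> f ~= 0"
 shows "\<exists>\<gamma>. sl \<gamma> f ~= 0 & (\<gamma> = \<beta> \<or> klt \<beta> \<gamma>) & (\<forall>\<delta>. klt \<gamma> \<delta> --> sl \<delta> f = 0)"
proof -
 let ?A = "{\<gamma>. sl \<gamma> f ~= 0 & (\<gamma> = \<beta> \<or> klt \<beta> \<gamma>)}"
 have "finite ?A" by (rule finite_subset[of _ "fst ` ks f"]) (use sl_ks in auto)
 moreover have "?A ~= {}" using assms by blast
 moreover have "asymp_on ?A klt" using klt_trans klt_irrefl by (intro asymp_onI) blast
 moreover have "transp_on ?A klt" using klt_trans by (intro transp_onI) blast
 ultimately obtain \<gamma> where g: "\<gamma> \<in> ?A" "\<And>x. x \<in> ?A ==> x ~= \<gamma> ==> \<not> klt \<gamma> x"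
  using Finite_Set.bex_max_element[of ?A klt] by blast
 have "sl \<delta> f = 0" if d: "klt \<gamma> \<delta>" for \<delta>
 proof (rule ccontr)
  assume "sl \<delta> f ~= 0"
  moreover have "klt \<beta> \<delta>" using g(1) d klt_trans by blast
  ultimately have "\<delta> \<in> ?A" by blast
  thus False using g(2)[of \<delta>] d klt_irrefl by blast
 qed
 thus ?thesis using g(1) by blast
qed

lemma isw_support:
 assumes g: "gen c" and T: "T \<in> SYT" and f: "isw c \<alpha> T f" and s: "sl \<beta> f ~= 0"
 shows "\<beta> = \<alpha> \<or> klt \<beta> \<alpha>"
proof -
 obtain \<gamma> where \<gamma>: "sl \<gamma> f ~= 0" "\<gamma> = \<beta> \<or> klt \<beta> \<gamma>" "\<And>\<delta>. klt \<gamma> \<delta> ==> sl \<delta> f = 0"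
  using exists_top[OF s] by blast
 obtain m where m: "f \<in> NM m" using f by (auto simp: isw_def)
 have "\<gamma> \<in> comps" using sl_NM[OF m, of \<gamma>] \<gamma>(1) cm_comps by blast
 moreover obtain T' where "T' \<in> SYT" "coef \<gamma> T' f ~= 0"
  using VV_coef_zero[of "sl \<gamma> f" \<gamma>] sl_NM[OF m] \<gamma>(1) by (auto simp: coef_def)
 ultimately have "\<gamma> = \<alpha>" using top_coef[OF g T _ f _ \<gamma>(3)] by blast
 thus ?thesis using \<gamma>(2) by blast
qed

subsection \<open>The norm of a weight vector\<close>

text \<open>The sorted entries g_1 \<le> ... \<le> g_n of \<alpha>; GG is the gap g_t - g_s, lessened by 1 for an inversion of the
 sorting permutation.\<close>

definition gg :: "(nat => nat) => nat => nat" where "gg \<alpha> s = \<alpha> (so \<alpha> s)"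
definition GG :: "(nat => nat) => nat => nat => nat" where
 "GG \<alpha> s t = (if so \<alpha> s < so \<alpha> t then gg \<alpha> t - gg \<alpha> s else gg \<alpha> t - gg \<alpha> s - 1)"
definition qq :: "real => nat => int => real" where
 "qq c l D = (real l - c * of_int (D - 1)) * (real l - c * of_int (D + 1)) / (real l - c * of_int D)\<^sup>2"
definition N1 :: "real => (nat => nat) => tableau => real" where
 "N1 c \<alpha> T = (\<Prod>s\<in>Ix. \<Prod>l\<in>{1..gg \<alpha> s}. real l - c * of_int (ct T s))"
definition N2 :: "real => (nat => nat) => tableau => real" where
 "N2 c \<alpha> T = (\<Prod>s\<in>Ix. \<Prod>t\<in>{s<..n}. \<Prod>l\<in>{1..GG \<alpha> s t}. qq c l (ct T t - ct T s))"
text \<open>The norm of the weight vector relative to the norm of yv T. Each factor of N1 comes from a step with Phi, each factor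
 qq of N2 from an adjacent intertwiner.\<close>

definition NN :: "real => (nat => nat) => tableau => real" where
 "NN c \<alpha> T = N1 c \<alpha> T * N2 c \<alpha> T"

lemma gg_sh: "s \<in> Ix ==> gg (sh \<alpha>) s = (if s = rk \<alpha> n then Suc (gg \<alpha> s) else gg \<alpha> s)"
proof -
 assume s: "s \<in> Ix"
 have "so \<alpha> s = n \<longleftrightarrow> s = rk \<alpha> n" by (metis rk_so)
 thus ?thesis using sh_om[OF so_in[OF s], of \<alpha> \<alpha>] by (simp add: gg_def so_sh)
qed

lemma gg_less: "s \<in> Ix ==> t \<in> Ix ==> s < t ==> gg \<alpha> s < gg \<alpha> t \<or> gg \<alpha> s = gg \<alpha> t & so \<alpha> s < so \<alpha> t"
 using blw_so[of s t \<alpha>] by (simp add: blw_def gg_def)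

lemma GG_sh:
 assumes s: "s \<in> Ix" and t: "t \<in> Ix" and st: "s < t"
 shows "GG (sh \<alpha>) s t = GG \<alpha> s t"
proof -
 have n: "n \<in> Ix" using s by auto
 have e: "\<And>x. so \<alpha> x = n \<longleftrightarrow> x = rk \<alpha> n" by (metis rk_so)
 have l: "so \<alpha> s \<in> Ix" "so \<alpha> t \<in> Ix" by (rule so_in[OF s], rule so_in[OF t])
 have o: "om x = (if x = n then 1 else Suc x)" if "x \<in> Ix" for x using that by (auto simp: om_def)
 have ne: "so \<alpha> s ~= so \<alpha> t" using st by (metis rk_so(1) nat_neq_iff)
 show ?thesis
  unfolding GG_def gg_sh[OF s] gg_sh[OF t] so_sh o_apply o[OF l(1)] o[OF l(2)] e[symmetric]
  using l ne gg_less[OF s t st, of \<alpha>] by auto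
qed

lemma N1_sh:
 assumes n: "1 \<le> n" shows "N1 c (sh \<alpha>) T = N1 c \<alpha> T * zr c \<alpha> T n"
 unfolding N1_def
proof (rule prod_one_factor[of _ "rk \<alpha> n"])
 show r: "rk \<alpha> n \<in> Ix" by (rule rk_in) (use n in auto)
 have "gg \<alpha> (rk \<alpha> n) = \<alpha> n" by (simp add: gg_def)
 thus "(\<Prod>l\<in>{1..gg (sh \<alpha>) (rk \<alpha> n)}. real l - c * of_int (ct T (rk \<alpha> n))) =
  (\<Prod>l\<in>{1..gg \<alpha> (rk \<alpha> n)}. real l - c * of_int (ct T (rk \<alpha> n))) * zr c \<alpha> T n"
  using gg_sh[OF r, of \<alpha>] by (simp add: zr_def algebra_simps)
qed (use gg_sh in auto)

text \<open>Phi raises one sorted entry by 1 and changes no gap, so a single new factor appears in N1, the eigenvalue of ZZ n.\<close>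

lemma NN_sh: "1 \<le> n ==> NN c (sh \<alpha>) T = NN c \<alpha> T * zr c \<alpha> T n"
proof -
 assume n: "1 \<le> n"
 have "N2 c (sh \<alpha>) T = N2 c \<alpha> T" unfolding N2_def
  by (intro prod.cong refl) (use GG_sh in auto)
 thus ?thesis by (simp add: NN_def N1_sh[OF n])
qed

lemma qq_eq: "real l - c * of_int D ~= 0 ==> qq c l D = 1 - (c / (real l - c * of_int D))\<^sup>2"
 by (simp add: qq_def power_divide diff_divide_eq_iff) (simp add: divide_simps power2_eq_square algebra_simps)

text \<open>Exchanging a descent of \<alpha> at i turns an inversion of the sorting permutation into a non-inversion, which
 enlarges a single gap by 1; the new factor of N2 is qq = 1 - (c / difference of eigenvalues)^2.\<close>

lemma NN_sw:
 assumes i: "1 \<le> i" "i < n" and gt: "\<alpha> (Suc i) < \<alpha> i"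
  and nz: "zr c \<alpha> T (Suc i) ~= zr c \<alpha> T i"
 shows "NN c (\<alpha> o sw i) T = NN c \<alpha> T * (1 - (c / (zr c \<alpha> T (Suc i) - zr c \<alpha> T i))\<^sup>2)"
proof -
 let ?b = "\<alpha> o sw i" let ?s = "rk \<alpha> (Suc i)" let ?t = "rk \<alpha> i" let ?l = "\<alpha> i - \<alpha> (Suc i)"
 let ?D = "ct T ?t - ct T ?s"
 have i1: "i \<in> Ix" "Suc i \<in> Ix" using i by auto
 have ne: "\<alpha> i ~= \<alpha> (Suc i)" using gt by simp
 note so = so_sw[OF i ne]
 have st: "?s < ?t" using rk_less_iff[OF i1(2,1), of \<alpha>] gt by (simp add: blw_def)
 have g: "gg ?b s = gg \<alpha> s" for s by (simp add: gg_def so)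
 have N1: "N1 c ?b T = N1 c \<alpha> T" by (simp add: N1_def g)
 have other: "GG ?b s t = GG \<alpha> s t" if s: "s \<in> Ix" "t \<in> {s<..n}" and x: "s ~= ?s \<or> t ~= ?t" for s t
 proof -
  have e: "so \<alpha> s = Suc i \<longleftrightarrow> s = ?s" "so \<alpha> t = i \<longleftrightarrow> t = ?t" "so \<alpha> s = i \<longleftrightarrow> s = ?t" "so \<alpha> t = Suc i \<longleftrightarrow> t = ?s" by (metis rk_so)+
  have neq: "so \<alpha> s ~= so \<alpha> t" using s(2) by (metis rk_so(1) greaterThanAtMost_iff nat_neq_iff)
  have "\<not> (so \<alpha> s = Suc i & so \<alpha> t = i)" "\<not> (so \<alpha> s = i & so \<alpha> t = Suc i)" using e x s(2) st by auto
  hence "sw i (so \<alpha> s) < sw i (so \<alpha> t) \<longleftrightarrow> so \<alpha> s < so \<alpha> t" using neq by (auto simp: transpose_def)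
  thus ?thesis by (simp add: GG_def g so)
 qed
 have this_pair: "GG ?b ?s ?t = Suc (GG \<alpha> ?s ?t)" "Suc (GG \<alpha> ?s ?t) = ?l"
  using gt by (auto simp: GG_def gg_def so)
 have l: "real ?l - c * of_int ?D = zr c \<alpha> T i - zr c \<alpha> T (Suc i)"
  using gt by (simp add: zr_def of_nat_diff algebra_simps)
 have q: "qq c ?l ?D = 1 - (c / (zr c \<alpha> T (Suc i) - zr c \<alpha> T i))\<^sup>2"
  using qq_eq[of ?l c ?D] nz unfolding l by (simp add: power_divide power2_commute)
 have "N2 c ?b T = N2 c \<alpha> T * qq c ?l ?D" unfolding N2_def
 proof (rule prod_one_factor[of _ ?s])
  show "(\<Prod>t\<in>{?s<..n}. \<Prod>l\<in>{1..GG ?b ?s t}. qq c l (ct T t - ct T ?s)) =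
   (\<Prod>t\<in>{?s<..n}. \<Prod>l\<in>{1..GG \<alpha> ?s t}. qq c l (ct T t - ct T ?s)) * qq c ?l ?D"
  proof (rule prod_one_factor[of _ ?t])
   show "?t \<in> {?s<..n}" using st rk_in[OF i1(1), of \<alpha>] by auto
   show "(\<Prod>l\<in>{1..GG ?b ?s ?t}. qq c l ?D) = (\<Prod>l\<in>{1..GG \<alpha> ?s ?t}. qq c l ?D) * qq c ?l ?D"
    unfolding this_pair(1) by (simp add: this_pair(2)[symmetric])
   fix t assume t: "t \<in> {?s<..n}" "t ~= ?t"
   thus "(\<Prod>l\<in>{1..GG ?b ?s t}. qq c l (ct T t - ct T ?s)) = (\<Prod>l\<in>{1..GG \<alpha> ?s t}. qq c l (ct T t - ct T ?s))"
    using other[OF rk_in[OF i1(2)], of t] by simp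
  qed simp
  fix s assume s: "s \<in> Ix" "s ~= ?s"
  show "(\<Prod>t\<in>{s<..n}. \<Prod>l\<in>{1..GG ?b s t}. qq c l (ct T t - ct T s)) =
   (\<Prod>t\<in>{s<..n}. \<Prod>l\<in>{1..GG \<alpha> s t}. qq c l (ct T t - ct T s))"
   by (rule prod.cong[OF refl]) (use other s in auto)
 qed (use rk_in[OF i1(2)] in auto)
 thus ?thesis by (simp add: NN_def N1 q)
qed

subsection \<open>Construction by intertwiners\<close>

text \<open>The leading coefficient is prescribed as well: it is needed for the induction, and later for triangular matrices.\<close>

definition good :: "real => (nat => nat) => bool" where
 "good c \<alpha> \<longleftrightarrow> (\<forall>T\<in>SYT. \<exists>f. isw c \<alpha> T f &
  BB (of_real c) f f = of_real (NN c \<alpha> T) * ip (yv T) (yv T) & sl \<alpha> f = pv \<alpha> T)"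

lemma good_zf: "good c zf"
 unfolding good_def
proof
 fix T assume T: "T \<in> SYT"
 let ?f = "xv zf (yv T)"
 have yV: "yv T \<in> VV" using yv[OF T] by (simp add: ewt_def)
 have f0: "?f \<in> NM 0" by (rule NM_xv[OF zf_cm yV])
 have Z: "ZZ (of_real c) i ?f = sc (of_real (zr c zf T i)) ?f" if i: "i \<in> Ix" for i
 proof -
  have N: "ZZ (of_real c) i ?f \<in> NM 0" by (rule ZZ_NM[OF i f0])
  have "sl zf (ZZ (of_real c) i ?f) = sc (of_real (zr c zf T i)) (yv T)"
   using dg_yv[OF T i, of c zf] by (simp add: sl_ZZ_xv[OF i klt_irrefl] so_zf)
  thus ?thesis unfolding mv_eq_iff_sl using sl_NM[OF N] by (auto simp: cm_0 sl_lops sl_xv)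
 qed
 have "isw c zf T ?f" using Z f0 zf_cm by (auto simp: isw_def)
 moreover have "NN c zf T = 1" by (simp add: NN_def N1_def N2_def GG_def gg_def)
 moreover have "BB (of_real c) ?f ?f = ip (yv T) (yv T)" by (simp add: BB_xv Ymon_zero sl_xv)
 ultimately show "\<exists>f. isw c zf T f & BB (of_real c) f f = of_real (NN c zf T) * ip (yv T) (yv T) & sl zf f = pv zf T"
  by (intro exI[of _ ?f]) (simp add: sl_xv pv_def so_zf)
qed

lemma sl_XX: "sl (up k \<gamma>) (XX k f) = sl \<gamma> f"
proof (rule mv_linear_eqI[OF lin_compI[OF linear_sl linear_XX] linear_sl])
 fix \<alpha> p
 have "up k \<alpha> = up k \<gamma> \<longleftrightarrow> \<alpha> = \<gamma>" by (auto simp: up_def fun_eq_iff)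
 thus "sl (up k \<gamma>) (XX k (ba (\<alpha>, p))) = sl \<gamma> (ba (\<alpha>, p))" by (simp add: sl_ba)
qed

lemma sl_WW: "bij w ==> sl (\<gamma> o pinv w) (WW w f) = perm_act w (sl \<gamma> f)"
proof -
 assume b: "bij w"
 have z: "\<alpha> o pinv w = \<gamma> o pinv w \<longleftrightarrow> \<alpha> = \<gamma>" for \<alpha> :: "nat => nat"
 proof
  assume e: "\<alpha> o pinv w = \<gamma> o pinv w"
  have "\<alpha> x = \<gamma> x" for x using fun_cong[OF e, of "w x"] b by (simp add: bij_is_inj inv_f_f)
  thus "\<alpha> = \<gamma>" by auto
 qed auto
 show ?thesis
  by (rule mv_linear_eqI[OF lin_compI[OF linear_sl linear_WW] lin_compI[OF linear_perm_act linear_sl]])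
   (simp add: sl_ba z perm_act_lops)
qed

lemma good_sh:
 assumes n: "1 \<le> n" and g: "good c \<alpha>" shows "good c (sh \<alpha>)"
 unfolding good_def
proof
 fix T assume T: "T \<in> SYT"
 obtain f where f: "isw c \<alpha> T f" "BB (of_real c) f f = of_real (NN c \<alpha> T) * ip (yv T) (yv T)" "sl \<alpha> f = pv \<alpha> T"
  using g T unfolding good_def by blast
 obtain m where m: "\<alpha> \<in> cm m" "f \<in> NM m" using f(1) by (auto simp: isw_def)
 have nn: "n \<in> Ix" "1 \<in> Ix" using n by auto
 have Z: "ZZ (of_real c) i f = sc (of_real (zr c \<alpha> T i)) f" if "i \<in> Ix" for i
  using f(1) that by (simp add: isw_def)
 have shc: "sh \<alpha> \<in> cm (Suc m)" unfolding sh_def by (rule up_cm[OF nn(2) perm_cm[OF om_perm m(1)]])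
 have "ZZ (of_real c) j (Phi f) = sc (of_real (zr c (sh \<alpha>) T j)) (Phi f)" if j: "j \<in> Ix" for j
 proof -
  have linPhi: "Phi (sc a u) = sc a (Phi u)" for a u by (simp add: Phi_def WW_lops XX_lops)
  show ?thesis
  proof (cases "j = 1")
   case True
   have "sh \<alpha> 1 = Suc (\<alpha> n)" "rk (sh \<alpha>) 1 = rk \<alpha> n" using sh_om[OF nn(1), of \<alpha>] rk_sh[of \<alpha> n] n by (auto simp: om_simps)
   hence "zr c (sh \<alpha>) T 1 = zr c \<alpha> T n + 1" by (simp add: zr_def)
   thus ?thesis unfolding True ZZ_Phi_1[OF n] Z[OF nn(1)] linPhi
    by (simp add: fv.scale_left_distrib)
  next
   case False
   define i where "i = j - 1"
   have i: "1 \<le> i" "i < n" "j = Suc i" "i \<in> Ix" using False j by (auto simp: i_def)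
   have "sh \<alpha> j = \<alpha> i" "rk (sh \<alpha>) j = rk \<alpha> i" using sh_om[OF i(4), of \<alpha>] rk_sh[of \<alpha> i] i by (auto simp: om_simps)
   hence "zr c (sh \<alpha>) T j = zr c \<alpha> T i" by (simp add: zr_def)
   thus ?thesis using ZZ_Phi_Suc[OF i(1,2), of "of_real c" f] i by (simp add: Z linPhi)
  qed
 qed
 hence "isw c (sh \<alpha>) T (Phi f)" using shc Phi_NM[OF n m(2)] by (auto simp: isw_def)
 moreover have "BB (of_real c) (Phi f) (Phi f) = of_real (NN c (sh \<alpha>) T) * ip (yv T) (yv T)"
  by (simp add: BB_Phi[OF n] Z[OF nn(1)] BB_simps f(2) NN_sh[OF n])
 moreover have "sl (sh \<alpha>) (Phi f) = pv (sh \<alpha>) T"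
  by (simp add: sh_def Phi_def sl_XX sl_WW[OF om_bij] f(3)) (simp add: pv_def perm_act_comp so_sh[unfolded sh_def])
 ultimately show "\<exists>f. isw c (sh \<alpha>) T f & BB (of_real c) f f = of_real (NN c (sh \<alpha>) T) * ip (yv T) (yv T) & sl (sh \<alpha>) f = pv (sh \<alpha>) T"
  by blast
qed

text \<open>The weight vector for the exchanged exponent is s_i f + k f, where k = c / (z (i+1) - z i) is chosen so that the
 result is again an eigenvector; it has norm 1 - k^2 times that of f. Since x^\<alpha> is lower than its image under
 s_i, the added multiple of f does not change the leading coefficient.\<close>

lemma good_sw:
 assumes gc: "gen c" and i: "1 \<le> i" "i < n" and gt: "\<alpha> (Suc i) < \<alpha> i" and g: "good c \<alpha>"
 shows "good c (\<alpha> o sw i)"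
 unfolding good_def
proof
 fix T assume T: "T \<in> SYT"
 let ?b = "\<alpha> o sw i" let ?C = "complex_of_real c"
 obtain f where f: "isw c \<alpha> T f" "BB ?C f f = of_real (NN c \<alpha> T) * ip (yv T) (yv T)" "sl \<alpha> f = pv \<alpha> T"
  using g T unfolding good_def by blast
 obtain m where m: "\<alpha> \<in> cm m" "f \<in> NM m" using f(1) by (auto simp: isw_def)
 have i1: "i \<in> Ix" "Suc i \<in> Ix" using i by auto
 have p: "sw i permutes Ix" by (rule tr_perm[OF i1])
 have ne: "\<alpha> i ~= \<alpha> (Suc i)" using gt by simp
 have b: "?b \<in> cm m" using perm_cm[OF p m(1)] by simp
 have Z: "ZZ ?C k f = sc (of_real (zr c \<alpha> T k)) f" if "k \<in> Ix" for k
  using f(1) that by (simp add: isw_def)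
 let ?z = "zr c \<alpha> T"
 have zb: "zr c ?b T (sw i k) = ?z k" for k using rk_sw[OF i ne, of k] by (simp add: zr_def)
 have zne: "?z (Suc i) ~= ?z i"
 proof
  assume "?z (Suc i) = ?z i"
  hence "of_int (int (\<alpha> i) - int (\<alpha> (Suc i))) - c * of_int (ct T (rk \<alpha> i) - ct T (rk \<alpha> (Suc i))) = 0"
   by (simp add: zr_def algebra_simps)
  thus False
   using gen_nonzero[OF gc, of "ct T (rk \<alpha> i) - ct T (rk \<alpha> (Suc i))" "int (\<alpha> i) - int (\<alpha> (Suc i))"]
    ct_diff_le[OF T rk_in[OF i1(1)] rk_in[OF i1(2)], of \<alpha> \<alpha>] ne by auto
 qed
 define k where "k = c / (?z (Suc i) - ?z i)"
 have ck: "c = k * (?z (Suc i) - ?z i)" using zne by (simp add: k_def)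
 hence Ck: "?C = of_real k * (of_real (?z (Suc i)) - of_real (?z i))" by (metis of_real_diff of_real_mult)
 define h where "h = WW (sw i) f + sc (of_real k) f"
 have hN: "h \<in> NM m" unfolding h_def by (intro NM_closed WW_NM p m)
 have Zh: "ZZ ?C j h = sc (of_real (zr c ?b T j)) h" if j: "j \<in> Ix" for j
 proof -
  consider "j = i" | "j = Suc i" | "j ~= i" "j ~= Suc i" by blast
  thus ?thesis
  proof cases
   case 1
   have "zr c ?b T i = ?z (Suc i)" using zb[of "Suc i"] by simp
   moreover have "ZZ ?C i h = sc (of_real (?z (Suc i))) (WW (sw i) f) + (sc ?C f + sc (of_real k * of_real (?z i)) f)"
    unfolding h_def by (simp add: ZZ_lops ZZ_sw'[OF i] Z[OF i1(1)] Z[OF i1(2)] WW_lops)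
   moreover have "?C + of_real k * of_real (?z i) = of_real (?z (Suc i)) * of_real k" unfolding Ck by (simp add: algebra_simps)
   ultimately show ?thesis unfolding 1 h_def by (simp only: fv.scale_left_distrib[symmetric] fv.scale_right_distrib sc_simps(1))
  next
   case 2
   have "zr c ?b T (Suc i) = ?z i" using zb[of i] by simp
   moreover have "ZZ ?C (Suc i) h = sc (of_real (?z i)) (WW (sw i) f) + (sc (of_real k * of_real (?z (Suc i))) f - sc ?C f)"
    unfolding h_def by (simp add: ZZ_lops ZZ_sw[OF i] Z[OF i1(1)] Z[OF i1(2)] WW_lops)
   moreover have "of_real k * of_real (?z (Suc i)) - ?C = of_real (?z i) * of_real k" unfolding Ck by (simp add: algebra_simps)
   ultimately show ?thesis unfolding 2 h_def by (simp only: fv.scale_left_diff_distrib[symmetric] fv.scale_right_distrib sc_simps(1))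
  next
   case 3
   have "sw i j = j" using 3 by (simp add: transpose_def)
   hence "zr c ?b T j = ?z j" using zb[of j] by simp
   thus ?thesis unfolding h_def by (simp add: ZZ_lops ZZ_sw_other[OF i 3] Z[OF j] WW_lops sc_distribs mult.commute)
  qed
 qed
 have hw: "isw c ?b T h" unfolding isw_def using b hN Zh by blast
 have bne: "?b ~= \<alpha>" using ne by (auto simp: fun_eq_iff transpose_def)
 have o: "BB ?C f h = 0" by (rule isw_orth[OF gc T T f(1) hw]) (use bne in auto)
 have fs: "BB ?C f (WW (sw i) f) = - of_real k * BB ?C f f"
  using o by (simp add: h_def BB_simps add_eq_0_iff2)
 have "BB ?C h h = BB ?C (WW (sw i) f) h + of_real k * BB ?C f h"
  by (subst (1) h_def) (simp only: BB_simps)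
 also have "... = BB ?C (WW (sw i) f) h" using o by simp
 also have "... = BB ?C f f + of_real k * BB ?C f (WW (sw i) f)"
  by (simp add: h_def BB_simps BB_WW[OF p] BB_tr[OF i1])
 also have "... = of_real (1 - k\<^sup>2) * BB ?C f f" by (simp add: fs power2_eq_square algebra_simps)
 finally have "BB ?C h h = of_real (NN c ?b T) * ip (yv T) (yv T)"
  by (simp add: f(2) NN_sw[OF i gt zne] k_def)
 moreover have "sl ?b h = pv ?b T"
 proof -
  have "klt \<alpha> ?b" using klt_swap[OF i1, of ?b] gt by (simp add: comp_assoc)
  hence "sl ?b f = 0" using isw_support[OF gc T f(1), of ?b] bne klt_trans klt_irrefl by blast
  moreover have "sl ?b (WW (sw i) f) = perm_act (sw i) (sl \<alpha> f)" using sl_WW[of "sw i" \<alpha> f] by simp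
  ultimately show ?thesis by (simp add: h_def sl_lops f(3) pv_def perm_act_comp so_sw[OF i ne])
 qed
 ultimately show "\<exists>f. isw c ?b T f & BB ?C f f = of_real (NN c ?b T) * ip (yv T) (yv T) & sl ?b f = pv ?b T"
  using hw by blast
qed

text \<open>Induction on the degree and, within a degree, on the least index with a positive entry: exponents with \<alpha> 1 > 0
 are images under sh of exponents of lower degree, and a positive entry at k+1 can be moved to k by an exchange.\<close>

lemma good_all:
 assumes gc: "gen c" and a: "\<alpha> \<in> cm m" shows "good c \<alpha>"
 using a
proof (induction m arbitrary: \<alpha>)
 case 0
 thus ?case using good_zf by (simp add: cm_0)
next
 case (Suc m)
 have P: "\<forall>\<alpha>\<in>cm (Suc m). 0 < \<alpha> k --> good c \<alpha>" if "1 \<le> k" "k \<le> n" for k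
  using that
 proof (induction k rule: dec_induct)
  case base
  show ?case
  proof (intro ballI impI)
   fix \<alpha> assume a: "\<alpha> \<in> cm (Suc m)" "0 < \<alpha> 1"
   have nn: "1 \<in> Ix" using base by auto
   define \<beta> where "\<beta> = \<alpha>(1 := \<alpha> 1 - 1)"
   have e: "\<alpha> = up 1 \<beta>" using a(2) by (auto simp: \<beta>_def up_def fun_eq_iff)
   have bc: "\<beta> \<in> comps" using a(1) nn by (auto simp: cm_def comps_def \<beta>_def)
   then obtain m' where m': "\<beta> \<in> cm m'" using comps_cm by blast
   hence "m' = m" using up_cm[OF nn m'] a e by (auto simp: cm_def)
   hence "\<beta> o pinv (pinv om) \<in> cm m" using perm_cm[OF permutes_inv[OF om_perm]] m' by blast
   hence "good c (\<beta> o om)" using Suc.IH by (simp add: permutes_inv_inv[OF om_perm])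
   hence "good c (sh (\<beta> o om))" using good_sh base by blast
   moreover have "sh (\<beta> o om) = \<alpha>" by (simp add: sh_def e comp_assoc permutes_inv_o[OF om_perm])
   ultimately show "good c \<alpha>" by simp
  qed
 next
  case (step k)
  show ?case
  proof (intro ballI impI)
   fix \<alpha> assume a: "\<alpha> \<in> cm (Suc m)" "0 < \<alpha> (Suc k)"
   show "good c \<alpha>"
   proof (cases "0 < \<alpha> k")
    case True thus ?thesis using step a by auto
   next
    case False
    have k: "1 \<le> k" "k < n" using step by auto
    have "sw k permutes Ix" by (rule tr_perm) (use k in auto)
    hence "\<alpha> o sw k \<in> cm (Suc m)" using perm_cm[of "sw k" \<alpha>] a(1) by simp
    moreover have "0 < (\<alpha> o sw k) k" using a(2) by simp
    ultimately have "good c (\<alpha> o sw k)" using step by auto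
    hence "good c ((\<alpha> o sw k) o sw k)" using good_sw[OF gc k] False a(2) by simp
    thus ?thesis by (simp add: comp_assoc)
   qed
  qed
 qed
 obtain k where "k \<in> Ix" "\<alpha> k ~= 0"
 proof (rule ccontr)
  assume "\<not> thesis"
  hence "(\<Sum>i\<in>Ix. \<alpha> i) = 0" using that by (intro sum.neutral) blast
  thus False using Suc.prems by (simp add: cm_def)
 qed
 thus ?case using P[of k] Suc.prems by auto
qed

lemma NN_nz:
 assumes gc: "gen c" and T: "T \<in> SYT" shows "NN c \<alpha> T ~= 0"
proof -
 have nz: "real l - c * of_int k ~= 0" if "l \<in> {1..m}" "\<bar>k\<bar> \<le> int n" for l k m
  using gen_nonzero[OF gc that(2), of "int l"] that(1) by simp
 have "qq c l (ct T t - ct T s) ~= 0" if "s \<in> Ix" "t \<in> Ix" "l \<in> {1..m}" for s t l m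
 proof -
  have "\<bar>ct T t - ct T s\<bar> + 1 \<le> int n" using ct_diff_le[OF T that(2,1)] .
  thus ?thesis using nz[OF that(3), of "ct T t - ct T s"] nz[OF that(3), of "ct T t - ct T s - 1"]
    nz[OF that(3), of "ct T t - ct T s + 1"] by (simp add: qq_def)
 qed
 hence "(\<Prod>l\<in>{1..GG \<alpha> s t}. qq c l (ct T t - ct T s)) ~= 0" if "s \<in> Ix" "t \<in> {s<..n}" for s t
  using that by (subst prod_zero_iff) (simp, metis atLeastAtMost_iff greaterThanAtMost_iff less_imp_le order.trans)
 hence "N2 c \<alpha> T ~= 0" unfolding N2_def by (simp only: prod_zero_iff finite_atLeastAtMost finite_greaterThanAtMost) blast
 moreover have "N1 c \<alpha> T ~= 0" unfolding N1_def using nz ct_le[OF T]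
  by (simp only: prod_zero_iff finite_atLeastAtMost) blast
 ultimately show ?thesis by (simp add: NN_def)
qed

end

subsection \<open>Polynomial families and orders of vanishing\<close>

lemma det_lower_mult_upper:
 fixes A V :: "complex mat"
 assumes A: "A \<in> carrier_mat r r" "\<And>i j. i < r ==> j < r ==> i < j ==> A $$ (i, j) = 0"
  and V: "V \<in> carrier_mat r r" "\<And>i j. i < r ==> j < r ==> j < i ==> V $$ (i, j) = 0"
 shows "det (A * V) = (\<Prod>i\<in>{0..<r}. A $$ (i, i) * V $$ (i, i))"
proof -
 have "upper_triangular (transpose_mat A)" using A by auto
 hence "det (transpose_mat A) = prod_list (diag_mat (transpose_mat A))" by (rule det_upper_triangular) (use A in auto)
 moreover have "diag_mat (transpose_mat A) = diag_mat A" using A by (auto simp: diag_mat_def)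
 moreover have "det (transpose_mat A) = det A" by (rule det_transpose[OF A(1)])
 moreover have "upper_triangular V" using V by auto
 hence "det V = prod_list (diag_mat V)" by (rule det_upper_triangular) (use V in auto)
 ultimately show ?thesis using A(1) V(1)
  by (simp add: det_mult[OF A(1) V(1)] prod_list_diag_prod prod.distrib)
qed

lemma continuous_det:
 fixes F :: "real => nat => nat => complex"
 assumes "\<And>i j. i < r ==> j < r ==> continuous_on UNIV (%c. F c i j)"
 shows "continuous_on UNIV (%c. det (mat r r (%(i, j). F c i j)))"
proof -
 have "det (mat r r (%(i, j). F c i j)) = (\<Sum>p\<in>{p. p permutes {0..<r}}. signof p * (\<Prod>i\<in>{0..<r}. F c i (p i)))" for c
 proof -
  have "mat r r (%(i, j). F c i j) $$ (i, p i) = F c i (p i)" if "p permutes {0..<r}" "i \<in> {0..<r}" for i p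
   using that permutes_in_image[OF that(1), of i] by auto
  thus ?thesis unfolding det_def'[OF mat_carrier] by (auto intro!: sum.cong prod.cong)
 qed
 moreover have "continuous_on UNIV (%c. F c i (p i))" if "p permutes {0..<r}" "i \<in> {0..<r}" for i p
  using assms that permutes_in_image[OF that(1), of i] by auto
 ultimately show ?thesis by (simp, intro continuous_intros) auto
qed

text \<open>Families that depend on c through finitely many continuous coefficients. Continuity is thus defined without a topology
 on the infinite-dimensional space.\<close>

inductive pfam :: "(real => ('a \<Rightarrow>\<^sub>0 complex)) => bool" where
 const: "pfam (%_. u)"
| add: "pfam F ==> pfam G ==> pfam (%c. F c + G c)"
| scale: "continuous_on UNIV \<phi> ==> pfam F ==> pfam (%c. sc (\<phi> c) (F c))"

lemma pfam_linear: "pfam F ==> linear_op f ==> pfam (%c. f (F c))"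
 by (induction rule: pfam.induct) (auto simp: lops intro: pfam.intros)

lemma pfam_sum: "(\<And>i. i \<in> A ==> pfam (%c. F i c)) ==> pfam (%c. \<Sum>i\<in>A. F i c)"
 by (induction A rule: infinite_finite_induct) (auto intro: pfam.intros)

lemma pfam_ip: "pfam F ==> continuous_on UNIV (%c. ip v (F c))"
 by (induction rule: pfam.induct) (auto simp: ip_simps intro!: continuous_intros)

text \<open>The order of vanishing of F at c0 is a; poles have negative order.\<close>

definition tz :: "real => (real => real) => int => bool" where
 "tz c0 F a \<longleftrightarrow> (\<exists>L. L ~= 0 & ((%c. F c * (c - c0) powi (- a)) \<longlongrightarrow> L) (at c0))"

lemma tz_mult: "tz c0 F a ==> tz c0 G b ==> tz c0 (%c. F c * G c) (a + b)"
proof -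
 assume "tz c0 F a" "tz c0 G b"
 then obtain L M where L: "L ~= 0" "((%c. F c * (c - c0) powi (- a)) \<longlongrightarrow> L) (at c0)"
  and M: "M ~= 0" "((%c. G c * (c - c0) powi (- b)) \<longlongrightarrow> M) (at c0)" unfolding tz_def by blast
 have "((%c. (F c * (c - c0) powi (- a)) * (G c * (c - c0) powi (- b))) \<longlongrightarrow> L * M) (at c0)"
  by (rule tendsto_mult[OF L(2) M(2)])
 moreover have "\<forall>\<^sub>F c in at c0. (F c * (c - c0) powi (- a)) * (G c * (c - c0) powi (- b)) = F c * G c * (c - c0) powi (- (a + b))"
  unfolding eventually_at_filter
 proof (intro always_eventually allI impI)
  fix c assume "c ~= c0"
  hence "(c - c0) powi (- a + - b) = (c - c0) powi (- a) * (c - c0) powi (- b)"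
   by (intro power_int_add) simp
  moreover have "- (a + b) = - a + - b" by simp
  ultimately have e: "(c - c0) powi (- (a + b)) = (c - c0) powi (- a) * (c - c0) powi (- b)" by metis
  show "(F c * (c - c0) powi (- a)) * (G c * (c - c0) powi (- b)) = F c * G c * (c - c0) powi (- (a + b))"
   unfolding e by (simp only: mult.assoc mult.left_commute[of "(c - c0) powi (- a)" "G c"])
 qed
 ultimately have "((%c. F c * G c * (c - c0) powi (- (a + b))) \<longlongrightarrow> L * M) (at c0)"
  by (rule Lim_transform_eventually)
 thus ?thesis unfolding tz_def using L M by (intro exI[of _ "L * M"]) simp
qed

lemma tz_inverse: "tz c0 F a ==> tz c0 (%c. inverse (F c)) (- a)"
proof -
 assume "tz c0 F a"
 then obtain L where L: "L ~= 0" "((%c. F c * (c - c0) powi (- a)) \<longlongrightarrow> L) (at c0)" unfolding tz_def by blast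
 have "((%c. inverse (F c * (c - c0) powi (- a))) \<longlongrightarrow> inverse L) (at c0)" by (rule tendsto_inverse[OF L(2,1)])
 hence "((%c. inverse (F c) * (c - c0) powi (- (- a))) \<longlongrightarrow> inverse L) (at c0)"
  by (simp add: power_int_minus)
 thus ?thesis unfolding tz_def using L by (intro exI[of _ "inverse L"]) simp
qed

lemma tz_one: "tz c0 (%_. 1) 0" unfolding tz_def by (intro exI[of _ 1]) simp

lemma tz_prod: "finite A ==> (\<And>x. x \<in> A ==> tz c0 (F x) (a x)) ==> tz c0 (%c. \<Prod>x\<in>A. F x c) (\<Sum>x\<in>A. a x)"
 by (induction A rule: finite_induct) (auto simp: tz_one tz_mult)

lemma tz_linear:
 assumes "l ~= 0" shows "tz c0 (%c. l - c * e) (if l = c0 * e then 1 else 0)"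
proof (cases "l = c0 * e")
 case True
 have "((%c. - e) \<longlongrightarrow> - e) (at c0)" by simp
 moreover have "\<forall>\<^sub>F c in at c0. - e = (l - c * e) * (c - c0) powi (- 1)"
  unfolding eventually_at_filter by (rule always_eventually) (auto simp: True power_int_minus field_simps)
 ultimately have "((%c. (l - c * e) * (c - c0) powi (- 1)) \<longlongrightarrow> - e) (at c0)"
  by (rule Lim_transform_eventually)
 thus ?thesis using True assms unfolding tz_def by (intro exI[of _ "- e"]) auto
next
 case False
 have "((%c. l - c * e) \<longlongrightarrow> l - c0 * e) (at c0)" by (intro tendsto_intros)
 thus ?thesis using False unfolding tz_def by (intro exI[of _ "l - c0 * e"]) simp
qed

context young
begin

subsection \<open>Continuity in the parameter\<close>

lemma pfam_YY: "pfam F ==> pfam (%c. YY (of_real c) i (F c))"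
proof -
 assume F: "pfam F"
 have aff: "YY z i u = YY 0 i u + sc z (YY 1 i u - YY 0 i u)" for z u
 proof (rule mv_linear_eqI[OF linear_YY])
  show "linear_op (%u. YY 0 i u + sc z (YY 1 i u - YY 0 i u))"
   by (intro lin_plusI lin_scaledI lin_minusI linear_YY)
  fix \<alpha> p
  show "YY z i (ba (\<alpha>, p)) = YY 0 i (ba (\<alpha>, p)) + sc z (YY 1 i (ba (\<alpha>, p)) - YY 0 i (ba (\<alpha>, p)))"
   unfolding YY_def lin_ba case_prod_conv
   by (cases "i \<in> Ix") (simp_all only: if_True if_False sc_simps, simp_all add: fv.scale_minus_right)
 qed
 have "pfam (%c. YY 0 i (F c) + sc (of_real c) (YY 1 i (F c) - YY 0 i (F c)))"
  by (rule pfam.add[OF pfam_linear[OF F linear_YY]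
   pfam.scale[OF _ pfam_linear[OF F lin_minusI[OF linear_YY linear_YY]]]]) (intro continuous_intros)
 thus ?thesis unfolding aff[symmetric] .
qed

lemma pfam_ZZ: "pfam F ==> pfam (%c. ZZ (of_real c) i (F c))"
 unfolding ZZ_def
 by (rule pfam.add[OF pfam_YY[OF pfam_linear[OF _ linear_XX]] pfam.scale[OF _ pfam_sum[OF pfam_linear[OF _ linear_WW]]]])
  (auto intro: continuous_intros)

lemma pfam_Ymon: "pfam F ==> pfam (%c. Ymon (of_real c) \<alpha> (F c))"
proof -
 have p: "pfam F ==> pfam (%c. (YY (of_real c) i ^^ a) (F c))" for F i a
  by (induction a) (simp_all add: pfam_YY)
 have "pfam F ==> pfam (%c. fold (%i. YY (of_real c) i ^^ \<alpha> i) is (F c))" for "is" F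
  by (induction "is" arbitrary: F) (simp_all add: p)
 thus "pfam F ==> ?thesis" unfolding Ymon_def by blast
qed

lemma BB_continuous: "pfam F ==> continuous_on UNIV (%c. BB (of_real c) (F c) g)"
proof (induction rule: pfam.induct)
 case (const u)
 have "continuous_on UNIV (%c. BB (of_real c) (xv \<alpha> v) g)" for \<alpha> v
  unfolding BB_xv by (intro pfam_ip pfam_linear[OF pfam_Ymon] pfam.const linear_sl)
 thus ?case by (subst BB_expand) (intro continuous_intros)
qed (auto simp: BB_simps intro!: continuous_intros)

subsection \<open>The basis of weight vectors\<close>

definition fw :: "real => (nat => nat) => tableau => mv" where
 "fw c \<alpha> T = (SOME f. isw c \<alpha> T f & BB (of_real c) f f = of_real (NN c \<alpha> T) * ip (yv T) (yv T) & sl \<alpha> f = pv \<alpha> T)"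

lemma fw:
 assumes "gen c" "\<alpha> \<in> cm m" "T \<in> SYT"
 shows "isw c \<alpha> T (fw c \<alpha> T)" "BB (of_real c) (fw c \<alpha> T) (fw c \<alpha> T) = of_real (NN c \<alpha> T) * ip (yv T) (yv T)"
  "sl \<alpha> (fw c \<alpha> T) = pv \<alpha> T" "fw c \<alpha> T \<in> NM m"
proof -
 have "\<exists>f. isw c \<alpha> T f & BB (of_real c) f f = of_real (NN c \<alpha> T) * ip (yv T) (yv T) & sl \<alpha> f = pv \<alpha> T"
  using good_all[OF assms(1,2)] assms(3) unfolding good_def by blast
 from someI_ex[OF this] show a: "isw c \<alpha> T (fw c \<alpha> T)" "BB (of_real c) (fw c \<alpha> T) (fw c \<alpha> T) = of_real (NN c \<alpha> T) * ip (yv T) (yv T)"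
  "sl \<alpha> (fw c \<alpha> T) = pv \<alpha> T" unfolding fw_def by blast+
 obtain m' where "\<alpha> \<in> cm m'" "fw c \<alpha> T \<in> NM m'" using a(1) by (auto simp: isw_def)
 thus "fw c \<alpha> T \<in> NM m" using assms(2) by (simp add: cm_def)
qed

text \<open>A numerical key refining klt in degree m: the second sum of klt is at most n m there.\<close>

definition kn :: "nat => (nat => nat) => nat" where
 "kn m \<alpha> = (\<Sum>k\<in>Ix. \<alpha> k * \<alpha> k) * Suc (n * m) + (\<Sum>k\<in>Ix. k * \<alpha> k)"

lemma klt_kn:
 assumes "\<alpha> \<in> cm m" "klt \<alpha> \<beta>" shows "kn m \<alpha> < kn m \<beta>"
proof -
 have "(\<Sum>k\<in>Ix. k * \<alpha> k) \<le> (\<Sum>k\<in>Ix. n * \<alpha> k)" by (intro sum_mono) auto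
 hence b: "(\<Sum>k\<in>Ix. k * \<alpha> k) < Suc (n * m)" using assms(1) by (simp add: cm_def sum_distrib_left[symmetric])
 show ?thesis
 proof (cases "(\<Sum>k\<in>Ix. \<alpha> k * \<alpha> k) < (\<Sum>k\<in>Ix. \<beta> k * \<beta> k)")
  case True
  hence "Suc (\<Sum>k\<in>Ix. \<alpha> k * \<alpha> k) * Suc (n * m) \<le> (\<Sum>k\<in>Ix. \<beta> k * \<beta> k) * Suc (n * m)"
   by (intro mult_right_mono) auto
  thus ?thesis using b by (simp add: kn_def)
 next
  case False thus ?thesis using assms(2) by (simp add: klt_def kn_def)
 qed
qed

definition IX :: "nat => ((nat => nat) \<times> tableau) set" where "IX m = cm m \<times> SYT"
lemma finite_IX [simp]: "finite (IX m)" by (simp add: IX_def)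

lemma ip_pv: "T \<in> SYT ==> T' \<in> SYT ==> ip (pv \<alpha> T) (pv \<alpha> T') = (if T = T' then ip (yv T) (yv T) else 0)"
 unfolding pv_def using yv_orth by (simp add: ip_perm_act[OF permutes_inj[OF so_perm]])

lemma yv_norm: "T \<in> SYT ==> ip (yv T) (yv T) ~= 0" using yv ip_self_zero by blast

lemma pv_VV: "T \<in> SYT ==> pv \<alpha> T \<in> VV"
 unfolding pv_def by (rule VV_perm_act[OF _ so_perm]) (use yv in \<open>auto simp: ewt_def\<close>)

lemma coef_fw:
 assumes g: "gen c" and a: "\<alpha> \<in> cm m" "\<beta> \<in> cm m" and T: "T \<in> SYT" "T' \<in> SYT" and k: "kn m \<alpha> \<le> kn m \<beta>"
 shows "coef \<beta> T' (fw c \<alpha> T) = (if (\<beta>, T') = (\<alpha>, T) then ip (yv T) (yv T) else 0)"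
proof (cases "\<beta> = \<alpha>")
 case True
 thus ?thesis using T by (simp add: coef_def fw(3)[OF g a(1) T(1)] ip_pv)
next
 case False
 hence "\<not> klt \<beta> \<alpha>" using klt_kn[OF a(2)] k by fastforce
 hence "sl \<beta> (fw c \<alpha> T) = 0" using isw_support[OF g T(1) fw(1)[OF g a(1) T(1)]] False by blast
 thus ?thesis using False by (simp add: coef_def)
qed

lemma NM_coef_zero: "h \<in> NM m ==> (\<And>T. T \<in> SYT ==> coef \<beta> T h = 0) ==> sl \<beta> h = 0"
 using VV_coef_zero[of "sl \<beta> h" \<beta>] sl_NM[of h m \<beta>] by (simp add: coef_def)

text \<open>Subtracting multiples of the weight vectors for the exponents with the largest key lowers the key, since all other
 exponents of these vectors are lower. The last clause records the leading coefficients.\<close>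

lemma fw_expand:
 assumes g: "gen c" and h: "h \<in> NM m" and K: "\<And>\<gamma>. sl \<gamma> h ~= 0 ==> kn m \<gamma> < K"
 shows "\<exists>a. h = (\<Sum>v\<in>IX m. sc (a v) (fw c (fst v) (snd v))) & (\<forall>v\<in>IX m. K \<le> kn m (fst v) --> a v = 0) &
  (\<forall>v\<in>IX m. Suc (kn m (fst v)) = K --> a v = coef (fst v) (snd v) h / ip (yv (snd v)) (yv (snd v)))"
 using h K
proof (induction K arbitrary: h)
 case 0
 hence "h = 0" by (auto simp: mv_eq_iff_sl sl_lops)
 thus ?case by (intro exI[of _ "%_. 0"]) auto
next
 case (Suc K)
 define b where "b v = (if kn m (fst v) = K then coef (fst v) (snd v) h / ip (yv (snd v)) (yv (snd v)) else 0)" for v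
 define h' where "h' = h - (\<Sum>v\<in>IX m. sc (b v) (fw c (fst v) (snd v)))"
 have N: "fw c (fst v) (snd v) \<in> NM m" if "v \<in> IX m" for v
  using that fw(4)[OF g] by (auto simp: IX_def)
 have h'N: "h' \<in> NM m" unfolding h'_def by (intro NM_closed Suc.prems(1) N)
 have small: "kn m \<gamma> < K" if nz: "sl \<gamma> h' ~= 0" for \<gamma>
 proof (rule ccontr)
  assume ge: "\<not> kn m \<gamma> < K"
  have gc: "\<gamma> \<in> cm m" using sl_NM[OF h'N, of \<gamma>] nz by blast
  have "coef \<gamma> T h' = 0" if T: "T \<in> SYT" for T
  proof -
   have "coef \<gamma> T h' = coef \<gamma> T h - (\<Sum>v\<in>IX m. b v * coef \<gamma> T (fw c (fst v) (snd v)))"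
    by (simp add: h'_def coef_simps)
   also have "(\<Sum>v\<in>IX m. b v * coef \<gamma> T (fw c (fst v) (snd v))) = (\<Sum>v\<in>IX m. if v = (\<gamma>, T) then b v * ip (yv T) (yv T) else 0)"
   proof (rule sum.cong[OF refl])
    fix v assume v: "v \<in> IX m"
    obtain \<alpha> T' where vv: "v = (\<alpha>, T')" "\<alpha> \<in> cm m" "T' \<in> SYT" using v by (auto simp: IX_def)
    show "b v * coef \<gamma> T (fw c (fst v) (snd v)) = (if v = (\<gamma>, T) then b v * ip (yv T) (yv T) else 0)"
    proof (cases "kn m \<alpha> = K")
     case True
     thus ?thesis using coef_fw[OF g vv(2) gc vv(3) T] ge vv(1) by auto
    next
     case False thus ?thesis by (auto simp: b_def vv)
    qed
   qed
   also have "... = b (\<gamma>, T) * ip (yv T) (yv T)" using gc T by (simp add: IX_def)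
   also have "... = coef \<gamma> T h"
   proof (cases "kn m \<gamma> = K")
    case True thus ?thesis using yv_norm[OF T] by (simp add: b_def)
   next
    case False
    hence "sl \<gamma> h = 0" using Suc.prems(2)[of \<gamma>] ge by fastforce
    thus ?thesis using False by (simp add: b_def coef_def)
   qed
   finally show ?thesis by simp
  qed
  thus False using NM_coef_zero[OF h'N] nz by blast
 qed
 obtain a where a: "h' = (\<Sum>v\<in>IX m. sc (a v) (fw c (fst v) (snd v)))" "\<forall>v\<in>IX m. K \<le> kn m (fst v) --> a v = 0"
  using Suc.IH[OF h'N small] by blast
 have "h = (\<Sum>v\<in>IX m. sc (a v + b v) (fw c (fst v) (snd v)))"
  using a(1) by (simp add: h'_def fv.scale_left_distrib sum.distrib algebra_simps)
 thus ?case using a(2) by (intro exI[of _ "%v. a v + b v"]) (auto simp: b_def)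
qed

end

section \<open>The norm at a negative integer\<close>

lemma sum_triangle:
 fixes F :: "nat => nat => 'a :: comm_monoid_add"
 shows "(\<Sum>s\<in>{1..n}. \<Sum>t\<in>{s<..n}. F s t) = (\<Sum>t\<in>{1..n}. \<Sum>s\<in>{1..<t}. F s t)"
 unfolding sum.Sigma[OF finite_atLeastAtMost ballI[OF finite_greaterThanAtMost]]
  sum.Sigma[OF finite_atLeastAtMost ballI[OF finite_atLeastLessThan]]
 by (rule sum.reindex_bij_witness[of _ "%(t, s). (s, t)" "%(s, t). (t, s)"]) auto

text \<open>At c = -k a factor l - c e vanishes for l = -k e, and the range of l is long enough to contain this value when e is
 negative.\<close>

lemma count_hits:
 assumes "\<bar>e\<bar> \<le> int n" "k * n \<le> g" "1 \<le> k"
 shows "(\<Sum>l\<in>{1..g}. if real l = - real k * of_int e then 1 else 0) = (if e < 0 then 1 else (0::int))"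
proof -
 have eq: "real l = - real k * of_int e \<longleftrightarrow> int l = int k * (- e)" for l
 proof -
  have "- real k * of_int e = of_int (int k * (- e))" by simp
  thus ?thesis by (metis of_int_eq_iff of_int_of_nat_eq)
 qed
 show ?thesis
 proof (cases "e < 0")
  case True
  define l0 where "l0 = k * nat (- e)"
  have "nat (- e) \<le> n" "1 \<le> nat (- e)" using True assms(1) by auto
  hence l0: "l0 \<le> g" "1 \<le> l0"
   using assms(2) mult_le_mono2[of "nat (- e)" n k] mult_le_mono[OF assms(3), of 1 "nat (- e)"]
   unfolding l0_def by linarith+
  have "int l = int k * (- e) \<longleftrightarrow> l = l0" for l
  proof -
   have "int k * (- e) = int l0" using True by (simp add: l0_def)
   thus ?thesis by simp
  qed
  hence "(\<Sum>l\<in>{1..g}. if real l = - real k * of_int e then 1 else 0) = (\<Sum>l\<in>{1..g}. if l = l0 then 1 else (0::int))"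
   unfolding eq by (intro sum.cong) simp_all
  thus ?thesis using True l0 by simp
 next
  case False
  hence "int k * (- e) \<le> 0" by (simp add: mult_nonneg_nonneg)
  hence "\<And>l. l \<in> {1..g} ==> int l ~= int k * (- e)" by auto
  thus ?thesis using False by (simp only: eq if_False) (auto intro!: sum.neutral)
 qed
qed

context young
begin

text \<open>For L > k n all products in NN at c = -k run past their zeros and poles.\<close>

definition wide :: "nat => (nat => nat) => bool" where
 "wide L \<alpha> \<longleftrightarrow> (\<forall>i\<in>Ix. L \<le> \<alpha> i) & (\<forall>i\<in>Ix. \<forall>j\<in>Ix. i ~= j --> int L \<le> \<bar>int (\<alpha> i) - int (\<alpha> j)\<bar>)"

text \<open>Summing the identity for the diagonals over all entries t gives the total order of vanishing of the norm for wide
 exponents.\<close>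

lemma order_identity:
 assumes T: "T \<in> SYT"
 shows "(\<Sum>s\<in>Ix. if ct T s < 0 then 1 else 0) + (\<Sum>s\<in>Ix. \<Sum>t\<in>{s<..n}.
  (if ct T t - ct T s - 1 < 0 then 1 else 0) + (if ct T t - ct T s + 1 < 0 then 1 else 0)
  - 2 * (if ct T t - ct T s < 0 then 1 else 0)) = (0::int)"
proof -
 have c: "(\<Sum>s\<in>{1..<t}. (if ct T t - ct T s - 1 < 0 then 1 else 0) + (if ct T t - ct T s + 1 < 0 then 1 else 0)
  - 2 * (if ct T t - ct T s < 0 then 1 else 0)) = int (card {j \<in> {1..<t}. ct T j = ct T t}) - int (card {j \<in> {1..<t}. ct T j = ct T t + 1})" for t
 proof -
  have k: "int (card {j \<in> {1..<t}. P j}) = (\<Sum>s\<in>{1..<t}. if P s then 1 else 0)" for P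
   by (simp add: sum.If_cases Int_def)
  show ?thesis unfolding k sum_subtractf[symmetric] by (rule sum.cong) auto
 qed
 have "(if ct T t < 0 then 1 else 0) + (int (card {j \<in> {1..<t}. ct T j = ct T t}) - int (card {j \<in> {1..<t}. ct T j = ct T t + 1})) = 0"
  if "t \<in> Ix" for t
  using theta_identity[OF T that] by linarith
 thus ?thesis unfolding sum_triangle c sum.distrib[symmetric] by (intro sum.neutral ballI) blast
qed

lemma NN_tz:
 assumes T: "T \<in> SYT" and k: "1 \<le> k" and w: "wide (Suc (k * n)) \<alpha>" and c0: "c0 = - real k"
 shows "tz c0 (%c. NN c \<alpha> T) 0"
proof -
 let ?o = "%l e. if real l = - real k * of_int e then 1 else (0::int)"
 have lin: "tz c0 (%c. real l - c * of_int e) (?o l e)" if "l \<in> {1..g}" for l e g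
  using tz_linear[of "real l" c0 "of_int e"] that c0 by simp
 have q: "tz c0 (%c. qq c l D) (?o l (D - 1) + ?o l (D + 1) - 2 * ?o l D)" if l: "l \<in> {1..g}" for l D g
 proof -
  have "tz c0 (%c. (real l - c * of_int (D - 1)) * (real l - c * of_int (D + 1)) *
    (inverse (real l - c * of_int D) * inverse (real l - c * of_int D)))
   (?o l (D - 1) + ?o l (D + 1) + (- ?o l D + - ?o l D))"
   by (intro tz_mult tz_inverse lin[OF l])
  thus ?thesis unfolding qq_def by (simp add: divide_inverse power2_eq_square)
 qed
 have gg: "k * n \<le> gg \<alpha> s" if "s \<in> Ix" for s
  using w so_in[OF that, of \<alpha>] unfolding wide_def gg_def by (metis Suc_leD)
 have GG: "k * n \<le> GG \<alpha> s t" if s: "s \<in> Ix" "t \<in> Ix" "s < t" for s t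
 proof -
  have "so \<alpha> s ~= so \<alpha> t" using s by (metis rk_so(1) nat_neq_iff)
  define K where "K = k * n"
  have "int (Suc K) \<le> \<bar>int (gg \<alpha> s) - int (gg \<alpha> t)\<bar>"
   using w so_in[OF s(1), of \<alpha>] so_in[OF s(2), of \<alpha>] \<open>so \<alpha> s ~= so \<alpha> t\<close> unfolding wide_def gg_def K_def by blast
  thus ?thesis using gg_less[OF s, of \<alpha>] unfolding K_def[symmetric] by (auto simp: GG_def)
 qed
 have "tz c0 (%c. N1 c \<alpha> T) (\<Sum>s\<in>Ix. \<Sum>l\<in>{1..gg \<alpha> s}. ?o l (ct T s))"
  unfolding N1_def by (intro tz_prod lin) auto
 also have "(\<Sum>s\<in>Ix. \<Sum>l\<in>{1..gg \<alpha> s}. ?o l (ct T s)) = (\<Sum>s\<in>Ix. if ct T s < 0 then 1 else 0)"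
  by (rule sum.cong[OF refl], rule count_hits[OF ct_le[OF T] gg k])
 finally have A: "tz c0 (%c. N1 c \<alpha> T) (\<Sum>s\<in>Ix. if ct T s < 0 then 1 else 0)" .
 have "tz c0 (%c. N2 c \<alpha> T) (\<Sum>s\<in>Ix. \<Sum>t\<in>{s<..n}. \<Sum>l\<in>{1..GG \<alpha> s t}.
   ?o l (ct T t - ct T s - 1) + ?o l (ct T t - ct T s + 1) - 2 * ?o l (ct T t - ct T s))"
  unfolding N2_def by (intro tz_prod q) auto
 also have "(\<Sum>s\<in>Ix. \<Sum>t\<in>{s<..n}. \<Sum>l\<in>{1..GG \<alpha> s t}.
   ?o l (ct T t - ct T s - 1) + ?o l (ct T t - ct T s + 1) - 2 * ?o l (ct T t - ct T s)) =
  (\<Sum>s\<in>Ix. \<Sum>t\<in>{s<..n}. (if ct T t - ct T s - 1 < 0 then 1 else 0) + (if ct T t - ct T s + 1 < 0 then 1 else 0)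
  - 2 * (if ct T t - ct T s < 0 then 1 else 0))"
 proof (intro sum.cong[OF refl])
  fix s t assume s: "s \<in> Ix" and t: "t \<in> {s<..n}"
  have t': "t \<in> Ix" "s < t" using s t by auto
  have d: "\<bar>ct T t - ct T s\<bar> + 1 \<le> int n" by (rule ct_diff_le[OF T t'(1) s])
  show "(\<Sum>l\<in>{1..GG \<alpha> s t}. ?o l (ct T t - ct T s - 1) + ?o l (ct T t - ct T s + 1) - 2 * ?o l (ct T t - ct T s)) =
   (if ct T t - ct T s - 1 < 0 then 1 else 0) + (if ct T t - ct T s + 1 < 0 then 1 else 0) - 2 * (if ct T t - ct T s < 0 then 1 else 0)"
   unfolding sum.distrib sum_subtractf sum_distrib_left[symmetric]
   using d by (subst (1 2 3) count_hits[OF _ GG[OF s t'] k]) auto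
 qed
 finally have "tz c0 (%c. NN c \<alpha> T) ((\<Sum>s\<in>Ix. if ct T s < 0 then 1 else 0) + (\<Sum>s\<in>Ix. \<Sum>t\<in>{s<..n}.
  (if ct T t - ct T s - 1 < 0 then 1 else 0) + (if ct T t - ct T s + 1 < 0 then 1 else 0) - 2 * (if ct T t - ct T s < 0 then 1 else 0)))"
  unfolding NN_def by (rule tz_mult[OF A])
 thus ?thesis unfolding order_identity[OF T] .
qed

lemma gen_near_int: "\<forall>\<^sub>F c in at (of_int z). gen c"
 unfolding eventually_at
proof (intro exI[of _ "1 / (real n + 1)"] conjI ballI impI)
 fix c :: real assume c: "c ~= of_int z & dist c (of_int z) < 1 / (real n + 1)"
 show "gen c" unfolding gen_def
 proof (intro allI impI notI)
  fix k :: int assume k: "k ~= 0 & \<bar>k\<bar> \<le> int n" and "c * of_int k \<in> \<int>"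
  hence "c * of_int k - of_int z * of_int k \<in> \<int>" by (intro Ints_diff) auto
  then obtain j where "c * of_int k - of_int z * of_int k = of_int j" by (elim Ints_cases)
  hence j: "(c - of_int z) * of_int k = of_int j" by (simp only: left_diff_distrib)
  have "\<bar>(c - of_int z) * of_int k\<bar> < 1"
  proof -
   have "\<bar>real_of_int k\<bar> \<le> real n" using k by linarith
   hence "\<bar>c - of_int z\<bar> * \<bar>real_of_int k\<bar> \<le> \<bar>c - of_int z\<bar> * (real n + 1)" by (intro mult_left_mono) auto
   also have "... < 1" using c by (simp add: dist_real_def field_simps)
   finally show ?thesis by (simp add: abs_mult)
  qed
  hence "j = 0" unfolding j by simp
  thus False using j c k by simp
 qed
qed auto

section \<open>The radical\<close>

definition Rad :: "real => nat => mv set" where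
 "Rad c m = {f \<in> NM m. \<forall>g\<in>NM m. BB (of_real c) f g = 0}"

lemma Rad_XX: "i \<in> Ix ==> f \<in> Rad c m ==> XX i f \<in> Rad c (Suc m)"
 unfolding Rad_def using XX_NM YY_NM by (auto simp: BB_XX simp del: atLeastAtMost_iff)

lemma Rad_ZZ: "i \<in> Ix ==> f \<in> Rad c m ==> ZZ (of_real c) i f - sc a f \<in> Rad c m"
 unfolding Rad_def using ZZ_NM NM_NC by (auto simp: BB_ZZ BB_simps simp del: atLeastAtMost_iff intro!: NM_closed)

text \<open>Multiplication by x^\<beta> is injective and preserves the radical.\<close>

lemma Rad_shift:
 assumes f: "f \<in> Rad c m" "f ~= 0" and b: "\<beta> \<in> cm M"
 shows "\<exists>f'\<in>Rad c (m + M). f' ~= 0 & (\<forall>\<gamma>. sl \<gamma> f' ~= 0 --> (\<exists>\<alpha>\<in>cm m. \<gamma> = (%i. \<alpha> i + \<beta> i)))"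
 using b
proof (induction M arbitrary: \<beta>)
 case 0
 have "f \<in> NM m" using f by (simp add: Rad_def)
 hence "\<gamma> \<in> cm m" if "sl \<gamma> f ~= 0" for \<gamma> using sl_NM that by blast
 thus ?case using f 0 by (intro bexI[of _ f]) (auto simp: cm_0)
next
 case (Suc M)
 obtain k \<beta>' where k: "k \<in> Ix" "\<beta>' \<in> cm M" "\<beta> = up k \<beta>'" using cm_Suc Suc.prems by blast
 obtain f' where f': "f' \<in> Rad c (m + M)" "f' ~= 0" "\<And>\<gamma>. sl \<gamma> f' ~= 0 ==> \<exists>\<alpha>\<in>cm m. \<gamma> = (%i. \<alpha> i + \<beta>' i)"
  using Suc.IH[OF k(2)] by blast
 have e: "XX k f' = (\<Sum>\<alpha>\<in>fst ` ks f'. xv (up k \<alpha>) (sl \<alpha> f'))"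
  by (subst mv_expand[of f']) (simp only: XX_lops XX_xv)
 show ?case
 proof (intro bexI[of _ "XX k f'"] conjI allI impI)
  show "XX k f' \<in> Rad c (m + Suc M)" using Rad_XX[OF k(1) f'(1)] by simp
  obtain \<gamma> where "sl \<gamma> f' ~= 0" using f'(2) mv_eq_iff_sl[of f' 0] by (auto simp: sl_lops)
  hence "sl (up k \<gamma>) (XX k f') ~= 0" by (simp add: sl_XX)
  thus "XX k f' ~= 0" by (auto simp: sl_lops)
  fix \<gamma> assume g: "sl \<gamma> (XX k f') ~= 0"
  have "\<exists>\<alpha>. \<gamma> = up k \<alpha> & sl \<alpha> f' ~= 0"
  proof (rule ccontr)
   assume no: "\<not> ?thesis"
   have "sl \<gamma> (XX k f') = 0" unfolding e sl_lops sl_xv by (rule sum.neutral) (use no in auto)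
   thus False using g by simp
  qed
  then obtain \<delta> \<alpha> where "\<gamma> = up k \<delta>" "\<alpha> \<in> cm m" "\<delta> = (%i. \<alpha> i + \<beta>' i)" using f'(3) by blast
  thus "\<exists>\<alpha>\<in>cm m. \<gamma> = (%i. \<alpha> i + \<beta> i)" using k(3) by (intro bexI[of _ \<alpha>]) (auto simp: up_def fun_eq_iff)
 qed
qed

text \<open>The product over a list of weights w of the operators ZZ i - z w, with i depending on w. It kills all weight vectors
 whose weight is in the list and serves as a spectral projector, up to a scalar that stays polynomial in the
 parameter.\<close>

definition Qo :: "real => ('b => nat) => (real => 'b => real) => 'b list => mv => mv" where
 "Qo c iw z ws u = foldr (%w u. ZZ (of_real c) (iw w) u - sc (of_real (z c w)) u) ws u"

lemma Qo_simps: "Qo c iw z [] u = u" "Qo c iw z (w # ws) u = ZZ (of_real c) (iw w) (Qo c iw z ws u) - sc (of_real (z c w)) (Qo c iw z ws u)"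
 by (simp_all add: Qo_def)

lemma linear_Qo: "linear_op (Qo c iw z ws)"
proof (induction ws)
 case Nil thus ?case using lin_idI by (simp add: Qo_simps linear_op_def)
next
 case (Cons w ws)
 thus ?case using lin_minusI[OF lin_compI[OF linear_ZZ Cons] lin_scaledI[OF Cons]]
  by (simp add: Qo_simps linear_op_def)
qed

lemma Qo_Rad: "(\<And>w. w \<in> set ws ==> iw w \<in> Ix) ==> f \<in> Rad c m ==> Qo c iw z ws f \<in> Rad c m"
 by (induction ws) (simp_all only: Qo_simps, auto intro!: Rad_ZZ simp del: atLeastAtMost_iff)

lemma Qo_eig: "(\<And>w. w \<in> set ws ==> iw w \<in> Ix) ==> (\<And>i. i \<in> Ix ==> ZZ (of_real c) i f = sc (of_real (y i)) f) ==>
 Qo c iw z ws f = sc (of_real (\<Prod>w\<leftarrow>ws. y (iw w) - z c w)) f"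
 by (induction ws) (simp_all add: Qo_simps ZZ_lops fv.scale_left_diff_distrib[symmetric] left_diff_distrib mult.commute)

lemma pfam_Qo: "(\<And>w. continuous_on UNIV (%c. z c w)) ==> pfam (%c. Qo c iw z ws f)"
proof (induction ws)
 case Nil thus ?case by (simp add: Qo_simps pfam.const)
next
 case (Cons w ws)
 have P: "pfam (%c. Qo c iw z ws f)" using Cons by blast
 have "pfam (%c. ZZ (of_real c) (iw w) (Qo c iw z ws f) + sc (- of_real (z c w)) (Qo c iw z ws f))"
  by (rule pfam.add[OF pfam_ZZ[OF P] pfam.scale[OF _ P]]) (intro continuous_intros Cons.prems)
 thus ?case by (simp add: Qo_simps)
qed

subsection \<open>Nondegeneracy at negative integers\<close>

lemma coef_basis: "T \<in> SYT ==> T' \<in> SYT ==>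
 coef \<beta> T' (xv \<alpha> (pv \<alpha> T)) = (if (\<beta>, T') = (\<alpha>, T) then ip (yv T) (yv T) else 0)"
 by (auto simp: coef_def sl_xv ip_pv)

text \<open>Multiply a radical vector by a monomial that makes its exponents wide. Let E be the set of pairs whose weights agree
 at c0 with the weight v0 of a leading term of the resulting vector f'; weights that agree at c0 have exponents
 differing by at most k n, so all pairs in E have wide exponents. Consider the vectors b w for w in E, namely f' for w
 = v0 and x^\<alpha> pv \<alpha> T for the other pairs w = (\<alpha>, T), and the matrix M(c) of the form between Q(c)
 (b w) and b u, where Q(c) kills all weights outside of E. For generic c near c0 it is the product of a triangular
 matrix, the diagonal matrix of eigenvalues of Q times norms, and the adjoint of the triangular matrix. Therefore det
 M(c) tends to a nonzero number. But det M is continuous, and at c0 the row of f' is zero.\<close>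

lemma nondeg_int:
 assumes k: "1 \<le> k" and c0: "c0 = - real k" and f: "f \<in> Rad c0 m0"
 shows "f = 0"
proof (rule ccontr)
 assume f0: "f ~= 0"
 \<comment> \<open>three times k n, because each of the two entries compared below may move by k n\<close>
 define L where "L = Suc (3 * (k * n))"
 define B where "B = L + m0"
 \<comment> \<open>exponents of degree m0 have entries at most m0, so adding multiples of L + m0 keeps distance L\<close>
 define \<beta> where "\<beta> = (%i. if i \<in> Ix then B * i else 0)"
 have bc: "\<beta> \<in> cm (\<Sum>i\<in>Ix. \<beta> i)" by (auto simp: cm_def comps_def \<beta>_def)
 define m where "m = m0 + (\<Sum>i\<in>Ix. \<beta> i)"
 obtain f' where f': "f' \<in> Rad c0 m" "f' ~= 0"
   "\<And>\<gamma>. sl \<gamma> f' ~= 0 ==> \<exists>\<alpha>\<in>cm m0. \<gamma> = (%i. \<alpha> i + \<beta> i)"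
  using Rad_shift[OF f f0 bc] unfolding m_def by blast
 have f'N: "f' \<in> NM m" using f'(1) by (simp add: Rad_def)
 have wideL: "wide L \<gamma>" if nzg: "sl \<gamma> f' ~= 0" for \<gamma>
 proof -
  obtain \<alpha> where a: "\<alpha> \<in> cm m0" "\<gamma> = (%i. \<alpha> i + \<beta> i)" using f'(3)[OF nzg] by blast
  have am: "\<alpha> i \<le> m0" if "i \<in> Ix" for i
   using member_le_sum[OF that, of \<alpha>] a(1) by (auto simp: cm_def)
  have step: "int L \<le> \<bar>int (\<gamma> i) - int (\<gamma> j)\<bar>" if ij: "i \<in> Ix" "j \<in> Ix" "i < j" for i j
  proof -
   obtain d where d: "j = i + Suc d" using ij(3) less_iff_Suc_add[of i j] by auto
   have "\<beta> j = \<beta> i + B + B * d" using ij by (simp add: \<beta>_def d algebra_simps)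
   hence "\<gamma> i + L \<le> \<gamma> j" using am[OF ij(1)] B_def le0[of "B * d"] unfolding a(2) by linarith
   thus ?thesis by simp
  qed
  show ?thesis unfolding wide_def
  proof (intro conjI ballI impI)
   fix i assume i: "i \<in> Ix"
   hence "B * 1 \<le> B * i" by (intro mult_le_mono2) auto
   moreover have "\<gamma> i = \<alpha> i + B * i" using i by (simp add: a(2) \<beta>_def)
   ultimately show "L \<le> \<gamma> i" using B_def by linarith
  next
   fix i j assume "i \<in> Ix" "j \<in> Ix" "i ~= j"
   thus "int L \<le> \<bar>int (\<gamma> i) - int (\<gamma> j)\<bar>" using step[of i j] step[of j i] by (cases "i < j") auto
  qed
 qed
 let ?S = "{\<gamma>. sl \<gamma> f' ~= 0}"
 have Sfin: "finite ?S" by (rule finite_subset[of _ "fst ` ks f'"]) (use sl_ks in auto)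
 have "?S ~= {}" using f'(2) mv_eq_iff_sl[of f' 0] by (auto simp: sl_lops)
 hence "Max (kn m ` ?S) \<in> kn m ` ?S" using Sfin by (intro Max_in) auto
 then obtain \<alpha>0 where a0: "sl \<alpha>0 f' ~= 0" "kn m \<alpha>0 = Max (kn m ` ?S)" by auto
 have top: "kn m \<gamma> \<le> kn m \<alpha>0" if "sl \<gamma> f' ~= 0" for \<gamma>
  unfolding a0(2) using Sfin that by (intro Max_ge) auto
 have a0c: "\<alpha>0 \<in> cm m" using sl_NM[OF f'N] a0(1) by blast
 obtain T0 where T0: "T0 \<in> SYT" "coef \<alpha>0 T0 f' ~= 0" using NM_coef_zero[OF f'N] a0(1) by blast
 \<comment> \<open>the weight of a leading term of the radical vector\<close>
 define v0 where "v0 = (\<alpha>0, T0)"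
 have v0I: "v0 \<in> IX m" using a0c T0 by (simp add: v0_def IX_def)
 define zc where "zc c v = zr c (fst v) (snd v)" for c and v :: "(nat => nat) \<times> tableau"
 define E where "E = {v \<in> IX m. \<forall>i\<in>Ix. zc c0 v i = zc c0 v0 i}"
 have Efin: "finite E" unfolding E_def by simp
 have v0E: "v0 \<in> E" using v0I by (simp add: E_def)
 have EI: "v \<in> IX m" if "v \<in> E" for v using that by (simp add: E_def)
 have wideE: "wide (Suc (k * n)) (fst v)" if v: "v \<in> E" for v
 proof -
  have T: "snd v \<in> SYT" using EI[OF v] by (auto simp: IX_def)
  have close: "\<bar>int (fst v i) - int (\<alpha>0 i)\<bar> \<le> int (k * n)" if i: "i \<in> Ix" for i
  proof -
   let ?d = "ct (snd v) (rk (fst v) i) - ct T0 (rk \<alpha>0 i)"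
   have "zr c0 (fst v) (snd v) i = zr c0 \<alpha>0 T0 i" using v i by (simp add: E_def zc_def v0_def)
   hence "real_of_int (int (fst v i) - int (\<alpha>0 i)) = of_int (- int k * ?d)"
    by (simp add: zr_def c0 algebra_simps)
   hence "int (fst v i) - int (\<alpha>0 i) = - int k * ?d" by (simp only: of_int_eq_iff)
   moreover have "\<bar>?d\<bar> \<le> int n" using bo_content_bound[OF T T0(1) rk_in[OF i] rk_in[OF i], of "fst v" \<alpha>0] by simp
   hence "int k * \<bar>?d\<bar> \<le> int k * int n" by (intro mult_left_mono) auto
   ultimately show ?thesis by (simp add: abs_mult)
  qed
  define K where "K = k * n"
  have w0: "wide (Suc (3 * K)) \<alpha>0" using wideL[OF a0(1)] unfolding L_def K_def .
  show ?thesis unfolding wide_def K_def[symmetric]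
  proof (intro conjI ballI impI)
   fix i assume i: "i \<in> Ix"
   hence "Suc (3 * K) \<le> \<alpha>0 i" using w0 unfolding wide_def by blast
   thus "Suc K \<le> fst v i" using close[OF i] unfolding K_def[symmetric] by linarith
  next
   fix i j assume ij: "i \<in> Ix" "j \<in> Ix" "i ~= j"
   hence "int (Suc (3 * K)) \<le> \<bar>int (\<alpha>0 i) - int (\<alpha>0 j)\<bar>" using w0 unfolding wide_def by blast
   thus "int (Suc K) \<le> \<bar>int (fst v i) - int (fst v j)\<bar>"
    using close[OF ij(1)] close[OF ij(2)] unfolding K_def[symmetric] by linarith
  qed
 qed
 \<comment> \<open>for each weight outside of E an index at which it can be told apart from v0 at c0\<close>
 define iw where "iw w = (SOME i. i \<in> Ix & zc c0 w i ~= zc c0 v0 i)" for w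
 have iw: "iw w \<in> Ix & zc c0 w (iw w) ~= zc c0 v0 (iw w)" if "w \<in> IX m - E" for w
  unfolding iw_def by (rule someI_ex) (use that in \<open>auto simp: E_def\<close>)
 obtain ws where ws: "set ws = IX m - E" using finite_list[of "IX m - E"] by auto
 have iws: "\<And>w. w \<in> set ws ==> iw w \<in> Ix" using iw ws by blast
 define Q where "Q c = Qo c iw (%c w. zc c w (iw w)) ws" for c
 define q where "q c v = (\<Prod>w\<leftarrow>ws. zc c v (iw w) - zc c w (iw w))" for c v
 define F where "F c v = fw c (fst v) (snd v)" for c and v :: "(nat => nat) \<times> tableau"
 define h where "h v = ip (yv (snd v)) (yv (snd v))" for v :: "(nat => nat) \<times> tableau"
 define N where "N c v = NN c (fst v) (snd v)" for c and v :: "(nat => nat) \<times> tableau"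
 define b where "b w = (if w = v0 then f' else xv (fst w) (pv (fst w) (snd w)))" for w
 define d where "d w = (if w = v0 then coef \<alpha>0 T0 f' / h v0 else 1)" for w
 \<comment> \<open>the key, doubled to place v0 after the other pairs with the same key\<close>
 define \<kappa> where "\<kappa> v = 2 * kn m (fst v) + (if v = v0 then 1 else 0)" for v
 have IXD: "fst v \<in> cm m" "snd v \<in> SYT" if "v \<in> IX m" for v using that by (auto simp: IX_def)
 have hnz: "h v ~= 0" if "v \<in> IX m" for v unfolding h_def by (rule yv_norm[OF IXD(2)[OF that]])
 have dnz: "d w ~= 0" for w using T0(2) hnz[OF v0I] by (simp add: d_def)
 have bN: "b w \<in> NM m" if "w \<in> E" for w
  using f'N IXD[OF EI[OF that]] by (auto simp: b_def intro!: NM_xv pv_VV)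
 have expand: "\<exists>a. b w = (\<Sum>v\<in>IX m. sc (a v) (F c v)) & a w = d w & (\<forall>v\<in>IX m. a v ~= 0 --> v = w \<or> \<kappa> v < \<kappa> w)"
  if g: "gen c" and w: "w \<in> E" for c w
 proof -
  have K: "kn m \<gamma> < Suc (kn m (fst w))" if "sl \<gamma> (b w) ~= 0" for \<gamma>
   using that top by (auto simp: b_def sl_xv v0_def less_Suc_eq_le split: if_splits)
  obtain a where a: "b w = (\<Sum>v\<in>IX m. sc (a v) (F c v))" "\<And>v. v \<in> IX m ==> Suc (kn m (fst w)) \<le> kn m (fst v) ==> a v = 0"
   "\<And>v. v \<in> IX m ==> kn m (fst v) = kn m (fst w) ==> a v = coef (fst v) (snd v) (b w) / h v"
   using fw_expand[OF g bN[OF w] K] unfolding F_def h_def by auto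
  have wI: "w \<in> IX m" by (rule EI[OF w])
  have "a w = d w"
   using a(3)[OF wI] hnz[OF wI] coef_basis[OF IXD(2)[OF wI] IXD(2)[OF wI], of "fst w" "fst w"]
   by (auto simp: b_def d_def h_def v0_def)
  moreover have "v = w \<or> \<kappa> v < \<kappa> w" if v: "v \<in> IX m" and nz: "a v ~= 0" for v
  proof (cases "kn m (fst v) < kn m (fst w)")
   case True thus ?thesis unfolding \<kappa>_def by (cases "v = v0"; cases "w = v0") auto
  next
   case False
   hence e: "kn m (fst v) = kn m (fst w)" using a(2)[OF v] nz by fastforce
   show ?thesis
   proof (cases "w = v0")
    case True thus ?thesis using e by (auto simp: \<kappa>_def)
   next
    case False
    thus ?thesis using a(3)[OF v e] nz coef_basis[OF IXD(2)[OF wI] IXD(2)[OF v], of "fst v" "fst w"]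
     by (auto simp: b_def prod_eq_iff split: if_splits)
   qed
  qed
  ultimately show ?thesis using a(1) by blast
 qed
 define es where "es = sort_key \<kappa> (SOME xs. set xs = E & distinct xs)"
 have esE: "set es = E" "distinct es" "sorted (map \<kappa> es)"
  using someI_ex[OF finite_distinct_list[OF Efin]] unfolding es_def by auto
 define r where "r = length es"
 have esn: "es ! i \<in> E" if "i < r" for i using that esE(1) by (auto simp: r_def)
 define M where "M c = mat r r (%(i, j). BB (of_real c) (Q c (b (es ! i))) (b (es ! j)))" for c
 have Mcont: "continuous_on UNIV (%c. det (M c))"
  unfolding M_def Q_def
  by (intro continuous_det BB_continuous pfam_Qo) (auto simp: zc_def zr_def intro!: continuous_intros)
 have Mdet: "det (M c) = (\<Prod>w\<in>E. d w * (of_real (q c w * N c w) * h w * cnj (d w)))" if g: "gen c" for c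
 proof -
  have "\<forall>w\<in>E. \<exists>a. b w = (\<Sum>v\<in>IX m. sc (a v) (F c v)) & a w = d w & (\<forall>v\<in>IX m. a v ~= 0 --> v = w \<or> \<kappa> v < \<kappa> w)"
   using expand[OF g] by blast
  from bchoice[OF this] obtain t where t0: "\<forall>w\<in>E. b w = (\<Sum>v\<in>IX m. sc (t w v) (F c v)) & t w w = d w &
    (\<forall>v\<in>IX m. t w v ~= 0 --> v = w \<or> \<kappa> v < \<kappa> w)" by blast
  have t: "\<And>w. w \<in> E ==> b w = (\<Sum>v\<in>IX m. sc (t w v) (F c v))" "\<And>w. w \<in> E ==> t w w = d w"
    "\<And>w v. w \<in> E ==> v \<in> IX m ==> t w v ~= 0 ==> v = w \<or> \<kappa> v < \<kappa> w"
   using t0 by blast+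
  have isF: "isw c (fst v) (snd v) (F c v)" if "v \<in> IX m" for v
   unfolding F_def by (rule fw(1)[OF g IXD[OF that]])
  have QF: "Q c (F c v) = sc (of_real (q c v)) (F c v)" if v: "v \<in> IX m" for v
   unfolding Q_def q_def by (rule Qo_eig[OF iws]) (use isF[OF v] in \<open>auto simp: isw_def zc_def\<close>)
  have q0: "q c v = 0" if "v \<in> IX m - E" for v
   unfolding q_def using that ws by (force simp: prod_list_zero_iff)
  have FF: "BB (of_real c) (F c v) (F c v') = (if v = v' then of_real (N c v) * h v else 0)"
   if v: "v \<in> IX m" "v' \<in> IX m" for v v'
  proof (cases "v = v'")
   case True thus ?thesis using fw(2)[OF g IXD[OF v(1)]] by (simp add: F_def N_def h_def)
  next
   case False
   thus ?thesis using isw_orth[OF g IXD(2)[OF v(1)] IXD(2)[OF v(2)] isF[OF v(1)] isF[OF v(2)]] by simp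
  qed
  have entry: "BB (of_real c) (Q c (b w)) (b u) = (\<Sum>v\<in>E. t w v * (of_real (q c v * N c v) * h v * cnj (t u v)))"
   if w: "w \<in> E" "u \<in> E" for w u
  proof -
   have "Q c (b w) = (\<Sum>v\<in>IX m. sc (t w v * of_real (q c v)) (F c v))"
    unfolding t(1)[OF w(1)] by (simp add: Q_def lops[OF linear_Qo]) (simp add: Q_def[symmetric] QF)
   hence "BB (of_real c) (Q c (b w)) (b u) = (\<Sum>v\<in>IX m. \<Sum>v'\<in>IX m. t w v * of_real (q c v) * (cnj (t u v') * BB (of_real c) (F c v) (F c v')))"
    unfolding t(1)[OF w(2)] by (simp only: BB_sum_left, simp only: BB_sum_right BB_simps, simp add: sum_distrib_left mult_ac)
   also have "... = (\<Sum>v\<in>IX m. \<Sum>v'\<in>IX m. if v = v' then t w v * (of_real (q c v * N c v) * h v * cnj (t u v)) else 0)"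
    by (intro sum.cong refl) (auto simp: FF)
   also have "... = (\<Sum>v\<in>IX m. t w v * (of_real (q c v * N c v) * h v * cnj (t u v)))" by simp
   also have "... = (\<Sum>v\<in>E. t w v * (of_real (q c v * N c v) * h v * cnj (t u v)))"
    by (rule sum.mono_neutral_right) (use q0 EI in auto)
   finally show ?thesis .
  qed
  have tri: "t (es ! i) (es ! j) = 0" if ij: "i < r" "j < r" "i < j" for i j
  proof (rule ccontr)
   assume "t (es ! i) (es ! j) ~= 0"
   moreover have "es ! j ~= es ! i" using ij esE(2) by (auto simp: r_def nth_eq_iff_index_eq)
   ultimately have "\<kappa> (es ! j) < \<kappa> (es ! i)" using t(3)[OF esn[OF ij(1)] EI[OF esn[OF ij(2)]]] by blast
   moreover have "map \<kappa> es ! i \<le> map \<kappa> es ! j" by (rule sorted_nth_mono[OF esE(3)]) (use ij in \<open>auto simp: r_def\<close>)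
   ultimately show False using ij by (simp add: r_def)
  qed
  define A where "A = mat r r (%(i, j). t (es ! i) (es ! j))"
  define V where "V = mat r r (%(i, j). of_real (q c (es ! i) * N c (es ! i)) * h (es ! i) * cnj (t (es ! j) (es ! i)))"
  have bij: "bij_betw ((!) es) {0..<r} E" by (simp add: r_def esE(1)[symmetric] atLeast0LessThan bij_betw_nth esE(2))
  have "M c = A * V"
  proof (rule eq_matI)
   fix i j assume ij: "i < dim_row (A * V)" "j < dim_col (A * V)"
   hence i: "i < r" "j < r" by (auto simp: A_def V_def)
   have "(A * V) $$ (i, j) = (\<Sum>l\<in>{0..<r}. t (es ! i) (es ! l) * (of_real (q c (es ! l) * N c (es ! l)) * h (es ! l) * cnj (t (es ! j) (es ! l))))"
    using i by (simp add: A_def V_def scalar_prod_def)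
   also have "... = (\<Sum>v\<in>E. t (es ! i) v * (of_real (q c v * N c v) * h v * cnj (t (es ! j) v)))"
    by (rule sum.reindex_bij_betw[OF bij])
   finally show "M c $$ (i, j) = (A * V) $$ (i, j)" using i by (simp add: M_def entry[OF esn esn])
  qed (auto simp: M_def A_def V_def)
  hence "det (M c) = (\<Prod>i\<in>{0..<r}. A $$ (i, i) * V $$ (i, i))"
   using det_lower_mult_upper[of A r V] tri by (simp add: A_def V_def)
  also have "... = (\<Prod>i\<in>{0..<r}. d (es ! i) * (of_real (q c (es ! i) * N c (es ! i)) * h (es ! i) * cnj (d (es ! i))))"
   by (intro prod.cong refl) (use t(2) esn in \<open>auto simp: A_def V_def\<close>)
  also have "... = (\<Prod>w\<in>E. d w * (of_real (q c w * N c w) * h w * cnj (d w)))"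
   by (rule prod.reindex_bij_betw[OF bij])
  finally show ?thesis .
 qed
 have "\<exists>Ld. Ld ~= 0 & ((%c. \<Prod>w\<in>E. d w * (of_real (q c w * N c w) * h w * cnj (d w))) \<longlongrightarrow> Ld) (at c0)"
 proof -
  have "\<exists>l. l ~= 0 & ((%c. N c w) \<longlongrightarrow> l) (at c0)" if w: "w \<in> E" for w
   using NN_tz[OF IXD(2)[OF EI[OF w]] k wideE[OF w] c0] unfolding tz_def N_def by simp
  then obtain l where l: "\<And>w. w \<in> E ==> l w ~= 0" "\<And>w. w \<in> E ==> ((%c. N c w) \<longlongrightarrow> l w) (at c0)" by metis
  have qt: "((%c. q c w) \<longlongrightarrow> q c0 w) (at c0)" for w
  proof -
   have "continuous_on UNIV (%c. q c w)" unfolding q_def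
    by (induction ws) (auto simp: zc_def zr_def intro!: continuous_intros)
   thus ?thesis by (simp add: continuous_on_def)
  qed
  have qn: "q c0 w ~= 0" if "w \<in> E" for w
  proof
   assume "q c0 w = 0"
   hence "0 \<in> set (map (%x. zc c0 w (iw x) - zc c0 x (iw x)) ws)" by (simp only: q_def prod_list_zero_iff)
   then obtain x where x: "x \<in> set ws" "zc c0 w (iw x) = zc c0 x (iw x)" by (auto simp only: set_map image_iff eq_commute[of 0] right_minus_eq)
   hence "x \<in> IX m - E" using ws by blast
   hence "iw x \<in> Ix" "zc c0 x (iw x) ~= zc c0 v0 (iw x)" using iw by blast+
   moreover have "zc c0 w (iw x) = zc c0 v0 (iw x)" using that calculation(1) unfolding E_def by blast
   ultimately show False using x(2) by simp
  qed
  show ?thesis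
  proof (intro exI conjI)
   show "((%c. \<Prod>w\<in>E. d w * (of_real (q c w * N c w) * h w * cnj (d w))) \<longlongrightarrow>
    (\<Prod>w\<in>E. d w * (of_real (q c0 w * l w) * h w * cnj (d w)))) (at c0)"
    by (intro tendsto_prod tendsto_mult tendsto_const tendsto_of_real qt l)
   show "(\<Prod>w\<in>E. d w * (of_real (q c0 w * l w) * h w * cnj (d w))) ~= 0"
    using Efin dnz qn l(1) hnz EI by (auto simp: prod_zero_iff)
  qed
 qed
 then obtain Ld where Ld: "Ld ~= 0" "((%c. \<Prod>w\<in>E. d w * (of_real (q c w * N c w) * h w * cnj (d w))) \<longlongrightarrow> Ld) (at c0)" by blast
 have "c0 = of_int (- int k)" by (simp add: c0)
 hence "\<forall>\<^sub>F c in at c0. gen c" using gen_near_int by metis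
 hence "\<forall>\<^sub>F c in at c0. (\<Prod>w\<in>E. d w * (of_real (q c w * N c w) * h w * cnj (d w))) = det (M c)"
  by (rule eventually_mono) (simp add: Mdet)
 hence lim1: "((%c. det (M c)) \<longlongrightarrow> Ld) (at c0)" by (rule Lim_transform_eventually[OF Ld(2)])
 have lim2: "((%c. det (M c)) \<longlongrightarrow> det (M c0)) (at c0)" using Mcont by (simp add: continuous_on_def)
 have "det (M c0) = Ld" by (rule tendsto_unique[OF _ lim2 lim1]) simp
 moreover have "det (M c0) = 0"
 proof -
  obtain i0 where i0: "i0 < r" "es ! i0 = v0" using v0E esE(1) unfolding r_def by (metis in_set_conv_nth)
  have "Q c0 f' \<in> Rad c0 m" unfolding Q_def by (rule Qo_Rad[OF iws f'(1)])
  hence z: "M c0 $$ (i0, j) = 0" if "j < r" for j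
   using that i0 bN[OF esn[OF that]] by (simp add: M_def Rad_def b_def[of v0])
  have "M c0 \<in> carrier_mat r r" by (simp add: M_def)
  thus ?thesis
  proof (subst det_def', assumption, intro sum.neutral ballI)
   fix p assume p: "p \<in> {p. p permutes {0..<r}}"
   hence "p i0 < r" using i0(1) permutes_in_image[of p "{0..<r}" i0] by auto
   hence "(\<Prod>i = 0..<r. M c0 $$ (i, p i)) = 0" using i0(1) z by (intro prod_zero bexI[of _ i0]) auto
   thus "signof p * (\<Prod>i = 0..<r. M c0 $$ (i, p i)) = 0" by simp
  qed
 qed
 ultimately show False using Ld(1) by simp
qed

text \<open>The weight vectors form an orthogonal basis with nonzero norms.\<close>

lemma nondeg_gen:
 assumes g: "gen c" and f: "f \<in> Rad c m" shows "f = 0"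
proof -
 have fN: "f \<in> NM m" using f by (simp add: Rad_def)
 have "kn m \<gamma> < Suc (Max (kn m ` fst ` ks f))" if "sl \<gamma> f ~= 0" for \<gamma>
  using sl_ks[OF that] by (auto simp: less_Suc_eq_le intro!: Max_ge)
 then obtain a where a: "f = (\<Sum>v\<in>IX m. sc (a v) (fw c (fst v) (snd v)))" using fw_expand[OF g fN] by blast
 have "a v = 0" if v: "v \<in> IX m" for v
 proof -
  have V: "fst v \<in> cm m" "snd v \<in> SYT" using v by (auto simp: IX_def)
  have "BB (of_real c) f (fw c (fst v) (snd v)) = (\<Sum>u\<in>IX m. a u * BB (of_real c) (fw c (fst u) (snd u)) (fw c (fst v) (snd v)))"
   by (subst a) (simp add: BB_sum_left BB_simps)
  also have "... = (\<Sum>u\<in>IX m. if u = v then a v * (of_real (NN c (fst v) (snd v)) * ip (yv (snd v)) (yv (snd v))) else 0)"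
  proof (intro sum.cong refl)
   fix u assume u: "u \<in> IX m"
   have U: "fst u \<in> cm m" "snd u \<in> SYT" using u by (auto simp: IX_def)
   show "a u * BB (of_real c) (fw c (fst u) (snd u)) (fw c (fst v) (snd v)) = (if u = v then a v * (of_real (NN c (fst v) (snd v)) * ip (yv (snd v)) (yv (snd v))) else 0)"
    using isw_orth[OF g U(2) V(2) fw(1)[OF g U] fw(1)[OF g V]] fw(2)[OF g V] by (cases "u = v") simp_all
  qed
  also have "... = a v * (of_real (NN c (fst v) (snd v)) * ip (yv (snd v)) (yv (snd v)))" using v by simp
  finally show ?thesis using f fw(4)[OF g V] NN_nz[OF g V(2)] yv_norm[OF V(2)] by (simp add: Rad_def)
 qed
 thus ?thesis by (subst a) (simp add: sum.neutral)
qed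

end

section \<open>Signatures of Hermitian matrices\<close>

definition hadj :: "complex mat => complex mat" where
 "hadj A = mat (dim_col A) (dim_row A) (%(i, j). cnj (A $$ (j, i)))"

lemma hadj_carrier [simp]: "A \<in> carrier_mat a b ==> hadj A \<in> carrier_mat b a" by (simp add: hadj_def)
lemma hadj_dim [simp]: "dim_row (hadj A) = dim_col A" "dim_col (hadj A) = dim_row A" by (simp_all add: hadj_def)
lemma hadj_index [simp]: "i < dim_col A ==> j < dim_row A ==> hadj A $$ (i, j) = cnj (A $$ (j, i))" by (simp add: hadj_def)
lemma hadj_hadj [simp]: "hadj (hadj A) = A" by (rule eq_matI) auto
lemma hadj_mult:
 assumes "A \<in> carrier_mat a b" "B \<in> carrier_mat b e" shows "hadj (A * B) = hadj B * hadj A"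
 using assms by (intro eq_matI) (auto simp: scalar_prod_def mult.commute)
lemma hadj_one [simp]: "hadj (1\<^sub>m k) = 1\<^sub>m k" by (rule eq_matI) auto

text \<open>Complete v to a basis, orthogonalise it and normalise the columns.\<close>

lemma unitary_first_column:
 fixes v :: "complex vec"
 assumes v: "v \<in> carrier_vec k" "v ~= 0\<^sub>v k"
 shows "\<exists>W a. W \<in> carrier_mat k k & hadj W * W = 1\<^sub>m k & W * hadj W = 1\<^sub>m k & a ~= 0 & col W 0 = a \<cdot>\<^sub>v v"
proof -
 interpret cof_vec_space k "TYPE(complex)" .
 define b where "b = basis_completion v"
 from basis_completion[OF v, folded b_def]
 have b: "distinct b" "\<not> lin_dep (set b)" "set b \<subseteq> carrier_vec k" "hd b = v" "length b = k" by auto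
 have k0: "0 < k" using v by (cases k) auto
 obtain vs where bv: "b = v # vs" using b(4,5) k0 by (cases b) auto
 define ws where "ws = gram_schmidt k b"
 from gram_schmidt_result[OF b(3,1,2) refl, folded ws_def]
 have ws: "set ws \<subseteq> carrier_vec k" "corthogonal ws" "length ws = k" by (auto simp: b(5))
 have hd: "ws ! 0 = v" using gram_schmidt_hd[OF v(1), of vs, folded bv ws_def] ws(3) k0 by (cases ws) auto
 have wsc: "ws ! i \<in> carrier_vec k" if "i < k" for i using ws that by (auto simp: subset_iff)
 have orth: "ws ! i \<bullet>c ws ! j = 0 \<longleftrightarrow> i ~= j" if "i < k" "j < k" for i j
  using corthogonalD[OF ws(2), of i j] that ws(3) by simp
 define nm where "nm i = complex_of_real (sqrt (Re (ws ! i \<bullet>c ws ! i)))" for i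
 have self: "ws ! i \<bullet>c ws ! i = of_real (\<Sum>j<k. (cmod (ws ! i $ j))\<^sup>2)" if "i < k" for i
  using wsc[OF that] by (simp add: scalar_prod_def complex_norm_square lessThan_atLeast0 del: of_real_power)
 have nm2: "nm i * nm i = ws ! i \<bullet>c ws ! i" if "i < k" for i
 proof -
  have "0 \<le> (\<Sum>j<k. (cmod (ws ! i $ j))\<^sup>2)" by (intro sum_nonneg) auto
  thus ?thesis unfolding nm_def self[OF that] by (simp add: of_real_mult[symmetric] del: of_real_mult)
 qed
 have nmz: "nm i ~= 0" if "i < k" for i using nm2[OF that] orth[OF that that] by auto
 have nmc: "cnj (nm i) = nm i" for i by (simp add: nm_def)
 define W where "W = mat k k (%(i, j). ws ! j $ i / nm j)"
 have W: "W \<in> carrier_mat k k" by (simp add: W_def)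
 have WW: "hadj W * W = 1\<^sub>m k"
 proof (rule eq_matI)
  fix i j assume "i < dim_row (1\<^sub>m k)" "j < dim_col (1\<^sub>m k)"
  hence ij: "i < k" "j < k" by auto
  have "(hadj W * W) $$ (i, j) = (\<Sum>l\<in>{0..<k}. cnj (ws ! i $ l / nm i) * (ws ! j $ l / nm j))"
   using ij W by (simp add: scalar_prod_def) (simp add: W_def)
  also have "... = (ws ! j \<bullet>c ws ! i) / (nm i * nm j)"
   using wsc[OF ij(1)] wsc[OF ij(2)] by (simp add: scalar_prod_def sum_divide_distrib nmc mult_ac)
  also have "... = (1\<^sub>m k) $$ (i, j)" using ij orth[OF ij(2,1)] nm2[OF ij(1)] nmz[OF ij(1)] by auto
  finally show "(hadj W * W) $$ (i, j) = (1\<^sub>m k) $$ (i, j)" .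
 qed (use W in auto)
 have "W * hadj W = 1\<^sub>m k" by (rule mat_mult_left_right_inverse[OF hadj_carrier[OF W] W WW])
 moreover have "col W 0 = (1 / nm 0) \<cdot>\<^sub>v v"
  using k0 v(1) by (intro eq_vecI) (auto simp: W_def hd)
 ultimately show ?thesis using W WW nmz[OF k0] by (intro exI[of _ W] exI[of _ "1 / nm 0"]) simp
qed

text \<open>Conjugation with a unitary matrix whose first column is an eigenvector leaves a block matrix, since hermiticity clears
 the first row along with the first column; induction applies to the remaining block.\<close>

lemma hermitian_spectral:
 fixes A :: "complex mat"
 assumes "A \<in> carrier_mat k k" "hadj A = A"
 shows "\<exists>W ls. W \<in> carrier_mat k k & hadj W * W = 1\<^sub>m k & W * hadj W = 1\<^sub>m k & length ls = k &
  A = W * mat k k (%(i, j). if i = j then of_real (ls ! i) else 0) * hadj W &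
  char_poly A = (\<Prod>l\<leftarrow>ls. [:- of_real l, 1:])"
 using assms
proof (induction k arbitrary: A)
 case 0
 hence "char_poly A = 1" using degree_monic_char_poly[of A 0] by (metis monic_degree_0)
 thus ?case using 0 by (intro exI[of _ "1\<^sub>m 0"] exI[of _ "[]"]) (auto intro!: eq_matI)
next
 case (Suc k)
 have A: "A \<in> carrier_mat (Suc k) (Suc k)" "hadj A = A" by fact+
 have "degree (char_poly A) = Suc k" using degree_monic_char_poly[OF A(1)] by simp
 hence "\<not> constant (poly (char_poly A))" by (simp add: constant_degree)
 then obtain e where "poly (char_poly A) e = 0" using fundamental_theorem_of_algebra by blast
 hence "eigenvalue A e" using eigenvalue_root_char_poly[OF A(1)] by simp
 then obtain v where v: "v \<in> carrier_vec (Suc k)" "v ~= 0\<^sub>v (Suc k)" "A *\<^sub>v v = e \<cdot>\<^sub>v v"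
  using A unfolding eigenvalue_def eigenvector_def by auto
 obtain W a where W: "W \<in> carrier_mat (Suc k) (Suc k)" "hadj W * W = 1\<^sub>m (Suc k)" "W * hadj W = 1\<^sub>m (Suc k)" "a ~= 0" "col W 0 = a \<cdot>\<^sub>v v"
  using unitary_first_column[OF v(1,2)] by blast
 have Wh: "hadj W \<in> carrier_mat (Suc k) (Suc k)" using W by simp
 note as = assoc_mult_mat[of _ "Suc k" "Suc k" _ "Suc k" _ "Suc k"]
 note mc = mult_carrier_mat[of _ "Suc k" "Suc k" _ "Suc k"]
 define B where "B = hadj W * A * W"
 have B: "B \<in> carrier_mat (Suc k) (Suc k)" using W(1) A(1) Wh by (simp add: B_def mc)
 have Bh: "hadj B = B"
  unfolding B_def using W(1) A Wh by (simp add: hadj_mult[of _ "Suc k" "Suc k" _ "Suc k"] as mc)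
 have AB: "A = W * B * hadj W"
 proof -
  have "W * B * hadj W = (W * hadj W) * A * (W * hadj W)"
   unfolding B_def using W(1) A(1) Wh by (simp add: as mc)
  thus ?thesis using A(1) by (simp add: W(3))
 qed
 have AW: "A *\<^sub>v col W 0 = e \<cdot>\<^sub>v col W 0"
  unfolding W(5) using A v by (simp add: mult_mat_vec[of _ "Suc k" "Suc k"] smult_smult_assoc mult.commute)
 have col0: "col B 0 = e \<cdot>\<^sub>v unit_vec (Suc k) 0"
 proof -
  have "B = hadj W * (A * W)" unfolding B_def using W(1) A(1) Wh by (simp add: as)
  moreover have "col (hadj W * (A * W)) 0 = hadj W *\<^sub>v col (A * W) 0"
   by (rule col_mult2[OF Wh mult_carrier_mat[OF A(1) W(1)]]) simp
  moreover have "col (A * W) 0 = A *\<^sub>v col W 0" by (rule col_mult2[OF A(1) W(1)]) simp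
  ultimately have "col B 0 = hadj W *\<^sub>v (A *\<^sub>v col W 0)" by simp
  also have "... = e \<cdot>\<^sub>v (hadj W *\<^sub>v col W 0)" unfolding AW
   by (rule mult_mat_vec[OF Wh]) (use W(1) in \<open>auto intro!: carrier_vecI\<close>)
  also have "hadj W *\<^sub>v col W 0 = col (hadj W * W) 0" by (rule col_mult2[OF Wh W(1), symmetric]) simp
  also have "... = unit_vec (Suc k) 0" unfolding W(2) by simp
  finally show ?thesis .
 qed
 have Bi0: "B $$ (i, 0) = (if i = 0 then e else 0)" if "i < Suc k" for i
  using arg_cong[OF col0, of "%v. v $ i"] that B by auto
 have B0i: "B $$ (0, i) = (if i = 0 then cnj e else 0)" if "i < Suc k" for i
 proof -
  have "B $$ (0, i) = hadj B $$ (0, i)" by (simp add: Bh)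
  also have "... = cnj (B $$ (i, 0))" using B that by simp
  finally show ?thesis using Bi0[OF that] by simp
 qed
 have er: "e = of_real (Re e)" using Bi0[of 0] B0i[of 0] by (simp add: complex_eq_iff)
 define D where "D = mat k k (%(i, j). B $$ (Suc i, Suc j))"
 have D: "D \<in> carrier_mat k k" by (simp add: D_def)
 have Dh: "hadj D = D"
 proof (rule eq_matI)
  fix i j assume "i < dim_row D" "j < dim_col D"
  hence ij: "i < k" "j < k" by (auto simp: D_def)
  have "B $$ (Suc i, Suc j) = hadj B $$ (Suc i, Suc j)" by (simp add: Bh)
  thus "hadj D $$ (i, j) = D $$ (i, j)" using ij B by (simp add: D_def)
 qed (auto simp: D_def)
 obtain U ls where U: "U \<in> carrier_mat k k" "hadj U * U = 1\<^sub>m k" "U * hadj U = 1\<^sub>m k" "length ls = k"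
  "D = U * mat k k (%(i, j). if i = j then of_real (ls ! i) else 0) * hadj U" "char_poly D = (\<Prod>l\<leftarrow>ls. [:- of_real l, 1:])"
  using Suc.IH[OF D Dh] by blast
 define P where "P X = four_block_mat (1\<^sub>m 1) (0\<^sub>m 1 k) (0\<^sub>m k 1) X" for X :: "complex mat"
 have Pc: "P X \<in> carrier_mat (Suc k) (Suc k)" if "X \<in> carrier_mat k k" for X
  using four_block_carrier_mat[OF one_carrier_mat that, of 1] by (simp add: P_def One_nat_def)
 have Pm: "P X * P Y = P (X * Y)" if "X \<in> carrier_mat k k" "Y \<in> carrier_mat k k" for X Y
  unfolding P_def by (subst mult_four_block_mat[of _ 1 1 _ k _ k _ _ 1 _ k]) (use that in auto)
 have P1: "P (1\<^sub>m k) = 1\<^sub>m (Suc k)" by (auto simp: P_def intro!: eq_matI)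
 have Ph: "hadj (P X) = P (hadj X)" if "X \<in> carrier_mat k k" for X
  using that by (intro eq_matI) (auto simp: P_def)
 let ?d = "mat k k (%(i, j). if i = j then complex_of_real (ls ! i) else 0)"
 let ?d' = "mat (Suc k) (Suc k) (%(i, j). if i = j then complex_of_real ((Re e # ls) ! i) else 0)"
 let ?f = "%X. four_block_mat (mat 1 1 (%_. e)) (0\<^sub>m 1 k) (0\<^sub>m k 1) X"
 have Bf: "B = ?f D"
 proof (rule eq_matI)
  fix i j assume "i < dim_row (?f D)" "j < dim_col (?f D)"
  hence "i < Suc k" "j < Suc k" by (auto simp: D_def)
  thus "B $$ (i, j) = ?f D $$ (i, j)" using Bi0[of i] B0i[of j] er
   by (cases i; cases j) (auto simp: D_def)
 qed (use B in \<open>auto simp: D_def\<close>)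
 have fd: "?f ?d = ?d'"
 proof (rule eq_matI)
  fix i j assume "i < dim_row ?d'" "j < dim_col ?d'"
  thus "?f ?d $$ (i, j) = ?d' $$ (i, j)" using er by (cases i; cases j) auto
 qed auto
 have conj_f: "P X * ?f Y * P Z = ?f (X * Y * Z)" if "X \<in> carrier_mat k k" "Y \<in> carrier_mat k k" "Z \<in> carrier_mat k k" for X Y Z
 proof -
  have "P X * ?f Y = ?f (X * Y)" unfolding P_def by (subst mult_four_block_mat[of _ 1 1 _ k _ k _ _ 1 _ k]) (use that in auto)
  moreover have "?f (X * Y) * P Z = ?f (X * Y * Z)" unfolding P_def by (subst mult_four_block_mat[of _ 1 1 _ k _ k _ _ 1 _ k]) (use that in auto)
  ultimately show ?thesis by simp
 qed
 have Beq: "B = P U * ?d' * P (hadj U)"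
  unfolding Bf fd[symmetric] using U by (subst conj_f) auto
 define W' where "W' = W * P U"
 have W': "W' \<in> carrier_mat (Suc k) (Suc k)" "hadj W' = P (hadj U) * hadj W"
  unfolding W'_def using W(1) Pc[OF U(1)] Ph[OF U(1)] by (auto simp: hadj_mult[of _ "Suc k" "Suc k" _ "Suc k"])
 have PU: "P U \<in> carrier_mat (Suc k) (Suc k)" "P (hadj U) \<in> carrier_mat (Suc k) (Suc k)" using Pc U(1) by auto
 have PUU: "P (hadj U) * P U = 1\<^sub>m (Suc k)" "P U * P (hadj U) = 1\<^sub>m (Suc k)"
  using Pm[of "hadj U" U] Pm[of U "hadj U"] U P1 by auto
 have "hadj W' * W' = P (hadj U) * ((hadj W * W) * P U)"
  unfolding W'(2) unfolding W'_def using W(1) Wh PU by (simp add: as mc)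
 hence I1: "hadj W' * W' = 1\<^sub>m (Suc k)" using PU by (simp add: W(2) PUU)
 have I2: "W' * hadj W' = 1\<^sub>m (Suc k)" by (rule mat_mult_left_right_inverse[OF hadj_carrier[OF W'(1)] W'(1) I1])
 have d'c: "?d' \<in> carrier_mat (Suc k) (Suc k)" by simp
 have dec: "A = W' * ?d' * hadj W'"
  unfolding W'(2) unfolding W'_def using W(1) Wh PU d'c by (subst AB, subst Beq) (simp add: as mc)
 have "similar_mat A B"
  unfolding similar_mat_def using similar_mat_witI[OF W(3,2) AB A(1) B W(1) Wh] by blast
 hence "char_poly A = char_poly B" by (rule char_poly_similar)
 also have "... = char_poly (mat 1 1 (%_. e)) * char_poly D"
  unfolding Bf by (rule char_poly_four_block_zeros_col[OF _ _ D]) auto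
 also have "char_poly (mat 1 1 (%_. e)) = [:- e, 1:]" by (simp add: char_poly_defs det_def sign_def One_nat_def)
 finally have "char_poly A = (\<Prod>l\<leftarrow>Re e # ls. [:- of_real l, 1:])" using U(6) er by simp
 thus ?case using W'(1) I1 I2 dec U(4) by (intro exI[of _ W'] exI[of _ "Re e # ls"]) simp
qed

lemma nontrivial_solution:
 fixes A :: "'p => 'k => complex"
 assumes "finite K" "finite P" "card K < card P"
 shows "\<exists>a. (\<exists>v\<in>P. a v ~= 0) & (\<forall>k\<in>K. (\<Sum>v\<in>P. a v * A v k) = 0)"
 using assms
proof (induction K arbitrary: P A rule: finite_induct)
 case empty
 hence "P ~= {}" by auto
 thus ?case by (intro exI[of _ "%_. 1"]) auto
next
 case (insert k K)
 show ?case
 proof (cases "\<forall>v\<in>P. A v k = 0")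
  case True
  thus ?thesis using insert.IH[OF insert.prems(1), of A] insert.prems insert.hyps by auto
 next
  case False
  then obtain v0 where v0: "v0 \<in> P" "A v0 k ~= 0" by blast
  let ?P = "P - {v0}"
  have "card K < card ?P" using insert.prems insert.hyps v0 by simp
  then obtain a where a: "\<exists>v\<in>?P. a v ~= 0" "\<And>j. j \<in> K ==> (\<Sum>v\<in>?P. a v * (A v j - A v k / A v0 k * A v0 j)) = 0"
   using insert.IH[of ?P "%v j. A v j - A v k / A v0 k * A v0 j"] insert.prems by auto
  define b where "b v = (if v = v0 then - (\<Sum>v\<in>?P. a v * A v k) / A v0 k else a v)" for v
  have sp: "(\<Sum>v\<in>P. b v * A v j) = (\<Sum>v\<in>?P. a v * A v j) - (\<Sum>v\<in>?P. a v * A v k) / A v0 k * A v0 j" for j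
  proof -
   have "(\<Sum>v\<in>?P. b v * A v j) = (\<Sum>v\<in>?P. a v * A v j)" by (rule sum.cong) (auto simp: b_def)
   thus ?thesis by (simp add: sum.remove[OF insert.prems(1) v0(1)]) (simp add: b_def)
  qed
  have "(\<Sum>v\<in>P. b v * A v j) = 0" if "j \<in> insert k K" for j
  proof (cases "j = k")
   case True thus ?thesis unfolding sp using v0 by simp
  next
   case False
   hence "(\<Sum>v\<in>?P. a v * (A v j - A v k / A v0 k * A v0 j)) = 0" using a(2) that by simp
   moreover have "(\<Sum>v\<in>?P. a v * (A v k / A v0 k * A v0 j)) = (\<Sum>v\<in>?P. a v * A v k) / A v0 k * A v0 j"
    unfolding sum_divide_distrib sum_distrib_right by (rule sum.cong) simp_all
   ultimately show ?thesis unfolding sp by (simp add: right_diff_distrib sum_subtractf)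
  qed
  moreover have "\<exists>v\<in>P. b v ~= 0" using a(1) by (auto simp: b_def)
  ultimately show ?thesis by blast
 qed
qed

definition quad :: "complex mat => (nat => complex) => complex" where
 "quad G y = (\<Sum>i<dim_row G. \<Sum>j<dim_row G. y i * cnj (y j) * G $$ (i, j))"

lemma quad_comb:
 assumes "G \<in> carrier_mat k k"
 shows "quad G (%i. \<Sum>v\<in>P. a v * x v i) =
  (\<Sum>v\<in>P. \<Sum>w\<in>P. a v * cnj (a w) * (\<Sum>i<k. \<Sum>j<k. x v i * cnj (x w j) * G $$ (i, j)))"
proof -
 let ?T = "%i j v w. a v * cnj (a w) * (x v i * cnj (x w j) * G $$ (i, j))"
 have "(\<Sum>v\<in>P. a v * x v i) * cnj (\<Sum>v\<in>P. a v * x v j) * G $$ (i, j) = (\<Sum>v\<in>P. \<Sum>w\<in>P. ?T i j v w)" for i j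
  by (simp only: cnj_sum sum_product, simp only: sum_distrib_right, intro sum.cong refl, simp add: mult_ac)
 hence "quad G (%i. \<Sum>v\<in>P. a v * x v i) = (\<Sum>i<k. \<Sum>j<k. \<Sum>v\<in>P. \<Sum>w\<in>P. ?T i j v w)"
  using assms by (simp add: quad_def)
 also have "... = (\<Sum>i<k. \<Sum>v\<in>P. \<Sum>j<k. \<Sum>w\<in>P. ?T i j v w)" by (rule sum.cong[OF refl sum.swap])
 also have "... = (\<Sum>v\<in>P. \<Sum>i<k. \<Sum>j<k. \<Sum>w\<in>P. ?T i j v w)" by (rule sum.swap)
 also have "... = (\<Sum>v\<in>P. \<Sum>i<k. \<Sum>w\<in>P. \<Sum>j<k. ?T i j v w)" by (rule sum.cong[OF refl sum.cong[OF refl sum.swap]])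
 also have "... = (\<Sum>v\<in>P. \<Sum>w\<in>P. \<Sum>i<k. \<Sum>j<k. ?T i j v w)" by (rule sum.cong[OF refl sum.swap])
 finally show ?thesis by (simp add: sum_distrib_left)
qed

definition pos_ev :: "complex mat => nat" where "pos_ev G = size {#z \<in># proots (char_poly G). Re z > 0#}"
definition neg_ev :: "complex mat => nat" where "neg_ev G = size {#z \<in># proots (char_poly G). Re z < 0#}"

lemma proots_real_factors: "proots (\<Prod>l\<leftarrow>ls. [:- complex_of_real l, 1:]) = mset (map of_real ls)"
proof (induction ls)
 case (Cons l ls)
 have "(\<Prod>l\<leftarrow>ls. [:- complex_of_real l, 1:]) ~= 0" by (auto simp: prod_list_zero_iff)
 hence "proots ([:- complex_of_real l, 1:] * (\<Prod>l\<leftarrow>ls. [:- complex_of_real l, 1:])) =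
  proots [:- complex_of_real l, 1:] + proots (\<Prod>l\<leftarrow>ls. [:- complex_of_real l, 1:])"
  by (intro proots_mult) auto
 thus ?case using Cons by simp
qed simp

lemma spectral_entries:
 assumes "G \<in> carrier_mat k k" "hadj G = G"
 obtains W ls where "length ls = k" "\<And>i j. i < k ==> j < k ==> G $$ (i, j) = (\<Sum>l<k. W i l * of_real (ls ! l) * cnj (W j l))"
  "\<And>l m. l < k ==> m < k ==> (\<Sum>i<k. cnj (W i l) * W i m) = (if l = m then 1 else 0)"
  "pos_ev G = card {l. l < k & 0 < ls ! l}" "neg_ev G = card {l. l < k & ls ! l < 0}"
proof -
 obtain W ls where W: "W \<in> carrier_mat k k" "hadj W * W = 1\<^sub>m k" "length ls = k"
  "G = W * mat k k (%(i, j). if i = j then of_real (ls ! i) else 0) * hadj W" "char_poly G = (\<Prod>l\<leftarrow>ls. [:- of_real l, 1:])"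
  using hermitian_spectral[OF assms] by blast
 let ?D = "mat k k (%(i, j). if i = j then complex_of_real (ls ! i) else 0)"
 have WD: "(W * ?D) $$ (i, l) = W $$ (i, l) * of_real (ls ! l)" if "i < k" "l < k" for i l
 proof -
  have "(W * ?D) $$ (i, l) = (\<Sum>q\<in>{0..<k}. W $$ (i, q) * (if q = l then of_real (ls ! q) else 0))"
   using that W(1) by (simp add: scalar_prod_def)
  also have "... = (\<Sum>q\<in>{0..<k}. if q = l then W $$ (i, l) * of_real (ls ! l) else 0)"
   by (rule sum.cong) auto
  finally show ?thesis using that by simp
 qed
 have E: "G $$ (i, j) = (\<Sum>l<k. W $$ (i, l) * of_real (ls ! l) * cnj (W $$ (j, l)))" if "i < k" "j < k" for i j
 proof -
  have "G $$ (i, j) = (\<Sum>l\<in>{0..<k}. (W * ?D) $$ (i, l) * hadj W $$ (l, j))"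
   unfolding W(4) using that W(1) by (subst index_mult_mat) (auto simp: scalar_prod_def)
  also have "... = (\<Sum>l<k. W $$ (i, l) * of_real (ls ! l) * cnj (W $$ (j, l)))"
   unfolding lessThan_atLeast0 by (rule sum.cong) (use WD that W(1) in auto)
  finally show ?thesis .
 qed
 have I: "(\<Sum>i<k. cnj (W $$ (i, l)) * W $$ (i, m)) = (if l = m then 1 else 0)" if "l < k" "m < k" for l m
  using arg_cong[OF W(2), of "%A. A $$ (l, m)"] that W(1) by (simp add: scalar_prod_def lessThan_atLeast0)
 have cnt: "size (filter_mset P (proots (char_poly G))) = card {l. l < k & P (of_real (ls ! l))}" for P
 proof -
  have "size (filter_mset P (mset (map complex_of_real ls))) = length (filter (%l. P (of_real l)) ls)"
   by (simp only: mset_filter[symmetric] size_mset filter_map length_map o_def)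
  also have "... = card {l. l < k & P (of_real (ls ! l))}" by (simp add: length_filter_conv_card W(3))
  finally show ?thesis unfolding W(5) proots_real_factors .
 qed
 show ?thesis
  by (rule that[of ls "%i l. W $$ (i, l)", OF W(3) E I]) (simp_all add: pos_ev_def neg_ev_def cnt)
qed

text \<open>The law of inertia of Sylvester, for spanning families of a positive and a negative subspace. If P had more elements
 than there are positive eigenvalues, some nonzero combination of P would be orthogonal to all eigenvectors with
 positive eigenvalue, and its form would not be positive; likewise for N. As the sizes add up to k, both bounds are
 sharp.\<close>

lemma inertia:
 assumes G: "G \<in> carrier_mat k k" "hadj G = G" and fin: "finite P" "finite N" and k: "card P + card N = k"
  and pos: "\<And>a. \<exists>v\<in>P. a v ~= 0 ==> 0 < Re (quad G (%i. \<Sum>v\<in>P. a v * x v i))"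
  and neg: "\<And>a. \<exists>v\<in>N. a v ~= 0 ==> Re (quad G (%i. \<Sum>v\<in>N. a v * x v i)) < 0"
 shows "pos_ev G = card P & neg_ev G = card N"
proof -
 obtain W ls where W: "length ls = k" "\<And>i j. i < k ==> j < k ==> G $$ (i, j) = (\<Sum>l<k. W i l * of_real (ls ! l) * cnj (W j l))"
  "\<And>l m. l < k ==> m < k ==> (\<Sum>i<k. cnj (W i l) * W i m) = (if l = m then 1 else 0)"
  "pos_ev G = card {l. l < k & 0 < ls ! l}" "neg_ev G = card {l. l < k & ls ! l < 0}"
  by (rule spectral_entries[OF G]) (rule that)
 have Q: "Re (quad G y) = (\<Sum>l<k. ls ! l * (cmod (\<Sum>i<k. y i * W i l))\<^sup>2)" for y
 proof -
  let ?T = "%i j l. of_real (ls ! l) * ((y i * W i l) * cnj (y j * W j l))"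
  have "quad G y = (\<Sum>i<k. \<Sum>j<k. \<Sum>l<k. ?T i j l)"
  proof -
   have "y i * cnj (y j) * G $$ (i, j) = (\<Sum>l<k. ?T i j l)" if "i < k" "j < k" for i j
    unfolding W(2)[OF that] sum_distrib_left by (rule sum.cong) (simp_all add: mult_ac)
   thus ?thesis using G(1) unfolding quad_def by simp
  qed
  also have "... = (\<Sum>l<k. \<Sum>i<k. \<Sum>j<k. ?T i j l)"
   by (rule trans[OF sum.cong[OF refl sum.swap] sum.swap])
  also have "... = (\<Sum>l<k. of_real (ls ! l) * ((\<Sum>i<k. y i * W i l) * cnj (\<Sum>i<k. y i * W i l)))"
   by (simp only: cnj_sum sum_product, simp only: sum_distrib_left)
  also have "... = of_real (\<Sum>l<k. ls ! l * (cmod (\<Sum>i<k. y i * W i l))\<^sup>2)"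
   by (simp add: complex_norm_square del: of_real_power)
  finally show ?thesis by simp
 qed
 have bound: "\<exists>a. (\<exists>v\<in>R. a v ~= 0) & (\<forall>l\<in>K. (\<Sum>i<k. (\<Sum>v\<in>R. a v * x v i) * W i l) = 0)"
  if R: "finite R" "finite K" "card K < card R" for R and K :: "nat set"
 proof -
  obtain a where a: "\<exists>v\<in>R. a v ~= 0" "\<forall>l\<in>K. (\<Sum>v\<in>R. a v * (\<Sum>i<k. x v i * W i l)) = 0"
   using nontrivial_solution[OF R(2,1,3), of "%v l. \<Sum>i<k. x v i * W i l"] by blast
  have "(\<Sum>i<k. (\<Sum>v\<in>R. a v * x v i) * W i l) = (\<Sum>v\<in>R. a v * (\<Sum>i<k. x v i * W i l))" for l
   by (simp add: sum_distrib_left sum_distrib_right mult.assoc) (rule sum.swap)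
  thus ?thesis using a by auto
 qed
 have "card P \<le> pos_ev G"
 proof (rule ccontr)
  assume "\<not> ?thesis"
  then obtain a where a: "\<exists>v\<in>P. a v ~= 0" "\<forall>l\<in>{l. l < k & 0 < ls ! l}. (\<Sum>i<k. (\<Sum>v\<in>P. a v * x v i) * W i l) = 0"
   using bound[OF fin(1), of "{l. l < k & 0 < ls ! l}"] W(4) by auto
  have "Re (quad G (%i. \<Sum>v\<in>P. a v * x v i)) \<le> 0" unfolding Q
  proof (rule sum_nonpos)
   fix l assume "l \<in> {..<k}"
   thus "ls ! l * (cmod (\<Sum>i<k. (\<Sum>v\<in>P. a v * x v i) * W i l))\<^sup>2 \<le> 0"
    using a(2) by (cases "0 < ls ! l") (auto simp: mult_nonpos_nonneg)
  qed
  thus False using pos[OF a(1)] by simp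
 qed
 moreover have "card N \<le> neg_ev G"
 proof (rule ccontr)
  assume "\<not> ?thesis"
  then obtain a where a: "\<exists>v\<in>N. a v ~= 0" "\<forall>l\<in>{l. l < k & ls ! l < 0}. (\<Sum>i<k. (\<Sum>v\<in>N. a v * x v i) * W i l) = 0"
   using bound[OF fin(2), of "{l. l < k & ls ! l < 0}"] W(5) by auto
  have "0 \<le> Re (quad G (%i. \<Sum>v\<in>N. a v * x v i))" unfolding Q
  proof (rule sum_nonneg)
   fix l assume "l \<in> {..<k}"
   thus "0 \<le> ls ! l * (cmod (\<Sum>i<k. (\<Sum>v\<in>N. a v * x v i) * W i l))\<^sup>2"
    using a(2) by (cases "ls ! l < 0") auto
  qed
  thus False using neg[OF a(1)] by simp
 qed
 moreover have "pos_ev G + neg_ev G \<le> k"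
 proof -
  have "card {l. l < k & 0 < ls ! l} + card {l. l < k & ls ! l < 0} = card ({l. l < k & 0 < ls ! l} \<union> {l. l < k & ls ! l < 0})"
   by (rule card_Un_disjoint[symmetric]) auto
  also have "... \<le> card {..<k}" by (rule card_mono) auto
  finally show ?thesis unfolding W(4,5) by simp
 qed
 ultimately show ?thesis using k by linarith
qed

text \<open>By the Cauchy-Schwarz inequality the deviation from the diagonal form is at most \<epsilon> (card P) times the squared
 norm of a.\<close>

lemma near_diagonal_positive:
 assumes fin: "finite P" and d: "\<And>l. l \<in> P ==> \<mu> \<le> d l"
  and B: "\<And>l m. l \<in> P ==> m \<in> P ==> cmod (B l m - (if l = m then of_real (d l) else 0)) \<le> \<epsilon>"
  and e: "\<epsilon> * real (card P) < \<mu>" and a: "\<exists>v\<in>P. a v ~= 0"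
 shows "0 < Re (\<Sum>l\<in>P. \<Sum>m\<in>P. a l * cnj (a m) * B l m)"
proof -
 let ?E = "%l m. B l m - (if l = m then of_real (d l) else 0)"
 let ?S = "\<Sum>l\<in>P. (cmod (a l))\<^sup>2"
 obtain l0 where l0: "l0 \<in> P" "a l0 ~= 0" using a by blast
 have S: "0 < ?S" by (rule sum_pos2[OF fin l0(1)]) (use l0 in auto)
 have eps: "0 \<le> \<epsilon>" using B[OF l0(1) l0(1)] norm_ge_zero order.trans by blast
 have "(\<Sum>l\<in>P. \<Sum>m\<in>P. a l * cnj (a m) * B l m) =
  (\<Sum>l\<in>P. \<Sum>m\<in>P. a l * cnj (a m) * ?E l m) + (\<Sum>l\<in>P. \<Sum>m\<in>P. if l = m then of_real (d l * (cmod (a l))\<^sup>2) else 0)"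
  unfolding sum.distrib[symmetric]
  by (intro sum.cong refl) (auto simp: algebra_simps complex_norm_square simp del: of_real_power)
 also have "(\<Sum>l\<in>P. \<Sum>m\<in>P. if l = m then complex_of_real (d l * (cmod (a l))\<^sup>2) else 0) = of_real (\<Sum>l\<in>P. d l * (cmod (a l))\<^sup>2)"
  using fin by simp
 finally have eq: "Re (\<Sum>l\<in>P. \<Sum>m\<in>P. a l * cnj (a m) * B l m) =
  Re (\<Sum>l\<in>P. \<Sum>m\<in>P. a l * cnj (a m) * ?E l m) + (\<Sum>l\<in>P. d l * (cmod (a l))\<^sup>2)" by simp
 have "cmod (\<Sum>l\<in>P. \<Sum>m\<in>P. a l * cnj (a m) * ?E l m) \<le> (\<Sum>l\<in>P. \<Sum>m\<in>P. \<epsilon> * (((cmod (a l))\<^sup>2 + (cmod (a m))\<^sup>2) / 2))"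
 proof (intro order.trans[OF norm_sum] sum_mono)
  fix l m assume lm: "l \<in> P" "m \<in> P"
  have "cmod (a l) * cmod (a m) \<le> ((cmod (a l))\<^sup>2 + (cmod (a m))\<^sup>2) / 2"
   using sum_squares_bound[of "cmod (a l)" "cmod (a m)"] by simp
  hence "(cmod (a l) * cmod (a m)) * cmod (?E l m) \<le> ((cmod (a l))\<^sup>2 + (cmod (a m))\<^sup>2) / 2 * \<epsilon>"
   by (intro mult_mono[OF _ B[OF lm]]) auto
  thus "cmod (a l * cnj (a m) * ?E l m) \<le> \<epsilon> * (((cmod (a l))\<^sup>2 + (cmod (a m))\<^sup>2) / 2)"
   by (simp add: norm_mult mult.commute)
 qed
 also have "... = \<epsilon> * real (card P) * ?S"
  by (simp add: sum_distrib_left[symmetric] sum_divide_distrib[symmetric] sum.distrib)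
 finally have "- (\<epsilon> * real (card P) * ?S) \<le> Re (\<Sum>l\<in>P. \<Sum>m\<in>P. a l * cnj (a m) * ?E l m)"
  using abs_Re_le_cmod[of "\<Sum>l\<in>P. \<Sum>m\<in>P. a l * cnj (a m) * ?E l m"] by linarith
 moreover have "\<mu> * ?S \<le> (\<Sum>l\<in>P. d l * (cmod (a l))\<^sup>2)"
  unfolding sum_distrib_left by (intro sum_mono mult_right_mono d) auto
 moreover have "\<epsilon> * real (card P) * ?S < \<mu> * ?S" using e S by (intro mult_strict_right_mono)
 ultimately show ?thesis unfolding eq by linarith
qed

text \<open>In an eigenbasis of G c0 the form of G c is close to a diagonal form without zero entries, so it stays definite on the
 positive and on the negative part.\<close>

lemma signature_locally_constant:
 fixes G :: "real => complex mat"
 assumes G: "\<And>c. G c \<in> carrier_mat k k" "\<And>c. hadj (G c) = G c"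
  and cont: "\<And>i j. i < k ==> j < k ==> continuous_on UNIV (%c. G c $$ (i, j))"
  and nondeg: "\<And>y. (\<And>j. j < k ==> (\<Sum>i<k. y i * G c0 $$ (i, j)) = 0) ==> \<forall>i<k. y i = 0"
 shows "\<forall>\<^sub>F c in at c0. pos_ev (G c) = pos_ev (G c0) & neg_ev (G c) = neg_ev (G c0)"
proof -
 obtain W ls where W: "length ls = k" "\<And>i j. i < k ==> j < k ==> G c0 $$ (i, j) = (\<Sum>l<k. W i l * of_real (ls ! l) * cnj (W j l))"
  "\<And>l m. l < k ==> m < k ==> (\<Sum>i<k. cnj (W i l) * W i m) = (if l = m then 1 else 0)"
  "pos_ev (G c0) = card {l. l < k & 0 < ls ! l}" "neg_ev (G c0) = card {l. l < k & ls ! l < 0}"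
  by (rule spectral_entries[OF G(1)[of c0] G(2)[of c0]]) (rule that)
 have ker: "(\<Sum>i<k. cnj (W i l) * G c0 $$ (i, j)) = of_real (ls ! l) * cnj (W j l)" if "l < k" "j < k" for l j
 proof -
  have "(\<Sum>i<k. cnj (W i l) * G c0 $$ (i, j)) = (\<Sum>i<k. \<Sum>m<k. (cnj (W i l) * W i m) * (of_real (ls ! m) * cnj (W j m)))"
   using that by (auto simp: W(2) sum_distrib_left mult_ac intro!: sum.cong)
  also have "... = (\<Sum>m<k. (\<Sum>i<k. cnj (W i l) * W i m) * (of_real (ls ! m) * cnj (W j m)))"
   by (subst sum.swap) (simp add: sum_distrib_right)
  also have "... = (\<Sum>m<k. if m = l then of_real (ls ! l) * cnj (W j l) else 0)"
   by (rule sum.cong) (use W(3)[OF that(1)] in auto)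
  finally show ?thesis using that by simp
 qed
 have nz: "ls ! l ~= 0" if l: "l < k" for l
 proof
  assume "ls ! l = 0"
  hence "\<forall>i<k. cnj (W i l) = 0" using nondeg[of "%i. cnj (W i l)"] ker[OF l] by simp
  hence "(\<Sum>i<k. cnj (W i l) * W i l) = 0" by simp
  thus False using W(3)[OF l l] by simp
 qed
 define B where "B c l m = (\<Sum>i<k. \<Sum>j<k. cnj (W i l) * W j m * G c $$ (i, j))" for c l m
 have B0: "B c0 l m = (if l = m then of_real (ls ! l) else 0)" if "l < k" "m < k" for l m
 proof -
  have "B c0 l m = (\<Sum>j<k. W j m * (\<Sum>i<k. cnj (W i l) * G c0 $$ (i, j)))"
   unfolding B_def by (subst sum.swap) (simp add: sum_distrib_left mult_ac)
  also have "... = of_real (ls ! l) * cnj (\<Sum>j<k. cnj (W j m) * W j l)"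
   using that by (simp add: ker sum_distrib_left mult_ac)
  also have "... = (if l = m then of_real (ls ! l) else 0)" using W(3)[OF that(2,1)] by simp
  finally show ?thesis .
 qed
 have quadB: "quad (G c) (%i. \<Sum>l\<in>P. a l * cnj (W i l)) = (\<Sum>l\<in>P. \<Sum>m\<in>P. a l * cnj (a m) * B c l m)" if "P \<subseteq> {..<k}" for P a c
 proof -
  show ?thesis unfolding B_def using quad_comb[OF G(1)[of c], where P = P and a = a and x = "%l i. cnj (W i l)"] by simp
 qed
 have "\<exists>\<mu>>0. \<forall>l<k. \<mu> \<le> \<bar>ls ! l\<bar>"
 proof (cases "k = 0")
  case True thus ?thesis by (intro exI[of _ 1]) auto
 next
  case False
  let ?M = "Min ((%l. \<bar>ls ! l\<bar>) ` {..<k})"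
  have "?M \<in> (%l. \<bar>ls ! l\<bar>) ` {..<k}" using False by (intro Min_in) auto
  hence "0 < ?M" using nz by auto
  thus ?thesis by (intro exI[of _ ?M]) (auto intro!: Min_le)
 qed
 then obtain \<mu> where mu: "0 < \<mu>" "\<And>l. l < k ==> \<mu> \<le> \<bar>ls ! l\<bar>" by blast
 \<comment> \<open>small enough for at most k terms\<close>
 define \<epsilon> where "\<epsilon> = \<mu> / (real k + 1)"
 have e0: "0 < \<epsilon>" using mu by (simp add: \<epsilon>_def)
 have ek: "\<epsilon> * real r < \<mu>" if "r \<le> k" for r
 proof -
  have "\<epsilon> * real r \<le> \<epsilon> * real k" using that e0 by (intro mult_left_mono) auto
  also have "... < \<mu>" using mu by (simp add: \<epsilon>_def field_simps)
  finally show ?thesis .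
 qed
 have "\<forall>\<^sub>F c in at c0. \<forall>l\<in>{..<k}. \<forall>m\<in>{..<k}. dist (B c l m) (B c0 l m) < \<epsilon>"
 proof (intro eventually_ball_finite ballI finite_lessThan)
  fix l m
  have "continuous_on UNIV (%c. B c l m)" unfolding B_def by (intro continuous_intros cont) auto
  hence "((%c. B c l m) \<longlongrightarrow> B c0 l m) (at c0)" by (simp add: continuous_on_def)
  thus "\<forall>\<^sub>F c in at c0. dist (B c l m) (B c0 l m) < \<epsilon>" using e0 by (rule tendstoD)
 qed
 thus ?thesis
 proof (rule eventually_mono)
  fix c assume c: "\<forall>l\<in>{..<k}. \<forall>m\<in>{..<k}. dist (B c l m) (B c0 l m) < \<epsilon>"
  have close: "cmod (B c l m - (if l = m then of_real (ls ! l) else 0)) \<le> \<epsilon>" if "l < k" "m < k" for l m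
   using c[rule_format, of l m] that unfolding B0[OF that] by (simp add: dist_norm less_imp_le)
  let ?P = "{l. l < k & 0 < ls ! l}" and ?N = "{l. l < k & ls ! l < 0}"
  have cP: "card ?P \<le> k" "card ?N \<le> k" using card_mono[of "{..<k}" ?P] card_mono[of "{..<k}" ?N] by auto
  have un: "card ?P + card ?N = k"
  proof -
   have "card ?P + card ?N = card (?P \<union> ?N)" by (rule card_Un_disjoint[symmetric]) auto
   also have "?P \<union> ?N = {..<k}" using nz by (auto simp: neq_iff)
   finally show ?thesis by simp
  qed
  have "pos_ev (G c) = card ?P & neg_ev (G c) = card ?N"
  proof (rule inertia[OF G _ _ un, where x = "%l i. cnj (W i l)"])
   fix a :: "nat => complex" assume a: "\<exists>v\<in>?P. a v ~= 0"
   have "0 < Re (\<Sum>l\<in>?P. \<Sum>m\<in>?P. a l * cnj (a m) * B c l m)"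
    by (rule near_diagonal_positive[where d = "%l. ls ! l" and \<mu> = \<mu> and \<epsilon> = \<epsilon>, OF _ _ _ ek[OF cP(1)] a]) (use mu(2) close in fastforce)+
   thus "0 < Re (quad (G c) (%i. \<Sum>l\<in>?P. a l * cnj (W i l)))" by (subst quadB) auto
  next
   fix a :: "nat => complex" assume a: "\<exists>v\<in>?N. a v ~= 0"
   have "0 < Re (\<Sum>l\<in>?N. \<Sum>m\<in>?N. a l * cnj (a m) * (- B c l m))"
   proof (rule near_diagonal_positive[where d = "%l. - ls ! l" and \<mu> = \<mu> and \<epsilon> = \<epsilon>, OF _ _ _ ek[OF cP(2)] a])
    fix l m assume "l \<in> ?N" "m \<in> ?N"
    hence "cmod (B c l m - (if l = m then of_real (ls ! l) else 0)) \<le> \<epsilon>" by (intro close) auto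
    moreover have "- B c l m - (if l = m then of_real (- ls ! l) else 0) = - (B c l m - (if l = m then of_real (ls ! l) else 0))" by simp
    ultimately show "cmod (- B c l m - (if l = m then of_real (- ls ! l) else 0)) \<le> \<epsilon>" by (metis norm_minus_cancel)
   qed (use mu(2) in fastforce)+
   hence "Re (\<Sum>l\<in>?N. \<Sum>m\<in>?N. a l * cnj (a m) * B c l m) < 0" by (simp add: sum_negf)
   thus "Re (quad (G c) (%i. \<Sum>l\<in>?N. a l * cnj (W i l))) < 0" by (subst quadB) auto
  qed auto
  thus "pos_ev (G c) = pos_ev (G c0) & neg_ev (G c) = neg_ev (G c0)" using W(4,5) by simp
 qed
qed

section \<open>Signs and signatures\<close>

text \<open>The factor l - x is negative exactly for l \<le> floor x. If x is an integer other than 0 it may vanish, which is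
 excluded.\<close>

lemma cut_min_step:
 assumes "x = 0 \<or> x \<notin> \<int>"
 shows "(-1) ^ cut_min (int (Suc g)) \<lfloor>x\<rfloor> = (-1) ^ cut_min (int g) \<lfloor>x\<rfloor> * sgn (real (Suc g) - x)"
proof (cases "\<lfloor>x\<rfloor> < 0")
 case True
 hence "x < real (Suc g)" by linarith
 thus ?thesis using True by (simp add: cut_min_def)
next
 case nn: False
 hence nx: "\<not> x < 0" by linarith
 show ?thesis
 proof (cases "int (Suc g) \<le> \<lfloor>x\<rfloor>")
  case True
  hence "real (Suc g) \<le> x" by linarith
  moreover have "x ~= real (Suc g)" using assms by auto
  ultimately have "sgn (real (Suc g) - x) = - 1" by simp
  moreover have "cut_min (int (Suc g)) \<lfloor>x\<rfloor> = Suc (cut_min (int g) \<lfloor>x\<rfloor>)"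
   using True nx by (simp add: cut_min_def min_def nat_add_distrib)
  ultimately show ?thesis by simp
 next
  case False
  hence "x < real (Suc g)" by linarith
  moreover have "cut_min (int (Suc g)) \<lfloor>x\<rfloor> = cut_min (int g) \<lfloor>x\<rfloor>"
  proof -
   have "int g \<le> \<lfloor>x\<rfloor> ==> nat \<lfloor>x\<rfloor> = g" using False by linarith
   thus ?thesis using False nx by (simp add: cut_min_def min_def)
  qed
  ultimately show ?thesis by simp
 qed
qed

lemma sgn_prod_cut_min:
 assumes "x = 0 \<or> x \<notin> \<int>"
 shows "sgn (\<Prod>l\<in>{1..g}. real l - x) = (-1) ^ cut_min (int g) \<lfloor>x\<rfloor>"
proof (induction g)
 case 0
 show ?case by (simp add: cut_min_def min_def)
next
 case (Suc g)
 have "sgn (\<Prod>l\<in>{1..Suc g}. real l - x) = sgn (\<Prod>l\<in>{1..g}. real l - x) * sgn (real (Suc g) - x)"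
  by (simp add: sgn_mult)
 thus ?case using Suc cut_min_step[OF assms, of g] by simp
qed

lemma sgn_prod': "sgn (\<Prod>x\<in>A. f x) = (\<Prod>x\<in>A. sgn (f x :: real))"
 by (induction A rule: infinite_finite_induct) (auto simp: sgn_mult)

context young
begin

text \<open>The exponent f of the theorem in terms of \<alpha> and T (sign_exponent_SE).\<close>

definition SE :: "real => (nat => nat) => tableau => nat" where
 "SE c \<alpha> T = (\<Sum>s\<in>Ix. cut_min (int (gg \<alpha> s)) \<lfloor>c * of_int (ct T s)\<rfloor>) +
  (\<Sum>s\<in>Ix. \<Sum>t\<in>{s<..n}. cut_min (int (GG \<alpha> s t)) \<lfloor>c * of_int (ct T t - ct T s - 1)\<rfloor> +
   cut_min (int (GG \<alpha> s t)) \<lfloor>c * of_int (ct T t - ct T s + 1)\<rfloor>)"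

lemma sgn_NN:
 assumes g: "gen c" and T: "T \<in> SYT" shows "sgn (NN c \<alpha> T) = (-1) ^ SE c \<alpha> T"
proof -
 have x: "c * of_int e = 0 \<or> c * of_int e \<notin> \<int>" if "\<bar>e\<bar> \<le> int n" for e
  using g that unfolding gen_def by (cases "e = 0") auto
 have 1: "sgn (N1 c \<alpha> T) = (-1) ^ (\<Sum>s\<in>Ix. cut_min (int (gg \<alpha> s)) \<lfloor>c * of_int (ct T s)\<rfloor>)"
  unfolding N1_def sgn_prod'[of _ "Ix"] power_sum
  by (intro prod.cong refl sgn_prod_cut_min x ct_le[OF T])
 have q: "sgn (\<Prod>l\<in>{1..G}. qq c l D) = (-1) ^ (cut_min (int G) \<lfloor>c * of_int (D - 1)\<rfloor> + cut_min (int G) \<lfloor>c * of_int (D + 1)\<rfloor>)"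
  if D: "\<bar>D\<bar> + 1 \<le> int n" for G D
 proof -
  have "sgn (qq c l D) = sgn (real l - c * of_int (D - 1)) * sgn (real l - c * of_int (D + 1))" if "l \<in> {1..G}" for l
  proof -
   have "real l - c * of_int D ~= 0" using gen_nonzero[OF g, of D "int l"] that D by simp
   hence "sgn ((real l - c * of_int D)\<^sup>2) = 1" by (intro sgn_pos) simp
   thus ?thesis unfolding qq_def sgn_divide sgn_mult by simp
  qed
  hence "sgn (\<Prod>l\<in>{1..G}. qq c l D) = sgn (\<Prod>l\<in>{1..G}. real l - c * of_int (D - 1)) * sgn (\<Prod>l\<in>{1..G}. real l - c * of_int (D + 1))"
   by (simp add: sgn_prod' prod.distrib)
  also have "... = (-1) ^ cut_min (int G) \<lfloor>c * of_int (D - 1)\<rfloor> * (-1) ^ cut_min (int G) \<lfloor>c * of_int (D + 1)\<rfloor>"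
   using D x[of "D - 1"] x[of "D + 1"] by (subst (1 2) sgn_prod_cut_min) (auto simp del: of_int_diff of_int_add)
  finally show ?thesis by (simp only: power_add)
 qed
 have 2: "sgn (N2 c \<alpha> T) = (-1) ^ (\<Sum>s\<in>Ix. \<Sum>t\<in>{s<..n}. cut_min (int (GG \<alpha> s t)) \<lfloor>c * of_int (ct T t - ct T s - 1)\<rfloor> +
   cut_min (int (GG \<alpha> s t)) \<lfloor>c * of_int (ct T t - ct T s + 1)\<rfloor>)"
 proof -
  have "sgn (N2 c \<alpha> T) = (\<Prod>s\<in>Ix. \<Prod>t\<in>{s<..n}. sgn (\<Prod>l\<in>{1..GG \<alpha> s t}. qq c l (ct T t - ct T s)))"
   unfolding N2_def by (simp only: sgn_prod')
  also have "... = (\<Prod>s\<in>Ix. \<Prod>t\<in>{s<..n}. (-1) ^ (cut_min (int (GG \<alpha> s t)) \<lfloor>c * of_int (ct T t - ct T s - 1)\<rfloor> +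
   cut_min (int (GG \<alpha> s t)) \<lfloor>c * of_int (ct T t - ct T s + 1)\<rfloor>))"
   by (intro prod.cong refl q ct_diff_le[OF T]) auto
  finally show ?thesis by (simp only: power_sum)
 qed
 show ?thesis unfolding NN_def sgn_mult 1 2 SE_def power_add ..
qed

text \<open>For e \<le> 0 the number c e lies slightly to the right of the integer -k e, so the floor does not change. For e > 0
 both numbers are negative and the minimum is replaced by 0. To the right of -k the floors would differ.\<close>

lemma SE_left_of_int:
 assumes k: "1 \<le> k" and T: "T \<in> SYT" and c: "- real k - 1 / (real n + 1) < c" "c < - real k"
 shows "SE c \<alpha> T = SE (- real k) \<alpha> T"
proof -
 have x: "cut_min g \<lfloor>c * of_int e\<rfloor> = cut_min g \<lfloor>- real k * of_int e\<rfloor>" if e: "\<bar>e\<bar> \<le> int n" for e g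
 proof (cases "e \<le> 0")
  case True
  define d where "d = - real k - c"
  have d: "0 < d" "d * (real n + 1) < 1" using c by (auto simp: d_def field_simps)
  have e': "0 \<le> - real_of_int e" "- real_of_int e \<le> real n" using e True by linarith+
  have "0 \<le> d * (- real_of_int e)" using d e' by (intro mult_nonneg_nonneg) auto
  moreover have "d * (- real_of_int e) \<le> d * (real n + 1)" using d e' by (intro mult_left_mono) auto
  moreover have "c * of_int e = of_int (- int k * e) + d * (- real_of_int e)" by (simp add: d_def algebra_simps)
  ultimately have "\<lfloor>c * of_int e\<rfloor> = - int k * e" using d(2) by (simp add: floor_eq_iff)
  moreover have "\<lfloor>- real k * of_int e\<rfloor> = - int k * e"
   by (metis floor_of_int of_int_minus of_int_mult of_int_of_nat_eq)
  ultimately show ?thesis by simp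
 next
  case False
  hence "c * of_int e < 0" "- real k * of_int e < 0" using c k by (auto intro!: mult_neg_pos)
  hence "\<lfloor>c * of_int e\<rfloor> < 0" "\<lfloor>- real k * of_int e\<rfloor> < 0" by linarith+
  thus ?thesis by (simp add: cut_min_def)
 qed
 have d: "\<bar>ct T t - ct T s - 1\<bar> \<le> int n" "\<bar>ct T t - ct T s + 1\<bar> \<le> int n" if "s \<in> Ix" "t \<in> {s<..n}" for s t
  using ct_diff_le[OF T, of t s] that by auto
 show ?thesis unfolding SE_def
  by (intro arg_cong2[of _ _ _ _ "(+)"] sum.cong refl x ct_le[OF T] d)
qed

subsection \<open>The signature in each degree\<close>

definition GM :: "real => mv list => complex mat" where
 "GM c bs = mat (length bs) (length bs) (%(i, j). BB (of_real c) (bs ! i) (bs ! j))"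

definition NMbasis :: "nat => mv list => bool" where
 "NMbasis m bs \<longleftrightarrow> distinct bs & fv.independent (set bs) & fv.span (set bs) = NM m"

lemma NMbasis_NM: "NMbasis m bs ==> i < length bs ==> bs ! i \<in> NM m"
 unfolding NMbasis_def using fv.span_base nth_mem by blast

lemma NMbasis_coords:
 assumes b: "NMbasis m bs" and f: "f \<in> NM m" shows "\<exists>y. f = (\<Sum>i<length bs. sc (y i) (bs ! i))"
proof -
 obtain u where u: "f = (\<Sum>v\<in>set bs. sc (u v) v)"
  using f b fv.span_finite[of "set bs"] unfolding NMbasis_def by auto
 have "bij_betw ((!) bs) {..<length bs} (set bs)" using b by (simp add: NMbasis_def bij_betw_nth)
 from sum.reindex_bij_betw[OF this, of "%v. sc (u v) v"] show ?thesis using u by (intro exI[of _ "%i. u (bs ! i)"]) simp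
qed

lemma NMbasis_indep:
 assumes b: "NMbasis m bs" and z: "(\<Sum>i<length bs. sc (y i) (bs ! i)) = 0" and i: "i < length bs"
 shows "y i = 0"
proof -
 have d: "distinct bs" using b by (simp add: NMbasis_def)
 have bij: "bij_betw ((!) bs) {..<length bs} (set bs)" using d by (simp add: bij_betw_nth)
 define u where "u v = y (the_inv_into {..<length bs} ((!) bs) v)" for v
 have u: "u (bs ! j) = y j" if "j < length bs" for j
  unfolding u_def by (subst the_inv_into_f_f) (use bij that in \<open>auto simp: bij_betw_def\<close>)
 have "(\<Sum>v\<in>set bs. sc (u v) v) = (\<Sum>j<length bs. sc (u (bs ! j)) (bs ! j))"
  by (rule sum.reindex_bij_betw[OF bij, symmetric])
 also have "... = 0" using z u by simp
 finally have "u (bs ! i) = 0"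
  using b fv.independentD[of "set bs" "set bs" u "bs ! i"] i by (simp add: NMbasis_def)
 thus ?thesis using u[OF i] by simp
qed

lemma GM_herm: "NMbasis m bs ==> hadj (GM c bs) = GM c bs"
 by (rule eq_matI) (auto simp: GM_def intro!: BB_herm[symmetric] NM_NC[OF NMbasis_NM])

lemma quad_GM: "quad (GM c bs) y = BB (of_real c) (\<Sum>i<length bs. sc (y i) (bs ! i)) (\<Sum>i<length bs. sc (y i) (bs ! i))"
proof -
 have "BB (of_real c) (\<Sum>i<length bs. sc (y i) (bs ! i)) (\<Sum>i<length bs. sc (y i) (bs ! i)) =
  (\<Sum>i<length bs. \<Sum>j<length bs. cnj (y j) * (y i * BB (of_real c) (bs ! i) (bs ! j)))"
  by (simp only: BB_sum_left, simp only: BB_sum_right BB_simps sum_distrib_left)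
 thus ?thesis by (simp add: quad_def GM_def mult_ac)
qed

lemma card_NMbasis:
 assumes b: "NMbasis m bs" and g: "gen c" shows "length bs = card (IX m)"
proof -
 let ?F = "%v. fw c (fst v) (snd v)"
 have V: "fst v \<in> cm m" "snd v \<in> SYT" if "v \<in> IX m" for v using that by (auto simp: IX_def)
 have FF: "BB (of_real c) (?F u) (?F v) = (if u = v then of_real (NN c (fst v) (snd v)) * ip (yv (snd v)) (yv (snd v)) else 0)"
  if "u \<in> IX m" "v \<in> IX m" for u v
  using isw_orth[OF g V(2)[OF that(1)] V(2)[OF that(2)] fw(1)[OF g V[OF that(1)]] fw(1)[OF g V[OF that(2)]]]
   fw(2)[OF g V[OF that(2)]] by (cases "u = v") simp_all
 have nz: "BB (of_real c) (?F v) (?F v) ~= 0" if "v \<in> IX m" for v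
  unfolding FF[OF that that] using NN_nz[OF g V(2)[OF that]] yv_norm[OF V(2)[OF that]] by simp
 have inj: "inj_on ?F (IX m)"
  by (rule inj_onI) (metis FF nz)
 have ind: "fv.independent (?F ` IX m)"
 proof (rule fv.independent_if_scalars_zero)
  fix u x assume z: "(\<Sum>x\<in>?F ` IX m. sc (u x) x) = 0" and x: "x \<in> ?F ` IX m"
  obtain v where v: "v \<in> IX m" "x = ?F v" using x by blast
  have "0 = BB (of_real c) (\<Sum>w\<in>IX m. sc (u (?F w)) (?F w)) (?F v)" using z by (simp add: sum.reindex[OF inj])
  also have "... = (\<Sum>w\<in>IX m. if w = v then u x * BB (of_real c) (?F v) (?F v) else 0)"
   unfolding BB_sum_left BB_sc_left by (rule sum.cong) (use FF v in auto)
  also have "... = u x * BB (of_real c) (?F v) (?F v)" using v by simp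
  finally show "u x = 0" using nz[OF v(1)] by simp
 qed simp
 have sub: "?F ` IX m \<subseteq> fv.span (set bs)" using b fw(4)[OF g V] by (auto simp: NMbasis_def)
 have "set bs \<subseteq> fv.span (?F ` IX m)"
 proof
  fix f assume "f \<in> set bs"
  hence fN: "f \<in> NM m" using b fv.span_base unfolding NMbasis_def by blast
  have "kn m \<gamma> < Suc (Max (kn m ` fst ` ks f))" if "sl \<gamma> f ~= 0" for \<gamma>
   using sl_ks[OF that] by (auto simp: less_Suc_eq_le intro!: Max_ge)
  then obtain a where a: "f = (\<Sum>v\<in>IX m. sc (a v) (?F v))" using fw_expand[OF g fN] by blast
  show "f \<in> fv.span (?F ` IX m)" unfolding a by (intro fv.span_sum fv.span_scale fv.span_base) auto
 qed
 hence "card (set bs) \<le> card (?F ` IX m)"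
  using fv.independent_span_bound[of "?F ` IX m" "set bs"] b by (simp add: NMbasis_def)
 moreover have "card (?F ` IX m) \<le> card (set bs)"
  using fv.independent_span_bound[OF _ ind sub] by simp
 ultimately show ?thesis using b by (simp add: card_image[OF inj] NMbasis_def distinct_card)
qed

text \<open>The law of inertia for the orthogonal basis of weight vectors.\<close>

lemma signature_gen:
 assumes b: "NMbasis m bs" and g: "gen c"
 shows "pos_ev (GM c bs) = card {v \<in> IX m. 0 < NN c (fst v) (snd v)} & neg_ev (GM c bs) = card {v \<in> IX m. NN c (fst v) (snd v) < 0}"
proof -
 let ?F = "%v. fw c (fst v) (snd v)" and ?P = "{v \<in> IX m. 0 < NN c (fst v) (snd v)}" and ?N = "{v \<in> IX m. NN c (fst v) (snd v) < 0}"
 have V: "fst v \<in> cm m" "snd v \<in> SYT" if "v \<in> IX m" for v using that by (auto simp: IX_def)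
 have "\<forall>v\<in>IX m. \<exists>y. ?F v = (\<Sum>i<length bs. sc (y i) (bs ! i))" using NMbasis_coords[OF b fw(4)[OF g V]] by blast
 from bchoice[OF this] obtain x where x: "\<And>v. v \<in> IX m ==> ?F v = (\<Sum>i<length bs. sc (x v i) (bs ! i))" by blast
 have Q: "Re (quad (GM c bs) (%i. \<Sum>v\<in>R. a v * x v i)) = (\<Sum>v\<in>R. (cmod (a v))\<^sup>2 * (NN c (fst v) (snd v) * Re (ip (yv (snd v)) (yv (snd v)))))"
  if R: "R \<subseteq> IX m" for R a
 proof -
  have fin: "finite R" by (rule finite_subset[OF R]) simp
  have "(\<Sum>i<length bs. sc (\<Sum>v\<in>R. a v * x v i) (bs ! i)) = (\<Sum>v\<in>R. sc (a v) (?F v))"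
  proof -
   have "(\<Sum>v\<in>R. sc (a v) (?F v)) = (\<Sum>v\<in>R. \<Sum>i<length bs. sc (a v * x v i) (bs ! i))"
    by (rule sum.cong[OF refl]) (use R x in \<open>auto simp: fv.scale_sum_right\<close>)
   also have "... = (\<Sum>i<length bs. \<Sum>v\<in>R. sc (a v * x v i) (bs ! i))" by (rule sum.swap)
   finally show ?thesis by (simp add: fv.scale_sum_left)
  qed
  hence "quad (GM c bs) (%i. \<Sum>v\<in>R. a v * x v i) = BB (of_real c) (\<Sum>v\<in>R. sc (a v) (?F v)) (\<Sum>v\<in>R. sc (a v) (?F v))"
   by (simp add: quad_GM)
  also have "... = (\<Sum>u\<in>R. \<Sum>v\<in>R. cnj (a v) * (a u * BB (of_real c) (?F u) (?F v)))"
   by (simp only: BB_sum_left, simp only: BB_sum_right BB_simps sum_distrib_left)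
  also have "... = (\<Sum>u\<in>R. \<Sum>v\<in>R. if u = v then of_real ((cmod (a u))\<^sup>2 * (NN c (fst u) (snd u) * Re (ip (yv (snd u)) (yv (snd u))))) else 0)"
  proof (intro sum.cong refl)
   fix u v assume "u \<in> R" "v \<in> R"
   hence uv: "u \<in> IX m" "v \<in> IX m" using R by auto
   show "cnj (a v) * (a u * BB (of_real c) (?F u) (?F v)) = (if u = v then of_real ((cmod (a u))\<^sup>2 * (NN c (fst u) (snd u) * Re (ip (yv (snd u)) (yv (snd u))))) else 0)"
   proof (cases "u = v")
    case True
    have e: "cnj (a u) * (a u * (of_real N * of_real r)) = of_real ((cmod (a u))\<^sup>2 * (N * r))" for N r
     by (simp add: complex_norm_square mult_ac del: of_real_power)
    have "BB (of_real c) (?F u) (?F u) = of_real (NN c (fst u) (snd u)) * of_real (Re (ip (yv (snd u)) (yv (snd u))))"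
     using fw(2)[OF g V[OF uv(1)]] by (simp add: ip_self_real[symmetric])
    thus ?thesis using True e by simp
   next
    case False
    thus ?thesis using isw_orth[OF g V(2)[OF uv(1)] V(2)[OF uv(2)] fw(1)[OF g V[OF uv(1)]] fw(1)[OF g V[OF uv(2)]]] by simp
   qed
  qed
  also have "... = of_real (\<Sum>v\<in>R. (cmod (a v))\<^sup>2 * (NN c (fst v) (snd v) * Re (ip (yv (snd v)) (yv (snd v)))))"
   using fin by simp
  finally show ?thesis by simp
 qed
 have h: "0 < Re (ip (yv (snd v)) (yv (snd v)))" if "v \<in> IX m" for v by (rule ip_pos) (use yv[OF V(2)[OF that]] in blast)
 have un: "card ?P + card ?N = length bs"
 proof -
  have "card ?P + card ?N = card (?P \<union> ?N)" by (rule card_Un_disjoint[symmetric]) auto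
  also have "?P \<union> ?N = IX m" using NN_nz[OF g V(2)] by (auto simp: neq_iff)
  finally show ?thesis by (simp add: card_NMbasis[OF b g])
 qed
 have GMc: "GM c bs \<in> carrier_mat (length bs) (length bs)" by (simp add: GM_def)
 show ?thesis
 proof (rule inertia[OF GMc GM_herm[OF b] _ _ un, where x = x])
  fix a :: "_ => complex" assume "\<exists>v\<in>?P. a v ~= 0"
  then obtain v where v: "v \<in> ?P" "a v ~= 0" by blast
  have "0 < (\<Sum>v\<in>?P. (cmod (a v))\<^sup>2 * (NN c (fst v) (snd v) * Re (ip (yv (snd v)) (yv (snd v)))))"
  proof (rule sum_pos2[of _ v])
   have t: "0 < NN c (fst w) (snd w) * Re (ip (yv (snd w)) (yv (snd w)))" if "w \<in> ?P" for w
    by (rule mult_pos_pos) (use that h[of w] in auto)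
   show "0 < (cmod (a v))\<^sup>2 * (NN c (fst v) (snd v) * Re (ip (yv (snd v)) (yv (snd v))))"
    by (rule mult_pos_pos[OF _ t[OF v(1)]]) (use v in auto)
   fix w assume "w \<in> ?P"
   from t[OF this] show "0 \<le> (cmod (a w))\<^sup>2 * (NN c (fst w) (snd w) * Re (ip (yv (snd w)) (yv (snd w))))"
    by (intro mult_nonneg_nonneg[OF zero_le_power2 less_imp_le])
  qed (use v in auto)
  thus "0 < Re (quad (GM c bs) (%i. \<Sum>v\<in>?P. a v * x v i))" by (subst Q) auto
 next
  fix a :: "_ => complex" assume "\<exists>v\<in>?N. a v ~= 0"
  then obtain v where v: "v \<in> ?N" "a v ~= 0" by blast
  have "0 < (\<Sum>v\<in>?N. (cmod (a v))\<^sup>2 * (- NN c (fst v) (snd v) * Re (ip (yv (snd v)) (yv (snd v)))))"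
  proof (rule sum_pos2[of _ v])
   have t: "0 < - NN c (fst w) (snd w) * Re (ip (yv (snd w)) (yv (snd w)))" if "w \<in> ?N" for w
    by (rule mult_pos_pos) (use that h[of w] in auto)
   show "0 < (cmod (a v))\<^sup>2 * (- NN c (fst v) (snd v) * Re (ip (yv (snd v)) (yv (snd v))))"
    by (rule mult_pos_pos[OF _ t[OF v(1)]]) (use v in auto)
   fix w assume "w \<in> ?N"
   from t[OF this] show "0 \<le> (cmod (a w))\<^sup>2 * (- NN c (fst w) (snd w) * Re (ip (yv (snd w)) (yv (snd w))))"
    by (intro mult_nonneg_nonneg[OF zero_le_power2 less_imp_le])
  qed (use v in auto)
  hence "(\<Sum>v\<in>?N. (cmod (a v))\<^sup>2 * (NN c (fst v) (snd v) * Re (ip (yv (snd v)) (yv (snd v))))) < 0"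
   by (simp add: sum_negf)
  thus "Re (quad (GM c bs) (%i. \<Sum>v\<in>?N. a v * x v i)) < 0" by (subst Q) auto
 qed auto
qed

lemma signature_sum_gen:
 assumes b: "NMbasis m bs" and g: "gen c"
 shows "int (pos_ev (GM c bs)) - int (neg_ev (GM c bs)) = (\<Sum>v\<in>IX m. (-1) ^ SE c (fst v) (snd v))"
proof -
 have V: "snd v \<in> SYT" if "v \<in> IX m" for v using that by (auto simp: IX_def)
 have "(-1) ^ SE c (fst v) (snd v) = (if 0 < NN c (fst v) (snd v) then 1 else 0) - (if NN c (fst v) (snd v) < 0 then 1 else (0::int))"
  if "v \<in> IX m" for v
 proof -
  have "real_of_int ((-1) ^ SE c (fst v) (snd v)) = real_of_int ((if 0 < NN c (fst v) (snd v) then 1 else 0) - (if NN c (fst v) (snd v) < 0 then 1 else (0::int)))"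
   using sgn_NN[OF g V[OF that], of "fst v"] NN_nz[OF g V[OF that], of "fst v"] by (auto simp: sgn_if split: if_splits)
  thus ?thesis by (simp only: of_int_eq_iff)
 qed
 hence "(\<Sum>v\<in>IX m. (-1) ^ SE c (fst v) (snd v)) = (\<Sum>v\<in>IX m. if 0 < NN c (fst v) (snd v) then 1 else 0) - (\<Sum>v\<in>IX m. if NN c (fst v) (snd v) < 0 then 1 else (0::int))"
  unfolding sum_subtractf[symmetric] by (rule sum.cong[OF refl])
 also have "... = int (card {v \<in> IX m. 0 < NN c (fst v) (snd v)}) - int (card {v \<in> IX m. NN c (fst v) (snd v) < 0})"
  by (simp add: sum.If_cases Int_def)
 finally show ?thesis using signature_gen[OF b g] by simp
qed

lemma signature_sum_int:
 assumes b: "NMbasis m bs" and k: "1 \<le> k"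
 shows "int (pos_ev (GM (- real k) bs)) - int (neg_ev (GM (- real k) bs)) = (\<Sum>v\<in>IX m. (-1) ^ SE (- real k) (fst v) (snd v))"
proof -
 let ?c0 = "- real k"
 have nondeg: "\<forall>i<length bs. y i = 0" if y: "\<And>j. j < length bs ==> (\<Sum>i<length bs. y i * GM ?c0 bs $$ (i, j)) = 0" for y
 proof -
  let ?f = "\<Sum>i<length bs. sc (y i) (bs ! i)"
  have fb: "BB (of_real ?c0) ?f (bs ! j) = 0" if "j < length bs" for j
   using y[OF that] that by (simp add: BB_sum_left BB_simps GM_def)
  have "BB (of_real ?c0) ?f h = 0" if hN: "h \<in> NM m" for h
  proof -
   obtain z where "h = (\<Sum>i<length bs. sc (z i) (bs ! i))" using NMbasis_coords[OF b hN] by blast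
   thus ?thesis using fb by (simp only: BB_sum_right BB_sc_right) simp
  qed
  moreover have "?f \<in> NM m" using NMbasis_NM[OF b] by (intro NM_closed) auto
  ultimately have "?f \<in> Rad ?c0 m" by (simp add: Rad_def)
  hence "?f = 0" by (rule nondeg_int[OF k refl])
  thus ?thesis using NMbasis_indep[OF b] by blast
 qed
 have ev: "\<forall>\<^sub>F c in at ?c0. pos_ev (GM c bs) = pos_ev (GM ?c0 bs) & neg_ev (GM c bs) = neg_ev (GM ?c0 bs)"
  by (rule signature_locally_constant[where k = "length bs"])
   (use nondeg GM_herm[OF b] in \<open>auto simp: GM_def intro!: BB_continuous pfam.const\<close>)
 have "\<forall>\<^sub>F c in at (of_int (- int k)). gen c" by (rule gen_near_int)
 hence "\<forall>\<^sub>F c in at ?c0. gen c" by simp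
 from eventually_conj[OF ev this]
 have "\<forall>\<^sub>F c in at_left ?c0. (pos_ev (GM c bs) = pos_ev (GM ?c0 bs) & neg_ev (GM c bs) = neg_ev (GM ?c0 bs)) & gen c"
  by (simp add: eventually_at_split)
 moreover have "\<forall>\<^sub>F c in at_left ?c0. c \<in> {?c0 - 1 / (real n + 1)<..<?c0}"
  by (rule eventually_at_left_real) simp
 ultimately have "\<forall>\<^sub>F c in at_left ?c0. ((pos_ev (GM c bs) = pos_ev (GM ?c0 bs) & neg_ev (GM c bs) = neg_ev (GM ?c0 bs)) & gen c) & c \<in> {?c0 - 1 / (real n + 1)<..<?c0}"
  by (rule eventually_conj)
 then obtain c where c: "pos_ev (GM c bs) = pos_ev (GM ?c0 bs)" "neg_ev (GM c bs) = neg_ev (GM ?c0 bs)" "gen c"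
   "?c0 - 1 / (real n + 1) < c" "c < ?c0"
  using eventually_happens[of _ "at_left ?c0"] by (auto simp: trivial_limit_at_left_real)
 have "(\<Sum>v\<in>IX m. (-1) ^ SE c (fst v) (snd v)) = (\<Sum>v\<in>IX m. (-1) ^ SE ?c0 (fst v) (snd v) :: int)"
  by (rule sum.cong[OF refl]) (use SE_left_of_int[OF k _ c(4,5)] in \<open>auto simp: IX_def\<close>)
 thus ?thesis using signature_sum_gen[OF b c(3)] c(1,2) by simp
qed

end

section \<open>The algebra and its polynomial representation\<close>

lemma word_add: "Word a + Word b = Word (a @ b)" by (simp add: plus_free_monoid_def)
lemma word_zero: "(0 :: 'a free_monoid) = Word []" by (simp add: zero_free_monoid_def)

lemma scalar_mult: "scalar z * p = sc z p"
proof -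
 have "scalar z * p = (\<Sum>k\<in>ks p. scalar z * sc (lk p k) (ba k))" by (subst expand[of p]) (simp only: sum_distrib_left)
 also have "... = sc z (\<Sum>k\<in>ks p. sc (lk p k) (ba k))"
  unfolding fv.scale_sum_right by (rule sum.cong[OF refl]) (simp add: sc_single mult_single)
 finally show ?thesis using expand[of p] by simp
qed

lemma sc_mult_left: "sc z p * q = sc z (p * q)" for p q :: falg
 unfolding scalar_mult[symmetric] by (rule mult.assoc)
lemma scalar_commute: "p * scalar z = scalar z * p" for p :: falg
proof -
 have b: "ba k * scalar z = scalar z * ba k" for k :: "generator free_monoid" by (simp add: mult_single)
 have "p * scalar z = (\<Sum>k\<in>ks p. sc (lk p k) (ba k) * scalar z)" by (subst expand[of p]) (simp only: sum_distrib_right)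
 also have "... = (\<Sum>k\<in>ks p. scalar z * sc (lk p k) (ba k))"
  by (rule sum.cong[OF refl]) (simp only: sc_mult_left b, simp only: scalar_mult sc_simps mult.commute)
 also have "... = scalar z * p" by (subst (2) expand[of p]) (simp only: sum_distrib_left)
 finally show ?thesis .
qed
lemma sc_mult_right: "p * sc z q = sc z (p * q)" for p q :: falg
 unfolding scalar_mult[symmetric] mult.assoc[symmetric] scalar_commute ..

lemma monom_mult: "monom_of a * monom_of b = monom_of (a @ b)" by (simp add: mult_single word_add)
lemma monom_Nil: "monom_of [] = 1" by (metis single_one word_zero)

lemma lin_ext_eq:
 assumes "linear_op f" "linear_op g" "\<And>k. k \<in> ks u ==> f (ba k) = g (ba k)"
 shows "f u = g u" by (rule linear_eqI[OF assms])

locale cherednik = young n \<tau> for n \<tau> + fixes c :: real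
begin

abbreviation "FA \<equiv> carrier (free_algebra n)"
abbreviation "CI \<equiv> cherednik_ideal n c"
abbreviation "H \<equiv> cherednik_algebra n c"
abbreviation "C \<equiv> complex_of_real c"

lemma FA_iff: "p \<in> FA \<longleftrightarrow> (\<forall>w\<in>ks p. set (letters w) \<subseteq> generators n)" by (simp add: free_algebra_def)
lemma FA_ops [simp]: "monoid.mult (free_algebra n) = (*)" "add (free_algebra n) = (+)" "\<one>\<^bsub>free_algebra n\<^esub> = 1" "\<zero>\<^bsub>free_algebra n\<^esub> = 0"
 by (simp_all add: free_algebra_def)

lemma FA_add: "p \<in> FA ==> q \<in> FA ==> p + q \<in> FA" using keys_add[of p q] by (auto simp: FA_iff)
lemma FA_sc: "p \<in> FA ==> sc z p \<in> FA" by (auto simp: FA_iff in_keys_iff)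
lemma FA_uminus: "p \<in> FA ==> - p \<in> FA" using FA_sc[of p "-1"] by (simp add: sc_minus1)
lemma FA_diff: "p \<in> FA ==> q \<in> FA ==> p - q \<in> FA" using FA_add[of p "- q"] FA_uminus[of q] by simp
lemma FA_mult: "p \<in> FA ==> q \<in> FA ==> p * q \<in> FA"
proof -
 assume a: "p \<in> FA" "q \<in> FA"
 show ?thesis unfolding FA_iff
 proof
  fix w assume "w \<in> ks (p * q)"
  then obtain u v where "w = u + v" "u \<in> ks p" "v \<in> ks q" using keys_mult[of p q] by blast
  thus "set (letters w) \<subseteq> generators n" using a by (auto simp: FA_iff plus_free_monoid_def)
 qed
qed
lemma FA_mon: "set gs \<subseteq> generators n ==> monom_of gs \<in> FA" by (simp add: FA_iff)
lemma FA_one: "1 \<in> FA" using FA_mon[of "[]"] by (simp add: monom_Nil)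
lemma FA_zero: "0 \<in> FA" by (simp add: FA_iff)
lemma FA_sum: "(\<And>i. i \<in> A ==> f i \<in> FA) ==> (\<Sum>i\<in>A. f i) \<in> FA"
 by (induction A rule: infinite_finite_induct) (auto simp: FA_zero FA_add)
lemma FA_scalar: "scalar z \<in> FA" using FA_sc[OF FA_one, of z] scalar_mult[of z 1] by simp
lemmas FA_closed = FA_add FA_sc FA_diff FA_mult FA_one FA_zero FA_sum FA_scalar FA_uminus

lemma ring_FA: "ring (free_algebra n)"
proof (rule ringI)
 show "abelian_group (free_algebra n)"
 proof (rule abelian_groupI)
  fix x assume "x \<in> FA"
  thus "\<exists>y\<in>FA. y \<oplus>\<^bsub>free_algebra n\<^esub> x = \<zero>\<^bsub>free_algebra n\<^esub>"
   by (intro bexI[of _ "- x"]) (auto simp: FA_uminus)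
 qed (auto simp: FA_closed add_ac)
 show "Group.monoid (free_algebra n)"
  by (rule monoidI) (auto simp: FA_closed mult.assoc)
qed (auto simp: FA_closed algebra_simps)

sublocale R: ring "free_algebra n" by (rule ring_FA)

lemma gens: "i \<in> Ix ==> X i \<in> generators n" "i \<in> Ix ==> Y i \<in> generators n" "w permutes Ix ==> Perm w \<in> generators n"
 by (simp_all only: generators_def) blast+

lemma perm_in: "w permutes Ix ==> i \<in> Ix ==> w i \<in> Ix" by (simp only: permutes_in_image)

lemma relators_FA: "cherednik_relators n c \<subseteq> FA"
 unfolding cherednik_relators_def
 by (intro Un_least subsetI; elim CollectE exE conjE insertE emptyE; simp only:;
  intro FA_closed FA_mon; simp only: list.set insert_subset empty_subsetI gens permutes_id permutes_inv permutes_compose perm_in tr_perm Diff_iff)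

lemma ideal_CI: "ideal CI (free_algebra n)" unfolding cherednik_ideal_def by (rule R.genideal_ideal[OF relators_FA])
sublocale I: ideal CI "free_algebra n" by (rule ideal_CI)

lemma R_minus: "q \<in> FA ==> p \<in> FA ==> p \<ominus>\<^bsub>free_algebra n\<^esub> q = p - q"
proof -
 assume q: "q \<in> FA" "p \<in> FA"
 have "\<ominus>\<^bsub>free_algebra n\<^esub> q = - q" by (rule R.minus_equality) (use q FA_uminus in auto)
 thus ?thesis by (simp add: a_minus_def)
qed

abbreviation "Cl \<equiv> cls n c"

lemma Cl_eq: "p \<in> FA ==> q \<in> FA ==> Cl p = Cl q \<longleftrightarrow> p - q \<in> CI"
 using R.quotient_eq_iff_same_a_r_cos[OF ideal_CI, of p q] R_minus[of q p] by (auto simp: cls_def)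
lemma Cl_mult: "p \<in> FA ==> q \<in> FA ==> Cl p \<otimes>\<^bsub>H\<^esub> Cl q = Cl (p * q)"
 using I.rcoset_mult_add[of p q] by (simp add: cherednik_algebra_def FactRing_def cls_def)
lemma Cl_add: "p \<in> FA ==> q \<in> FA ==> Cl p \<oplus>\<^bsub>H\<^esub> Cl q = Cl (p + q)"
 using I.a_rcos_sum[of p q] by (simp add: cherednik_algebra_def FactRing_def cls_def)
lemma carrier_H: "carrier H = Cl ` FA"
 by (auto simp: cherednik_algebra_def FactRing_def A_RCOSETS_def' cls_def)

definition ceq :: "falg => falg => bool" where "ceq p q \<longleftrightarrow> p \<in> FA & q \<in> FA & p - q \<in> CI"

lemma CI_add: "p \<in> CI ==> q \<in> CI ==> p + q \<in> CI" using I.a_closed by simp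
lemma CI_left: "a \<in> FA ==> p \<in> CI ==> a * p \<in> CI" using I.I_l_closed[of p a] by simp
lemma CI_right: "a \<in> FA ==> p \<in> CI ==> p * a \<in> CI" using I.I_r_closed[of p a] by simp
lemma CI_minus: "p \<in> CI ==> - p \<in> CI" using CI_left[OF FA_scalar[of "-1"], of p] by (simp add: scalar_mult sc_minus1)
lemma CI_zero: "0 \<in> CI" using I.additive_subgroup_axioms additive_subgroup.zero_closed by fastforce

lemma ceq_refl: "p \<in> FA ==> ceq p p" by (simp add: ceq_def CI_zero)
lemma ceq_sym: "ceq p q ==> ceq q p" using CI_minus[of "p - q"] by (simp add: ceq_def)
lemma ceq_trans [trans]: "ceq p q ==> ceq q r ==> ceq p r" using CI_add[of "p - q" "q - r"] by (simp add: ceq_def)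
lemma ceq_left: "a \<in> FA ==> ceq p q ==> ceq (a * p) (a * q)"
 using CI_left[of a "p - q"] by (simp add: ceq_def FA_mult right_diff_distrib)
lemma ceq_right: "a \<in> FA ==> ceq p q ==> ceq (p * a) (q * a)"
 using CI_right[of a "p - q"] by (simp add: ceq_def FA_mult left_diff_distrib)
lemma ceq_Cl: "ceq p q ==> Cl p = Cl q" by (simp add: ceq_def Cl_eq)

lemma relI: "p - q \<in> cherednik_relators n c ==> p \<in> FA ==> q \<in> FA ==> ceq p q"
 unfolding ceq_def cherednik_ideal_def using R.genideal_self[OF relators_FA] by blast

abbreviation "xp i \<equiv> monom_of [X i]"
abbreviation "yp i \<equiv> monom_of [Y i]"
abbreviation "wp w \<equiv> monom_of [Perm w]"

lemma xp_FA: "i \<in> Ix ==> xp i \<in> FA" by (rule FA_mon) (simp only: list.set insert_subset empty_subsetI gens)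
lemma yp_FA: "i \<in> Ix ==> yp i \<in> FA" by (rule FA_mon) (simp only: list.set insert_subset empty_subsetI gens)
lemma wp_FA: "w permutes Ix ==> wp w \<in> FA" by (rule FA_mon) (simp only: list.set insert_subset empty_subsetI gens)

lemma rel_XX: "i \<in> Ix ==> j \<in> Ix ==> ceq (xp i * xp j) (xp j * xp i)"
 by (intro relI FA_mult xp_FA, unfold cherednik_relators_def monom_mult append.simps, blast)

lemma rel_id: "ceq (wp id) 1"
 by (intro relI FA_one wp_FA permutes_id, unfold cherednik_relators_def, blast)

lemma rel_WW: "v permutes Ix ==> w permutes Ix ==> ceq (wp v * wp w) (wp (v o w))"
 by (intro relI FA_mult wp_FA permutes_compose, unfold cherednik_relators_def monom_mult append.simps, blast+)

lemma rel_WX: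
 assumes w: "w permutes Ix" and i: "i \<in> Ix"
 shows "ceq (wp w * xp i) (xp (w i) * wp w)"
proof -
 have wi: "pinv w permutes Ix" and wiin: "w i \<in> Ix" using permutes_inv[OF w] i by (simp_all only: permutes_in_image[OF w])
 note F = wp_FA[OF w] wp_FA[OF wi] xp_FA[OF i] xp_FA[OF wiin]
 have "monom_of [Perm w, X i, Perm (pinv w)] - xp (w i) \<in> cherednik_relators n c"
  unfolding cherednik_relators_def using w i by blast
 hence A: "ceq (wp w * xp i * wp (pinv w)) (xp (w i))"
  by (intro relI) (simp_all only: monom_mult append.simps, simp_all only: F, intro FA_mon, simp only: list.set insert_subset empty_subsetI gens w wi i)
 have B: "ceq (wp (pinv w) * wp w) 1"
  using ceq_trans[OF rel_WW[OF wi w]] rel_id by (simp add: permutes_inv_o[OF w])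
 have "ceq (wp w * xp i * 1) (wp w * xp i * (wp (pinv w) * wp w))"
  by (rule ceq_left[OF _ ceq_sym[OF B]]) (intro FA_mult F)
 also have "ceq ... (xp (w i) * wp w)" unfolding mult.assoc[symmetric] by (rule ceq_right[OF F(1) A])
 finally show ?thesis by simp
qed

definition ccp :: "nat => nat => falg" where
 "ccp i k = (if i = k then 1 - scalar C * (\<Sum>j\<in>Ix - {i}. wp (transpose i j)) else scalar C * wp (transpose i k))"

lemma ccp_FA: "i \<in> Ix ==> k \<in> Ix ==> ccp i k \<in> FA"
 unfolding ccp_def by (cases "i = k") (simp_all only: if_True if_False simp_thms, (intro FA_closed wp_FA tr_perm, blast+)+)

lemma rel_YX: "i \<in> Ix ==> k \<in> Ix ==> ceq (yp i * xp k) (xp k * yp i + ccp i k)"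
proof -
 assume i: "i \<in> Ix" and k: "k \<in> Ix"
 have "monom_of [Y i, X k] - monom_of [X k, Y i] - ccp i k \<in> cherednik_relators n c"
  unfolding cherednik_relators_def ccp_def using i k by (cases "i = k") (simp_all only: if_True if_False simp_thms, blast+)
 thus ?thesis
  by (intro relI FA_closed xp_FA yp_FA ccp_FA i k) (simp only: monom_mult append.simps diff_diff_eq)
qed

subsection \<open>The representation\<close>

fun gop :: "generator => mv => mv" where
 "gop (X i) = XX i" | "gop (Y i) = YY C i" | "gop (Perm w) = WW w"

lemma linear_gop [simp]: "linear_op (gop g)" by (cases g) auto

definition wop :: "generator free_monoid => mv => mv" where "wop w u = foldr gop (letters w) u"
definition rho :: "falg => mv => mv" where "rho p u = lin (%w. wop w u) p"

lemma linear_wop: "linear_op (wop w)"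
proof -
 have "linear_op (foldr gop gs)" for gs
 proof (induction gs)
  case (Cons g gs) thus ?case using lin_compI[OF linear_gop Cons] by (simp add: o_def)
 qed (simp add: linear_id'[unfolded id_def] id_def)
 thus ?thesis by (simp add: wop_def[abs_def])
qed

lemma linear_rho: "linear_op (rho p)"
 unfolding rho_def[abs_def] lin_def by (intro lin_sumI lin_scaledI linear_wop)
lemma linear_rho_left: "linear_op (%p. rho p u)" unfolding rho_def by simp
lemmas rho_lops = lops[OF linear_rho] and rho_left = lops[OF linear_rho_left]

lemma wop_add: "wop (v + w) u = wop v (wop w u)" by (simp add: wop_def plus_free_monoid_def)
lemma rho_monom: "rho (monom_of gs) u = foldr gop gs u" by (simp add: rho_def wop_def)
lemma rho_one: "rho 1 u = u" using rho_monom[of "[]" u] by (simp add: monom_Nil)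
lemma rho_scalar: "rho (scalar z * p) u = sc z (rho p u)" by (simp add: scalar_mult rho_left)

lemma rho_mult: "rho (p * q) u = rho p (rho q u)"
proof -
 have 2: "rho (ba v * q) u = rho (ba v) (rho q u)" for v
 proof (rule lin_ext_eq[of "%q. rho (ba v * q) u" "%q. rho (ba v) (rho q u)"])
  show "linear_op (%q. rho (ba v * q) u)"
   by (rule linear_opI) (simp_all add: distrib_left sc_mult_right rho_left)
  show "linear_op (%q. rho (ba v) (rho q u))" by (rule lin_compI[OF linear_rho linear_rho_left])
  fix w show "rho (ba v * ba w) u = rho (ba v) (rho (ba w) u)" by (simp add: mult_single rho_def wop_add)
 qed
 show ?thesis
 proof (rule lin_ext_eq[of "%p. rho (p * q) u" "%p. rho p (rho q u)"])
  show "linear_op (%p. rho (p * q) u)"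
   by (rule linear_opI) (simp_all add: distrib_right sc_mult_left rho_left)
 qed (simp_all add: linear_rho_left 2)
qed

lemma rho_relators: "r \<in> cherednik_relators n c ==> rho r u = 0"
proof -
 have wX: "WW w (XX i (WW (pinv w) u)) = XX (w i) u" "WW w (YY C i (WW (pinv w) u)) = YY C (w i) u" if w: "w permutes Ix" for w i
 proof -
  have "WW w (WW (pinv w) u) = u"
   using WW_WW[OF permutes_bij[OF w] permutes_bij[OF permutes_inv[OF w]], of u] by (simp add: permutes_inv_o[OF w])
  thus "WW w (XX i (WW (pinv w) u)) = XX (w i) u" "WW w (YY C i (WW (pinv w) u)) = YY C (w i) u"
   by (simp_all add: WW_XX[OF permutes_bij[OF w]] WW_YY[OF w])
 qed
 assume "r \<in> cherednik_relators n c"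
 thus ?thesis
  unfolding cherednik_relators_def
 proof (elim UnE CollectE exE conjE insertE emptyE, goal_cases)
  case 1 thus ?case by (simp add: rho_left rho_monom rho_one)
 next
  case (2 v w) thus ?case by (simp add: rho_left rho_monom WW_WW permutes_bij)
 next
  case (3 i j) thus ?case by (simp add: rho_left rho_monom XX_commute[of i j])
 next
  case (4 i j) thus ?case by (simp add: rho_left rho_monom YY_commute[of C i j])
 next
  case (5 w i) thus ?case by (simp add: rho_left rho_monom wX)
 next
  case (6 w i) thus ?case by (simp add: rho_left rho_monom wX)
 next
  case (7 i j)
  hence "cc C i j u = sc C (WW (transpose i j) u)" unfolding cc_def by simp
  thus ?case using 7 by (simp add: rho_left rho_monom rho_scalar YY_XX)
 next
  case (8 i)
  hence "cc C i i u = u - sc C (\<Sum>l\<in>Ix - {i}. WW (transpose i l) u)" unfolding cc_def by simp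
  thus ?case using 8 by (simp add: rho_left rho_monom rho_scalar rho_one YY_XX)
 qed
qed

lemma rho_CI: "p \<in> CI ==> rho p u = 0"
proof -
 let ?K = "{p \<in> FA. \<forall>u. rho p u = 0}"
 have "ideal ?K (free_algebra n)"
 proof (rule idealI[OF ring_FA])
  show "subgroup ?K (add_monoid (free_algebra n))"
  proof (rule R.add.subgroupI)
   fix a assume "a \<in> ?K"
   moreover have "\<ominus>\<^bsub>free_algebra n\<^esub> a = - a" by (rule R.minus_equality) (use calculation FA_uminus in auto)
   ultimately show "\<ominus>\<^bsub>free_algebra n\<^esub> a \<in> ?K" by (auto simp: FA_uminus rho_left)
  qed (use FA_zero in \<open>auto simp: rho_left FA_add\<close>)
 qed (auto simp: FA_mult rho_mult rho_lops)
 moreover have "cherednik_relators n c \<subseteq> ?K" using relators_FA rho_relators by blast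
 ultimately have "CI \<subseteq> ?K" unfolding cherednik_ideal_def by (rule R.genideal_minimal)
 thus "p \<in> CI ==> ?thesis" by blast
qed

definition rhoH :: "falg set => mv => mv" where "rhoH h u = rho (SOME p. p \<in> h) u"

lemma rhoH_Cl: "p \<in> FA ==> rhoH (Cl p) u = rho p u"
proof -
 assume p: "p \<in> FA"
 have "p \<in> Cl p" unfolding cls_def by (rule I.a_rcos_self[OF p])
 hence "(SOME q. q \<in> Cl p) \<in> Cl p" by (rule someI)
 then obtain i where i: "i \<in> CI" "(SOME q. q \<in> Cl p) = i + p" unfolding cls_def a_r_coset_def' by auto
 show ?thesis unfolding rhoH_def i(2) using rho_CI[OF i(1)] by (simp add: rho_left)
qed

section \<open>The standard module\<close>

abbreviation "TR \<equiv> tensor_relators n c \<tau>"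
abbreviation "TN \<equiv> tensor_null n c \<tau>"
abbreviation "PT \<equiv> pre_tensor_space n c \<tau>"
abbreviation "SM \<equiv> standard_module n c \<tau>"
abbreviation pc :: "falg => gv => pre_tensor" where "pc p v \<equiv> ba (Cl p, v)"

lemma PT_carrier: "carrier PT = {u. ks u \<subseteq> carrier H \<times> VV}"
 by (simp add: pre_tensor_space_def carrier_formal specht_eq)

lemma TR_I:
 "h \<in> carrier H ==> h' \<in> carrier H ==> v \<in> VV ==> pure (h \<oplus>\<^bsub>H\<^esub> h') v - pure h v - pure h' v \<in> TR"
 "h \<in> carrier H ==> v \<in> VV ==> v' \<in> VV ==> pure h (v + v') - pure h v - pure h v' \<in> TR"
 "h \<in> carrier H ==> v \<in> VV ==> pure (Cl (scalar z) \<otimes>\<^bsub>H\<^esub> h) v - Poly_Mapping.single (h, v) z \<in> TR"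
 "h \<in> carrier H ==> v \<in> VV ==> pure h (sc z v) - Poly_Mapping.single (h, v) z \<in> TR"
 "h \<in> carrier H ==> w permutes Ix ==> v \<in> VV ==> pure (h \<otimes>\<^bsub>H\<^esub> Cl (wp w)) v - pure h (perm_act w v) \<in> TR"
 "h \<in> carrier H ==> i \<in> Ix ==> v \<in> VV ==> pure (h \<otimes>\<^bsub>H\<^esub> Cl (yp i)) v \<in> TR"
 unfolding tensor_relators_def Let_def specht_eq sc_def by blast+

lemma Cl_H: "p \<in> FA ==> Cl p \<in> carrier H" by (simp add: carrier_H)
lemma Cl_scalar: "p \<in> FA ==> Cl (scalar z) \<otimes>\<^bsub>H\<^esub> Cl p = Cl (sc z p)"
 using Cl_mult[OF FA_scalar] by (simp add: scalar_mult)

lemma TR_cases [consumes 1, case_names add addv sc scv W Y]: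
 assumes t: "t \<in> TR"
 obtains p q v where "t = pc (p + q) v - pc p v - pc q v" "p \<in> FA" "q \<in> FA" "v \<in> VV"
 | p v v' where "t = pc p (v + v') - pc p v - pc p v'" "p \<in> FA" "v \<in> VV" "v' \<in> VV"
 | z p v where "t = pc (sc z p) v - sc z (pc p v)" "p \<in> FA" "v \<in> VV"
 | z p v where "t = pc p (sc z v) - sc z (pc p v)" "p \<in> FA" "v \<in> VV"
 | p w v where "t = pc (p * wp w) v - pc p (perm_act w v)" "p \<in> FA" "w permutes Ix" "v \<in> VV"
 | p i v where "t = pc (p * yp i) v" "p \<in> FA" "i \<in> Ix" "v \<in> VV"
 using t unfolding tensor_relators_def Let_def specht_eq sc_def[symmetric]
proof (elim UnE CollectE exE conjE, goal_cases)
 case (1 h h' v)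
 then obtain p q where "p \<in> FA" "h = Cl p" "q \<in> FA" "h' = Cl q" unfolding carrier_H by blast
 thus ?case using 1(1)[of p q v] 1 by (simp add: Cl_add)
next
 case (2 h v v')
 then obtain p where "p \<in> FA" "h = Cl p" unfolding carrier_H by blast
 thus ?case using 2(2)[of p v v'] 2 by simp
next
 case (3 z h v)
 then obtain p where "p \<in> FA" "h = Cl p" unfolding carrier_H by blast
 thus ?case using 3(3)[of z p v] 3 by (simp add: Cl_scalar single_sc[of "(Cl p, v)" z])
next
 case (4 z h v)
 then obtain p where "p \<in> FA" "h = Cl p" unfolding carrier_H by blast
 thus ?case using 4(4)[of p z v] 4 by (simp add: single_sc[of "(Cl p, v)" z])
next
 case (5 h w v)
 then obtain p where "p \<in> FA" "h = Cl p" unfolding carrier_H by blast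
 thus ?case using 5(5)[of p w v] 5 by (simp add: Cl_mult wp_FA)
next
 case (6 h i v)
 then obtain p where "p \<in> FA" "h = Cl p" unfolding carrier_H by blast
 thus ?case using 6(6)[of p i v] 6 by (simp add: Cl_mult yp_FA del: atLeastAtMost_iff)
qed

lemma TN_span: "TN = fv.span TR"
 unfolding tensor_null_def pre_tensor_space_def
proof (rule span_formal)
 have k: "Cl p \<in> carrier H" if "p \<in> FA" for p using that by (auto simp: carrier_H)
 have b: "ba (Cl p, v) \<in> carrier PT" if "p \<in> FA" "v \<in> VV" for p v using that k by (simp add: PT_carrier)
 have d: "u - u' \<in> carrier PT" if "u \<in> carrier PT" "u' \<in> carrier PT" for u u'
 proof -
  have "u - u' = u + sc (-1) u'" by (simp add: sc_minus1)
  thus ?thesis using that unfolding PT_carrier by (metis ks_add_sub ks_sc_sub mem_Collect_eq)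
 qed
 have s: "sc z u \<in> carrier PT" if "u \<in> carrier PT" for z u using that unfolding PT_carrier by (metis ks_sc_sub mem_Collect_eq)
 have "t \<in> carrier PT" if "t \<in> TR" for t
  using that by (cases t rule: TR_cases)
   (simp only:, intro d s b FA_closed wp_FA yp_FA VV_closed VV_perm_act; assumption)+
 hence "TR \<subseteq> carrier PT" by blast
 thus "TR \<subseteq> carrier (formal_space (carrier H \<times> specht \<tau>))" by (simp add: pre_tensor_space_def)
qed

lemmas TN_closed = fv.span_add[of _ TR, folded TN_span] fv.span_scale[of _ TR, folded TN_span]
 fv.span_diff[of _ TR, folded TN_span] fv.span_zero[of TR, folded TN_span] fv.span_base[of _ TR, folded TN_span]
 fv.span_sum[of _ _ TR, folded TN_span] fv.span_neg[of _ TR, folded TN_span]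

text \<open>Equality in the tensor product over the subalgebra generated by S_n and the y_i.\<close>

definition eqv :: "pre_tensor => pre_tensor => bool" where "eqv u w \<longleftrightarrow> u - w \<in> TN"

lemma eqv_refl [simp]: "eqv u u" by (simp add: eqv_def TN_closed)
lemma eqv_sym: "eqv u w ==> eqv w u" using TN_closed(7)[of "u - w"] by (simp add: eqv_def)
lemma eqv_trans [trans]: "eqv u w ==> eqv w x ==> eqv u x" using TN_closed(1)[of "u - w" "w - x"] by (simp add: eqv_def)
lemma eqv_add: "eqv u w ==> eqv u' w' ==> eqv (u + u') (w + w')"
 using TN_closed(1)[of "u - w" "u' - w'"] by (simp add: eqv_def algebra_simps)
lemma eqv_sc: "eqv u w ==> eqv (sc z u) (sc z w)"
 using TN_closed(2)[of "u - w" z] by (simp add: eqv_def sc_distribs)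
lemma eqv_sum: "(\<And>i. i \<in> A ==> eqv (f i) (g i)) ==> eqv (\<Sum>i\<in>A. f i) (\<Sum>i\<in>A. g i)"
 by (induction A rule: infinite_finite_induct) (auto intro: eqv_add)
lemma T_add: "p \<in> FA ==> q \<in> FA ==> v \<in> VV ==> eqv (pc (p + q) v) (pc p v + pc q v)"
 using TN_closed(5)[OF TR_I(1)[OF Cl_H Cl_H]] by (simp add: eqv_def Cl_add diff_diff_eq)
lemma T_addv: "p \<in> FA ==> v \<in> VV ==> v' \<in> VV ==> eqv (pc p (v + v')) (pc p v + pc p v')"
 using TN_closed(5)[OF TR_I(2)[OF Cl_H]] by (simp add: eqv_def diff_diff_eq)
lemma T_sc: "p \<in> FA ==> v \<in> VV ==> eqv (pc (sc z p) v) (sc z (pc p v))"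
 using TN_closed(5)[OF TR_I(3)[OF Cl_H], of p v z] by (simp add: eqv_def Cl_scalar single_sc[of "(Cl p, v)" z])
lemma T_scv: "p \<in> FA ==> v \<in> VV ==> eqv (pc p (sc z v)) (sc z (pc p v))"
 using TN_closed(5)[OF TR_I(4)[OF Cl_H], of p v z] by (simp add: eqv_def single_sc[of "(Cl p, v)" z])
lemma T_W: "p \<in> FA ==> w permutes Ix ==> v \<in> VV ==> eqv (pc (p * wp w) v) (pc p (perm_act w v))"
 using TN_closed(5)[OF TR_I(5)[OF Cl_H]] by (simp add: eqv_def Cl_mult wp_FA)
lemma T_Y: "p \<in> FA ==> i \<in> Ix ==> v \<in> VV ==> eqv (pc (p * yp i) v) 0"
 using TN_closed(5)[OF TR_I(6)[OF Cl_H]] by (simp add: eqv_def Cl_mult yp_FA del: atLeastAtMost_iff)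
lemma T_zero: "p \<in> FA ==> eqv (pc p 0) 0" using T_scv[of p 0 0] VV_closed by simp
lemma T_zero': "v \<in> VV ==> eqv (pc 0 v) 0" using T_sc[of 0 v 0] FA_zero by simp
lemma T_sum: "(\<And>i. i \<in> A ==> f i \<in> FA) ==> v \<in> VV ==> eqv (pc (\<Sum>i\<in>A. f i) v) (\<Sum>i\<in>A. pc (f i) v)"
proof (induction A rule: infinite_finite_induct)
 case (insert x A)
 have "eqv (pc (f x + (\<Sum>i\<in>A. f i)) v) (pc (f x) v + pc (\<Sum>i\<in>A. f i) v)"
  by (rule T_add) (use insert in \<open>auto intro: FA_sum\<close>)
 also have "eqv ... (pc (f x) v + (\<Sum>i\<in>A. pc (f i) v))" by (rule eqv_add) (use insert in auto)
 finally show ?case using insert by simp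
qed (simp_all add: T_zero')
lemma T_ceq: "ceq p q ==> pc p v = pc q v" using ceq_Cl by metis

definition Lc :: "falg => pre_tensor => pre_tensor" where "Lc p = linear_ext (%(h, v). (Cl p \<otimes>\<^bsub>H\<^esub> h, v))"
lemma linear_Lc [simp]: "linear_op (Lc p)" by (simp add: Lc_def)
lemma Lc_pc: "p \<in> FA ==> q \<in> FA ==> Lc p (pc q v) = pc (p * q) v" by (simp add: Lc_def Cl_mult)

lemma Lc_TN: assumes p: "p \<in> FA" and t: "t \<in> TN" shows "Lc p t \<in> TN"
proof -
 note L = lops[OF linear_Lc] Lc_pc[OF p]
 have "Lc p t \<in> TN" if "t \<in> TR" for t
  using that
 proof (cases t rule: TR_cases)
  case (add q r v) thus ?thesis using T_add[of "p * q" "p * r" v] p by (simp add: L FA_closed distrib_left eqv_def diff_diff_eq)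
 next
  case (addv q v v') thus ?thesis using T_addv[of "p * q" v v'] p by (simp add: L FA_closed eqv_def diff_diff_eq)
 next
  case (sc z q v) thus ?thesis using T_sc[of "p * q" v z] p by (simp add: L FA_closed sc_mult_right eqv_def)
 next
  case (scv z q v) thus ?thesis using T_scv[of "p * q" v z] p by (simp add: L FA_closed eqv_def)
 next
  case (W q w v) thus ?thesis using T_W[of "p * q" w v] p by (simp add: L FA_closed wp_FA mult.assoc[symmetric] eqv_def)
 next
  case (Y q i v) thus ?thesis using T_Y[of "p * q" i v] p yp_FA[of i] by (simp add: L FA_closed mult.assoc[symmetric] eqv_def del: atLeastAtMost_iff)
 qed
 thus ?thesis using linear_span_image[OF linear_Lc, of TR p TR t] t unfolding TN_span by blast
qed

lemma eqv_Lc: "p \<in> FA ==> eqv u w ==> eqv (Lc p u) (Lc p w)"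
 using Lc_TN[of p "u - w"] by (simp add: eqv_def lops[OF linear_Lc])

text \<open>The map that sends h \<otimes> v to h applied to the constant v. It respects the relators (Psi_TN), and Th inverts it
 up to the null space.\<close>

definition Psi :: "pre_tensor => mv" where "Psi = lin (%(h, v). rhoH h (xv zf v))"
lemma linear_Psi [simp]: "linear_op Psi" by (simp add: Psi_def)
lemmas Psi_lops = lops[OF linear_Psi]
lemma Psi_pc: "p \<in> FA ==> Psi (pc p v) = rho p (xv zf v)" by (simp add: Psi_def rhoH_Cl)

lemma Psi_TN: "t \<in> TN ==> Psi t = 0"
proof -
 have "Psi t = 0" if "t \<in> TR" for t
  using that
 proof (cases t rule: TR_cases)
  case (add p q v) thus ?thesis by (simp add: Psi_lops Psi_pc FA_closed rho_left)
 next
  case (addv p v v') thus ?thesis by (simp add: Psi_lops Psi_pc rho_lops xv_lops)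
 next
  case (sc z p v) thus ?thesis by (simp add: Psi_lops Psi_pc FA_closed rho_left)
 next
  case (scv z p v) thus ?thesis by (simp add: Psi_lops Psi_pc rho_lops xv_lops)
 next
  case (W p w v)
  have "zf o pinv w = zf" by auto
  thus ?thesis using W by (simp add: Psi_lops Psi_pc FA_closed wp_FA rho_mult rho_monom WW_xv)
 next
  case (Y p i v) thus ?thesis using yp_FA[of i] by (simp add: Psi_pc FA_closed rho_mult rho_monom YY_xv_0 rho_lops del: atLeastAtMost_iff)
 qed
 thus "t \<in> TN ==> ?thesis" using linear_span_eq[OF linear_Psi lin_zeroI, of TR t] unfolding TN_span by blast
qed

subsection \<open>Normal form\<close>

definition pl :: "(nat => nat) => nat list => falg" where "pl \<alpha> is = prod_list (map (%i. xp i ^ \<alpha> i) is)"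
definition mon :: "(nat => nat) => falg" where "mon \<alpha> = pl \<alpha> [1..<Suc n]"

lemma xpow_FA: "i \<in> Ix ==> xp i ^ a \<in> FA" by (induction a) (simp_all only: power_0 power_Suc FA_one FA_mult xp_FA)
lemma pl_FA: "set is \<subseteq> Ix ==> pl \<alpha> is \<in> FA"
 by (induction "is") (simp_all only: pl_def list.map prod_list.Nil prod_list.Cons FA_one list.set insert_subset FA_mult xpow_FA)
lemma mon_FA: "mon \<alpha> \<in> FA" unfolding mon_def by (rule pl_FA) auto

lemma xpow_comm: "i \<in> Ix ==> j \<in> Ix ==> ceq (xp i * xp j ^ a) (xp j ^ a * xp i)"
proof (induction a)
 case 0 thus ?case using ceq_refl[OF xp_FA] by simp
next
 case (Suc a)
 have "ceq (xp i * xp j * xp j ^ a) (xp j * xp i * xp j ^ a)"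
  by (rule ceq_right[OF xpow_FA[OF Suc.prems(2)] rel_XX[OF Suc.prems]])
 also have "ceq (xp j * xp i * xp j ^ a) (xp j * (xp j ^ a * xp i))"
  unfolding mult.assoc by (rule ceq_left[OF xp_FA[OF Suc.prems(2)] Suc.IH[OF Suc.prems]])
 finally show ?case by (simp only: power_Suc mult.assoc)
qed

lemma pl_up: "distinct is ==> set is \<subseteq> Ix ==> i \<in> set is ==> ceq (xp i * pl \<alpha> is) (pl (up i \<alpha>) is)"
proof (induction "is")
 case (Cons j js)
 have j: "j \<in> Ix" "set js \<subseteq> Ix" using Cons.prems by auto
 have P: "pl \<beta> (a # js) = xp a ^ \<beta> a * pl \<beta> js" for \<beta> a by (simp add: pl_def)
 show ?case
 proof (cases "j = i")
  case True
  have "pl (up i \<alpha>) js = pl \<alpha> js" unfolding pl_def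
   by (intro arg_cong[of _ _ prod_list] map_cong refl) (use Cons.prems True in \<open>auto simp: up_def\<close>)
  hence "xp i * pl \<alpha> (j # js) = pl (up i \<alpha>) (j # js)" using True by (simp add: P mult.assoc up_def)
  moreover have "pl (up i \<alpha>) (j # js) \<in> FA" by (rule pl_FA[OF Cons.prems(2)])
  ultimately show ?thesis using ceq_refl by simp
 next
  case False
  have i: "i \<in> Ix" "i \<in> set js" using Cons.prems False by auto
  have "ceq (xp i * xp j ^ \<alpha> j * pl \<alpha> js) (xp j ^ \<alpha> j * xp i * pl \<alpha> js)"
   by (rule ceq_right[OF pl_FA[OF j(2)] xpow_comm[OF i(1) j(1)]])
  also have "ceq (xp j ^ \<alpha> j * xp i * pl \<alpha> js) (xp j ^ \<alpha> j * pl (up i \<alpha>) js)"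
   unfolding mult.assoc by (rule ceq_left[OF xpow_FA[OF j(1)] Cons.IH]) (use Cons.prems i in auto)
  finally show ?thesis using False by (simp add: P mult.assoc) (simp add: up_def)
 qed
qed simp

lemma mon_up: "i \<in> Ix ==> ceq (xp i * mon \<alpha>) (mon (up i \<alpha>))" unfolding mon_def by (rule pl_up) auto
lemma mon_zf: "mon zf = 1"
proof -
 have "pl zf is = 1" for "is" by (induction "is") (simp_all add: pl_def)
 thus ?thesis by (simp add: mon_def)
qed

text \<open>The image of the standard module in the polynomial model: polynomials with coefficients in VV.\<close>

definition "NV = {f. \<forall>\<alpha>. sl \<alpha> f \<in> VV & (\<alpha> \<notin> comps --> sl \<alpha> f = 0)}"

lemma NV_add: "f \<in> NV ==> g \<in> NV ==> f + g \<in> NV" and NV_sc: "f \<in> NV ==> sc z f \<in> NV" and NV_zero: "0 \<in> NV"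
 by (auto simp: NV_def sl_lops VV_closed)
lemma NV_sum: "(\<And>i. i \<in> A ==> f i \<in> NV) ==> (\<Sum>i\<in>A. f i) \<in> NV"
 by (induction A rule: infinite_finite_induct) (auto simp: NV_zero NV_add)
lemma NM_NV: "f \<in> NM m ==> f \<in> NV" using sl_NM[of f m] cm_comps unfolding NV_def by blast
lemma NV_xv: "\<alpha> \<in> comps ==> v \<in> VV ==> xv \<alpha> v \<in> NV" using NM_xv NM_NV comps_cm by blast

lemma ks_sl: "\<beta> \<in> fst ` ks f \<longleftrightarrow> sl \<beta> f ~= 0"
proof
 assume "\<beta> \<in> fst ` ks f"
 then obtain p where "(\<beta>, p) \<in> ks f" by auto
 hence "lk (sl \<beta> f) p ~= 0" by (simp add: lk_sl in_keys_iff)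
 thus "sl \<beta> f ~= 0" by auto
qed (rule sl_ks)

definition Th :: "mv => pre_tensor" where "Th f = (\<Sum>\<alpha>\<in>fst ` ks f. pc (mon \<alpha>) (sl \<alpha> f))"

lemma Th_sup: "finite S ==> fst ` ks f \<subseteq> S ==> eqv (Th f) (\<Sum>\<alpha>\<in>S. pc (mon \<alpha>) (sl \<alpha> f))"
proof -
 assume S: "finite S" "fst ` ks f \<subseteq> S"
 have "(\<Sum>\<alpha>\<in>S. pc (mon \<alpha>) (sl \<alpha> f)) = Th f + (\<Sum>\<alpha>\<in>S - fst ` ks f. pc (mon \<alpha>) (sl \<alpha> f))"
  unfolding Th_def using sum.subset_diff[OF S(2,1)] by (simp add: add.commute)
 moreover have "eqv (\<Sum>\<alpha>\<in>S - fst ` ks f. pc (mon \<alpha>) (sl \<alpha> f)) (\<Sum>\<alpha>\<in>S - fst ` ks f. 0)"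
 proof (rule eqv_sum)
  fix \<alpha> assume "\<alpha> \<in> S - fst ` ks f"
  hence "sl \<alpha> f = 0" using ks_sl[of \<alpha> f] by blast
  thus "eqv (pc (mon \<alpha>) (sl \<alpha> f)) 0" using T_zero[OF mon_FA] by simp
 qed
 ultimately show ?thesis using eqv_add[OF eqv_refl[of "Th f"]] eqv_sym by fastforce
qed

lemma Th_add: "f \<in> NV ==> g \<in> NV ==> eqv (Th (f + g)) (Th f + Th g)"
proof -
 assume fg: "f \<in> NV" "g \<in> NV"
 let ?S = "fst ` ks f \<union> fst ` ks g"
 have "fst ` ks (f + g) \<subseteq> ?S" using keys_add[of f g] by fastforce
 hence "eqv (Th (f + g)) (\<Sum>\<alpha>\<in>?S. pc (mon \<alpha>) (sl \<alpha> (f + g)))" by (intro Th_sup) auto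
 also have "eqv ... (\<Sum>\<alpha>\<in>?S. pc (mon \<alpha>) (sl \<alpha> f) + pc (mon \<alpha>) (sl \<alpha> g))"
  unfolding sl_lops by (rule eqv_sum, rule T_addv[OF mon_FA]) (use fg in \<open>auto simp: NV_def\<close>)
 also have "eqv ... (Th f + Th g)"
  unfolding sum.distrib by (intro eqv_add eqv_sym[OF Th_sup]) auto
 finally show ?thesis .
qed

lemma Th_sc: "f \<in> NV ==> eqv (Th (sc z f)) (sc z (Th f))"
proof -
 assume f: "f \<in> NV"
 have "eqv (Th (sc z f)) (\<Sum>\<alpha>\<in>fst ` ks f. pc (mon \<alpha>) (sl \<alpha> (sc z f)))"
  by (rule Th_sup) (auto simp: in_keys_iff intro!: image_eqI)
 also have "eqv ... (\<Sum>\<alpha>\<in>fst ` ks f. sc z (pc (mon \<alpha>) (sl \<alpha> f)))"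
  unfolding sl_lops by (rule eqv_sum, rule T_scv[OF mon_FA]) (use f in \<open>auto simp: NV_def\<close>)
 finally show ?thesis by (simp add: Th_def fv.scale_sum_right)
qed

lemma Th_zero: "Th 0 = 0" by (simp add: Th_def)
lemma Th_sum: "(\<And>i. i \<in> A ==> f i \<in> NV) ==> eqv (Th (\<Sum>i\<in>A. f i)) (\<Sum>i\<in>A. Th (f i))"
proof (induction A rule: infinite_finite_induct)
 case (insert x A)
 have "eqv (Th (f x + (\<Sum>i\<in>A. f i))) (Th (f x) + Th (\<Sum>i\<in>A. f i))"
  by (rule Th_add) (use insert in \<open>auto intro: NV_sum\<close>)
 also have "eqv ... (Th (f x) + (\<Sum>i\<in>A. Th (f i)))" by (rule eqv_add) (use insert in auto)
 finally show ?case using insert by simp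
qed (simp_all add: Th_zero)

lemma Th_xv: "v \<in> VV ==> eqv (Th (xv \<alpha> v)) (pc (mon \<alpha>) v)"
proof -
 have "fst ` ks (xv \<alpha> v) \<subseteq> {\<alpha>}"
 proof
  fix \<beta> assume "\<beta> \<in> fst ` ks (xv \<alpha> v)"
  hence "sl \<beta> (xv \<alpha> v) ~= 0" by (rule ks_sl[THEN iffD1])
  thus "\<beta> \<in> {\<alpha>}" by (auto simp: sl_xv split: if_splits)
 qed
 thus ?thesis using Th_sup[of "{\<alpha>}" "xv \<alpha> v"] by (simp add: sl_xv)
qed

text \<open>A generator g can be moved past an ordered monomial, with the effect predicted by the polynomial model.\<close>

definition good_gen :: "generator => bool" where
 "good_gen g \<longleftrightarrow> (\<forall>\<alpha>\<in>comps. \<forall>v\<in>VV. gop g (xv \<alpha> v) \<in> NV & eqv (pc (monom_of [g] * mon \<alpha>) v) (Th (gop g (xv \<alpha> v))))"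

lemma good_gen_lin:
 assumes g: "good_gen g" "monom_of [g] \<in> FA" and f: "f \<in> NV"
 shows "gop g f \<in> NV & eqv (Lc (monom_of [g]) (Th f)) (Th (gop g f))"
proof -
 have a: "\<alpha> \<in> comps" if "\<alpha> \<in> fst ` ks f" for \<alpha> using f that ks_sl[of \<alpha> f] unfolding NV_def by blast
 have v: "sl \<alpha> f \<in> VV" for \<alpha> using f by (simp add: NV_def)
 have e: "gop g f = (\<Sum>\<alpha>\<in>fst ` ks f. gop g (xv \<alpha> (sl \<alpha> f)))" by (subst mv_expand[of f]) (simp only: lops[OF linear_gop])
 have N: "gop g (xv \<alpha> (sl \<alpha> f)) \<in> NV" if "\<alpha> \<in> fst ` ks f" for \<alpha> using g(1) a[OF that] v unfolding good_gen_def by blast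
 have "Lc (monom_of [g]) (Th f) = (\<Sum>\<alpha>\<in>fst ` ks f. pc (monom_of [g] * mon \<alpha>) (sl \<alpha> f))"
  by (simp add: Th_def lops[OF linear_Lc] Lc_pc[OF g(2) mon_FA])
 also have "eqv ... (\<Sum>\<alpha>\<in>fst ` ks f. Th (gop g (xv \<alpha> (sl \<alpha> f))))"
  by (rule eqv_sum) (use g(1) a v in \<open>auto simp: good_gen_def\<close>)
 also have "eqv ... (Th (gop g f))" unfolding e by (rule eqv_sym[OF Th_sum[OF N]])
 finally show ?thesis unfolding e using NV_sum[OF N] by simp
qed

lemma good_X: "i \<in> Ix ==> good_gen (X i)"
 unfolding good_gen_def
proof (intro ballI)
 fix \<alpha> v assume i: "i \<in> Ix" and a: "\<alpha> \<in> comps" "v \<in> VV"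
 have "up i \<alpha> \<in> comps" using i a(1) by (auto simp: comps_def up_def)
 thus "gop (X i) (xv \<alpha> v) \<in> NV & eqv (pc (xp i * mon \<alpha>) v) (Th (gop (X i) (xv \<alpha> v)))"
  using eqv_sym[OF Th_xv[OF a(2), of "up i \<alpha>"]] T_ceq[OF mon_up[OF i], of \<alpha> v] NV_xv a by (simp add: XX_xv)
qed

lemma mon_W:
 assumes w: "w permutes Ix" and a: "\<alpha> \<in> comps"
 shows "ceq (wp w * mon \<alpha>) (mon (\<alpha> o pinv w) * wp w)"
 using a
proof (induction \<alpha> rule: comps_induct)
 case zero
 have "zf o pinv w = zf" by auto
 thus ?case using ceq_refl[OF wp_FA[OF w]] by (simp add: mon_zf)
next
 case (up k \<beta>)
 have wk: "w k \<in> Ix" by (rule perm_in[OF w up(1)])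
 note F = mon_FA wp_FA[OF w] xp_FA[OF up(1)] xp_FA[OF wk]
 have "ceq (wp w * mon (up k \<beta>)) (wp w * (xp k * mon \<beta>))" by (rule ceq_left[OF F(2) ceq_sym[OF mon_up[OF up(1)]]])
 also have "ceq ... (xp (w k) * wp w * mon \<beta>)" unfolding mult.assoc[symmetric] by (rule ceq_right[OF F(1) rel_WX[OF w up(1)]])
 also have "ceq ... (xp (w k) * (mon (\<beta> o pinv w) * wp w))" unfolding mult.assoc by (rule ceq_left[OF F(4) up.IH])
 also have "ceq ... (mon (up (w k) (\<beta> o pinv w)) * wp w)" unfolding mult.assoc[symmetric] by (rule ceq_right[OF F(2) mon_up[OF wk]])
 finally show ?case by (simp add: up_comp_inv[OF permutes_bij[OF w]])
qed

lemma good_W: "w permutes Ix ==> good_gen (Perm w)"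
 unfolding good_gen_def
proof (intro ballI)
 fix \<alpha> v assume w: "w permutes Ix" and a: "\<alpha> \<in> comps" "v \<in> VV"
 have c': "\<alpha> o pinv w \<in> comps" using perm_cm[OF w] a(1) comps_cm by blast
 have v': "perm_act w v \<in> VV" by (rule VV_perm_act[OF a(2) w])
 have "pc (wp w * mon \<alpha>) v = pc (mon (\<alpha> o pinv w) * wp w) v" by (rule T_ceq[OF mon_W[OF w a(1)]])
 also have "eqv ... (pc (mon (\<alpha> o pinv w)) (perm_act w v))" by (rule T_W[OF mon_FA w a(2)])
 also have "eqv ... (Th (xv (\<alpha> o pinv w) (perm_act w v)))" by (rule eqv_sym[OF Th_xv[OF v']])
 finally show "gop (Perm w) (xv \<alpha> v) \<in> NV & eqv (pc (wp w * mon \<alpha>) v) (Th (gop (Perm w) (xv \<alpha> v)))"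
  using NV_xv[OF c' v'] by (simp add: WW_xv)
qed

lemma T_cc:
 assumes i: "i \<in> Ix" and k: "k \<in> Ix" and a: "\<beta> \<in> comps" and v: "v \<in> VV"
 shows "eqv (pc (ccp i k * mon \<beta>) v) (Th (cc C i k (xv \<beta> v)))"
proof -
 have g: "eqv (pc (wp (transpose i j) * mon \<beta>) v) (Th (WW (transpose i j) (xv \<beta> v)))"
  "WW (transpose i j) (xv \<beta> v) \<in> NV" "wp (transpose i j) * mon \<beta> \<in> FA" if j: "j \<in> Ix" for j
  using good_W[OF tr_perm[OF i j]] a v FA_mult[OF wp_FA[OF tr_perm[OF i j]] mon_FA] by (simp_all add: good_gen_def)
 show ?thesis
 proof (cases "i = k")
  case False
  have "pc (ccp i k * mon \<beta>) v = pc (sc C (wp (transpose i k) * mon \<beta>)) v"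
   using False by (simp add: ccp_def scalar_mult sc_mult_left)
  also have "eqv ... (sc C (pc (wp (transpose i k) * mon \<beta>) v))" by (rule T_sc[OF g(3)[OF k] v])
  also have "eqv ... (sc C (Th (WW (transpose i k) (xv \<beta> v))))" by (rule eqv_sc[OF g(1)[OF k]])
  also have "eqv ... (Th (sc C (WW (transpose i k) (xv \<beta> v))))" by (rule eqv_sym[OF Th_sc[OF g(2)[OF k]]])
  finally show ?thesis using False i k unfolding cc_def by (simp only: if_True if_False simp_thms)
 next
  case True
  let ?J = "Ix - {i}"
  let ?S = "\<Sum>j\<in>?J. wp (transpose i j) * mon \<beta>"
  let ?W = "\<Sum>j\<in>?J. WW (transpose i j) (xv \<beta> v)"
  have J: "j \<in> Ix" if "j \<in> ?J" for j using that by blast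
  have SF: "?S \<in> FA" by (rule FA_sum) (use g(3) J in blast)
  have WN: "?W \<in> NV" by (rule NV_sum) (use g(2) J in blast)
  have "pc (ccp i k * mon \<beta>) v = pc (mon \<beta> + sc (- C) ?S) v"
   using True by (simp add: ccp_def left_diff_distrib scalar_mult sc_mult_left sum_distrib_right)
  also have "eqv ... (pc (mon \<beta>) v + pc (sc (- C) ?S) v)" by (rule T_add[OF mon_FA FA_sc[OF SF] v])
  also have "eqv ... (pc (mon \<beta>) v + sc (- C) (pc ?S v))" by (rule eqv_add[OF eqv_refl T_sc[OF SF v]])
  also have "eqv ... (pc (mon \<beta>) v + sc (- C) (\<Sum>j\<in>?J. pc (wp (transpose i j) * mon \<beta>) v))"
   by (rule eqv_add[OF eqv_refl eqv_sc[OF T_sum[OF _ v]]]) (use g(3) J in blast)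
  also have "eqv ... (Th (xv \<beta> v) + sc (- C) (\<Sum>j\<in>?J. Th (WW (transpose i j) (xv \<beta> v))))"
   by (rule eqv_add[OF eqv_sym[OF Th_xv[OF v]] eqv_sc[OF eqv_sum]]) (use g(1) J in blast)
  also have "eqv ... (Th (xv \<beta> v) + sc (- C) (Th ?W))"
   by (rule eqv_add[OF eqv_refl eqv_sc[OF eqv_sym[OF Th_sum]]]) (use g(2) J in blast)
  also have "eqv ... (Th (xv \<beta> v) + Th (sc (- C) ?W))" by (rule eqv_add[OF eqv_refl eqv_sym[OF Th_sc[OF WN]]])
  also have "eqv ... (Th (xv \<beta> v + sc (- C) ?W))" by (rule eqv_sym[OF Th_add[OF NV_xv[OF a v] NV_sc[OF WN]]])
  finally show ?thesis using True i unfolding cc_def by (simp add: del: atLeastAtMost_iff)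
 qed
qed

text \<open>By induction on the exponent: y_i x_k = x_k y_i + ccp i k, and y_i annihilates the vectors 1 \<otimes> v.\<close>

lemma good_Y: "i \<in> Ix ==> good_gen (Y i)"
 unfolding good_gen_def
proof (intro ballI conjI)
 fix \<alpha> v assume i: "i \<in> Ix" and a: "\<alpha> \<in> comps" and v: "v \<in> VV"
 have Y: "YY C i (xv \<beta> v) \<in> NV" if b: "\<beta> \<in> comps" for \<beta>
 proof -
  obtain m where m: "xv \<beta> v \<in> NM m" using b NM_xv[OF _ v] comps_cm by blast
  show ?thesis
  proof (cases m)
   case 0 thus ?thesis using YY_NM0 m NV_zero by simp
  next
   case (Suc m') thus ?thesis using YY_NM[of _ m'] m NM_NV by blast
  qed
 qed
 thus "gop (Y i) (xv \<alpha> v) \<in> NV" using a by simp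
 have "eqv (pc (yp i * mon \<alpha>) v) (Th (YY C i (xv \<alpha> v)))"
  using a
 proof (induction \<alpha> rule: comps_induct)
  case zero
  show ?case using T_Y[OF FA_one i v] by (simp add: mon_zf YY_xv_0 Th_zero)
 next
  case (up k \<beta>)
  note F = xp_FA[OF up(1)] yp_FA[OF i] mon_FA ccp_FA[OF i up(1)]
  have ccN: "cc C i k (xv \<beta> v) \<in> NV"
   using cc_NM NM_NV NM_xv[OF _ v] up(2) comps_cm by metis
  have "ceq (yp i * mon (up k \<beta>)) (yp i * (xp k * mon \<beta>))" by (rule ceq_left[OF F(2) ceq_sym[OF mon_up[OF up(1)]]])
  also have "ceq ... ((xp k * yp i + ccp i k) * mon \<beta>)" unfolding mult.assoc[symmetric] by (rule ceq_right[OF F(3) rel_YX[OF i up(1)]])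
  finally have "pc (yp i * mon (up k \<beta>)) v = pc ((xp k * yp i + ccp i k) * mon \<beta>) v" by (rule T_ceq)
  also have "eqv ... (pc (xp k * (yp i * mon \<beta>)) v + pc (ccp i k * mon \<beta>) v)"
   unfolding distrib_right mult.assoc by (rule T_add) (use F FA_mult v in auto)
  also have "pc (xp k * (yp i * mon \<beta>)) v = Lc (xp k) (pc (yp i * mon \<beta>) v)" using F by (simp add: Lc_pc FA_mult)
  also have "eqv (Lc (xp k) (pc (yp i * mon \<beta>) v) + pc (ccp i k * mon \<beta>) v) (Lc (xp k) (Th (YY C i (xv \<beta> v))) + Th (cc C i k (xv \<beta> v)))"
   by (rule eqv_add[OF eqv_Lc[OF F(1) up.IH] T_cc[OF i up(1,2) v]])
  also have "eqv ... (Th (XX k (YY C i (xv \<beta> v))) + Th (cc C i k (xv \<beta> v)))"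
   using good_gen_lin[OF good_X[OF up(1)] F(1) Y[OF up(2)]] by (intro eqv_add) auto
  also have "eqv ... (Th (XX k (YY C i (xv \<beta> v)) + cc C i k (xv \<beta> v)))"
   using good_gen_lin[OF good_X[OF up(1)] F(1) Y[OF up(2)]] by (intro eqv_sym[OF Th_add] ccN) auto
  finally show ?case by (simp add: XX_xv[symmetric] YY_XX)
 qed
 thus "eqv (pc (yp i * mon \<alpha>) v) (Th (gop (Y i) (xv \<alpha> v)))" by simp
qed

lemma good_generators: "g \<in> generators n ==> good_gen g & monom_of [g] \<in> FA"
 unfolding generators_def using good_X good_Y good_W xp_FA yp_FA wp_FA by blast

lemma T_word:
 assumes v: "v \<in> VV"
 shows "set gs \<subseteq> generators n ==> foldr gop gs (xv zf v) \<in> NV & eqv (pc (monom_of gs) v) (Th (foldr gop gs (xv zf v)))"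
proof (induction gs)
 case Nil
 have "zf \<in> comps" by (simp add: comps_def)
 thus ?case using eqv_sym[OF Th_xv[OF v, of zf]] NV_xv[OF _ v] by (simp add: mon_zf monom_Nil)
next
 case (Cons g gs)
 have g: "good_gen g" "monom_of [g] \<in> FA" using good_generators Cons.prems by auto
 have gs: "monom_of gs \<in> FA" by (rule FA_mon) (use Cons.prems in auto)
 have "pc (monom_of (g # gs)) v = Lc (monom_of [g]) (pc (monom_of gs) v)" using g gs by (simp add: Lc_pc monom_mult)
 also have "eqv ... (Lc (monom_of [g]) (Th (foldr gop gs (xv zf v))))" using Cons by (intro eqv_Lc g) auto
 also have "eqv ... (Th (gop g (foldr gop gs (xv zf v))))" using good_gen_lin[OF g] Cons by auto
 finally show ?case using good_gen_lin[OF g] Cons by auto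
qed

lemma T_rho:
 assumes v: "v \<in> VV" and p: "p \<in> FA"
 shows "rho p (xv zf v) \<in> NV & eqv (pc p v) (Th (rho p (xv zf v)))"
proof -
 have w: "foldr gop (letters w) (xv zf v) \<in> NV & eqv (pc (ba w) v) (Th (foldr gop (letters w) (xv zf v)))" "ba w \<in> FA" if "w \<in> ks p" for w
  using T_word[OF v, of "letters w"] FA_mon[of "letters w"] p that by (auto simp: FA_iff)
 have r: "rho p (xv zf v) = (\<Sum>w\<in>ks p. sc (lk p w) (foldr gop (letters w) (xv zf v)))" by (simp add: rho_def lin_def wop_def)
 have "pc p v = pc (\<Sum>w\<in>ks p. sc (lk p w) (ba w)) v" using expand[of p] by simp
 also have "eqv ... (\<Sum>w\<in>ks p. pc (sc (lk p w) (ba w)) v)" by (rule T_sum[OF FA_sc[OF w(2)] v])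
 also have "eqv ... (\<Sum>w\<in>ks p. sc (lk p w) (pc (ba w) v))" by (rule eqv_sum, rule T_sc[OF w(2) v])
 also have "eqv ... (\<Sum>w\<in>ks p. sc (lk p w) (Th (foldr gop (letters w) (xv zf v))))" by (rule eqv_sum, rule eqv_sc) (use w in blast)
 also have "eqv ... (\<Sum>w\<in>ks p. Th (sc (lk p w) (foldr gop (letters w) (xv zf v))))" by (rule eqv_sum, rule eqv_sym[OF Th_sc]) (use w in blast)
 also have "eqv ... (Th (rho p (xv zf v)))" unfolding r by (rule eqv_sym[OF Th_sum]) (use w in \<open>auto intro: NV_sc\<close>)
 finally show ?thesis unfolding r using w by (auto intro!: NV_sum NV_sc)
qed

text \<open>Every tensor is equivalent to a combination of ordered monomials x^\<alpha> \<otimes> v, namely the one read off from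
 its image in the polynomial model. This is the half of the PBW theorem needed here; the linear independence of the
 monomials comes from the polynomial representation.\<close>

lemma T_normal: "u \<in> carrier PT ==> Psi u \<in> NV & eqv u (Th (Psi u))"
proof -
 assume u: "u \<in> carrier PT"
 have k: "Psi (ba k) \<in> NV & eqv (ba k) (Th (Psi (ba k)))" if "k \<in> ks u" for k
 proof -
  have "k \<in> Cl ` FA \<times> VV" using u that unfolding PT_carrier carrier_H by blast
  then obtain p v where "k = (Cl p, v)" "p \<in> FA" "v \<in> VV" by auto
  thus ?thesis using T_rho[of v p] by (simp add: Psi_pc)
 qed
 have e: "Psi u = (\<Sum>k\<in>ks u. sc (lk u k) (Psi (ba k)))" by (subst expand[of u]) (simp only: Psi_lops)
 have "u = (\<Sum>k\<in>ks u. sc (lk u k) (ba k))" by (rule expand)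
 also have "eqv ... (\<Sum>k\<in>ks u. sc (lk u k) (Th (Psi (ba k))))" by (rule eqv_sum, rule eqv_sc) (use k in blast)
 also have "eqv ... (\<Sum>k\<in>ks u. Th (sc (lk u k) (Psi (ba k))))" by (rule eqv_sum, rule eqv_sym[OF Th_sc]) (use k in blast)
 also have "eqv ... (Th (Psi u))" unfolding e by (rule eqv_sym[OF Th_sum]) (use k in \<open>auto intro: NV_sc\<close>)
 finally show ?thesis unfolding e using k by (auto intro!: NV_sum NV_sc)
qed

lemma rho_mon: "\<alpha> \<in> comps ==> rho (mon \<alpha>) (xv zf v) = xv \<alpha> v"
proof (induction \<alpha> rule: comps_induct)
 case zero show ?case by (simp add: mon_zf rho_one)
next
 case (up k \<beta>)
 have "rho (xp k * mon \<beta> - mon (up k \<beta>)) (xv zf v) = 0" using rho_CI mon_up[OF up(1), of \<beta>] by (simp add: ceq_def)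
 thus ?case using up.IH by (simp add: rho_left rho_mult rho_monom XX_xv)
qed

lemma Th_PT: "f \<in> NV ==> Th f \<in> carrier PT" and Psi_Th: "f \<in> NV ==> Psi (Th f) = f"
proof -
 assume f: "f \<in> NV"
 have "ks (Th f) \<subseteq> (\<Union>\<alpha>\<in>fst ` ks f. ks (pc (mon \<alpha>) (sl \<alpha> f)))" unfolding Th_def by (rule keys_sum)
 also have "... \<subseteq> carrier H \<times> VV" using f mon_FA by (auto simp: carrier_H NV_def)
 finally show "Th f \<in> carrier PT" by (simp add: PT_carrier)
 have "Psi (Th f) = (\<Sum>\<alpha>\<in>fst ` ks f. rho (mon \<alpha>) (xv zf (sl \<alpha> f)))" by (simp add: Th_def Psi_lops Psi_pc mon_FA)
 also have "... = (\<Sum>\<alpha>\<in>fst ` ks f. xv \<alpha> (sl \<alpha> f))"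
  by (rule sum.cong[OF refl], rule rho_mon) (use f ks_sl in \<open>auto simp: NV_def\<close>)
 finally show "Psi (Th f) = f" using mv_expand[of f] by simp
qed

lemma Psi_kernel: "u \<in> carrier PT ==> u' \<in> carrier PT ==> Psi u = Psi u' \<longleftrightarrow> u - u' \<in> TN"
proof
 assume u: "u \<in> carrier PT" "u' \<in> carrier PT" "Psi u = Psi u'"
 thus "u - u' \<in> TN" using T_normal[OF u(1)] T_normal[OF u(2)] eqv_trans eqv_sym unfolding eqv_def[symmetric] by metis
next
 assume "u - u' \<in> TN" thus "Psi u = Psi u'" using Psi_TN[of "u - u'"] by (simp add: Psi_lops)
qed

end

section \<open>Transport of bases\<close>

text \<open>A linear isomorphism from a module record onto a subspace of finitely supported functions. It carries bases over in
 both directions.\<close>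

locale coordinates =
 fixes V :: "(complex, 'b) module" and \<psi> :: "'b => ('a \<Rightarrow>\<^sub>0 complex)" and S
 assumes inj: "inj_on \<psi> (carrier V)" and range: "\<psi> ` carrier V = S" and subspace: "fv.subspace S"
  and add: "u \<in> carrier V ==> v \<in> carrier V ==> u \<oplus>\<^bsub>V\<^esub> v \<in> carrier V & \<psi> (u \<oplus>\<^bsub>V\<^esub> v) = \<psi> u + \<psi> v"
  and scale: "u \<in> carrier V ==> z \<odot>\<^bsub>V\<^esub> u \<in> carrier V & \<psi> (z \<odot>\<^bsub>V\<^esub> u) = sc z (\<psi> u)"
  and zero: "\<zero>\<^bsub>V\<^esub> \<in> carrier V & \<psi> \<zero>\<^bsub>V\<^esub> = 0"
begin

lemma eqI: "u \<in> carrier V ==> v \<in> carrier V ==> \<psi> u = \<psi> v ==> u = v" using inj by (simp add: inj_on_def)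

lemma vs: "vectorspace class_ring V"
proof -
 have "abelian_group V"
 proof (rule abelian_groupI)
  fix x assume x: "x \<in> carrier V"
  show "\<exists>y\<in>carrier V. y \<oplus>\<^bsub>V\<^esub> x = \<zero>\<^bsub>V\<^esub>"
   using scale[OF x, of "-1"] add[of "(-1) \<odot>\<^bsub>V\<^esub> x" x] zero x
   by (intro bexI[of _ "(-1) \<odot>\<^bsub>V\<^esub> x"] eqI) (simp_all add: sc_minus1)
 qed (auto intro!: eqI simp: add zero add_ac)
 moreover have "module_axioms class_ring V"
  by unfold_locales (auto intro!: eqI simp: add scale zero sc_distribs)
 ultimately have "Module.module class_ring V"
  by (intro module.intro class_cring.is_cring)
 thus ?thesis by (intro vectorspace.intro class_field.field_axioms)
qed

sublocale vectorspace class_ring V by (rule vs)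

lemma psi_lincomb: "finite A ==> A \<subseteq> carrier V ==> \<psi> (lincomb a A) = (\<Sum>v\<in>A. sc (a v) (\<psi> v))"
proof (induction A rule: finite_induct)
 case empty
 thus ?case using zero by (simp add: lincomb_def)
next
 case (insert x A)
 have t: "(%v. a v \<odot>\<^bsub>V\<^esub> v) \<in> A \<rightarrow> carrier V" "a x \<odot>\<^bsub>V\<^esub> x \<in> carrier V" using insert.prems scale by auto
 have l: "lincomb a A \<in> carrier V" unfolding lincomb_def using t(1) by (rule finsum_closed)
 have "lincomb a (insert x A) = a x \<odot>\<^bsub>V\<^esub> x \<oplus>\<^bsub>V\<^esub> lincomb a A"
  unfolding lincomb_def using insert.hyps t by (subst finsum_insert) auto
 thus ?case using insert add[OF t(2) l] scale[of x "a x"] by simp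
qed

lemma basis_image:
 assumes b: "basis B"
 shows "B \<subseteq> carrier V" "fv.independent (\<psi> ` B)" "fv.span (\<psi> ` B) = S"
proof -
 show B: "B \<subseteq> carrier V" using b by (simp add: basis_def)
 have iB: "inj_on \<psi> A" if "A \<subseteq> B" for A using inj_on_subset[OF inj] that B by blast
 have sumim: "(\<Sum>x\<in>\<psi> ` A. sc (u x) x) = \<psi> (lincomb (%v. u (\<psi> v)) A)" if "finite A" "A \<subseteq> B" for u A
  using that B by (subst psi_lincomb) (auto simp: sum.reindex[OF iB])
 show "fv.independent (\<psi> ` B)"
  unfolding fv.independent_explicit_finite_subsets
 proof (intro allI impI ballI)
  fix A' u v assume A': "A' \<subseteq> \<psi> ` B" "finite A'" "(\<Sum>v\<in>A'. sc (u v) v) = 0" "v \<in> A'"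
  obtain A where A: "A \<subseteq> B" "finite A" "A' = \<psi> ` A" using A'(1,2) finite_subset_image by metis
  have "\<psi> (lincomb (%v. u (\<psi> v)) A) = 0" using sumim[OF A(2,1)] A'(3) A(3) by simp
  moreover have "lincomb (%v. u (\<psi> v)) A \<in> carrier V" using A B by (intro lincomb_closed) auto
  ultimately have "lincomb (%v. u (\<psi> v)) A = \<zero>\<^bsub>V\<^esub>" using eqI zero by metis
  hence "\<forall>w\<in>A. u (\<psi> w) = 0" using b A unfolding basis_def lin_dep_def by auto
  thus "u v = 0" using A(3) A'(4) by auto
 qed
 show "fv.span (\<psi> ` B) = S"
 proof
  show "fv.span (\<psi> ` B) \<subseteq> S" by (rule fv.span_minimal) (use B range subspace in auto)
  show "S \<subseteq> fv.span (\<psi> ` B)"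
  proof
   fix s assume "s \<in> S"
   then obtain u where u: "u \<in> carrier V" "s = \<psi> u" using range by auto
   hence "u \<in> span B" using b by (simp add: basis_def)
   then obtain a A where "u = lincomb a A" "finite A" "A \<subseteq> B" unfolding span_def by blast
   hence s: "s = (\<Sum>v\<in>A. sc (a v) (\<psi> v))" and AB: "A \<subseteq> B" using u B psi_lincomb by auto
   show "s \<in> fv.span (\<psi> ` B)" unfolding s by (intro fv.span_sum fv.span_scale fv.span_base) (use AB in blast)
  qed
 qed
qed

lemma basis_exists:
 assumes f: "finite T" "fv.independent T" "fv.span T = S" shows "\<exists>B. finite B & basis B"
proof -
 have TS: "T \<subseteq> S" using f(3) fv.span_superset by blast
 define iv where "iv = inv_into (carrier V) \<psi>"
 have iv: "iv t \<in> carrier V" "\<psi> (iv t) = t" if "t \<in> S" for t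
  using that range unfolding iv_def by (auto intro: inv_into_into f_inv_into_f)
 let ?B = "iv ` T"
 have B: "?B \<subseteq> carrier V" "finite ?B" using iv TS f(1) by auto
 have ivp: "iv (\<psi> v) = v" if v: "v \<in> ?B" for v
 proof -
  obtain t where "t \<in> T" "v = iv t" using v by blast
  thus ?thesis using iv(2)[of t] TS by auto
 qed
 have sumB: "\<psi> (lincomb a A) = (\<Sum>t\<in>\<psi> ` A. sc (a (iv t)) t)" if "A \<subseteq> ?B" for a A
 proof -
  have "inj_on \<psi> A" using inj_on_subset[OF inj] that B by blast
  moreover have "iv (\<psi> v) = v" if "v \<in> A" for v using ivp that \<open>A \<subseteq> ?B\<close> by blast
  ultimately show ?thesis using that B finite_subset[OF that] by (subst psi_lincomb) (auto simp: sum.reindex)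
 qed
 have im: "\<psi> ` ?B = T" using iv TS by (force simp: image_image)
 have "\<not> lin_dep ?B"
 proof
  assume "lin_dep ?B"
  then obtain A a v where A: "finite A" "A \<subseteq> ?B" "lincomb a A = \<zero>\<^bsub>V\<^esub>" "v \<in> A" "a v ~= 0" unfolding lin_dep_def by auto
  have "(\<Sum>t\<in>\<psi> ` A. sc (a (iv t)) t) = 0" using sumB[OF A(2), of a] A(3) zero by simp
  moreover have "\<psi> ` A \<subseteq> T" using A(2) im by blast
  ultimately have "a (iv (\<psi> v)) = 0"
   using f(2) A(1,4) fv.independentD[of T "\<psi> ` A" "%t. a (iv t)" "\<psi> v"] by auto
  moreover have "iv (\<psi> v) = v" using A(2,4) ivp by blast
  ultimately show False using A(5) by simp
 qed
 moreover have "span ?B = carrier V"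
 proof
  show "span ?B \<subseteq> carrier V"
  proof
   fix u assume "u \<in> span ?B"
   then obtain a A where u: "u = lincomb a A" "A \<subseteq> ?B" unfolding span_def by blast
   show "u \<in> carrier V" unfolding u(1) by (rule lincomb_closed) (use u(2) B(1) in auto)
  qed
  show "carrier V \<subseteq> span ?B"
  proof
   fix u assume u: "u \<in> carrier V"
   hence "\<psi> u \<in> fv.span T" using range f(3) by auto
   then obtain a where a: "\<psi> u = (\<Sum>t\<in>T. sc (a t) t)" using fv.span_finite[OF f(1)] by auto
   have "\<psi> (lincomb (%v. a (\<psi> v)) ?B) = \<psi> u"
    unfolding sumB[OF order.refl] im a by (rule sum.cong[OF refl]) (use iv(2) TS in \<open>simp add: subset_iff\<close>)
   moreover have "lincomb (%v. a (\<psi> v)) ?B \<in> carrier V" using B by (intro lincomb_closed) auto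
   ultimately have "u = lincomb (%v. a (\<psi> v)) ?B" using eqI u by metis
   thus "u \<in> span ?B" unfolding span_def using B(2)
    by (intro CollectI exI[of _ "%v. a (\<psi> v)"] exI[of _ ?B]) simp
  qed
 qed
 ultimately have "basis ?B" using B by (simp add: basis_def)
 thus ?thesis using B by blast
qed

end

context cherednik
begin

subsection \<open>The standard module in coordinates\<close>

abbreviation cos :: "pre_tensor => pre_tensor set" where "cos u \<equiv> TN +>\<^bsub>PT\<^esub> u"

lemma cos_def': "cos u = {t + u | t. t \<in> TN}" unfolding pre_tensor_space_def by (rule coset_formal)

lemma cos_eqI: "u - u' \<in> TN ==> cos u = cos u'"
proof -
 have s: "cos u \<subseteq> cos u'" if "u - u' \<in> TN" for u u'
 proof
  fix x assume "x \<in> cos u"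
  then obtain t where "t \<in> TN" "x = t + u" by (auto simp: cos_def')
  hence "x = (t + (u - u')) + u'" "t + (u - u') \<in> TN" using TN_closed(1)[OF _ that] by simp_all
  thus "x \<in> cos u'" unfolding cos_def' by blast
 qed
 assume d: "u - u' \<in> TN"
 hence "u' - u \<in> TN" using TN_closed(7)[OF d] by simp
 thus ?thesis using s d by blast
qed

lemma UN_cos: "linear_op f ==> (\<And>t. t \<in> TN ==> f t \<in> TN) ==> (\<Union>u'\<in>cos u. cos (f u')) = cos (f u)"
proof -
 assume f: "linear_op f" "\<And>t. t \<in> TN ==> f t \<in> TN"
 have "cos (f u') = cos (f u)" if u': "u' \<in> cos u" for u'
 proof -
  obtain t where "t \<in> TN" "u' = t + u" using u' by (auto simp: cos_def')
  thus ?thesis using f(2)[of t] by (intro cos_eqI) (simp add: lops[OF f(1)])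
 qed
 moreover have "u \<in> cos u" unfolding cos_def' using TN_closed(4) by force
 ultimately show ?thesis by blast
qed

lemma SM_carrier: "carrier SM = cos ` carrier PT"
 by (auto simp: standard_module_def quot_module_def A_RCOSETS_def')
lemma PT_ops [simp]: "add PT = (+)" "\<zero>\<^bsub>PT\<^esub> = 0" "module.smult PT = sc" by (simp_all add: pre_tensor_space_def)
lemma SM_add: "cos u \<oplus>\<^bsub>SM\<^esub> cos u' = cos (u + u')"
proof -
 have "cos u \<oplus>\<^bsub>SM\<^esub> cos u' = {x + y | x y. x \<in> cos u & y \<in> cos u'}"
  by (auto simp: standard_module_def quot_module_def set_add_def set_mult_def)
 also have "... = cos (u + u')"
 proof (intro equalityI subsetI)
  fix x assume "x \<in> {x + y | x y. x \<in> cos u & y \<in> cos u'}"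
  then obtain t t' where "t \<in> TN" "t' \<in> TN" "x = (t + u) + (t' + u')" by (auto simp: cos_def')
  hence "x = (t + t') + (u + u')" "t + t' \<in> TN" by (simp_all add: TN_closed)
  thus "x \<in> cos (u + u')" unfolding cos_def' by blast
 next
  fix x assume "x \<in> cos (u + u')"
  then obtain t where "t \<in> TN" "x = (t + u) + (0 + u')" by (auto simp: cos_def' add_ac)
  thus "x \<in> {x + y | x y. x \<in> cos u & y \<in> cos u'}" using TN_closed(4) unfolding cos_def' by blast
 qed
 finally show ?thesis .
qed
lemma SM_smult: "z \<odot>\<^bsub>SM\<^esub> cos u = cos (sc z u)"
proof -
 have "(\<Union>x\<in>cos u. cos (sc z x)) = cos (sc z u)"
  by (rule UN_cos[OF lin_scaledI[OF lin_idI]]) (rule TN_closed)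
 thus ?thesis by (simp add: standard_module_def quot_module_def)
qed
lemma SM_zero: "\<zero>\<^bsub>SM\<^esub> = cos 0"
 by (simp add: standard_module_def quot_module_def cos_def')
lemma SM_gen: "g \<in> generators n ==> gen_act n c \<tau> g (cos u) = cos (Lc (monom_of [g]) u)"
 unfolding cherednik_act_def Lc_def[symmetric]
 by (rule UN_cos[OF linear_Lc Lc_TN]) (use good_generators in blast)+

definition psi :: "pre_tensor set => mv" where "psi U = Psi (SOME u. u \<in> U)"

text \<open>Independent of the representative, since Psi vanishes on the null space.\<close>

lemma psi_cos: "psi (cos u) = Psi u"
proof -
 have "u \<in> cos u" unfolding cos_def' using TN_closed(4) by force
 hence "(SOME x. x \<in> cos u) \<in> cos u" by (rule someI)
 then obtain t where "t \<in> TN" "(SOME x. x \<in> cos u) = t + u" by (auto simp: cos_def')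
 thus ?thesis by (simp add: psi_def Psi_lops Psi_TN)
qed

lemma PT_closed: "u \<in> carrier PT ==> u' \<in> carrier PT ==> u + u' \<in> carrier PT" "u \<in> carrier PT ==> sc z u \<in> carrier PT" "0 \<in> carrier PT"
 unfolding PT_carrier using ks_add_sub[of u _ u'] ks_sc_sub[of u _ z] by auto

lemma psi_inj: "inj_on psi (carrier SM)"
proof (rule inj_onI)
 fix U U' assume "U \<in> carrier SM" "U' \<in> carrier SM" "psi U = psi U'"
 then obtain u u' where "u \<in> carrier PT" "u' \<in> carrier PT" "U = cos u" "U' = cos u'" "Psi u = Psi u'" by (auto simp: SM_carrier psi_cos)
 thus "U = U'" using Psi_kernel[of u u'] cos_eqI by simp
qed

lemma psi_NV: "U \<in> carrier SM ==> psi U \<in> NV" using T_normal by (auto simp: SM_carrier psi_cos)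
lemma psi_iv: "f \<in> NV ==> cos (Th f) \<in> carrier SM & psi (cos (Th f)) = f" using Th_PT Psi_Th by (simp add: SM_carrier psi_cos)
lemma psi_add: "U \<in> carrier SM ==> U' \<in> carrier SM ==> U \<oplus>\<^bsub>SM\<^esub> U' \<in> carrier SM & psi (U \<oplus>\<^bsub>SM\<^esub> U') = psi U + psi U'"
 using PT_closed by (auto simp: SM_carrier SM_add psi_cos Psi_lops)
lemma psi_sc: "U \<in> carrier SM ==> z \<odot>\<^bsub>SM\<^esub> U \<in> carrier SM & psi (z \<odot>\<^bsub>SM\<^esub> U) = sc z (psi U)"
 using PT_closed by (auto simp: SM_carrier SM_smult psi_cos Psi_lops)
lemma psi_zero: "\<zero>\<^bsub>SM\<^esub> \<in> carrier SM & psi \<zero>\<^bsub>SM\<^esub> = 0"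
 using PT_closed(3) by (auto simp: SM_carrier SM_zero psi_cos Psi_lops)

lemma psi_gen: "g \<in> generators n ==> U \<in> carrier SM ==> gen_act n c \<tau> g U \<in> carrier SM & psi (gen_act n c \<tau> g U) = gop g (psi U)"
proof -
 assume g: "g \<in> generators n" and U: "U \<in> carrier SM"
 obtain u where u: "u \<in> carrier PT" "U = cos u" using U by (auto simp: SM_carrier)
 have gF: "monom_of [g] \<in> FA" using good_generators[OF g] by blast
 have P: "Psi (Lc (monom_of [g]) u) = gop g (Psi u)"
 proof (rule lin_ext_eq[OF lin_compI[OF linear_Psi linear_Lc] lin_compI[OF linear_gop linear_Psi]])
  fix k assume "k \<in> ks u"
  hence "k \<in> Cl ` FA \<times> VV" using u(1) unfolding PT_carrier carrier_H by blast
  then obtain p v where "k = (Cl p, v)" "p \<in> FA" by auto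
  thus "Psi (Lc (monom_of [g]) (ba k)) = gop g (Psi (ba k))"
   by (simp add: Lc_pc gF Psi_pc FA_mult rho_mult rho_monom)
 qed
 have "Lc (monom_of [g]) u \<in> carrier PT"
 proof -
  have "ks (Lc (monom_of [g]) u) \<subseteq> (%(h, v). (Cl (monom_of [g]) \<otimes>\<^bsub>H\<^esub> h, v)) ` ks u"
   unfolding Lc_def linear_ext_def by (rule order.trans[OF keys_sum]) auto
  also have "... \<subseteq> carrier H \<times> VV"
  proof (rule image_subsetI)
   fix k assume "k \<in> ks u"
   hence "k \<in> Cl ` FA \<times> VV" using u(1) unfolding PT_carrier carrier_H by blast
   thus "(case k of (h, v) => (Cl (monom_of [g]) \<otimes>\<^bsub>H\<^esub> h, v)) \<in> carrier H \<times> VV"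
    using gF by (auto simp: Cl_mult carrier_H FA_mult)
  qed
  finally show ?thesis by (simp add: PT_carrier)
 qed
 thus ?thesis using P unfolding u(2) SM_gen[OF g] by (simp add: psi_cos SM_carrier)
qed

lemma xpow_word: "xp i ^ a = monom_of (map X (replicate a i))"
 by (induction a) (simp_all add: monom_Nil monom_mult)
lemma pl_word: "pl \<alpha> is = monom_of (map X (concat (map (%i. replicate (\<alpha> i) i) is)))"
 by (induction "is") (simp_all add: pl_def monom_Nil xpow_word monom_mult)

lemma degree_part_psi: "degree_part n c \<tau> m \<subseteq> carrier SM" "psi ` degree_part n c \<tau> m = NM m"
proof -
 let ?K = "{(Cl (monom_of (map X is)), v) | is v. set is \<subseteq> Ix & length is = m & v \<in> VV}"
 have D: "degree_part n c \<tau> m = {cos u | u. ks u \<subseteq> ?K}" by (simp add: degree_part_def specht_eq)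
 have wF: "monom_of (map X is) \<in> FA" if "set is \<subseteq> Ix" for "is"
  by (rule FA_mon) (use that in \<open>auto simp: generators_def simp del: atLeastAtMost_iff\<close>)
 have K: "?K \<subseteq> carrier H \<times> VV" using wF by (auto simp: carrier_H simp del: atLeastAtMost_iff)
 thus sub: "degree_part n c \<tau> m \<subseteq> carrier SM" unfolding D SM_carrier PT_carrier by auto
 have wN: "foldr gop (map X is) (xv zf v) \<in> NM (length is)" if "set is \<subseteq> Ix" "v \<in> VV" for "is" v
  using that by (induction "is") (auto intro: NM_xv zf_cm XX_NM simp del: atLeastAtMost_iff)
 show "psi ` degree_part n c \<tau> m = NM m"
 proof (intro equalityI subsetI)
  fix f assume "f \<in> psi ` degree_part n c \<tau> m"
  then obtain u where u: "ks u \<subseteq> ?K" "f = Psi u" by (auto simp: D psi_cos)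
  have "Psi (ba k) \<in> NM m" if "k \<in> ks u" for k
  proof -
   obtain "is" v where "k = (Cl (monom_of (map X is)), v)" "set is \<subseteq> Ix" "length is = m" "v \<in> VV" using u(1) \<open>k \<in> ks u\<close> by blast
   thus ?thesis using wN[of "is" v] wF[of "is"] by (simp add: Psi_pc rho_monom)
  qed
  hence "(\<Sum>k\<in>ks u. sc (lk u k) (Psi (ba k))) \<in> NM m" by (intro NM_closed) auto
  moreover have "Psi u = (\<Sum>k\<in>ks u. sc (lk u k) (Psi (ba k)))" by (subst expand[of u]) (simp only: Psi_lops)
  ultimately show "f \<in> NM m" using u(2) by simp
 next
  fix f assume f: "f \<in> NM m"
  have "ks (Th f) \<subseteq> ?K"
  proof -
   have "ks (Th f) \<subseteq> (\<Union>\<alpha>\<in>fst ` ks f. ks (pc (mon \<alpha>) (sl \<alpha> f)))" unfolding Th_def by (rule keys_sum)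
   also have "... \<subseteq> ?K"
   proof (rule UN_least)
    fix \<alpha> assume "\<alpha> \<in> fst ` ks f"
    hence a: "\<alpha> \<in> cm m" "sl \<alpha> f \<in> VV" using ks_sl[of \<alpha> f] sl_NM[OF f, of \<alpha>] by blast+
    let ?is = "concat (map (%i. replicate (\<alpha> i) i) [1..<Suc n])"
    have "length ?is = (\<Sum>i\<in>Ix. \<alpha> i)"
     by (simp add: length_concat o_def interv_sum_list_conv_sum_set_nat atLeastLessThanSuc_atLeastAtMost del: upt_Suc)
    moreover have "set ?is \<subseteq> Ix" by (auto simp del: upt_Suc)
    moreover have "mon \<alpha> = monom_of (map X ?is)" unfolding mon_def by (rule pl_word)
    ultimately have "(Cl (mon \<alpha>), sl \<alpha> f) \<in> ?K" using a unfolding cm_def by (simp only: mem_Collect_eq) blast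
    thus "ks (pc (mon \<alpha>) (sl \<alpha> f)) \<subseteq> ?K" by simp
   qed
   finally show ?thesis .
  qed
  hence "cos (Th f) \<in> degree_part n c \<tau> m" unfolding D by blast
  thus "f \<in> psi ` degree_part n c \<tau> m" using psi_iv[OF NM_NV[OF f]] by (metis imageI)
 qed
qed

lemma degree_coordinates:
 assumes z: "z ~= 0"
 shows "coordinates (SM\<lparr>carrier := degree_part n c \<tau> m\<rparr>) (%U. sc z (psi U)) (NM m)"
proof -
 let ?D = "degree_part n c \<tau> m"
 note d = degree_part_psi[of m]
 have mem: "U \<in> ?D" if U: "U \<in> carrier SM" "psi U \<in> NM m" for U
 proof -
  have "psi U \<in> psi ` ?D" using U(2) d(2) by simp
  then obtain U' where U': "U' \<in> ?D" "psi U = psi U'" by blast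
  hence "U = U'" by (intro inj_onD[OF psi_inj]) (use U(1) d(1) in auto)
  thus ?thesis using U'(1) by simp
 qed
 have pN: "psi U \<in> NM m" if "U \<in> ?D" for U using d(2) that by blast
 show ?thesis
 proof (unfold_locales, goal_cases)
  case 1
  show ?case
  proof (rule inj_onI)
   fix U U' assume U: "U \<in> carrier (SM\<lparr>carrier := ?D\<rparr>)" "U' \<in> carrier (SM\<lparr>carrier := ?D\<rparr>)" "sc z (psi U) = sc z (psi U')"
   hence "psi U = psi U'" using z by simp
   thus "U = U'" by (rule inj_onD[OF psi_inj]) (use U d(1) in auto)
  qed
 next
  case 2
  have "sc z ` NM m = NM m"
  proof (intro equalityI subsetI)
   fix f assume "f \<in> NM m"
   hence "f = sc z (sc (1 / z) f)" "sc (1 / z) f \<in> NM m" using z by (simp_all add: NM_closed)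
   thus "f \<in> sc z ` NM m" by blast
  qed (auto intro: NM_closed)
  thus ?case using d(2) by (simp add: image_image[symmetric])
 next
  case 3 show ?case unfolding NM_def by (rule fv.subspace_span)
 next
  case (4 u v)
  hence uv: "u \<in> ?D" "v \<in> ?D" "u \<in> carrier SM" "v \<in> carrier SM" using d(1) by auto
  show ?case using psi_add[OF uv(3,4)] mem NM_closed(1)[OF pN[OF uv(1)] pN[OF uv(2)]] by (simp add: sc_distribs)
 next
  case (5 u a)
  hence u: "u \<in> ?D" "u \<in> carrier SM" using d(1) by auto
  show ?case using psi_sc[OF u(2), of a] mem NM_closed(2)[OF pN[OF u(1)]] by (simp add: mult.commute)
 next
  case 6 show ?case using psi_zero mem NM_closed(5) by simp
 qed
qed

section \<open>Contravariant forms\<close>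

lemma NV_NC: "f \<in> NV ==> f \<in> NC" by (simp add: NV_def NC_sl)
lemma C_real: "cnj C = C" by simp

lemma form_exists:
 assumes nd: "\<And>m f. f \<in> Rad c m ==> f = 0"
 shows "contravariant_form n c \<tau> (%U V. BB C (psi U) (psi V))"
 unfolding contravariant_form_def Let_def
proof (intro conjI ballI allI impI, goal_cases)
 case (3 U V) show ?case by (rule BB_herm[OF C_real NV_NC[OF psi_NV[OF 3(1)]] NV_NC[OF psi_NV[OF 3(2)]]])
next
 case (4 w U V) thus ?case using psi_gen[OF gens(3)[OF 4(1)] 4(2)] psi_gen[OF gens(3)[OF 4(1)] 4(3)] by (simp add: BB_WW[OF 4(1)])
next
 case (5 i U V) thus ?case using psi_gen[OF gens(1)[OF 5(1)] 5(2)] psi_gen[OF gens(2)[OF 5(1)] 5(3)] BB_XX[OF 5(1)] by simp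
next
 case (6 U)
 let ?f = "psi U"
 have fN: "?f \<in> NV" using 6 psi_NV by blast
 have z: "BB C ?f g = 0" if "g \<in> NV" for g using 6(2) psi_iv[OF that] by metis
 have "sl \<alpha> ?f = 0" if a: "\<alpha> \<in> cm m" for \<alpha> m
 proof -
  let ?h = "\<Sum>\<beta>\<in>cm m. xv \<beta> (sl \<beta> ?f)"
  have hN: "?h \<in> NM m" using fN by (intro NM_closed NM_xv) (auto simp: NV_def)
  have "BB C ?h g = 0" if g: "g \<in> NM m" for g
  proof -
   have "BB C ?f g = (\<Sum>\<beta>\<in>cm m. BB C (xv \<beta> (sl \<beta> ?f)) g)"
   proof (subst BB_expand, rule sum.mono_neutral_cong)
    fix \<beta> assume b: "\<beta> \<in> cm m - fst ` ks ?f"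
    hence "sl \<beta> ?f = 0" using ks_sl[of \<beta> ?f] by blast
    thus "BB C (xv \<beta> (sl \<beta> ?f)) g = 0" by (simp add: xv_lops)
   next
    fix \<beta> assume b: "\<beta> \<in> fst ` ks ?f - cm m"
    then obtain m' where "\<beta> \<in> cm m'" using fN ks_sl[of \<beta> ?f] comps_cm unfolding NV_def by blast
    moreover have "m' ~= m" using b calculation by blast
    ultimately show "BB C (xv \<beta> (sl \<beta> ?f)) g = 0" using fN g by (intro BB_deg[OF NM_xv]) (auto simp: NV_def)
   qed auto
   thus ?thesis using z[OF NM_NV[OF g]] by (simp add: BB_sum_left)
  qed
  hence "?h = 0" using nd[of ?h m] hN by (simp add: Rad_def)
  hence "sl \<alpha> ?h = 0" by (simp add: sl_lops)
  thus ?thesis using a by (simp add: sl_lops sl_xv)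
 qed
 hence "sl \<alpha> ?f = 0" for \<alpha> using fN comps_cm[of \<alpha>] unfolding NV_def by blast
 hence "?f = 0" by (simp add: mv_eq_iff_sl sl_lops)
 thus ?case using 6(1) psi_zero psi_inj unfolding inj_on_def by metis
next
 case (7 U)
 have U: "U \<in> carrier SM" "psi U \<in> NM 0" using 7(1) degree_part_psi[of 0] by blast+
 let ?v = "sl zf (psi U)"
 have e: "psi U = xv zf ?v" using sl_NM[OF U(2)] by (auto simp: mv_eq_iff_sl sl_xv cm_0)
 have "psi U ~= 0" using 7(2) U(1) psi_zero psi_inj unfolding inj_on_def by metis
 hence "?v ~= 0" using e by (auto simp: xv_lops)
 thus ?case by (subst (1 2) e) (simp add: BB_xv Ymon_zero sl_xv ip_pos)
qed (use psi_add psi_sc in \<open>auto simp: BB_simps\<close>)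

abbreviation iv :: "mv => pre_tensor set" where "iv f \<equiv> cos (Th f)"

lemma iv_eqI: "f \<in> NV ==> U \<in> carrier SM ==> psi U = f ==> iv f = U"
 using psi_iv[of f] psi_inj unfolding inj_on_def by blast

lemma NV_gop: "g \<in> generators n ==> f \<in> NV ==> gop g f \<in> NV"
 using good_gen_lin good_generators by blast

text \<open>The adjointness of x_k and y_k reduces a form to its values on constants x^0 v, and constants are orthogonal to all
 higher degrees because the y_k kill them. On constants the form is S_n-invariant. Averaging the first argument over
 the row group, which fixes yu, compares it with the standard inner product on pairs (x, yu), because the average of x
 is a multiple of yu; the translates of yu span VV. The factor is positive by the normalisation in degree 0.\<close>

lemma form_unique:
 assumes F: "contravariant_form n c \<tau> F"
 shows "\<exists>l>0. \<forall>U\<in>carrier SM. \<forall>V\<in>carrier SM. F U V = of_real l * BB C (psi U) (psi V)"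
proof -
 define b where "b f g = F (iv f) (iv g)" for f g
 note Fd = F[unfolded contravariant_form_def Let_def]
 have Fadd: "F (U \<oplus>\<^bsub>SM\<^esub> U') V = F U V + F U' V" if "U \<in> carrier SM" "U' \<in> carrier SM" "V \<in> carrier SM" for U U' V
  using that by (rule Fd[THEN conjunct1, rule_format])
 have Fsc: "F (z \<odot>\<^bsub>SM\<^esub> U) V = z * F U V" if "U \<in> carrier SM" "V \<in> carrier SM" for z U V using that by (rule Fd[THEN conjunct2, THEN conjunct1, rule_format])
 have Fherm: "F V U = cnj (F U V)" if "U \<in> carrier SM" "V \<in> carrier SM" for U V using that by (rule Fd[THEN conjunct2, THEN conjunct2, THEN conjunct1, rule_format])
 have FW: "F (gen_act n c \<tau> (Perm w) U) (gen_act n c \<tau> (Perm w) V) = F U V"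
  if "w permutes Ix" "U \<in> carrier SM" "V \<in> carrier SM" for w U V using that by (rule Fd[THEN conjunct2, THEN conjunct2, THEN conjunct2, THEN conjunct1, rule_format])
 have FX: "F (gen_act n c \<tau> (X k) U) V = F U (gen_act n c \<tau> (Y k) V)"
  if "k \<in> Ix" "U \<in> carrier SM" "V \<in> carrier SM" for k U V using that by (rule Fd[THEN conjunct2, THEN conjunct2, THEN conjunct2, THEN conjunct2, THEN conjunct1, rule_format])
 have Fpos: "0 < Re (F U U)" if "U \<in> degree_part n c \<tau> 0" "U ~= \<zero>\<^bsub>SM\<^esub>" for U using that by (rule Fd[THEN conjunct2, THEN conjunct2, THEN conjunct2, THEN conjunct2, THEN conjunct2, THEN conjunct2, rule_format])
 note i = psi_iv[THEN conjunct1] and p = psi_iv[THEN conjunct2]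
 have add: "b (f + f') g = b f g + b f' g" if "f \<in> NV" "f' \<in> NV" "g \<in> NV" for f f' g
 proof -
  have "iv (f + f') = iv f \<oplus>\<^bsub>SM\<^esub> iv f'"
   using that psi_add[OF i i, of f f'] p by (intro iv_eqI) (auto simp: NV_add)
  thus ?thesis using Fadd[OF i i i, of f f' g] that by (simp add: b_def)
 qed
 have sc: "b (sc z f) g = z * b f g" if "f \<in> NV" "g \<in> NV" for z f g
 proof -
  have "iv (sc z f) = z \<odot>\<^bsub>SM\<^esub> iv f" using that psi_sc[OF i, of f z] p by (intro iv_eqI) (auto simp: NV_sc)
  thus ?thesis using Fsc[OF i i, of f g z] that by (simp add: b_def)
 qed
 have herm: "b g f = cnj (b f g)" if "f \<in> NV" "g \<in> NV" for f g unfolding b_def by (rule Fherm[OF i[OF that(1)] i[OF that(2)]])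
 have act: "iv (gop g f) = gen_act n c \<tau> g (iv f)" if "g \<in> generators n" "f \<in> NV" for g f
  using psi_gen[OF that(1) i[OF that(2)]] p[OF that(2)] NV_gop[OF that] by (intro iv_eqI) auto
 have W: "b (WW w f) (WW w g) = b f g" if "w permutes Ix" "f \<in> NV" "g \<in> NV" for w f g
  using FW[OF that(1) i[OF that(2)] i[OF that(3)]] act[OF gens(3)[OF that(1)]] that by (simp add: b_def)
 have XY: "b (XX k f) g = b f (YY C k g)" if "k \<in> Ix" "f \<in> NV" "g \<in> NV" for k f g
  using FX[OF that(1) i[OF that(2)] i[OF that(3)]] act[OF gens(1)[OF that(1)] that(2)] act[OF gens(2)[OF that(1)] that(3)] by (simp add: b_def)
 have addr: "b g (f + f') = b g f + b g f'" if "f \<in> NV" "f' \<in> NV" "g \<in> NV" for f f' g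
  using herm[of "f + f'" g] add[OF that] herm[of f g] herm[of f' g] that by (simp add: NV_add)
 have scr: "b g (sc z f) = cnj z * b g f" if "f \<in> NV" "g \<in> NV" for z f g
  using herm[of "sc z f" g] sc[OF that] herm[OF that] that by (simp add: NV_sc)
 have zero: "b 0 g = 0" "b g 0 = 0" if "g \<in> NV" for g
  using sc[OF NV_zero that, of 0] scr[OF NV_zero that, of 0] by simp_all
 have sum: "b (\<Sum>x\<in>A. f x) g = (\<Sum>x\<in>A. b (f x) g)" if "\<And>x. x \<in> A ==> f x \<in> NV" "g \<in> NV" for A g and f :: "'z => mv"
  using that(1) by (induction A rule: infinite_finite_induct) (auto simp: zero that add NV_sum)
 have sumr: "b g (\<Sum>x\<in>A. f x) = (\<Sum>x\<in>A. b g (f x))" if "\<And>x. x \<in> A ==> f x \<in> NV" "g \<in> NV" for A g and f :: "'z => mv"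
  using that(1) by (induction A rule: infinite_finite_induct) (auto simp: zero that addr NV_sum)
 have zc: "zf \<in> comps" by (simp add: comps_def)
 have xz: "xv zf v \<in> NV" if "v \<in> VV" for v by (rule NV_xv[OF zc that])
 have YN: "YY C k g \<in> NV" if "k \<in> Ix" "g \<in> NV" for k g using NV_gop[OF gens(2)[OF that(1)] that(2)] by simp
 have slices: "xv \<alpha> (sl \<alpha> f) \<in> NV" if "f \<in> NV" for \<alpha> f
  using that NV_xv[of \<alpha> "sl \<alpha> f"] by (cases "\<alpha> \<in> comps") (auto simp: NV_def xv_lops NV_zero[unfolded NV_def] sl_lops VV_closed)
 have mono: "b (xv \<alpha> v) g = b (xv zf v) (Ymon C \<alpha> g) & Ymon C \<alpha> g \<in> NV" if "\<alpha> \<in> comps" "v \<in> VV" "g \<in> NV" for \<alpha> v g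
  using that(1,3)
 proof (induction \<alpha> arbitrary: g rule: comps_induct)
  case zero thus ?case by (simp add: Ymon_zero)
 next
  case (up k \<beta>)
  thus ?case using XY[OF up(1) NV_xv[OF up(2) that(2)] up.prems] YN by (simp add: XX_xv[symmetric] Ymon_up[OF up(1)])
 qed
 have low: "b (xv zf v) h = b (xv zf v) (xv zf (sl zf h))" if v: "v \<in> VV" and h: "h \<in> NV" for v h
 proof -
  have t: "b (xv zf v) (xv \<alpha> (sl \<alpha> h)) = (if \<alpha> = zf then b (xv zf v) (xv zf (sl zf h)) else 0)" if "\<alpha> \<in> fst ` ks h" for \<alpha>
  proof (cases "\<alpha> = zf")
   case False
   have "\<alpha> \<in> comps" using h that ks_sl[of \<alpha> h] unfolding NV_def by blast
   then obtain k \<beta> where k: "k \<in> Ix" "\<beta> \<in> comps" "\<alpha> = up k \<beta>" using comps_cases False by blast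
   have sv: "sl \<alpha> h \<in> VV" using h by (simp add: NV_def)
   have "b (xv \<alpha> (sl \<alpha> h)) (xv zf v) = b (xv \<beta> (sl \<alpha> h)) (YY C k (xv zf v))"
    using XY[OF k(1) NV_xv[OF k(2) sv] xz[OF v]] k(3) by (simp add: XX_xv)
   hence "b (xv \<alpha> (sl \<alpha> h)) (xv zf v) = 0" using zero NV_xv[OF k(2) sv] by (simp add: YY_xv_0)
   thus ?thesis using False herm[OF slices[OF h] xz[OF v], of \<alpha>] by simp
  qed simp
  have "b (xv zf v) h = (\<Sum>\<alpha>\<in>fst ` ks h. b (xv zf v) (xv \<alpha> (sl \<alpha> h)))"
   by (rule trans[OF arg_cong[OF mv_expand[of h], of "b (xv zf v)"] sumr[OF slices[OF h] xz[OF v]]])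
  also have "... = (if zf \<in> fst ` ks h then b (xv zf v) (xv zf (sl zf h)) else 0)"
   using t by (simp cong: sum.cong)
  also have "... = b (xv zf v) (xv zf (sl zf h))" using ks_sl[of zf h] zero xz[OF v] by (auto simp: xv_lops)
  finally show ?thesis .
 qed
 define B0 where "B0 v w = b (xv zf v) (xv zf w)" for v w
 have B0W: "B0 (perm_act w v) (perm_act w v') = B0 v v'" if "w permutes Ix" "v \<in> VV" "v' \<in> VV" for w v v'
 proof -
  have "zf o pinv w = zf" by auto
  thus ?thesis using W[OF that(1) xz[OF that(2)] xz[OF that(3)]] by (simp add: B0_def WW_xv)
 qed
 have yn: "ip yu yu ~= 0" using yu_nz ip_self_zero by blast
 have Rc: "card RG ~= 0" using id_RG by (auto simp: card_gt_0_iff)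
 have key: "B0 x yu * ip yu yu = B0 yu yu * ip x yu" if x: "x \<in> VV" for x
 proof -
  obtain z where z: "(\<Sum>a\<in>RG. perm_act a x) = sc z yu" using row_sym_VV[OF x] by blast
  have ax: "perm_act a x \<in> VV" if "a \<in> RG" for a by (rule VV_perm_act[OF x RG_perm[OF that]])
  have "of_nat (card RG) * B0 x yu = (\<Sum>a\<in>RG. B0 (perm_act a x) yu)"
   using B0W[OF RG_perm x yu_VV] perm_act_yu by simp
  also have "... = b (\<Sum>a\<in>RG. xv zf (perm_act a x)) (xv zf yu)"
   unfolding B0_def by (rule sum[symmetric]) (use ax xz yu_VV in auto)
  also have "... = z * B0 yu yu" using sc[OF xz[OF yu_VV] xz[OF yu_VV]] by (simp add: xv_lops[symmetric] z B0_def)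
  finally have A: "of_nat (card RG) * B0 x yu = z * B0 yu yu" .
  have "of_nat (card RG) * ip x yu = (\<Sum>a\<in>RG. ip (perm_act a x) yu)"
   using ip_perm_act[OF permutes_inj[OF RG_perm], of _ x yu] perm_act_yu by simp
  also have "... = z * ip yu yu" by (simp add: ip_sum_left[symmetric] z ip_simps)
  finally have B: "of_nat (card RG) * ip x yu = z * ip yu yu" .
  have "of_nat (card RG) * (B0 x yu * ip yu yu) = of_nat (card RG) * (B0 yu yu * ip x yu)"
   using A B by (simp add: mult.assoc[symmetric])
  thus ?thesis using Rc by simp
 qed
 define l where "l = Re (B0 yu yu) / Re (ip yu yu)"
 have "B0 yu yu = cnj (B0 yu yu)" unfolding B0_def by (rule herm[OF xz[OF yu_VV] xz[OF yu_VV]])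
 hence B0r: "B0 yu yu = of_real (Re (B0 yu yu))" by (simp add: complex_eq_iff)
 have pos: "0 < Re (B0 yu yu)"
 proof -
  have N0: "xv zf yu \<in> NM 0" by (rule NM_xv[OF zf_cm yu_VV])
  obtain U where U: "U \<in> degree_part n c \<tau> 0" "psi U = xv zf yu" using degree_part_psi(2)[of 0] N0 by (metis imageE)
  have Ui: "iv (xv zf yu) = U" by (rule iv_eqI[OF xz[OF yu_VV]]) (use U degree_part_psi(1) in auto)
  have "xv zf yu ~= 0" using sl_xv[of zf zf yu] yu_nz by (auto simp: sl_lops)
  hence "U ~= \<zero>\<^bsub>SM\<^esub>" using U(2) psi_zero by auto
  thus ?thesis using Fpos[OF U(1)] unfolding B0_def b_def Ui by blast
 qed
 have l0: "0 < l" using pos ip_pos[OF yu_nz] by (simp add: l_def)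
 have lam: "B0 yu yu = of_real l * ip yu yu"
  using ip_pos[OF yu_nz] by (subst B0r, subst ip_self_real) (simp add: l_def)
 have B0yu: "B0 x yu = of_real l * ip x yu" if "x \<in> VV" for x using key[OF that] yn unfolding lam by simp
 have B0: "B0 v w = of_real l * ip v w" if v: "v \<in> VV" and w: "w \<in> VV" for v w
 proof -
  have "w \<in> VV & B0 v w = of_real l * ip v w" using w unfolding VV_def
  proof (induction rule: fv.span_induct_alt)
   case base thus ?case using zero xz[OF v] by (simp add: B0_def xv_lops fv.span_zero)
  next
   case (step a x y)
   then obtain q where q: "x = perm_act q yu" "q permutes Ix" by blast
   have xV: "x \<in> VV" unfolding q(1) by (rule VV_perm_act[OF yu_VV q(2)])
   have yV: "y \<in> VV" using step by (simp add: VV_def)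
   have qi: "pinv q permutes Ix" by (rule permutes_inv[OF q(2)])
   have v': "perm_act (pinv q) v \<in> VV" by (rule VV_perm_act[OF v qi])
   have bk: "perm_act q (perm_act (pinv q) v) = v" by (simp add: perm_act_comp permutes_inv_o[OF q(2)])
   have "B0 v x = of_real l * ip v x"
    using B0W[OF q(2) v' yu_VV] B0yu[OF v'] ip_perm_act[OF permutes_inj[OF q(2)], of "perm_act (pinv q) v" yu] unfolding bk q(1) by simp
   moreover have "B0 v (sc a x + y) = cnj a * B0 v x + B0 v y"
    using addr[OF NV_sc[OF xz[OF xV]] xz[OF yV] xz[OF v]] scr[OF xz[OF xV] xz[OF v]] by (simp add: B0_def xv_lops)
   moreover have "sc a x + y \<in> VV" using xV yV by (intro VV_closed)
   ultimately show ?case using step by (simp add: ip_simps algebra_simps VV_def)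
  qed
  thus ?thesis by blast
 qed
 have "b f g = of_real l * BB C f g" if f: "f \<in> NV" and g: "g \<in> NV" for f g
 proof -
  have "b f g = (\<Sum>\<alpha>\<in>fst ` ks f. b (xv \<alpha> (sl \<alpha> f)) g)"
   by (rule trans[OF arg_cong[OF mv_expand[of f], of "%x. b x g"] sum[OF slices[OF f] g]])
  also have "... = (\<Sum>\<alpha>\<in>fst ` ks f. of_real l * BB C (xv \<alpha> (sl \<alpha> f)) g)"
  proof (rule sum.cong[OF refl])
   fix \<alpha> assume "\<alpha> \<in> fst ` ks f"
   hence a: "\<alpha> \<in> comps" "sl \<alpha> f \<in> VV" using f ks_sl[of \<alpha> f] unfolding NV_def by blast+
   note m = mono[OF a g]
   have "sl zf (Ymon C \<alpha> g) \<in> VV" using m by (simp add: NV_def)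
   thus "b (xv \<alpha> (sl \<alpha> f)) g = of_real l * BB C (xv \<alpha> (sl \<alpha> f)) g"
    using m low[OF a(2), of "Ymon C \<alpha> g"] B0[OF a(2)] by (simp add: B0_def BB_xv)
  qed
  also have "... = of_real l * BB C f g" by (subst (2) BB_expand) (simp add: sum_distrib_left)
  finally show ?thesis .
 qed
 moreover have "F U V = b (psi U) (psi V)" if "U \<in> carrier SM" "V \<in> carrier SM" for U V
  using iv_eqI[OF psi_NV[OF that(1)] that(1)] iv_eqI[OF psi_NV[OF that(2)] that(2)] by (simp add: b_def)
 ultimately show ?thesis using l0 psi_NV by (intro exI[of _ l]) simp
qed

section \<open>The signature character\<close>

lemma NM_finite_basis: "\<exists>T. finite T & fv.independent T & fv.span T = NM m"
proof -
 let ?T = "(%v. xv (fst v) (yv (snd v))) ` IX m"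
 have yV: "yv T \<in> VV" if "T \<in> SYT" for T using yv[OF that] by (simp add: ewt_def)
 have "xv \<alpha> v \<in> fv.span ?T" if "\<alpha> \<in> cm m" "v \<in> VV" for \<alpha> v
  using that(2) unfolding VV_span
 proof (rule linear_span_image[OF linear_xv, rotated])
  fix x assume "x \<in> yv ` SYT"
  then obtain T where T: "T \<in> SYT" "x = yv T" by blast
  hence "xv \<alpha> x = xv (fst (\<alpha>, T)) (yv (snd (\<alpha>, T)))" "(\<alpha>, T) \<in> IX m" using that(1) by (simp_all add: IX_def)
  thus "xv \<alpha> x \<in> fv.span ?T" by (intro fv.span_base) blast
 qed
 hence "NM m \<subseteq> fv.span ?T" unfolding NM_def by (intro fv.span_minimal fv.subspace_span) auto
 moreover obtain B where B: "B \<subseteq> NM m" "fv.independent B" "NM m \<subseteq> fv.span B" using fv.maximal_independent_subset[of "NM m"] by blast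
 ultimately have "finite B" using fv.independent_span_bound[of ?T B] by auto
 moreover have "fv.span B = NM m"
  using B fv.span_minimal[OF B(1)] fv.subspace_span[of "{xv \<alpha> v | \<alpha> v. \<alpha> \<in> cm m & v \<in> VV}"] unfolding NM_def by blast
 ultimately show ?thesis using B(2) by blast
qed

text \<open>The positive factor between the form and BB is absorbed by scaling the coordinates with its square root, so the Gram
 matrices agree on the nose.\<close>

lemma degree_signature_GM:
 assumes F: "contravariant_form n c \<tau> F"
 shows "\<exists>bs. NMbasis m bs & degree_signature n c \<tau> F m = int (pos_ev (GM c bs)) - int (neg_ev (GM c bs))"
proof -
 obtain l where l: "0 < l" "\<And>U V. U \<in> carrier SM ==> V \<in> carrier SM ==> F U V = of_real l * BB C (psi U) (psi V)"
  using form_unique[OF F] by blast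
 define z where "z = complex_of_real (sqrt l)"
 have z: "z ~= 0" "z * cnj z = of_real l" using l(1) by (simp_all add: z_def of_real_mult[symmetric] del: of_real_mult)
 define M where "M = SM\<lparr>carrier := degree_part n c \<tau> m\<rparr>"
 interpret co: coordinates M "%U. sc z (psi U)" "NM m" unfolding M_def by (rule degree_coordinates[OF z(1)])
 obtain T where "finite T" "fv.independent T" "fv.span T = NM m" using NM_finite_basis by blast
 then obtain B where "finite B" "co.basis B" using co.basis_exists by blast
 hence "\<exists>bs. distinct bs & co.basis (set bs)" using finite_distinct_list by metis
 from someI_ex[OF this] obtain bs where bs: "bs = (SOME bs. distinct bs & co.basis (set bs))" "distinct bs" "co.basis (set bs)" by blast
 let ?us = "map (%U. sc z (psi U)) bs"
 note im = co.basis_image[OF bs(3)]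
 have sub: "set bs \<subseteq> carrier SM" using im(1) degree_part_psi(1)[of m] by (auto simp: M_def)
 have "distinct ?us" using bs(2) inj_on_subset[OF co.inj im(1)] by (simp add: distinct_map)
 hence nb: "NMbasis m ?us" using im by (simp add: NMbasis_def)
 have "mat (length bs) (length bs) (%(i, j). F (bs ! i) (bs ! j)) = GM c ?us"
 proof (rule eq_matI)
  fix i j assume "i < dim_row (GM c ?us)" "j < dim_col (GM c ?us)"
  hence ij: "i < length bs" "j < length bs" by (auto simp: GM_def)
  hence "bs ! i \<in> carrier SM" "bs ! j \<in> carrier SM" using sub nth_mem by blast+
  thus "mat (length bs) (length bs) (%(i, j). F (bs ! i) (bs ! j)) $$ (i, j) = GM c ?us $$ (i, j)"
   using ij l(2) by (simp add: GM_def BB_simps z(2)[symmetric] mult_ac)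
 qed (auto simp: GM_def)
 hence "degree_signature n c \<tau> F m = int (pos_ev (GM c ?us)) - int (neg_ev (GM c ?us))"
  unfolding degree_signature_def Let_def M_def[symmetric] bs(1)[symmetric] by (simp add: pos_ev_def neg_ev_def)
 thus ?thesis using nb by blast
qed

lemma sign_exponent_SE: "sign_exponent n c \<tau> (restrict (gg \<alpha>) Ix, so \<alpha>, T) = SE c \<alpha> T"
proof -
 let ?cm = "%G s t. cut_min G \<lfloor>c * real_of_int (ct T t - ct T s - 1)\<rfloor> + cut_min G \<lfloor>c * real_of_int (ct T t - ct T s + 1)\<rfloor>"
 let ?g = "restrict (gg \<alpha>) Ix"
 let ?gap = "%s t. int (?g t) - int (?g s)"
 let ?A = "{(s, t). 1 \<le> s & s < t & t \<le> n & so \<alpha> s > so \<alpha> t}"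
 let ?B = "{(s, t). 1 \<le> s & s < t & t \<le> n & so \<alpha> s < so \<alpha> t}"
 let ?F = "%(s, t). ?cm (int (GG \<alpha> s t)) s t"
 have fin: "finite ?A" "finite ?B" by (rule finite_subset[of _ "Ix \<times> Ix"], auto)+
 have ne: "so \<alpha> s ~= so \<alpha> t" if "s < t" for s t using that by (metis rk_so(1) nat_neq_iff)
 have 1: "(\<Sum>(s, t)\<in>?A. ?cm (?gap s t - 1) s t) = (\<Sum>x\<in>?A. ?F x)"
 proof (rule sum.cong[OF refl])
  fix x assume "x \<in> ?A"
  then obtain s t where x: "x = (s, t)" "s \<in> Ix" "t \<in> Ix" "s < t" "so \<alpha> t < so \<alpha> s" by auto
  hence "?gap s t - 1 = int (GG \<alpha> s t)" using gg_less[OF x(2-4), of \<alpha>] by (auto simp: GG_def)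
  thus "(case x of (s, t) => ?cm (?gap s t - 1) s t) = ?F x" unfolding x(1) case_prod_conv by (simp only:)
 qed
 have 2: "(\<Sum>(s, t)\<in>?B. ?cm (?gap s t) s t) = (\<Sum>x\<in>?B. ?F x)"
 proof (rule sum.cong[OF refl])
  fix x assume "x \<in> ?B"
  then obtain s t where x: "x = (s, t)" "s \<in> Ix" "t \<in> Ix" "s < t" "so \<alpha> s < so \<alpha> t" by auto
  hence "?gap s t = int (GG \<alpha> s t)" using gg_less[OF x(2-4), of \<alpha>] by (auto simp: GG_def)
  thus "(case x of (s, t) => ?cm (?gap s t) s t) = ?F x" unfolding x(1) case_prod_conv by (simp only:)
 qed
 have "(\<Sum>x\<in>?A. ?F x) + (\<Sum>x\<in>?B. ?F x) = (\<Sum>x\<in>?A \<union> ?B. ?F x)" by (rule sum.union_disjoint[symmetric]) (use fin in auto)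
 also have "?A \<union> ?B = Sigma Ix (%s. {s<..n})"
 proof (intro equalityI subsetI)
  fix x assume "x \<in> Sigma Ix (%s. {s<..n})"
  then obtain s t where "x = (s, t)" "1 \<le> s" "s < t" "t \<le> n" by auto
  thus "x \<in> ?A \<union> ?B" using ne[of s t] by (cases "so \<alpha> s < so \<alpha> t") auto
 qed auto
 also have "(\<Sum>x\<in>\<dots>. ?F x) = (\<Sum>s\<in>Ix. \<Sum>t\<in>{s<..n}. ?cm (int (GG \<alpha> s t)) s t)" by (rule sum.Sigma[symmetric]) auto
 finally have 3: "(\<Sum>x\<in>?A. ?F x) + (\<Sum>x\<in>?B. ?F x) = (\<Sum>s\<in>Ix. \<Sum>t\<in>{s<..n}. ?cm (int (GG \<alpha> s t)) s t)" .
 have 0: "(\<Sum>i=1..n. cut_min (int (?g i)) \<lfloor>c * real_of_int (ct T i)\<rfloor>) = (\<Sum>s\<in>Ix. cut_min (int (gg \<alpha> s)) \<lfloor>c * of_int (ct T s)\<rfloor>)"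
  by (rule sum.cong) auto
 show ?thesis unfolding sign_exponent_def case_prod_conv Let_def SE_def 0 1 2 3[symmetric] by (simp only: add.assoc)
qed

text \<open>A triple (g, \<sigma>, T) corresponds to the exponent with entry g_s at \<sigma> s. The condition on \<sigma> makes it
 the sorting permutation of this exponent (so_unique).\<close>

lemma index_sum: "(\<Sum>v\<in>{v \<in> index_triples n \<tau>. wt n v = k}. (-1) ^ sign_exponent n c \<tau> v) = (\<Sum>v\<in>IX k. (-1) ^ SE c (fst v) (snd v) :: int)"
proof (rule sum.reindex_bij_witness[symmetric, of _ "%(g, \<sigma>, T). (%i. if i \<in> Ix then g (pinv \<sigma> i) else 0, T)" "%v. (restrict (gg (fst v)) Ix, so (fst v), snd v)"])
 fix v assume v: "v \<in> IX k"
 obtain \<alpha> T where vv: "v = (\<alpha>, T)" "\<alpha> \<in> cm k" "T \<in> SYT" using v by (auto simp: IX_def)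
 have "(%i. if i \<in> Ix then restrict (gg \<alpha>) Ix (rk \<alpha> i) else 0) = \<alpha>"
 proof
  fix i show "(if i \<in> Ix then restrict (gg \<alpha>) Ix (rk \<alpha> i) else 0) = \<alpha> i"
   using vv(2) rk_in[of i \<alpha>] by (cases "i \<in> Ix") (simp_all add: gg_def cm_def comps_def del: atLeastAtMost_iff)
 qed
 thus "(case (restrict (gg (fst v)) Ix, so (fst v), snd v) of (g, \<sigma>, T) => (%i. if i \<in> Ix then g (pinv \<sigma> i) else 0, T)) = v"
  unfolding vv fst_conv snd_conv case_prod_conv pinv_so by simp
 have "mono_on Ix (restrict (gg \<alpha>) Ix)"
 proof (rule mono_onI)
  fix r s assume "r \<in> Ix" "s \<in> Ix" "r \<le> s"
  thus "restrict (gg \<alpha>) Ix r \<le> restrict (gg \<alpha>) Ix s" using gg_less[of r s \<alpha>] by (cases "r = s") auto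
 qed
 moreover have "so \<alpha> i < so \<alpha> j" if "i \<in> Ix" "j \<in> Ix" "i < j" "restrict (gg \<alpha>) Ix i = restrict (gg \<alpha>) Ix j" for i j
  using gg_less[OF that(1-3), of \<alpha>] that by auto
 moreover have "(\<Sum>i=1..n. restrict (gg \<alpha>) Ix i) = k"
 proof -
  have "(\<Sum>i=1..n. restrict (gg \<alpha>) Ix i) = (\<Sum>i\<in>Ix. \<alpha> (so \<alpha> i))" by (rule sum.cong) (auto simp: gg_def)
  also have "... = (\<Sum>i\<in>Ix. \<alpha> i)" using sum.permute[OF so_perm, of \<alpha> \<alpha>] by (simp add: o_def)
  finally show ?thesis using vv(2) by (simp add: cm_def)
 qed
 ultimately show "(restrict (gg (fst v)) Ix, so (fst v), snd v) \<in> {v \<in> index_triples n \<tau>. wt n v = k}"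
  using so_perm vv by (auto simp: index_triples_def wt_def)
 show "(-1) ^ sign_exponent n c \<tau> (restrict (gg (fst v)) Ix, so (fst v), snd v) = ((-1) ^ SE c (fst v) (snd v) :: int)"
  by (simp only: sign_exponent_SE)
next
 fix v assume v: "v \<in> {v \<in> index_triples n \<tau>. wt n v = k}"
 obtain g \<sigma> T where vv: "v = (g, \<sigma>, T)" "g \<in> extensional Ix" "mono_on Ix g" "\<sigma> permutes Ix"
  "\<And>i j. i \<in> Ix ==> j \<in> Ix ==> i < j ==> g i = g j ==> \<sigma> i < \<sigma> j" "T \<in> SYT" "(\<Sum>i=1..n. g i) = k"
  using v by (auto simp: index_triples_def wt_def)
 define \<alpha> where "\<alpha> = (%i. if i \<in> Ix then g (pinv \<sigma> i) else 0)"
 have as: "\<alpha> (\<sigma> s) = g s" if "s \<in> Ix" for s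
  using perm_in[OF vv(4) that] by (simp only: \<alpha>_def if_True permutes_inverses(2)[OF vv(4)])
 have s: "so \<alpha> = \<sigma>"
 proof (rule so_unique[OF vv(4)])
  fix s t assume st: "s \<in> Ix" "t \<in> Ix" "s < t"
  have "g s \<le> g t" using mono_onD[OF vv(3) st(1,2)] st(3) by simp
  thus "blw \<alpha> (\<sigma> s) (\<sigma> t)" using vv(5)[OF st] unfolding blw_def as[OF st(1)] as[OF st(2)] by auto
 qed
 have gr: "restrict (gg \<alpha>) Ix = g"
 proof
  fix i show "restrict (gg \<alpha>) Ix i = g i"
   using as[of i] vv(2) by (cases "i \<in> Ix") (auto simp: gg_def s extensional_def)
 qed
 have e: "(case v of (g, \<sigma>, T) => (%i. if i \<in> Ix then g (pinv \<sigma> i) else 0, T)) = (\<alpha>, T)" by (simp only: vv(1) case_prod_conv \<alpha>_def)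
 show "(%v. (restrict (gg (fst v)) Ix, so (fst v), snd v)) (case v of (g, \<sigma>, T) => (%i. if i \<in> Ix then g (pinv \<sigma> i) else 0, T)) = v"
  unfolding e by (simp only: fst_conv snd_conv gr s vv(1))
 have "(\<Sum>i\<in>Ix. \<alpha> i) = (\<Sum>i\<in>Ix. \<alpha> (\<sigma> i))" using sum.permute[OF vv(4), of \<alpha>] by (simp add: o_def)
 also have "... = k" using vv(7) as by simp
 finally have "\<alpha> \<in> cm k" by (auto simp: cm_def comps_def \<alpha>_def)
 thus "(case v of (g, \<sigma>, T) => (%i. if i \<in> Ix then g (pinv \<sigma> i) else 0, T)) \<in> IX k"
  unfolding e using vv(6) by (simp add: IX_def)
qed

lemma signature_formula:
 assumes "gen c \<or> (\<exists>k\<ge>1. c = - real k)"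
 shows "signature_character n c \<tau> = Abs_fps (%k. \<Sum>v\<in>{v \<in> index_triples n \<tau>. wt n v = k}. (-1) ^ sign_exponent n c \<tau> v)"
proof -
 have "\<And>m f. f \<in> Rad c m ==> f = 0" using assms nondeg_gen nondeg_int by blast
 hence F: "contravariant_form n c \<tau> (SOME F. contravariant_form n c \<tau> F)" by (intro someI[of "contravariant_form n c \<tau>", OF form_exists])
 have "degree_signature n c \<tau> (SOME F. contravariant_form n c \<tau> F) m = (\<Sum>v\<in>IX m. (-1) ^ SE c (fst v) (snd v))" for m
 proof -
  obtain bs where bs: "NMbasis m bs" "degree_signature n c \<tau> (SOME F. contravariant_form n c \<tau> F) m = int (pos_ev (GM c bs)) - int (neg_ev (GM c bs))"
   using degree_signature_GM[OF F] by blast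
  have "int (pos_ev (GM c bs)) - int (neg_ev (GM c bs)) = (\<Sum>v\<in>IX m. (-1) ^ SE c (fst v) (snd v))"
   using assms
  proof
   assume "\<exists>k\<ge>1. c = - real k"
   then obtain k where "1 \<le> k" "c = - real k" by blast
   thus ?thesis using signature_sum_int[OF bs(1), of k] by simp
  qed (rule signature_sum_gen[OF bs(1)])
  thus ?thesis using bs(2) by simp
 qed
 thus ?thesis unfolding signature_character_def index_sum by presburger
qed

end

text \<open>If c k is an integer j with 0 < |k| \<le> n, the reduced denominator of j / k divides k, and by hypothesis it is 1.\<close>

lemma generic_or_integer:
 fixes c :: real
 assumes neg: "c < 0"
  and c: "\<not> (\<exists>(r::int) (m::nat). coprime r (int m) & 2 \<le> m & m \<le> n & c = of_int r / of_nat m)"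
 shows "(\<forall>k::int. k ~= 0 & \<bar>k\<bar> \<le> int n --> c * of_int k \<notin> \<int>) \<or> (\<exists>k\<ge>1. c = - real k)"
proof (rule disjCI)
 assume no: "\<not> (\<exists>k\<ge>1. c = - real k)"
 show "\<forall>k::int. k ~= 0 & \<bar>k\<bar> \<le> int n --> c * of_int k \<notin> \<int>"
 proof (intro allI impI notI)
  fix k :: int assume k: "k ~= 0 & \<bar>k\<bar> \<le> int n" and "c * of_int k \<in> \<int>"
  then obtain j where j: "c * of_int k = of_int j" by (auto elim: Ints_cases)
  define d where "d = gcd j k"
  define r where "r = sgn k * (j div d)"
  define m where "m = nat (\<bar>k\<bar> div d)"
  have d: "0 < d" using k by (simp add: d_def)
  have jd: "j = d * (j div d)" "k = d * (k div d)" by (simp_all add: d_def)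
  have md: "\<bar>k\<bar> div d = \<bar>k div d\<bar>"
   using jd(2) d by (metis abs_mult abs_of_pos nonzero_mult_div_cancel_left less_irrefl)
  have kd: "k div d ~= 0" using jd(2) k by auto
  hence im: "int m = \<bar>k div d\<bar>" "1 \<le> m" unfolding m_def md by auto
  have "coprime (j div d) (k div d)" unfolding d_def using k by (intro div_gcd_coprime) auto
  hence "coprime r (int m)" unfolding r_def im(1) using k by (auto simp: sgn_if)
  moreover have "m \<le> n"
  proof -
   have "\<bar>k div d\<bar> * 1 \<le> \<bar>k div d\<bar> * d" using d by (intro mult_left_mono) auto
   also have "... = \<bar>k\<bar>" using d by (subst (2) jd(2)) (simp add: abs_mult mult.commute)
   finally show ?thesis using k im by linarith
  qed
  moreover have cm: "c = of_int r / of_nat m"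
  proof -
   have "c * (real_of_int d * of_int (k div d)) = of_int d * of_int (j div d)"
    using j unfolding of_int_mult[symmetric] jd[symmetric] .
   hence "c * of_int (k div d) = of_int (j div d)" using d by simp
   moreover have "of_nat m = real_of_int (sgn k * (k div d))"
   proof -
    have "sgn k = sgn (k div d)" using d by (subst jd(2)) (simp add: sgn_mult)
    hence "int m = sgn k * (k div d)" using im(1) by (simp add: abs_sgn mult.commute)
    thus ?thesis by (metis of_int_of_nat_eq)
   qed
   ultimately have "c * of_nat m = of_int r" by (simp add: r_def mult.left_commute)
   thus ?thesis using im(2) by (simp add: field_simps)
  qed
  ultimately have "m = 1" using c im(2) by (metis One_nat_def Suc_1 le_antisym not_less_eq_eq)
  hence cr: "c = of_int r" using cm by simp
  hence "r < 0" using neg by simp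
  hence "c = - real (nat (- r))" "1 \<le> nat (- r)" using cr by auto
  thus False using no by blast
 qed
qed

theorem theorem1p2:
  fixes n :: nat and \<tau> :: "nat list" and c :: real
  assumes "n \<ge> 2"
    and "partition_of n \<tau>"
    and "c < 0"
    and "\<not> (\<exists>(r::int) (m::nat). coprime r (int m) \<and> 2 \<le> m \<and> m \<le> n \<and> c = of_int r / of_nat m)"
  shows "signature_character n c \<tau> =
    Abs_fps (\<lambda>k. \<Sum>v\<in>{v \<in> index_triples n \<tau>. wt n v = k}. (-1) ^ sign_exponent n c \<tau> v)"
proof -
 interpret cherednik n \<tau> c by unfold_locales (rule assms(2))
 show ?thesis
  by (rule signature_formula) (use generic_or_integer[OF assms(3,4)] in \<open>simp only: gen_def\<close>)
qed

end
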